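(* Let $2\leq p\leq \infty$ and $r=\frac{2p}{p+2}$. Assume that $\varphi\in \Phi^2$ satisfies the strong non-degeneracy condition, and let $a \in L^p S^m_\varrho$ with $0\leq \varrho\leq 1$ and $m < \frac{n(\varrho-1)}{2}$. Then the Fourier integral operator \[ T_a f(x)=(2\pi)^{-n}\int_{\mathbb{R}^n} e^{i\varphi(x,\xi)}a(x,\xi)\widehat f(\xi)\,d\xi,\qquad f\in\mathcal{S}(\mathbb{R}^n), \] is bounded from $L^2$ to $L^r$.
   Context: $\langle\xi\rangle=(1+|\xi|^2)^{1/2}$. For $1\le p\le\infty$, $m\in\mathbb{R}$, $0\le\varrho\le1$, the class $L^pS^m_\varrho$ consists of functions $a(x,\xi)$, $x,\xi\in\mathbb{R}^n$, measurable in $x$, with $a(x,\cdot)\in C^\infty(\mathbb{R}^n)$ for a.e. $x$, such that for every multi-index $\alpha$ there is $C_\alpha$ with $\|\partial_\xi^\alpha a(\cdot,\xi)\|_{L^p(\mathbb{R}^n)}\le C_\alpha\langle\xi\rangle^{m-\varrho|\alpha|}$ for all $\xi$. A real function $\varphi$ belongs to $\Phi^k$ if $\varphi\in C^\infty(\mathbb{R}^n\times(\mathbb{R}^n\setminus\{0\}))$, is positively homogeneous of degree $1$ in $\xi$, and for all multi-indices $\alpha,\beta$ with $|\alpha|+|\beta|\ge k$, $\sup_{x,\ \xi\neq0}|\xi|^{-1+|\alpha|}|\partial_\xi^\alpha\partial_x^\beta\varphi(x,\xi)|<\infty$. A real phase $\varphi\in C^2(\mathbb{R}^n\times(\mathbb{R}^n\setminus\{0\}))$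 satisfies the strong non-degeneracy (SND) condition if there is $c>0$ with $|\det(\partial^2\varphi/\partial x_j\partial\xi_k)(x,\xi)|\ge c$ for all $x$ and all $\xi\neq0$. *)

theory Defs
  imports "HOL-Analysis.Analysis"
begin

text \<open>dderiv [v1,...,vk] f = D_v1 (D_v2 ( ... (D_vk f))). A multi-index derivative
  is obtained by a list of coordinate directions (order irrelevant for smooth f).\<close>
fun dderiv :: "'a::real_normed_vector list \<Rightarrow> ('a \<Rightarrow> 'b::real_normed_vector) \<Rightarrow> 'a \<Rightarrow> 'b" where
  "dderiv [] f = f"
| "dderiv (v # vs) f = (\<lambda>x. frechet_derivative (dderiv vs f) (at x) v)"

definition smooth_on :: "'a::real_normed_vector set \<Rightarrow> ('a \<Rightarrow> 'b::real_normed_vector) \<Rightarrow> bool" where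
  "smooth_on S f \<longleftrightarrow> open S \<and> (\<forall>vs. \<forall>x\<in>S. dderiv vs f differentiable (at x))"

definition pd :: "'n::finite list \<Rightarrow> (real^'n \<Rightarrow> 'b::real_normed_vector) \<Rightarrow> real^'n \<Rightarrow> 'b" where
  "pd \<alpha> f = dderiv (map (\<lambda>i. axis i 1) \<alpha>) f"

definition pdxxi :: "'n::finite list \<Rightarrow> 'n list \<Rightarrow> (real^'n \<Rightarrow> real^'n \<Rightarrow> 'b::real_normed_vector)
     \<Rightarrow> real^'n \<Rightarrow> real^'n \<Rightarrow> 'b" where
  "pdxxi \<alpha> \<beta> g x \<xi> = dderiv (map (\<lambda>i. (0, axis i 1)) \<alpha> @ map (\<lambda>i. (axis i 1, 0)) \<beta>)
       (\<lambda>z. g (fst z) (snd z)) (x, \<xi>)"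

definition Lp_norm :: "ennreal \<Rightarrow> ('a \<Rightarrow> 'b::real_normed_vector) \<Rightarrow> 'a measure \<Rightarrow> ennreal" where
  "Lp_norm p f M =
     (if p = \<infinity> then Inf {C. AE x in M. ennreal (norm (f x)) \<le> C}
      else (let I = (\<integral>\<^sup>+ x. ennreal (norm (f x) powr enn2real p) \<partial>M) in
            if I = \<infinity> then \<infinity> else ennreal (enn2real I powr (1 / enn2real p))))"

definition japan :: "real^'n::finite \<Rightarrow> real" where
  "japan \<xi> = sqrt (1 + (norm \<xi>)\<^sup>2)"

definition schwartz :: "(real^'n::finite \<Rightarrow> complex) \<Rightarrow> bool" where
  "schwartz f \<longleftrightarrow> smooth_on UNIV f \<and>
     (\<forall>\<alpha> (N::nat). \<exists>C. \<forall>x. (1 + norm x) ^ N * norm (pd \<alpha> f x) \<le> C)"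

definition fourier :: "(real^'n::finite \<Rightarrow> complex) \<Rightarrow> real^'n \<Rightarrow> complex" where
  "fourier f \<xi> = (\<integral>x. exp (- \<i> * complex_of_real (x \<bullet> \<xi>)) * f x \<partial>lebesgue)"

definition LpS :: "ennreal \<Rightarrow> real \<Rightarrow> real \<Rightarrow> (real^'n::finite \<Rightarrow> real^'n \<Rightarrow> complex) \<Rightarrow> bool" where
  "LpS p m \<rho> a \<longleftrightarrow>
     (\<forall>\<xi>. (\<lambda>x. a x \<xi>) \<in> borel_measurable lebesgue) \<and>
     (AE x in lebesgue. smooth_on UNIV (a x)) \<and>
     (\<forall>\<alpha>. \<exists>C. \<forall>\<xi>. Lp_norm p (\<lambda>x. pd \<alpha> (a x) \<xi>) lebesgue
                     \<le> ennreal (C * japan \<xi> powr (m - \<rho> * real (length \<alpha>))))"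

definition PhiK :: "nat \<Rightarrow> (real^'n::finite \<Rightarrow> real^'n \<Rightarrow> real) \<Rightarrow> bool" where
  "PhiK k \<phi> \<longleftrightarrow>
     smooth_on (UNIV \<times> (UNIV - {0})) (\<lambda>z. \<phi> (fst z) (snd z)) \<and>
     (\<forall>x \<xi> t. \<xi> \<noteq> 0 \<longrightarrow> t > 0 \<longrightarrow> \<phi> x (t *\<^sub>R \<xi>) = t * \<phi> x \<xi>) \<and>
     (\<forall>\<alpha> \<beta>. length \<alpha> + length \<beta> \<ge> k \<longrightarrow>
        (\<exists>C. \<forall>x \<xi>. \<xi> \<noteq> 0 \<longrightarrow>
            norm \<xi> powr (-1 + real (length \<alpha>)) * \<bar>pdxxi \<alpha> \<beta> \<phi> x \<xi>\<bar> \<le> C))"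

definition SND :: "(real^'n::finite \<Rightarrow> real^'n \<Rightarrow> real) \<Rightarrow> bool" where
  "SND \<phi> \<longleftrightarrow> (\<exists>c>0. \<forall>x \<xi>. \<xi> \<noteq> 0 \<longrightarrow>
      \<bar>det (\<chi> j k. pdxxi [k] [j] \<phi> x \<xi>)\<bar> \<ge> c)"

definition FIO :: "(real^'n::finite \<Rightarrow> real^'n \<Rightarrow> real) \<Rightarrow> (real^'n \<Rightarrow> real^'n \<Rightarrow> complex)
     \<Rightarrow> (real^'n \<Rightarrow> complex) \<Rightarrow> real^'n \<Rightarrow> complex" where
  "FIO \<phi> a f x = complex_of_real ((2 * pi) powr (- real CARD('n))) *
     (\<integral>\<xi>. exp (\<i> * complex_of_real (\<phi> x \<xi>)) * a x \<xi> * fourier f \<xi> \<partial>lebesgue)"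

end

theory Submission
  imports Defs
begin

text \<open>An operator with kernel \<open>exp (i \<psi> x \<xi>)\<close> localised to a ball of radius \<open>R\<close> in \<open>\<xi>\<close> is bounded on \<open>L\<^sup>2\<close>, uniformly in \<open>R\<close>, as soon as
  for all \<open>x, y\<close> some partial derivative of \<open>\<psi> x - \<psi> y\<close> is comparable to \<open>|x - y|\<close> and the higher ones scale
  correctly: the kernel of \<open>TT\<^sup>*\<close> is then integrable by non-stationary phase. For \<open>\<phi>\<close> this holds on balls
  around \<open>\<zeta> \<noteq> 0\<close> of radius \<open>\<delta> |\<zeta>|\<close>, because by Hadamard's global inverse function theorem the
  SND condition makes \<open>x \<mapsto> \<nabla>\<^sub>\<xi> \<phi>(x, \<zeta>)\<close> globally expansive.

  On a frequency cube of side \<open>2\<^sup>k\<^sup>\<rho>\<close> inside the shell \<open>|\<xi>| \<approx> 2\<^sup>k\<close> the amplitude is removed by the fundamental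
  theorem of calculus, one coordinate at a time, and Hoelder's inequality turns \<open>L\<^sup>2\<close> into \<open>L\<^sup>r\<close>. Such a shell
  consists of about \<open>2\<^sup>n\<^sup>k\<^sup>(\<^sup>1\<^sup>-\<^sup>\<rho>\<^sup>)\<close> cubes, so the Cauchy-Schwarz inequality loses \<open>2\<^sup>n\<^sup>k\<^sup>(\<^sup>1\<^sup>-\<^sup>\<rho>\<^sup>)\<^sup>/\<^sup>2\<close>, which the decay
  \<open>2\<^sup>m\<^sup>k\<close> of the amplitude beats since \<open>m < n (\<rho> - 1) / 2\<close>. For \<open>|\<xi>| < 1\<close> the phase is compared
  with its linearisations along finitely many directions; the error on the cubes at distance \<open>2\<^sup>-\<^sup>k\<close> from the
  origin is \<open>O(2\<^sup>-\<^sup>k)\<close>, hence summable.\<close>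

section \<open>Bounds in \<open>L\<^sup>r\<close>\<close>

text \<open>Membership in \<open>PhiK 2\<close> controls derivatives of total order at least two
  only, so neither \<open>\<phi>\<close> nor its gradient in \<xi> need be bounded in
  \<open>x\<close>. Every estimate therefore works with differences: those between two points
  \<open>x\<close>, \<open>y\<close>, whose \<xi>-derivatives are Lipschitz in \<open>x\<close>, or
  increments of the gradient between nearby frequencies. The amplitude is merely L^p in
  \<open>x\<close>, separately for each \<xi>, so it cannot enter a kernel estimate. It is written
  as an average over frozen frequencies, each costing one multiplication by an L^p function, and 1/r
  = 1/p + 1/2. Near \<xi> = 0 the amplitude provides no decay from one dyadic shell to the next, and
  adding uniform bounds over infinitely many shells would diverge. Subtracting a linearised phase
  gains a factor |\<xi>|. The gradient is homogeneous of degree 0, so one linearisation serves all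
  cubes along a ray; the linear phase itself is treated on the whole unit ball at once. The
  constants of the oscillatory bounds are quantified before phase, centre and scale, because one
  constant must serve all cubes and all pairs \<open>x\<close>, \<open>y\<close>.\<close>

text \<open>The bound \<open>\<parallel>u\<parallel>\<^sub>r \<le> A\<close> in a form that avoids taking roots.\<close>
definition Lr_le :: "'a measure \<Rightarrow> real \<Rightarrow> ('a \<Rightarrow> complex) \<Rightarrow> real \<Rightarrow> bool" where
  "Lr_le M r u A \<longleftrightarrow> u \<in> borel_measurable M \<and>
     (\<integral>\<^sup>+x. ennreal (norm (u x) powr r) \<partial>M) \<le> ennreal (A powr r)"

text \<open>This is the convexity of \<open>y powr r\<close>: the graph lies above its tangent at
  \<open>z\<close>. The left side is linear in \<open>y\<close> and can therefore be integrated,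
  which replaces duality in Minkowski's inequality below.\<close>

lemma young_tangent:
  fixes r y z :: real
  assumes "1 \<le> r" "0 \<le> y" "0 \<le> z"
  shows "r * y * z powr (r - 1) \<le> y powr r + (r - 1) * z powr r"
proof (cases "r = 1 \<or> y = 0 \<or> z = 0")
  case True
  then show ?thesis using assms by (auto simp: powr_one_eq_one)
next
  case False
  with assms have r: "r > 1" and yz: "y > 0" "z > 0" by auto
  have "y * z powr (r - 1) \<le> y powr r / r + (z powr (r - 1)) powr (r/(r-1)) / (r/(r-1))"
    by (rule Youngs_inequality) (use r yz in \<open>auto simp: field_simps\<close>)
  also have "(z powr (r - 1)) powr (r/(r-1)) = z powr r"
    using r by (simp add: powr_powr)
  finally show ?thesis using r by (simp add: field_simps)
qed

text \<open>Minkowski's integral inequality when the norm of \<open>h\<close> at parameter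
  \<open>s\<close> is only known to be at most \<open>A s\<close>. In essence it is Jensen's
  inequality for the density \<open>A / B\<close>: pointwise, |u|^r is at most B^(r-1) times the
  integral of h^r A^(1-r), and integrating in \<open>x\<close> by Tonelli gives the claim.\<close>

lemma minkowski_integral:
  assumes M: "sigma_finite_measure M" and N: "sigma_finite_measure N"
    and r: "1 \<le> r" and B: "0 < B"
    and u: "u \<in> borel_measurable M"
    and h: "(\<lambda>(x, s). h x s) \<in> borel_measurable (M \<Otimes>\<^sub>M N)"
    and h0: "\<And>x s. 0 \<le> (h x s :: real)"
    and le: "AE x in M. ennreal (norm (u x :: complex)) \<le> (\<integral>\<^sup>+s. ennreal (h x s) \<partial>N)"
    and A: "A \<in> borel_measurable N" "\<And>s. 0 < (A s :: real)"
    and hA: "\<And>s. s \<in> space N \<Longrightarrow> (\<integral>\<^sup>+x. ennreal (h x s powr r) \<partial>M) \<le> ennreal (A s powr r)"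
    and AB: "(\<integral>\<^sup>+s. ennreal (A s) \<partial>N) \<le> ennreal B"
  shows "Lr_le M r u B"
proof -
  interpret M: sigma_finite_measure M by fact
  interpret N: sigma_finite_measure N by fact
  interpret P: pair_sigma_finite M N ..
  note [measurable] = u h A(1)
  have hx[measurable]: "(\<lambda>s. h x s) \<in> borel_measurable N" if "x \<in> space M" for x
    using measurable_Pair2[OF h that] by simp
  have hs[measurable]: "(\<lambda>x. h x s) \<in> borel_measurable M" if "s \<in> space N" for s
    using measurable_Pair1[OF h that] by simp
  define I where "I x = (\<integral>\<^sup>+s. ennreal (h x s powr r * A s powr (1 - r)) \<partial>N)" for x
  have I: "ennreal (norm (u x) powr r) \<le> ennreal (B powr (r - 1)) * I x"
    if x: "x \<in> space M" and lex: "ennreal (norm (u x)) \<le> (\<integral>\<^sup>+s. ennreal (h x s) \<partial>N)" for x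
  proof -
    define c where "c = norm (u x)"
    \<comment> \<open>The point of tangency. With this choice \<open>z powr (r - 1) * c\<close>
      equals \<open>z powr r * B\<close>, so that \<open>r - 1\<close> of the \<open>r\<close>
      copies on the left cancel against the error term.\<close>
    define z where "z = c / B"
    have cz: "c \<ge> 0" "z \<ge> 0" using B by (auto simp: c_def z_def)
    have pw: "r * z powr (r - 1) * h x s \<le> h x s powr r * A s powr (1 - r) + (r - 1) * z powr r * A s" for s
    proof -
      have "r * (h x s / A s) * z powr (r - 1) \<le> (h x s / A s) powr r + (r - 1) * z powr r"
        by (rule young_tangent) (use r h0 A(2)[of s] cz in \<open>auto simp: less_imp_le\<close>)
      from mult_left_mono[OF this, of "A s"] A(2)[of s]
      have "r * z powr (r - 1) * h x s \<le> A s * (h x s / A s) powr r + (r - 1) * z powr r * A s"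
        by (simp add: field_simps)
      also have "A s * (h x s / A s) powr r = h x s powr r * A s powr (1 - r)"
        using A(2)[of s] h0[of x s] by (simp add: powr_divide powr_diff)
      finally show ?thesis .
    qed
    have "ennreal (r * z powr (r - 1) * c) = ennreal (r * z powr (r - 1)) * ennreal c"
      using r cz by (simp add: ennreal_mult)
    also have "\<dots> \<le> ennreal (r * z powr (r - 1)) * (\<integral>\<^sup>+s. ennreal (h x s) \<partial>N)"
      using lex by (intro mult_left_mono) (auto simp: c_def)
    also have "\<dots> = (\<integral>\<^sup>+s. ennreal (r * z powr (r - 1) * h x s) \<partial>N)"
      using x r by (subst nn_integral_cmult[symmetric]) (auto intro!: nn_integral_cong simp: ennreal_mult h0)
    also have "\<dots> \<le> (\<integral>\<^sup>+s. ennreal (h x s powr r * A s powr (1 - r)) + ennreal ((r - 1) * z powr r * A s) \<partial>N)"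
    proof (intro nn_integral_mono)
      fix s
      have "0 \<le> (r - 1) * z powr r * A s" using r A(2)[of s] by simp
      then show "ennreal (r * z powr (r - 1) * h x s) \<le> ennreal (h x s powr r * A s powr (1 - r)) + ennreal ((r - 1) * z powr r * A s)"
        using pw[of s] by (subst ennreal_plus[symmetric]) (auto simp del: ennreal_plus intro: ennreal_leI)
    qed
    also have "\<dots> = I x + (\<integral>\<^sup>+s. ennreal ((r - 1) * z powr r * A s) \<partial>N)"
      unfolding I_def using x by (intro nn_integral_add) auto
    also have "(\<integral>\<^sup>+s. ennreal ((r - 1) * z powr r * A s) \<partial>N) = ennreal ((r - 1) * z powr r) * (\<integral>\<^sup>+s. ennreal (A s) \<partial>N)"
      using r A(2) by (subst nn_integral_cmult[symmetric]) (auto intro!: nn_integral_cong simp: ennreal_mult less_imp_le)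
    also have "\<dots> \<le> ennreal ((r - 1) * z powr r) * ennreal B"
      by (intro mult_left_mono AB) auto
    also have "\<dots> = ennreal ((r - 1) * z powr r * B)"
      using r B by (simp add: ennreal_mult)
    finally have 1: "ennreal (r * z powr (r - 1) * c) \<le> I x + ennreal ((r - 1) * z powr r * B)"
      by (simp add: add_left_mono)
    have 2: "z powr (r - 1) * c = z powr r * B"
      using B cz by (cases "c = 0") (auto simp: z_def powr_diff field_simps)
    have "ennreal (z powr r * B) + ennreal ((r - 1) * z powr r * B) = ennreal (r * z powr (r - 1) * c)"
    proof -
      have "r * z powr (r - 1) * c = r * (z powr (r - 1) * c)" by simp
      also have "\<dots> = z powr r * B + (r - 1) * z powr r * B" unfolding 2 by (simp add: algebra_simps)
      finally show ?thesis using r B by (subst ennreal_plus[symmetric]) (auto simp del: ennreal_plus)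
    qed
    with 1 have "ennreal (z powr r * B) + ennreal ((r - 1) * z powr r * B) \<le> I x + ennreal ((r - 1) * z powr r * B)"
      by simp
    \<comment> \<open>Cancellation in \<open>ennreal\<close> is legitimate since the common summand
      is finite.\<close>
    then have 3: "ennreal (z powr r * B) \<le> I x"
      by (simp add: add.commute)
    have "ennreal (c powr r) = ennreal (B powr (r - 1)) * ennreal (z powr r * B)"
      using B cz by (simp add: ennreal_mult[symmetric] z_def powr_divide powr_diff)
    also have "\<dots> \<le> ennreal (B powr (r - 1)) * I x" by (intro mult_left_mono 3) auto
    finally show ?thesis by (simp add: c_def)
  qed
  have Im: "I \<in> borel_measurable M" unfolding I_def by measurable
  have "(\<integral>\<^sup>+x. ennreal (norm (u x) powr r) \<partial>M) \<le> (\<integral>\<^sup>+x. ennreal (B powr (r - 1)) * I x \<partial>M)"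
    using le I by (intro nn_integral_mono_AE) auto
  also have "\<dots> = ennreal (B powr (r - 1)) * (\<integral>\<^sup>+x. I x \<partial>M)"
    using Im by (simp add: nn_integral_cmult)
  also have "(\<integral>\<^sup>+x. I x \<partial>M) = (\<integral>\<^sup>+s. (\<integral>\<^sup>+x. ennreal (h x s powr r * A s powr (1 - r)) \<partial>M) \<partial>N)"
    unfolding I_def by (rule P.Fubini'[symmetric]) measurable
  also have "\<dots> \<le> (\<integral>\<^sup>+s. ennreal (A s) \<partial>N)"
  proof (intro nn_integral_mono)
    fix s assume s: "s \<in> space N"
    have "(\<integral>\<^sup>+x. ennreal (h x s powr r * A s powr (1 - r)) \<partial>M) = ennreal (A s powr (1 - r)) * (\<integral>\<^sup>+x. ennreal (h x s powr r) \<partial>M)"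
      using s by (subst nn_integral_cmult[symmetric]) (auto intro!: nn_integral_cong simp: ennreal_mult mult.commute)
    also have "\<dots> \<le> ennreal (A s powr (1 - r)) * ennreal (A s powr r)"
      by (intro mult_left_mono hA s) auto
    also have "\<dots> = ennreal (A s)"
      using A(2)[of s] by (simp add: ennreal_mult[symmetric] powr_add[symmetric])
    finally show "(\<integral>\<^sup>+x. ennreal (h x s powr r * A s powr (1 - r)) \<partial>M) \<le> ennreal (A s)" .
  qed
  also have "\<dots> \<le> ennreal B" by (rule AB)
  also have "ennreal (B powr (r - 1)) * ennreal B = ennreal (B powr r)"
    using B by (simp add: ennreal_mult[symmetric] powr_diff)
  finally show ?thesis
    unfolding Lr_le_def using u by (simp add: mult_left_mono)
qed

text \<open>Minkowski's inequality over the counting measure. The pointwise bound is stated in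
  \<open>ennreal\<close>, where the series on the right always has a value.\<close>

lemma Lr_le_series:
  fixes u :: "nat \<Rightarrow> 'a \<Rightarrow> complex"
  assumes M: "sigma_finite_measure M" and r: "1 \<le> r"
    and v: "v \<in> borel_measurable M"
    and le: "AE x in M. ennreal (norm (v x)) \<le> (\<Sum>k. ennreal (norm (u k x)))"
    and u: "\<And>k. Lr_le M r (u k) (A k)" and A: "\<And>k. 0 < A k" "summable A"
  shows "Lr_le M r v (suminf A)"
proof (rule minkowski_integral[where N = "count_space UNIV" and A = A and h = "\<lambda>x k. norm (u k x)"])
  show "sigma_finite_measure (count_space (UNIV::nat set))"
    by (rule sigma_finite_measure_count_space)
  show "0 < suminf A" using A by (intro suminf_pos) auto
  have [measurable]: "\<And>k. u k \<in> borel_measurable M" using u by (auto simp: Lr_le_def)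
  show "(\<lambda>(x, s). norm (u s x)) \<in> borel_measurable (M \<Otimes>\<^sub>M count_space UNIV)"
    by measurable
  show "AE x in M. ennreal (norm (v x)) \<le> (\<integral>\<^sup>+ s. ennreal (norm (u s x)) \<partial>count_space UNIV)"
    using le by (simp add: nn_integral_count_space_nat)
  show "(\<integral>\<^sup>+ s. ennreal (A s) \<partial>count_space UNIV) \<le> ennreal (suminf A)"
    using A by (simp add: nn_integral_count_space_nat suminf_ennreal2 less_imp_le)
  show "(\<integral>\<^sup>+ x. ennreal (norm (u s x) powr r) \<partial>M) \<le> ennreal (A s powr r)" for s
    using u[of s] by (simp add: Lr_le_def)
qed (use M r v A(1) in simp_all)

lemma Lr_le_sum:
  fixes u :: "'i \<Rightarrow> 'a \<Rightarrow> complex"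
  assumes M: "sigma_finite_measure M" and r: "1 \<le> r"
    and v: "v \<in> borel_measurable M" and I: "finite I" "I \<noteq> {}"
    and le: "AE x in M. norm (v x) \<le> (\<Sum>k\<in>I. norm (u k x))"
    and u: "\<And>k. k \<in> I \<Longrightarrow> Lr_le M r (u k) (A k)" and A: "\<And>k. k \<in> I \<Longrightarrow> 0 < A k"
  shows "Lr_le M r v (sum A I)"
\<comment> \<open>The value 1 off \<open>I\<close> keeps the bound positive at every index, as
  \<open>minkowski_integral\<close> demands.\<close>
proof (rule minkowski_integral[where N = "count_space I" and A = "\<lambda>k. if k \<in> I then A k else 1" and h = "\<lambda>x k. norm (u k x)"])
  show "sigma_finite_measure (count_space I)"
    using I by (intro sigma_finite_measure_count_space_finite)
  show "0 < sum A I" using A I by (intro sum_pos) auto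
  have [measurable]: "\<And>k. k \<in> I \<Longrightarrow> u k \<in> borel_measurable M" using u by (auto simp: Lr_le_def)
  show "(\<lambda>(x, s). norm (u s x)) \<in> borel_measurable (M \<Otimes>\<^sub>M count_space I)"


    unfolding split_beta'
  proof (rule measurable_compose_countable'[where f = "\<lambda>k z. norm (u k (fst z))" and g = snd])
    show "snd \<in> measurable (M \<Otimes>\<^sub>M count_space I) (count_space I)" by (rule measurable_snd)
  qed (use I in \<open>auto simp: countable_finite intro!: borel_measurable_norm measurable_compose[OF measurable_fst]\<close>)
  show "AE x in M. ennreal (norm (v x)) \<le> (\<integral>\<^sup>+ s. ennreal (norm (u s x)) \<partial>count_space I)"
    using le I by (simp add: nn_integral_count_space_finite sum_nonneg ennreal_leI)
  have "(\<integral>\<^sup>+ s. ennreal (if s \<in> I then A s else 1) \<partial>count_space I) = (\<Sum>s\<in>I. ennreal (A s))"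
    using I by (simp add: nn_integral_count_space_finite)
  also have "\<dots> = ennreal (sum A I)"
    using A by (intro sum_ennreal) (auto simp: less_imp_le)
  finally show "(\<integral>\<^sup>+ s. ennreal (if s \<in> I then A s else 1) \<partial>count_space I) \<le> ennreal (sum A I)" by simp
  show "(\<integral>\<^sup>+ x. ennreal (norm (u s x) powr r) \<partial>M) \<le> ennreal ((if s \<in> I then A s else 1) powr r)"
    if "s \<in> space (count_space I)" for s
    using u[of s] that by (simp add: Lr_le_def)
qed (use M r v A in simp_all)

lemma Lr_le_scale:
  assumes "Lr_le M r u A" "0 \<le> A"
  shows "Lr_le M r (\<lambda>x. c * u x) (norm c * A)"
proof -
  have [measurable]: "u \<in> borel_measurable M" using assms by (auto simp: Lr_le_def)
  have "(\<integral>\<^sup>+x. ennreal (norm (c * u x) powr r) \<partial>M) = ennreal (norm c powr r) * (\<integral>\<^sup>+x. ennreal (norm (u x) powr r) \<partial>M)"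
    by (subst nn_integral_cmult[symmetric]) (auto intro!: nn_integral_cong simp: norm_mult powr_mult ennreal_mult)
  also have "\<dots> \<le> ennreal (norm c powr r) * ennreal (A powr r)"
    using assms by (intro mult_left_mono) (auto simp: Lr_le_def)
  also have "\<dots> = ennreal ((norm c * A) powr r)"
    using assms by (simp add: ennreal_mult[symmetric] powr_mult)
  finally show ?thesis by (auto simp: Lr_le_def)
qed

lemma Lr_le_mono:
  assumes "Lr_le M r u A" "v \<in> borel_measurable M" "AE x in M. norm (v x) \<le> norm (u x)" "0 \<le> A" "A \<le> B" "0 \<le> r"
  shows "Lr_le M r v B"
proof -
  have "(\<integral>\<^sup>+x. ennreal (norm (v x) powr r) \<partial>M) \<le> (\<integral>\<^sup>+x. ennreal (norm (u x) powr r) \<partial>M)"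
    using assms(3,6) by (intro nn_integral_mono_AE) (auto intro!: ennreal_leI powr_mono2)
  also have "\<dots> \<le> ennreal (A powr r)" using assms by (auto simp: Lr_le_def)
  also have "\<dots> \<le> ennreal (B powr r)" using assms by (intro ennreal_leI powr_mono2) auto
  finally show ?thesis using assms by (auto simp: Lr_le_def)
qed

text \<open>Hoelder's inequality for 1/r = 1/p + 1/2, obtained from Young's inequality applied
  pointwise to |b|/D and |u|/f. The factor 2 pays for dropping the weights r/p and r/2; for
  \<open>p = \<infinity>\<close> it pays for the gap between the infimum and an admissible essential
  bound.\<close>

lemma Lr_le_holder:
  fixes p :: ennreal
  assumes p: "2 \<le> p" and r: "r = (if p = \<infinity> then 2 else 2 * enn2real p / (enn2real p + 2))"
    and b: "b \<in> borel_measurable M" "Lp_norm p b M \<le> ennreal D" "0 < D"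
    and u: "Lr_le M 2 u f" "0 < f"
  shows "Lr_le M r (\<lambda>x. b x * u x) (2 * D * f)"
proof -
  have [measurable]: "u \<in> borel_measurable M" "b \<in> borel_measurable M" using u b by (auto simp: Lr_le_def)
  have u2: "(\<integral>\<^sup>+x. ennreal (norm (u x) powr 2) \<partial>M) \<le> ennreal (f powr 2)"
    using u by (auto simp: Lr_le_def)
  show ?thesis
  proof (cases "p = \<infinity>")
    case True
    have "Inf {C. AE x in M. ennreal (norm (b x)) \<le> C} < ennreal (2 * D)"
      using b True by (auto simp: Lp_norm_def ennreal_lessI intro: le_less_trans)
    then obtain C where C: "AE x in M. ennreal (norm (b x)) \<le> C" "C < ennreal (2 * D)"
      by (auto simp: Inf_less_iff)
    have "AE x in M. norm (b x * u x) \<le> norm (complex_of_real (2 * D) * u x)"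
      using C(1)
    proof eventually_elim
      case (elim x)
      then have "ennreal (norm (b x)) < ennreal (2 * D)" using C(2) by (rule le_less_trans)
      then have "norm (b x) \<le> 2 * D" by (simp add: ennreal_less_iff)
      then show ?case using \<open>0 < D\<close> by (simp add: norm_mult mult_right_mono)
    qed
    moreover have "Lr_le M 2 (\<lambda>x. complex_of_real (2 * D) * u x) (2 * D * f)"
      using Lr_le_scale[OF u(1), of "complex_of_real (2 * D)"] u(2) \<open>0 < D\<close> by (simp add: norm_mult)
    moreover have "(\<lambda>x. b x * u x) \<in> borel_measurable M" by simp
    ultimately have "Lr_le M 2 (\<lambda>x. b x * u x) (2 * D * f)"
      using Lr_le_mono[of M 2 "\<lambda>x. complex_of_real (2 * D) * u x" "2 * D * f" "\<lambda>x. b x * u x" "2 * D * f"]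
        u(2) \<open>0 < D\<close> by simp
    moreover have "r = 2" using r True by simp
    ultimately show ?thesis by simp
  next
    case False
    define q where "q = enn2real p"
    have pq: "ennreal q = p" unfolding q_def using False by (intro ennreal_enn2real) (simp add: less_top)
    have "ennreal 2 = 2" by (rule ennreal_numeral)
    with p pq have "ennreal 2 \<le> ennreal q" by argo
    then have q: "q \<ge> 2" by (subst (asm) ennreal_le_iff2) auto
    have rq: "r = 2 * q / (q + 2)" unfolding q_def by (subst r) (rule if_not_P[OF False])
    have r1: "1 \<le> r" using q by (simp add: rq field_simps)
    define I where "I = (\<integral>\<^sup>+x. ennreal (norm (b x) powr q) \<partial>M)"
    have I: "I \<le> ennreal (D powr q)"
    proof -
      have 1: "(if I = \<infinity> then \<infinity> else ennreal (enn2real I powr (1/q))) \<le> ennreal D"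
        using b(2) False unfolding Lp_norm_def I_def q_def Let_def by (simp split: if_splits)
      then have fin: "I \<noteq> \<infinity>" by (auto simp: top_unique)
      then have "enn2real I powr (1/q) \<le> D" using 1 b(3) by (simp add: ennreal_le_iff)
      then have "(enn2real I powr (1/q)) powr q \<le> D powr q" using q by (intro powr_mono2) auto
      then have "enn2real I \<le> D powr q" using q by (simp add: powr_powr)
      then have "ennreal (enn2real I) \<le> ennreal (D powr q)" by (rule ennreal_leI)
      then show ?thesis using fin by (simp add: ennreal_enn2real_if)
    qed
    have rq1: "r / q = 2 / (q + 2)" "r / 2 = q / (q + 2)" using q by (auto simp: rq divide_simps)
    then have rq2: "r / q + r / 2 = 1" "r / q \<le> 1" "r / 2 \<le> 1"
      unfolding rq1 using q by (auto simp: add_divide_distrib[symmetric])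
    have young: "(s * t) powr r \<le> s powr q + t powr 2" if "s \<ge> 0" "t \<ge> 0" for s t :: real
    proof -
      have "s powr r * t powr r \<le> (s powr r) powr (q/r) / (q/r) + (t powr r) powr (2/r) / (2/r)"
      proof (rule Youngs_inequality)
        have "r < 2" "r < q" using q by (auto simp: rq field_simps)
        then show "1 < q / r" "1 < 2 / r" using r1 by auto
        show "1 / (q / r) + 1 / (2 / r) = 1" using rq2(1) by simp
      qed auto
      also have "\<dots> = s powr q * (r/q) + t powr 2 * (r/2)"
        using r1 q by (simp add: powr_powr)
      also have "\<dots> \<le> s powr q * 1 + t powr 2 * 1"
        by (intro add_mono mult_left_mono rq2(2,3)) auto
      finally show ?thesis using that by (simp add: powr_mult)
    qed
    have pw: "norm (b x * u x) powr r \<le> (D * f) powr r * (norm (b x) powr q / D powr q + norm (u x) powr 2 / f powr 2)" for x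
    proof -
      have "norm (b x * u x) powr r = (D * f) powr r * ((norm (b x) / D) * (norm (u x) / f)) powr r"
        using b(3) u(2) by (simp add: norm_mult powr_mult[symmetric])
      also have "\<dots> \<le> (D * f) powr r * ((norm (b x) / D) powr q + (norm (u x) / f) powr 2)"
        using b(3) u(2) by (intro mult_left_mono young) auto
      finally show ?thesis using b(3) u(2) by (simp add: powr_divide)
    qed
    have "(\<integral>\<^sup>+x. ennreal (norm (b x * u x) powr r) \<partial>M) \<le>
      (\<integral>\<^sup>+x. ennreal ((D * f) powr r / D powr q) * ennreal (norm (b x) powr q) + ennreal ((D * f) powr r / f powr 2) * ennreal (norm (u x) powr 2) \<partial>M)"
    proof (intro nn_integral_mono)
      fix x
      have "ennreal (norm (b x * u x) powr r) \<le> ennreal ((D * f) powr r / D powr q * norm (b x) powr q + (D * f) powr r / f powr 2 * norm (u x) powr 2)"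
        using pw[of x] by (intro ennreal_leI) (simp add: distrib_left mult.commute)
      also have "\<dots> = ennreal ((D * f) powr r / D powr q) * ennreal (norm (b x) powr q) + ennreal ((D * f) powr r / f powr 2) * ennreal (norm (u x) powr 2)"
        by (subst ennreal_plus) (simp_all only: ennreal_mult[symmetric] divide_nonneg_nonneg powr_ge_zero mult_nonneg_nonneg)
      finally show "ennreal (norm (b x * u x) powr r) \<le> \<dots>" .
    qed
    also have "\<dots> = ennreal ((D * f) powr r / D powr q) * I + ennreal ((D * f) powr r / f powr 2) * (\<integral>\<^sup>+x. ennreal (norm (u x) powr 2) \<partial>M)"
      unfolding I_def by (subst nn_integral_add) (auto simp: nn_integral_cmult)
    also have "\<dots> \<le> ennreal ((D * f) powr r / D powr q) * ennreal (D powr q) + ennreal ((D * f) powr r / f powr 2) * ennreal (f powr 2)"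
      by (intro add_mono mult_left_mono I u2) auto
    also have "\<dots> = ennreal (2 * (D * f) powr r)"
      using b(3) u(2) by (simp add: ennreal_mult[symmetric] ennreal_plus[symmetric] del: ennreal_plus)
    also have "\<dots> \<le> ennreal (2 powr r * (D * f) powr r)"
    proof -
      have "(2::real) powr 1 \<le> 2 powr r" using r1 by (intro powr_mono) auto
      then show ?thesis by (intro ennreal_leI mult_right_mono) auto
    qed
    also have "2 powr r * (D * f) powr r = (2 * D * f) powr r"
      using b(3) u(2) by (simp add: powr_mult[symmetric] mult.assoc)
    finally show ?thesis by (auto simp: Lr_le_def)
  qed
qed

section \<open>Non-stationary phase\<close>

text \<open>Differentiability of order \<open>k\<close> along the single direction \<open>v\<close>,
  with one bound for all orders. The derivative is an existential witness constrained on
  \<open>S\<close> only, and the recursion on \<open>k\<close> matches integration by parts, which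
  uses up one derivative at a time.\<close>

fun dbd :: "'a::real_normed_vector set \<Rightarrow> 'a \<Rightarrow> nat \<Rightarrow> real \<Rightarrow> ('a \<Rightarrow> complex) \<Rightarrow> bool" where
  "dbd S v 0 A w \<longleftrightarrow> continuous_on S w \<and> (\<forall>\<xi>\<in>S. norm (w \<xi>) \<le> A)"
| "dbd S v (Suc k) A w \<longleftrightarrow> continuous_on S w \<and> (\<forall>\<xi>\<in>S. norm (w \<xi>) \<le> A) \<and>
     (\<exists>w'. (\<forall>\<xi>\<in>S. ((\<lambda>s. w (\<xi> + s *\<^sub>R v)) has_vector_derivative w' \<xi>) (at 0)) \<and> dbd S v k A w')"

declare dbd.simps(2) [simp del]

lemma dbd_cont: "dbd S v k A w \<Longrightarrow> continuous_on S w"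
  by (cases k) (auto simp: dbd.simps(2))

lemma dbd_bound: "dbd S v k A w \<Longrightarrow> \<xi> \<in> S \<Longrightarrow> norm (w \<xi>) \<le> A"
  by (cases k) (auto simp: dbd.simps(2))

lemma dbd_SucI:
  assumes "continuous_on S w" "\<And>\<xi>. \<xi> \<in> S \<Longrightarrow> norm (w \<xi>) \<le> A"
    "\<And>\<xi>. \<xi> \<in> S \<Longrightarrow> ((\<lambda>s. w (\<xi> + s *\<^sub>R v)) has_vector_derivative w' \<xi>) (at 0)" "dbd S v k A w'"
  shows "dbd S v (Suc k) A w"
  using assms unfolding dbd.simps(2) by blast

lemma dbd_SucE:
  assumes "dbd S v (Suc k) A w"
  obtains w' where "\<forall>\<xi>\<in>S. ((\<lambda>s. w (\<xi> + s *\<^sub>R v)) has_vector_derivative w' \<xi>) (at 0)" "dbd S v k A w'"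
  using assms unfolding dbd.simps(2) by blast

lemma dbd_mono: "dbd S v k A w \<Longrightarrow> A \<le> B \<Longrightarrow> dbd S v k B w"
proof (induction k arbitrary: w)
  case (Suc k)
  from Suc.prems(1) show ?case
    by (rule dbd_SucE, intro dbd_SucI)
       (use Suc in \<open>auto dest: dbd_cont dbd_bound intro: order_trans\<close>)
qed (auto intro: order_trans)

lemma dbd_Suc_imp: "dbd S v (Suc k) A w \<Longrightarrow> dbd S v k A w"
proof (induction k arbitrary: w)
  case 0
  then show ?case using dbd_cont dbd_bound unfolding dbd.simps(1) by blast
next
  case (Suc k)
  from Suc.prems show ?case
    by (rule dbd_SucE, intro dbd_SucI)
       (use Suc in \<open>auto dest: dbd_cont dbd_bound\<close>)
qed

lemma dbd_subset: "dbd S v k A w \<Longrightarrow> T \<subseteq> S \<Longrightarrow> dbd T v k A w"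
proof (induction k arbitrary: w)
  case 0
  then show ?case by (auto intro: continuous_on_subset)
next
  case (Suc k)
  from Suc.prems(1) show ?case
    by (rule dbd_SucE, intro dbd_SucI)
       (use Suc in \<open>auto dest: dbd_cont dbd_bound intro: continuous_on_subset\<close>)
qed

lemma eventually_line_in:
  fixes v :: "'a::real_normed_vector"
  assumes "open S" "\<xi> \<in> S"
  shows "eventually (\<lambda>s. \<xi> + s *\<^sub>R v \<in> S) (at 0)" "eventually (\<lambda>s. \<xi> + s *\<^sub>R v \<in> S) (nhds 0)"
proof -
  have "((\<lambda>s. \<xi> + s *\<^sub>R v) \<longlongrightarrow> \<xi> + 0 *\<^sub>R v) (nhds (0::real))"
    by (intro tendsto_intros filterlim_ident)
  then show 1: "eventually (\<lambda>s. \<xi> + s *\<^sub>R v \<in> S) (nhds 0)"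
    using assms topological_tendstoD by fastforce
  then show "eventually (\<lambda>s. \<xi> + s *\<^sub>R v \<in> S) (at 0)" by (simp add: eventually_at_filter eventually_mono)
qed

lemma has_vector_derivative_line_cong:
  fixes v \<xi> :: "'a::real_normed_vector"
  assumes "open S" "\<xi> \<in> S" "\<And>\<eta>. \<eta> \<in> S \<Longrightarrow> f \<eta> = g \<eta>"
    "((\<lambda>s. f (\<xi> + s *\<^sub>R v)) has_vector_derivative D) (at 0)"
  shows "((\<lambda>s. g (\<xi> + s *\<^sub>R v)) has_vector_derivative D) (at 0)"
  using assms(4) unfolding has_vector_derivative_def
proof (rule has_derivative_transform_eventually)
  show "\<forall>\<^sub>F s in at 0 within UNIV. f (\<xi> + s *\<^sub>R v) = g (\<xi> + s *\<^sub>R v)"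
    using eventually_line_in(1)[OF assms(1,2), of v] by eventually_elim (use assms(3) in auto)
qed (use assms in auto)

lemma dbd_cong:
  assumes "open S" "\<And>\<xi>. \<xi> \<in> S \<Longrightarrow> f \<xi> = g \<xi>" "dbd S v k A f"
  shows "dbd S v k A g"
proof -
  have c: "continuous_on S g" using assms dbd_cont continuous_on_cong by metis
  have b: "norm (g \<xi>) \<le> A" if "\<xi> \<in> S" for \<xi> using dbd_bound[OF assms(3) that] assms(2)[OF that] by simp
  show ?thesis
  proof (cases k)
    case (Suc k')
    from assms(3) obtain f' where
      f': "\<forall>\<xi>\<in>S. ((\<lambda>s. f (\<xi> + s *\<^sub>R v)) has_vector_derivative f' \<xi>) (at 0)" "dbd S v k' A f'"
      unfolding Suc by (rule dbd_SucE)
    have dg: "((\<lambda>s. g (\<xi> + s *\<^sub>R v)) has_vector_derivative f' \<xi>) (at 0)" if "\<xi> \<in> S" for \<xi>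
      by (rule has_vector_derivative_line_cong[OF assms(1) that assms(2) bspec[OF f'(1) that]])
    show ?thesis unfolding Suc by (rule dbd_SucI[OF c b dg f'(2)])
  qed (use b c in auto)
qed

lemma dbd_add: "dbd S v k A f \<Longrightarrow> dbd S v k B g \<Longrightarrow> dbd S v k (A + B) (\<lambda>\<xi>. f \<xi> + g \<xi>)"
proof (induction k arbitrary: f g)
  case 0
  then show ?case by (auto intro!: continuous_intros intro: norm_triangle_mono)
next
  case (Suc k)
  from Suc.prems(1) obtain f' where f: "\<forall>\<xi>\<in>S. ((\<lambda>s. f (\<xi> + s *\<^sub>R v)) has_vector_derivative f' \<xi>) (at 0)" "dbd S v k A f'"
    by (rule dbd_SucE)
  from Suc.prems(2) obtain g' where g: "\<forall>\<xi>\<in>S. ((\<lambda>s. g (\<xi> + s *\<^sub>R v)) has_vector_derivative g' \<xi>) (at 0)" "dbd S v k B g'"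
    by (rule dbd_SucE)
  show ?case
  proof (rule dbd_SucI)
    show "dbd S v k (A + B) (\<lambda>\<xi>. f' \<xi> + g' \<xi>)" using Suc.IH f g by blast
    show "((\<lambda>s. f (\<xi> + s *\<^sub>R v) + g (\<xi> + s *\<^sub>R v)) has_vector_derivative f' \<xi> + g' \<xi>) (at 0)" if "\<xi> \<in> S" for \<xi>
      using bspec[OF f(1) that] bspec[OF g(1) that] by (rule has_vector_derivative_add)
    show "continuous_on S (\<lambda>\<xi>. f \<xi> + g \<xi>)"
      using Suc.prems by (intro continuous_on_add) (auto dest: dbd_cont)
    show "norm (f \<xi> + g \<xi>) \<le> A + B" if "\<xi> \<in> S" for \<xi>
      using Suc.prems that dbd_bound norm_triangle_mono by meson
  qed
qed

lemma dbd_const: "norm c \<le> A \<Longrightarrow> dbd S v k A (\<lambda>_. c)"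
proof (induction k arbitrary: c)
  case (Suc k)
  have "norm (0::complex) \<le> A" using Suc.prems norm_ge_zero order_trans by (metis norm_zero)
  then show ?case by (intro dbd_SucI[where w' = "\<lambda>_. 0"] Suc.IH) (use Suc.prems in auto)
qed auto

text \<open>The factor \<open>2 ^ k\<close> counts the terms of the Leibniz rule: every
  differentiation doubles their number.\<close>

lemma dbd_mult:
  assumes "dbd S v k A f" "dbd S v k B g" "0 \<le> A" "0 \<le> B"
  shows "dbd S v k (2 ^ k * A * B) (\<lambda>\<xi>. f \<xi> * g \<xi>)"
  using assms(1,2)
proof (induction k arbitrary: f g)
  case 0
  then show ?case using assms(3,4) by (auto intro!: continuous_intros simp: norm_mult mult_mono)
next
  case (Suc k)
  from Suc.prems(1) obtain f' where f: "\<forall>\<xi>\<in>S. ((\<lambda>s. f (\<xi> + s *\<^sub>R v)) has_vector_derivative f' \<xi>) (at 0)" "dbd S v k A f'"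
    by (rule dbd_SucE)
  from Suc.prems(2) obtain g' where g: "\<forall>\<xi>\<in>S. ((\<lambda>s. g (\<xi> + s *\<^sub>R v)) has_vector_derivative g' \<xi>) (at 0)" "dbd S v k B g'"
    by (rule dbd_SucE)
  show ?case
  proof (rule dbd_SucI)
    have "dbd S v k (2 ^ k * A * B + 2 ^ k * A * B) (\<lambda>\<xi>. f \<xi> * g' \<xi> + f' \<xi> * g \<xi>)"
      using Suc.IH[OF dbd_Suc_imp[OF Suc.prems(1)] g(2)] Suc.IH[OF f(2) dbd_Suc_imp[OF Suc.prems(2)]]
      by (rule dbd_add)
    then show "dbd S v k (2 ^ Suc k * A * B) (\<lambda>\<xi>. f \<xi> * g' \<xi> + f' \<xi> * g \<xi>)" by (simp add: algebra_simps)
    show "((\<lambda>s. f (\<xi> + s *\<^sub>R v) * g (\<xi> + s *\<^sub>R v)) has_vector_derivative f \<xi> * g' \<xi> + f' \<xi> * g \<xi>) (at 0)" if "\<xi> \<in> S" for \<xi>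
      using has_vector_derivative_mult[OF bspec[OF f(1) that] bspec[OF g(1) that]] by simp
    show "norm (f \<xi> * g \<xi>) \<le> 2 ^ Suc k * A * B" if "\<xi> \<in> S" for \<xi>
    proof -
      have "norm (f \<xi> * g \<xi>) \<le> A * B"
        unfolding norm_mult by (intro mult_mono dbd_bound[OF Suc.prems(1) that] dbd_bound[OF Suc.prems(2) that] assms(3)) simp
      also have "A * B \<le> 2 ^ Suc k * (A * B)"
        using mult_right_mono[of 1 "2 ^ Suc k" "A * B"] assms(3,4) two_realpow_ge_one[of "Suc k"] by simp
      finally show ?thesis by (simp only: mult.assoc)
    qed
    show "continuous_on S (\<lambda>\<xi>. f \<xi> * g \<xi>)"
      using Suc.prems by (intro continuous_on_mult) (auto dest: dbd_cont)
  qed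
qed

lemma dbd_minus: "dbd S v k A w \<Longrightarrow> dbd S v k A (\<lambda>\<xi>. - w \<xi>)"
proof (induction k arbitrary: w)
  case 0
  then show ?case by (auto intro!: continuous_intros)
next
  case (Suc k)
  from Suc.prems obtain w' where w': "\<forall>\<xi>\<in>S. ((\<lambda>s. w (\<xi> + s *\<^sub>R v)) has_vector_derivative w' \<xi>) (at 0)" "dbd S v k A w'"
    by (rule dbd_SucE)
  show ?case
    by (rule dbd_SucI[OF _ _ has_vector_derivative_minus[OF bspec[OF w'(1)]] Suc.IH[OF w'(2)]])
       (use Suc.prems in \<open>auto intro: continuous_on_minus dest: dbd_cont dbd_bound\<close>)
qed

text \<open>The derivative of 1/g is (1/g) (1/g) (-g'), and all three factors are covered at the
  previous order. What matters is that \<open>C\<close> depends on \<open>k\<close> and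
  \<open>A\<close> alone, so that it is the same for all sets, directions and functions.\<close>

lemma dbd_inverse:
  "\<exists>C\<ge>1. \<forall>(S::'a::real_normed_vector set) v g. dbd S v k A g \<longrightarrow> (\<forall>\<xi>\<in>S. 1 \<le> norm (g \<xi>)) \<longrightarrow> dbd S v k C (\<lambda>\<xi>. inverse (g \<xi>))"
proof (induction k)
  case 0
  show ?case
    by (intro exI[of _ 1]) (auto intro!: continuous_intros simp: norm_inverse inverse_le_1_iff)
next
  case (Suc k)
  then obtain C where C: "C \<ge> 1" "\<And>(S::'a set) v g. dbd S v k A g \<Longrightarrow> \<forall>\<xi>\<in>S. 1 \<le> norm (g \<xi>) \<Longrightarrow> dbd S v k C (\<lambda>\<xi>. inverse (g \<xi>))"
    by auto
  define D where "D = max C (2 ^ k * (2 ^ k * C * C) * \<bar>A\<bar>)"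
  show ?case
  proof (intro exI[of _ D] conjI allI impI)
    show "1 \<le> D" using C by (auto simp: D_def)
    fix S :: "'a set" and v g
    assume g: "dbd S v (Suc k) A g" and g1: "\<forall>\<xi>\<in>S. 1 \<le> norm (g \<xi>)"
    from g obtain g' where g': "\<forall>\<xi>\<in>S. ((\<lambda>s. g (\<xi> + s *\<^sub>R v)) has_vector_derivative g' \<xi>) (at 0)" "dbd S v k A g'"
      by (rule dbd_SucE)
    have q: "dbd S v k C (\<lambda>\<xi>. inverse (g \<xi>))" using C(2) dbd_Suc_imp[OF g] g1 by blast
    have mg: "dbd S v k \<bar>A\<bar> (\<lambda>\<xi>. - g' \<xi>)"
      using dbd_minus[OF g'(2)] by (rule dbd_mono) simp
    have "dbd S v k (2 ^ k * (2 ^ k * C * C) * \<bar>A\<bar>) (\<lambda>\<xi>. inverse (g \<xi>) * inverse (g \<xi>) * (- g' \<xi>))"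
      using C(1) by (intro dbd_mult q mg) auto
    then have 1: "dbd S v k D (\<lambda>\<xi>. inverse (g \<xi>) * inverse (g \<xi>) * (- g' \<xi>))"
      by (rule dbd_mono) (simp add: D_def)
    have 2: "((\<lambda>s. inverse (g (\<xi> + s *\<^sub>R v))) has_vector_derivative inverse (g \<xi>) * inverse (g \<xi>) * (- g' \<xi>)) (at 0)"
      if "\<xi> \<in> S" for \<xi>
    proof -
      have "g \<xi> \<noteq> 0" using g1 that by force
      then have "(inverse has_field_derivative - (inverse (g \<xi>) * inverse (g \<xi>))) (at (g (\<xi> + 0 *\<^sub>R v)))"
        using DERIV_inverse[of "g \<xi>" UNIV] by (simp add: numeral_2_eq_2)
      from field_vector_diff_chain_at[OF bspec[OF g'(1) that] this]
      show ?thesis by (simp add: o_def mult_ac)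
    qed
    have "norm (inverse (g \<xi>)) \<le> D" if "\<xi> \<in> S" for \<xi>
      using dbd_bound[OF q that] by (simp add: D_def)
    then show "dbd S v (Suc k) D (\<lambda>\<xi>. inverse (g \<xi>))"
      by (intro dbd_SucI[OF dbd_cont[OF q] _ 2 1]) auto
  qed
qed

text \<open>Difference quotients of \<open>G\<close> integrate to zero by translation invariance.\<close>
lemma integral_line_derivative_eq_0:
  fixes G :: "'a::euclidean_space \<Rightarrow> complex"
  assumes K: "compact K" and G0: "\<And>\<xi>. \<xi> \<notin> K \<Longrightarrow> G \<xi> = 0"
    and Gm: "G \<in> borel_measurable borel" and Dm: "D \<in> borel_measurable borel"
    and D: "\<And>\<xi>. ((\<lambda>s. G (\<xi> + s *\<^sub>R v)) has_vector_derivative D \<xi>) (at 0)"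
    and B: "\<And>\<xi>. norm (D \<xi>) \<le> B" "\<And>\<xi>. norm (G \<xi>) \<le> B"
  shows "(\<integral>\<xi>. D \<xi> \<partial>lborel) = 0"
proof -
  obtain R where R: "K \<subseteq> cball 0 R"
    using compact_imp_bounded[OF K] bounded_subset_ballD[of K 0] ball_subset_cball by (metis subset_trans)
  note [measurable] = Gm Dm
  define q where "q k \<xi> = (G (\<xi> + (1/real (Suc k)) *\<^sub>R v) - G \<xi>) * of_nat (Suc k)" for k \<xi>
  have D': "((\<lambda>s. G (\<xi> + s *\<^sub>R v)) has_vector_derivative D (\<xi> + t *\<^sub>R v)) (at t)" for \<xi> t
  proof -
    have "(((\<lambda>s. G ((\<xi> + t *\<^sub>R v) + s *\<^sub>R v)) \<circ> (\<lambda>s. s - t)) has_vector_derivative 1 *\<^sub>R D (\<xi> + t *\<^sub>R v)) (at t)"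
      by (rule vector_diff_chain_at) (auto intro!: derivative_eq_intros simp: D)
    then show ?thesis by (simp add: o_def scaleR_left_distrib[symmetric] add.assoc)
  qed
  have qb: "norm (q k \<xi>) \<le> B" for k \<xi>
  proof -
    have "norm (G (\<xi> + (1/real (Suc k)) *\<^sub>R v) - G (\<xi> + 0 *\<^sub>R v)) \<le> B * norm (1/real (Suc k) - 0)"
    proof (rule differentiable_bound[where S = UNIV and f = "\<lambda>s. G (\<xi> + s *\<^sub>R v)" and f' = "\<lambda>t h. h *\<^sub>R D (\<xi> + t *\<^sub>R v)"])
      show "((\<lambda>s. G (\<xi> + s *\<^sub>R v)) has_derivative (\<lambda>h. h *\<^sub>R D (\<xi> + t *\<^sub>R v))) (at t within UNIV)" for t
        using D'[of \<xi> t] by (simp add: has_vector_derivative_def)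
      show "onorm (\<lambda>h. h *\<^sub>R D (\<xi> + t *\<^sub>R v)) \<le> B" for t
        using B(1) by (intro onorm_le) (auto simp: mult.commute[of B] intro!: mult_left_mono)
    qed auto
    then have "norm (G (\<xi> + (1/real (Suc k)) *\<^sub>R v) - G \<xi>) * real (Suc k) \<le> B"
      by (simp add: pos_le_divide_eq del: of_nat_Suc)
    then show ?thesis unfolding q_def norm_mult norm_of_nat .
  qed
  have q0: "q k \<xi> = 0" if "\<xi> \<notin> cball 0 (R + norm v)" for k \<xi>
  proof -
    have a: "norm \<xi> > R + norm v" using that by auto
    have "norm \<xi> \<le> norm (\<xi> + (1/real (Suc k)) *\<^sub>R v) + norm ((1/real (Suc k)) *\<^sub>R v)"
      by (metis add_diff_cancel norm_triangle_sub norm_triangle_ineq4 add.commute)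
    also have "norm ((1/real (Suc k)) *\<^sub>R v) \<le> norm v" by (auto simp: field_simps)
    finally have "norm (\<xi> + (1/real (Suc k)) *\<^sub>R v) > R" using a by linarith
    moreover have "norm \<xi> > R" using a by (smt (verit) norm_ge_zero)
    ultimately show ?thesis using R G0 unfolding q_def by (metis diff_zero linorder_not_less mem_cball_0 mult_zero_left subset_iff)
  qed
  have int: "integrable lborel G"
  proof (rule integrableI_bounded_set[where A = "cball 0 R" and B = B])
    show "AE x in lborel. x \<notin> cball 0 R \<longrightarrow> G x = 0" by (rule AE_I2) (use R G0 in blast)
  qed (use B emeasure_lborel_cball_finite in \<open>auto simp: less_top[symmetric]\<close>)
  have "(\<integral>\<xi>. q k \<xi> \<partial>lborel) = 0" for k
  proof -
    have 1: "integrable lborel (\<lambda>\<xi>. G (\<xi> + c))" for c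
      using int by (subst (asm) lborel_distr_plus[symmetric, of c]) (simp add: integrable_distr_eq add.commute)
    have 2: "(\<integral>\<xi>. G (\<xi> + c) \<partial>lborel) = (\<integral>\<xi>. G \<xi> \<partial>lborel)" for c
      by (subst (2) lborel_distr_plus[symmetric, of c]) (simp add: integral_distr add.commute)
    show ?thesis unfolding q_def using 1 2 int by simp
  qed
  moreover have "(\<lambda>k. (\<integral>\<xi>. q k \<xi> \<partial>lborel)) \<longlonglongrightarrow> (\<integral>\<xi>. D \<xi> \<partial>lborel)"
  proof (rule integral_dominated_convergence[where w = "\<lambda>\<xi>. B * indicator (cball 0 (R + norm v)) \<xi>"])
    show "AE \<xi> in lborel. (\<lambda>k. q k \<xi>) \<longlonglongrightarrow> D \<xi>"
    proof (rule AE_I2)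
      fix \<xi>
      have "((\<lambda>h. (G (\<xi> + h *\<^sub>R v) - G \<xi>) /\<^sub>R h) \<longlongrightarrow> D \<xi>) (at 0)"
      proof (rule Lim_transform_eventually[OF _ , THEN LIM_zero_cancel], rule tendsto_norm_zero_cancel)
        show "((\<lambda>h. norm ((G (\<xi> + h *\<^sub>R v) - G \<xi> - h *\<^sub>R D \<xi>) /\<^sub>R h)) \<longlongrightarrow> 0) (at 0)"
          using D[of \<xi>] unfolding has_vector_derivative_def has_derivative_at
          by (simp add: divide_inverse mult.commute)
        show "\<forall>\<^sub>F h in at 0. (G (\<xi> + h *\<^sub>R v) - G \<xi> - h *\<^sub>R D \<xi>) /\<^sub>R h = (G (\<xi> + h *\<^sub>R v) - G \<xi>) /\<^sub>R h - D \<xi>"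
          by (auto simp: eventually_at_filter algebra_simps)
      qed
      from filterlim_compose[OF this, of "\<lambda>k. 1 / real (Suc k)" sequentially]
      have "((\<lambda>k. (G (\<xi> + (1 / real (Suc k)) *\<^sub>R v) - G \<xi>) /\<^sub>R (1 / real (Suc k))) \<longlongrightarrow> D \<xi>) sequentially"
        using LIMSEQ_inverse_real_of_nat by (auto simp: filterlim_at inverse_eq_divide)
      then show "(\<lambda>k. q k \<xi>) \<longlonglongrightarrow> D \<xi>"
        by (simp add: q_def scaleR_conv_of_real mult.commute)
    qed
    show "integrable lborel (\<lambda>\<xi>. B * indicator (cball 0 (R + norm v)) \<xi>)"
      using emeasure_lborel_cball_finite by (intro integrable_mult_right integrable_real_indicator) (auto simp: less_top[symmetric])
    show "AE x in lborel. norm (q k x) \<le> B * indicator (cball 0 (R + norm v)) x" for k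
      using qb q0 by (auto split: split_indicator)
  qed (auto simp: q_def)
  ultimately show ?thesis by (simp add: LIMSEQ_const_iff)
qed


text \<open>Each induction step integrates by parts once along \<open>v\<close>, with
  \<open>w\<close> written as (w/g) g, and gains a factor \<open>1 / \<mu>\<close>; the order 0
  bound is the volume of the support. Only \<open>k\<close> and \<open>A\<close> enter
  \<open>C\<close>, because the lemma is applied to all pairs of points and all cubes at
  once.\<close>

lemma nonstationary_phase:
  assumes "0 \<le> A"
  shows "\<exists>C\<ge>0. \<forall>(S::'a::euclidean_space set) K v \<mu> \<Psi> g w W.
     open S \<longrightarrow> compact K \<longrightarrow> K \<subseteq> S \<longrightarrow> 0 < \<mu> \<longrightarrow> continuous_on S \<Psi> \<longrightarrow>
     (\<forall>\<xi>\<in>S. ((\<lambda>s. \<Psi> (\<xi> + s *\<^sub>R v)) has_real_derivative \<mu> * g \<xi>) (at 0)) \<longrightarrow>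
     (\<forall>\<xi>\<in>S. 1 \<le> \<bar>g \<xi>\<bar>) \<longrightarrow> dbd S v k A (\<lambda>\<xi>. complex_of_real (g \<xi>)) \<longrightarrow>
     dbd S v k W w \<longrightarrow> (\<forall>\<xi>. \<xi> \<notin> K \<longrightarrow> w \<xi> = 0) \<longrightarrow> 0 \<le> W \<longrightarrow>
     norm (\<integral>\<xi>. w \<xi> * exp (\<i> * complex_of_real (\<Psi> \<xi>)) \<partial>lborel) \<le> C * W * (1/\<mu>)^k * measure lborel K"
proof (induction k)
  case 0
  show ?case
  proof (intro exI[of _ 1] conjI allI impI)
    fix S K :: "'a set" and v and \<mu> :: real and \<Psi> g and w :: "'a \<Rightarrow> complex" and W
    assume K: "compact K" "K \<subseteq> S" and w: "dbd S v 0 W w" "\<forall>\<xi>. \<xi> \<notin> K \<longrightarrow> w \<xi> = 0" and W: "0 \<le> W"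
    have fin: "emeasure lborel K < \<infinity>" using emeasure_compact_finite[OF K(1)] by (simp add: less_top)
    have "norm (\<integral>\<xi>. w \<xi> * exp (\<i> * complex_of_real (\<Psi> \<xi>)) \<partial>lborel) \<le>
        (\<integral>\<xi>. norm (w \<xi> * exp (\<i> * complex_of_real (\<Psi> \<xi>))) \<partial>lborel)"
      by (rule integral_norm_bound)
    also have "\<dots> \<le> (\<integral>\<xi>. W * indicator K \<xi> \<partial>lborel)"
    proof (rule integral_mono')
      show "integrable lborel (\<lambda>\<xi>. W * indicator K \<xi> :: real)"
        using fin K(1) by (intro integrable_mult_right integrable_real_indicator) (auto intro: borel_compact)
      show "norm (w \<xi> * exp (\<i> * complex_of_real (\<Psi> \<xi>))) \<le> W * indicator K \<xi>" for \<xi>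
        using w K dbd_bound[OF w(1)] by (auto simp: norm_mult split: split_indicator)
    qed (use W in auto)
    also have "\<dots> = W * measure lborel K"
      using K(1) by (simp add: borel_compact)
    finally show "norm (\<integral>\<xi>. w \<xi> * exp (\<i> * complex_of_real (\<Psi> \<xi>)) \<partial>lborel) \<le> 1 * W * (1/\<mu>)^0 * measure lborel K"
      by simp
  qed auto
next
  case (Suc k)
  then obtain C where C: "C \<ge> 0" "\<And>(S::'a set) K v \<mu> \<Psi> g w W.
     open S \<Longrightarrow> compact K \<Longrightarrow> K \<subseteq> S \<Longrightarrow> 0 < \<mu> \<Longrightarrow> continuous_on S \<Psi> \<Longrightarrow>
     (\<forall>\<xi>\<in>S. ((\<lambda>s. \<Psi> (\<xi> + s *\<^sub>R v)) has_real_derivative \<mu> * g \<xi>) (at 0)) \<Longrightarrow>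
     (\<forall>\<xi>\<in>S. 1 \<le> \<bar>g \<xi>\<bar>) \<Longrightarrow> dbd S v k A (\<lambda>\<xi>. complex_of_real (g \<xi>)) \<Longrightarrow>
     dbd S v k W w \<Longrightarrow> (\<forall>\<xi>. \<xi> \<notin> K \<longrightarrow> w \<xi> = 0) \<Longrightarrow> 0 \<le> W \<Longrightarrow>
     norm (\<integral>\<xi>. w \<xi> * exp (\<i> * complex_of_real (\<Psi> \<xi>)) \<partial>lborel) \<le> C * W * (1/\<mu>)^k * measure lborel K"
    by blast
  from dbd_inverse[of "Suc k" A] obtain Q where Q: "Q \<ge> 1" "\<And>(S::'a set) v g. dbd S v (Suc k) A g \<Longrightarrow>
      (\<forall>\<xi>\<in>S. 1 \<le> norm (g \<xi>)) \<Longrightarrow> dbd S v (Suc k) Q (\<lambda>\<xi>. inverse (g \<xi>))"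
    by blast
  show ?case
  proof (intro exI[of _ "C * (2 ^ Suc k * Q)"] conjI allI impI)
    fix S K :: "'a set" and v and \<mu> :: real and \<Psi> g and w :: "'a \<Rightarrow> complex" and W
    assume S: "open S" and K: "compact K" "K \<subseteq> S" and \<mu>: "0 < \<mu>" and \<Psi>: "continuous_on S \<Psi>"
      and d\<Psi>: "\<forall>\<xi>\<in>S. ((\<lambda>s. \<Psi> (\<xi> + s *\<^sub>R v)) has_real_derivative \<mu> * g \<xi>) (at 0)"
      and g: "\<forall>\<xi>\<in>S. 1 \<le> \<bar>g \<xi>\<bar>" "dbd S v (Suc k) A (\<lambda>\<xi>. complex_of_real (g \<xi>))"
      and w: "dbd S v (Suc k) W w" "\<forall>\<xi>. \<xi> \<notin> K \<longrightarrow> w \<xi> = 0" and W: "0 \<le> W"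
    define q where "q \<xi> = w \<xi> * inverse (complex_of_real (g \<xi>))" for \<xi>
    define e where "e \<xi> = exp (\<i> * complex_of_real (\<Psi> \<xi>))" for \<xi>
    have q: "dbd S v (Suc k) (2 ^ Suc k * W * Q) q"
      unfolding q_def using g Q(1) W by (intro dbd_mult w Q(2)) auto
    then obtain q1 where q1: "\<forall>\<xi>\<in>S. ((\<lambda>s. q (\<xi> + s *\<^sub>R v)) has_vector_derivative q1 \<xi>) (at 0)"
      "dbd S v k (2 ^ Suc k * W * Q) q1" by (rule dbd_SucE)
    have zero: "((\<lambda>s. f (\<xi> + s *\<^sub>R v)) has_vector_derivative 0) (at 0)" if "\<xi> \<notin> K" "\<And>\<eta>. \<eta> \<notin> K \<Longrightarrow> f \<eta> = 0"
      for \<xi> and f :: "'a \<Rightarrow> complex"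
      by (rule has_vector_derivative_line_cong[of "-K" _ "\<lambda>_. 0"])
         (use that K(1) compact_imp_closed in auto)
    have q10: "q1 \<xi> = 0" if "\<xi> \<in> S" "\<xi> \<notin> K" for \<xi>
      using bspec[OF q1(1) that(1)] zero[OF that(2), of q] w(2) unfolding q_def
      by (intro vector_derivative_unique_at[of _ "q1 \<xi>" 0 0]) auto
    \<comment> \<open>The witness \<open>q1\<close> is arbitrary outside \<open>S\<close>. Cut off
      to \<open>K\<close> it becomes a function on the whole space and, by \<open>q10\<close>, stays
      the same on \<open>S\<close>.\<close>
    define q2 where "q2 \<xi> = indicator K \<xi> *\<^sub>R q1 \<xi>" for \<xi>
    have q2: "dbd S v k (2 ^ Suc k * W * Q) q2"
      by (rule dbd_cong[OF S _ q1(2)]) (auto simp: q2_def q10 split: split_indicator)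
    have ew: "((\<lambda>s. e (\<xi> + s *\<^sub>R v)) has_vector_derivative \<i> * \<mu> * g \<xi> * e \<xi>) (at 0)" if "\<xi> \<in> S" for \<xi>
    proof -
      have "((\<lambda>s. \<i> * complex_of_real (\<Psi> (\<xi> + s *\<^sub>R v))) has_vector_derivative \<i> * complex_of_real (\<mu> * g \<xi>)) (at 0)"
        using bspec[OF d\<Psi> that] by (intro derivative_eq_intros has_vector_derivative_of_real refl)
          (auto simp: has_real_derivative_iff_has_vector_derivative)
      from field_vector_diff_chain_at[OF this, of exp "exp (\<i> * complex_of_real (\<Psi> (\<xi> + 0 *\<^sub>R v)))"]
      show ?thesis by (auto simp: e_def o_def mult_ac intro: DERIV_exp)
    qed
    define G where "G \<xi> = q \<xi> * e \<xi>" for \<xi>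
    \<comment> \<open>The product rule for \<open>q * e\<close>, simplified by
      \<open>q * g = w\<close>. Since the integral of \<open>D\<close> vanishes, the integral of
      \<open>w * e\<close> equals that of \<open>q2 * e\<close> up to a factor of modulus
      \<open>1 / \<mu>\<close>, and \<open>q2\<close> has one derivative less than
      \<open>w\<close>.\<close>
    define D where "D \<xi> = q2 \<xi> * e \<xi> + \<i> * \<mu> * (w \<xi> * e \<xi>)" for \<xi>
    have dG: "((\<lambda>s. G (\<xi> + s *\<^sub>R v)) has_vector_derivative D \<xi>) (at 0)" for \<xi>
    proof (cases "\<xi> \<in> K")
      case True
      then have "\<xi> \<in> S" using K by auto
      then have "g \<xi> \<noteq> 0" using g(1) by force
      then have "q \<xi> * (\<i> * \<mu> * g \<xi> * e \<xi>) + q1 \<xi> * e \<xi> = D \<xi>"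
        using True by (simp add: D_def q_def q2_def field_simps)
      then show ?thesis using has_vector_derivative_mult[OF bspec[OF q1(1) \<open>\<xi> \<in> S\<close>] ew[OF \<open>\<xi> \<in> S\<close>]]
        by (simp add: G_def)
    next
      case False
      then show ?thesis using zero[OF False, of G] w(2) by (simp add: G_def D_def q2_def q_def)
    qed
    have ce: "continuous_on K e" unfolding e_def
      by (intro continuous_intros continuous_on_subset[OF \<Psi> K(2)])
    have cK: "continuous_on K f" if "dbd S v j B f" for f j B
      using dbd_cont[OF that] K(2) continuous_on_subset by blast
    have cont: "continuous_on K (\<lambda>\<xi>. q2 \<xi> * e \<xi>)" "continuous_on K (\<lambda>\<xi>. w \<xi> * e \<xi>)" "continuous_on K G"
      unfolding G_def by (intro continuous_intros ce cK[OF q2] cK[OF w(1)] cK[OF q])+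
    have Km: "K \<in> sets borel" using K(1) by (rule borel_compact)
    have fin: "emeasure lborel K < \<infinity>" using emeasure_compact_finite[OF K(1)] by (simp add: less_top)
    have supp: "(\<lambda>\<xi>. f \<xi>) = (\<lambda>\<xi>. indicator K \<xi> *\<^sub>R f \<xi>)" if "\<And>\<xi>. \<xi> \<notin> K \<Longrightarrow> f \<xi> = 0" for f :: "'a \<Rightarrow> complex"
      using that by (auto split: split_indicator)
    have meas: "f \<in> borel_measurable borel" "\<exists>B. \<forall>\<xi>. norm (f \<xi>) \<le> B" "integrable lborel f"
      if "continuous_on K f" "\<And>\<xi>. \<xi> \<notin> K \<Longrightarrow> f \<xi> = 0" for f :: "'a \<Rightarrow> complex"
    proof -
      show m: "f \<in> borel_measurable borel"
        by (subst supp[OF that(2)]) (use that(1) Km in \<open>auto intro: borel_measurable_continuous_on_indicator\<close>)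
      have "bounded (f ` K)" by (rule compact_imp_bounded[OF compact_continuous_image[OF that(1) K(1)]])
      then obtain B where "\<forall>y\<in>f ` K. norm y \<le> B" by (auto simp: bounded_iff)
      then have B: "norm (f \<xi>) \<le> max B 0" for \<xi> using that(2)[of \<xi>] by (cases "\<xi> \<in> K") (auto simp: le_max_iff_disj)
      then show "\<exists>B. \<forall>\<xi>. norm (f \<xi>) \<le> B" by blast
      show "integrable lborel f"
        by (rule integrableI_bounded_set[where A = K and B = "max B 0"]) (use m that(2) B Km fin in auto)
    qed
    have w0: "w \<xi> = 0" "q2 \<xi> = 0" "G \<xi> = 0" "D \<xi> = 0" if "\<xi> \<notin> K" for \<xi>
      using w(2) that by (auto simp: q2_def G_def q_def D_def)
    have cD: "continuous_on K D" unfolding D_def by (intro continuous_intros cont)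
    obtain B1 B2 where B12: "\<forall>\<xi>. norm (D \<xi>) \<le> B1" "\<forall>\<xi>. norm (G \<xi>) \<le> B2"
      using meas(2)[OF cD] meas(2)[OF cont(3)] w0 by blast
    have "(\<integral>\<xi>. D \<xi> \<partial>lborel) = 0"
      by (rule integral_line_derivative_eq_0[OF K(1) w0(3) meas(1)[OF cont(3) w0(3)] meas(1)[OF cD w0(4)] dG, of "max B1 B2"])
         (use B12 in \<open>auto simp: le_max_iff_disj\<close>)
    moreover have "(\<integral>\<xi>. D \<xi> \<partial>lborel) = (\<integral>\<xi>. q2 \<xi> * e \<xi> \<partial>lborel) + \<i> * \<mu> * (\<integral>\<xi>. w \<xi> * e \<xi> \<partial>lborel)"
      unfolding D_def using meas(3)[OF cont(1)] meas(3)[OF cont(2)] w0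
      by (subst Bochner_Integration.integral_add) auto
    ultimately have eq: "\<i> * \<mu> * (\<integral>\<xi>. w \<xi> * e \<xi> \<partial>lborel) = - (\<integral>\<xi>. q2 \<xi> * e \<xi> \<partial>lborel)"
      by (simp add: eq_neg_iff_add_eq_0 add.commute)
    have "\<mu> * norm (\<integral>\<xi>. w \<xi> * e \<xi> \<partial>lborel) = norm (\<i> * \<mu> * (\<integral>\<xi>. w \<xi> * e \<xi> \<partial>lborel))"
      using \<mu> by (simp add: norm_mult)
    also have "\<dots> = norm (\<integral>\<xi>. q2 \<xi> * e \<xi> \<partial>lborel)" unfolding eq by simp
    also have "\<dots> \<le> C * (2 ^ Suc k * W * Q) * (1/\<mu>)^k * measure lborel K"
      unfolding e_def
      by (rule C(2)[OF S K \<mu> \<Psi> d\<Psi> g(1) dbd_Suc_imp[OF g(2)] q2]) (use w0 W Q(1) in auto)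
    finally show "norm (\<integral>\<xi>. w \<xi> * exp (\<i> * complex_of_real (\<Psi> \<xi>)) \<partial>lborel) \<le> C * (2 ^ Suc k * Q) * W * (1/\<mu>)^Suc k * measure lborel K"
      using \<mu> by (simp add: e_def field_simps)
  qed (use C Q in auto)
qed

section \<open>Cutoff functions of finite smoothness\<close>

lemma DERIV_max_power:
  "((\<lambda>t::real. max 0 t ^ Suc (Suc a)) has_real_derivative real (Suc (Suc a)) * max 0 t ^ Suc a) (at t)"
proof -
  consider "t > 0" | "t < 0" | "t = 0" by linarith
  then show ?thesis
  proof cases
    case 1
    have "((\<lambda>t::real. t ^ Suc (Suc a)) has_real_derivative real (Suc (Suc a)) * max 0 t ^ Suc a) (at t)"
      using DERIV_pow[of "Suc (Suc a)" t] 1 by (simp add: max_def)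
    then show ?thesis
      by (rule has_field_derivative_transform_within_open[of _ _ _ "{0<..}"]) (use 1 in auto)
  next
    case 2
    have "((\<lambda>t::real. 0) has_real_derivative real (Suc (Suc a)) * max 0 t ^ Suc a) (at t)"
      using 2 by (auto intro!: derivative_eq_intros simp: max_def)
    then show ?thesis
      by (rule has_field_derivative_transform_within_open[of _ _ _ "{..<0}"]) (use 2 in auto)
  next
    case 3
    have "((\<lambda>h::real. max 0 h ^ Suc a) \<longlongrightarrow> max 0 0 ^ Suc a) (at 0)" by (intro tendsto_intros)
    moreover have "eventually (\<lambda>h::real. max 0 h ^ Suc a = (max 0 (t + h) ^ Suc (Suc a) - max 0 t ^ Suc (Suc a)) / h) (at 0)"
      using 3 by (auto simp: eventually_at_filter max_def)
    ultimately show ?thesis using 3 unfolding DERIV_def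
      by (auto intro: Lim_transform_eventually)
  qed
qed

text \<open>A truncated polynomial instead of a smooth bump. Its powers have as many continuous
  derivatives as are ever used, all of them explicit, and it depends on \<xi> only through the
  rescaled variable.\<close>

definition bump :: "'a::euclidean_space \<Rightarrow> real \<Rightarrow> 'a \<Rightarrow> real" where
  "bump \<xi>0 \<rho> \<xi> = max 0 (1 - (norm (\<xi> - \<xi>0) / \<rho>)\<^sup>2)"

lemma bump_bounds: "0 \<le> bump \<xi>0 \<rho> \<xi>" "bump \<xi>0 \<rho> \<xi> \<le> 1"
  by (auto simp: bump_def)

lemma continuous_bump: "0 < \<rho> \<Longrightarrow> continuous_on S (bump \<xi>0 \<rho>)"
  unfolding bump_def by (intro continuous_intros) auto

lemma bump_eq_0:
  assumes "0 < \<rho>" "\<xi> \<notin> cball \<xi>0 \<rho>" shows "bump \<xi>0 \<rho> \<xi> = 0"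
proof -
  have "1 \<le> norm (\<xi> - \<xi>0) / \<rho>" using assms by (simp add: dist_norm norm_minus_commute)
  then have "1\<^sup>2 \<le> (norm (\<xi> - \<xi>0) / \<rho>)\<^sup>2" by (intro power_mono) auto
  then show ?thesis by (simp add: bump_def)
qed

lemma bump_ge: "0 < \<rho> \<Longrightarrow> \<xi> \<in> cball \<xi>0 (\<rho>/2) \<Longrightarrow> 3/4 \<le> bump \<xi>0 \<rho> \<xi>"
proof -
  assume a: "0 < \<rho>" "\<xi> \<in> cball \<xi>0 (\<rho>/2)"
  then have "norm (\<xi> - \<xi>0) / \<rho> \<le> 1/2" by (auto simp: dist_norm norm_minus_commute field_simps)
  then have "(norm (\<xi> - \<xi>0) / \<rho>)\<^sup>2 \<le> (1/2)\<^sup>2" using a by (intro power_mono) auto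
  moreover have "(1/2::real)\<^sup>2 = 1/4" by (simp add: power2_eq_square)
  ultimately show ?thesis unfolding bump_def by linarith
qed

text \<open>The statement is generalised to products with powers of the linear form because these
  are closed under differentiation: the derivative of \<open>bump \<xi>0 \<rho> \<xi>\<close> along
  \<open>\<rho> *\<^sub>R e\<close> is -2 times that form wherever the bump is positive. Each
  differentiation lowers the exponent of the bump by at most one, hence \<open>k < a\<close>; the
  remaining positive power makes the product vanish off the ball.\<close>

lemma bump_dbd:
  "k < a \<Longrightarrow> \<exists>C\<ge>0. \<forall>(\<xi>0::'a::euclidean_space) \<rho> e. 0 < \<rho> \<longrightarrow> norm e = 1 \<longrightarrow>
     dbd UNIV (\<rho> *\<^sub>R e) k C (\<lambda>\<xi>. complex_of_real (bump \<xi>0 \<rho> \<xi> ^ a * ((\<xi> - \<xi>0) \<bullet> e / \<rho>) ^ b))"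
proof (induction k arbitrary: a b)
  case 0
  have bd: "norm (complex_of_real (bump \<xi>0 \<rho> \<xi> ^ a * ((\<xi> - \<xi>0) \<bullet> e / \<rho>) ^ b)) \<le> 1"
    if "0 < \<rho>" "norm e = 1" for \<xi>0 \<rho> and e \<xi> :: 'a
  proof (cases "\<xi> \<in> cball \<xi>0 \<rho>")
    case True
    have "\<bar>(\<xi> - \<xi>0) \<bullet> e\<bar> \<le> norm (\<xi> - \<xi>0) * norm e" by (rule Cauchy_Schwarz_ineq2)
    also have "\<dots> \<le> \<rho>" using True that by (simp add: dist_norm norm_minus_commute)
    finally have "\<bar>((\<xi> - \<xi>0) \<bullet> e / \<rho>)\<bar> ^ b \<le> 1" using that by (intro power_le_one) auto
    moreover have "bump \<xi>0 \<rho> \<xi> ^ a \<le> 1" by (intro power_le_one bump_bounds)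
    ultimately have "bump \<xi>0 \<rho> \<xi> ^ a * \<bar>((\<xi> - \<xi>0) \<bullet> e / \<rho>)\<bar> ^ b \<le> 1"
      using bump_bounds[of \<xi>0 \<rho> \<xi>] by (intro mult_le_one) auto
    then show ?thesis using bump_bounds[of \<xi>0 \<rho> \<xi>] by (simp add: norm_mult norm_power norm_divide power_divide power_abs abs_mult del: of_real_mult of_real_power of_real_divide)
  next
    case False
    then show ?thesis using bump_eq_0[OF that(1) False] 0 by (simp add: power_0_left)
  qed
  show ?case
    by (intro exI[of _ 1]) (use bd in \<open>auto intro!: continuous_intros continuous_bump simp del: of_real_mult of_real_power of_real_divide\<close>)
next
  case (Suc k)
  then obtain a' where a: "a = Suc (Suc a')" by (metis less_imp_Suc_add add_Suc_right add_Suc not_less_eq Suc_lessE less_Suc_eq_0_disj)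
  have k: "k < Suc a'" "k < a" using Suc.prems a by auto
  obtain C1 where C1: "C1 \<ge> 0" "\<And>(\<xi>0::'a) \<rho> e. 0 < \<rho> \<Longrightarrow> norm e = 1 \<Longrightarrow>
     dbd UNIV (\<rho> *\<^sub>R e) k C1 (\<lambda>\<xi>. complex_of_real (bump \<xi>0 \<rho> \<xi> ^ Suc a' * ((\<xi> - \<xi>0) \<bullet> e / \<rho>) ^ Suc b))"
    using Suc.IH[OF k(1)] by blast
  obtain C2 where C2: "C2 \<ge> 0" "\<And>(\<xi>0::'a) \<rho> e. 0 < \<rho> \<Longrightarrow> norm e = 1 \<Longrightarrow>
     dbd UNIV (\<rho> *\<^sub>R e) k C2 (\<lambda>\<xi>. complex_of_real (bump \<xi>0 \<rho> \<xi> ^ a * ((\<xi> - \<xi>0) \<bullet> e / \<rho>) ^ (b - 1)))"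
    using Suc.IH[OF k(2)] by blast
  obtain C0 where C0: "C0 \<ge> 0" "\<And>(\<xi>0::'a) \<rho> e. 0 < \<rho> \<Longrightarrow> norm e = 1 \<Longrightarrow>
     dbd UNIV (\<rho> *\<^sub>R e) k C0 (\<lambda>\<xi>. complex_of_real (bump \<xi>0 \<rho> \<xi> ^ a * ((\<xi> - \<xi>0) \<bullet> e / \<rho>) ^ b))"
    using Suc.IH[OF k(2)] by blast
  define C where "C = C0 + (2 ^ k * (2 * real a) * C1 + 2 ^ k * real b * C2)"
  show ?case
  proof (intro exI[of _ C] conjI allI impI)
    show "0 \<le> C" using C0 C1 C2 by (simp add: C_def)
    fix \<xi>0 :: 'a and \<rho> :: real and e :: 'a assume \<rho>: "0 < \<rho>" and e: "norm e = 1"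
    let ?m = "bump \<xi>0 \<rho>" and ?l = "\<lambda>\<xi>. (\<xi> - \<xi>0) \<bullet> e / \<rho>"
    let ?D = "\<lambda>\<xi>. - (2 * real a) * (?m \<xi> ^ Suc a' * ?l \<xi> ^ Suc b) + b * (?m \<xi> ^ a * ?l \<xi> ^ (b - 1))"
    show "dbd UNIV (\<rho> *\<^sub>R e) (Suc k) C (\<lambda>\<xi>. complex_of_real (?m \<xi> ^ a * ?l \<xi> ^ b))"
    proof (rule dbd_SucI)
      show "continuous_on UNIV (\<lambda>\<xi>. complex_of_real (?m \<xi> ^ a * ?l \<xi> ^ b))"
        using dbd_cont[OF C0(2)[OF \<rho> e]] .
      show "norm (complex_of_real (?m \<xi> ^ a * ?l \<xi> ^ b)) \<le> C" for \<xi>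
        using dbd_bound[OF C0(2)[OF \<rho> e], of \<xi>] C1(1) C2(1) unfolding C_def
        by (intro order_trans[OF _ le_add_same_cancel1[THEN iffD2]]) auto
      have "dbd UNIV (\<rho> *\<^sub>R e) k (2 ^ k * (2 * real a) * C1 + 2 ^ k * real b * C2)
         (\<lambda>\<xi>. of_real (- (2 * real a)) * complex_of_real (?m \<xi> ^ Suc a' * ?l \<xi> ^ Suc b) +
              of_real (real b) * complex_of_real (?m \<xi> ^ a * ?l \<xi> ^ (b - 1)))"
        by (rule dbd_add; rule dbd_mult)
           (use C1(1) C2(1) C1(2)[OF \<rho> e] C2(2)[OF \<rho> e] in \<open>simp_all add: dbd_const del: of_real_mult of_real_minus power_Suc\<close>)
      then have "dbd UNIV (\<rho> *\<^sub>R e) k (2 ^ k * (2 * real a) * C1 + 2 ^ k * real b * C2) (\<lambda>\<xi>. complex_of_real (?D \<xi>))"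
        by (simp only: of_real_add of_real_mult of_real_minus)
      then show "dbd UNIV (\<rho> *\<^sub>R e) k C (\<lambda>\<xi>. complex_of_real (?D \<xi>))"
        by (rule dbd_mono) (simp add: C_def C0)
      fix \<xi> :: 'a
      have ee: "e \<bullet> e = 1" using e by (simp add: dot_square_norm)
      have nrm: "(norm (\<xi> + s *\<^sub>R (\<rho> *\<^sub>R e) - \<xi>0) / \<rho>)\<^sup>2 = (norm (\<xi> - \<xi>0) / \<rho>)\<^sup>2 + 2 * s * ?l \<xi> + s\<^sup>2" for s
      proof -
        have "(norm (\<xi> + s *\<^sub>R (\<rho> *\<^sub>R e) - \<xi>0))\<^sup>2 = ((\<xi> - \<xi>0) + (s * \<rho>) *\<^sub>R e) \<bullet> ((\<xi> - \<xi>0) + (s * \<rho>) *\<^sub>R e)"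
        proof -
          have "\<xi> + s *\<^sub>R (\<rho> *\<^sub>R e) - \<xi>0 = (\<xi> - \<xi>0) + (s * \<rho>) *\<^sub>R e" by simp
          then show ?thesis by (simp only: power2_norm_eq_inner)
        qed
        also have "\<dots> = (norm (\<xi> - \<xi>0))\<^sup>2 + 2 * (s * \<rho>) * ((\<xi> - \<xi>0) \<bullet> e) + (s * \<rho>)\<^sup>2"
          using ee inner_commute[of e "\<xi> - \<xi>0"]
          by (simp add: inner_add_left inner_add_right power2_norm_eq_inner distrib_left mult_ac power_mult_distrib power2_eq_square[of s] power2_eq_square[of \<rho>] del: inner_diff_left inner_diff_right)
        finally have "(norm (\<xi> + s *\<^sub>R (\<rho> *\<^sub>R e) - \<xi>0))\<^sup>2 / \<rho>\<^sup>2 = ((norm (\<xi> - \<xi>0))\<^sup>2 + 2 * (s * \<rho>) * ((\<xi> - \<xi>0) \<bullet> e) + (s * \<rho>)\<^sup>2) / \<rho>\<^sup>2" by simp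
        then show ?thesis using \<rho> unfolding power_divide add_divide_distrib by (simp add: power2_eq_square)
      qed
      have dl: "((\<lambda>s. ?l (\<xi> + s *\<^sub>R (\<rho> *\<^sub>R e)) ^ b) has_real_derivative b * ?l \<xi> ^ (b - 1)) (at 0)"
      proof -
        have "?l (\<xi> + s *\<^sub>R (\<rho> *\<^sub>R e)) = ?l \<xi> + s" for s :: real
        proof -
          have "(\<xi> + s *\<^sub>R (\<rho> *\<^sub>R e) - \<xi>0) \<bullet> e = (\<xi> - \<xi>0) \<bullet> e + s * \<rho>"
            by (simp add: inner_add_left inner_diff_left ee)
          then show ?thesis using \<rho> by (simp add: add_divide_distrib)
        qed
        then have eq: "(\<lambda>s. ?l (\<xi> + s *\<^sub>R (\<rho> *\<^sub>R e)) ^ b) = (\<lambda>s. (?l \<xi> + s) ^ b)" by auto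
        have "((\<lambda>s. (L + s) ^ b) has_real_derivative b * L ^ (b - 1)) (at 0)" for L :: real
          by (auto intro!: derivative_eq_intros)
        then show ?thesis unfolding eq .
      qed
      have dm: "((\<lambda>s. ?m (\<xi> + s *\<^sub>R (\<rho> *\<^sub>R e)) ^ a) has_real_derivative (real a * ?m \<xi> ^ Suc a') * (- 2 * ?l \<xi>)) (at 0)"
        unfolding bump_def nrm a
      proof (rule DERIV_chain'[where g = "\<lambda>t. max 0 t ^ Suc (Suc a')", rotated])
        show "((\<lambda>s. 1 - ((norm (\<xi> - \<xi>0) / \<rho>)\<^sup>2 + 2 * s * ?l \<xi> + s\<^sup>2)) has_real_derivative - 2 * ?l \<xi>) (at 0)"
          using \<rho> by (auto intro!: derivative_eq_intros)
      qed (use DERIV_max_power[of a' "1 - (norm (\<xi> - \<xi>0) / \<rho>)\<^sup>2"] in simp)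
      have "((\<lambda>s. ?m (\<xi> + s *\<^sub>R (\<rho> *\<^sub>R e)) ^ a * ?l (\<xi> + s *\<^sub>R (\<rho> *\<^sub>R e)) ^ b) has_real_derivative ?D \<xi>) (at 0)"
        using DERIV_mult[OF dm dl] by (simp add: algebra_simps)
      then show "((\<lambda>s. complex_of_real (?m (\<xi> + s *\<^sub>R (\<rho> *\<^sub>R e)) ^ a * ?l (\<xi> + s *\<^sub>R (\<rho> *\<^sub>R e)) ^ b)) has_vector_derivative complex_of_real (?D \<xi>)) (at 0)"
        by (rule has_vector_derivative_of_real)
    qed
  qed
qed

section \<open>The \<open>TT\<^sup>*\<close> argument\<close>

lemma emeasure_cball_le:
  fixes x :: "'a::euclidean_space"
  assumes "0 \<le> r"
  shows "emeasure lborel (cball x r) \<le> ennreal ((2 * r) ^ DIM('a))"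
proof -
  have "cball x r \<subseteq> cbox (x - r *\<^sub>R One) (x + r *\<^sub>R One)"
  proof
    fix y assume "y \<in> cball x r"
    then have "\<bar>(x - y) \<bullet> b\<bar> \<le> r" if "b \<in> Basis" for b
      using Basis_le_norm[OF that, of "x - y"] by (auto simp: dist_norm intro: order_trans)
    then show "y \<in> cbox (x - r *\<^sub>R One) (x + r *\<^sub>R One)"
      by (auto simp: mem_box inner_diff_left inner_add_left abs_le_iff) (smt (verit))+
  qed
  then have "emeasure lborel (cball x r) \<le> emeasure lborel (cbox (x - r *\<^sub>R One) (x + r *\<^sub>R One))"
    by (intro emeasure_mono) auto
  also have "\<dots> = ennreal ((2 * r) ^ DIM('a))"
    using assms by (subst emeasure_lborel_cbox) (auto simp: inner_diff_left inner_add_left algebra_simps)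
  finally show ?thesis .
qed

text \<open>For positive \<open>t\<close> this is the smaller of the trivial bound and the bound
  after \<open>N\<close> integrations by parts, as a function of the rescaled distance.\<close>

definition decay_weight :: "nat \<Rightarrow> real \<Rightarrow> real" where
  "decay_weight N t = (if t \<le> 1 then 1 else (1 / t) ^ N)"

lemma decay_weight_nonneg: "0 \<le> decay_weight N t" by (auto simp: decay_weight_def)

lemma decay_weight_measurable [measurable]: "decay_weight N \<in> borel_measurable borel"
  unfolding decay_weight_def by measurable

text \<open>The weight is dominated by a sum over the dyadic balls of radius 2^k / R. Its height
  there is of order 2^(-k(n+1)) and the volume of order (2^k / R)^n, so the exponent n + 1 leaves a
  geometric series.\<close>

lemma decay_weight_integral:
  fixes x :: "'a::euclidean_space"
  assumes "0 < R"
  shows "(\<integral>\<^sup>+y. ennreal (decay_weight (Suc DIM('a)) (R * norm (x - y))) \<partial>lborel) \<le> ennreal (2 ^ (2 * DIM('a) + 2) / R ^ DIM('a))"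
proof -
  let ?N = "Suc DIM('a)" and ?n = "DIM('a)"
  let ?a = "\<lambda>k y. ennreal (2 ^ ?N * (1/2) ^ (k * ?N)) * indicator (cball x (2 ^ k / R)) y"
  have pw: "ennreal (decay_weight ?N (R * norm (x - y))) \<le> (\<Sum>k. ?a k y)" for y
  proof -
    let ?t = "R * norm (x - y)"
    \<comment> \<open>If \<open>k\<close> is not 0, minimality gives a value larger than 2^(k-1);
      the lost factor 2 is the origin of \<open>2 ^ ?N\<close>.\<close>
    define k where "k = (LEAST k. ?t \<le> 2 ^ k)"
    obtain k0 where "?t < 2 ^ k0" using real_arch_pow[of 2 ?t] by auto
    then have k: "?t \<le> 2 ^ k" unfolding k_def by (intro LeastI[of "\<lambda>k. ?t \<le> 2 ^ k" k0]) simp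
    have "decay_weight ?N ?t \<le> 2 ^ ?N * (1/2) ^ (k * ?N)"
    proof (cases k)
      case 0
      then show ?thesis using k one_le_power[of "2::real" ?N] by (simp add: decay_weight_def)
    next
      case (Suc j)
      then have "j < (LEAST k. ?t \<le> 2 ^ k)" by (simp add: k_def)
      then have "\<not> ?t \<le> 2 ^ j" by (rule not_less_Least)
      then have t: "?t > 2 ^ j" by (simp only: not_le)
      moreover have "(1::real) \<le> 2 ^ j" by simp
      ultimately have t1: "?t > 1" by linarith
      have "decay_weight ?N ?t = (1 / ?t) ^ ?N" using t1 by (simp add: decay_weight_def)
      also have "\<dots> \<le> (1 / 2 ^ j) ^ ?N" using t t1 by (intro power_mono divide_left_mono) auto
      also have "\<dots> = (2 * (1/2) ^ k) ^ ?N" by (simp add: Suc power_divide)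
      also have "\<dots> = 2 ^ ?N * (1/2) ^ (k * ?N)" by (simp only: power_mult_distrib power_mult)
      finally show ?thesis .
    qed
    moreover have "y \<in> cball x (2 ^ k / R)" using k assms by (simp add: dist_norm field_simps)
    ultimately have "ennreal (decay_weight ?N ?t) \<le> ?a k y" by (simp add: ennreal_leI)
    also have "f k \<le> (\<Sum>k. f k)" for f :: "nat \<Rightarrow> ennreal" using sum_le_suminf[of f "{k}"] by simp
    finally show ?thesis .
  qed
  have "(\<integral>\<^sup>+y. ennreal (decay_weight ?N (R * norm (x - y))) \<partial>lborel) \<le> (\<integral>\<^sup>+y. (\<Sum>k. ?a k y) \<partial>lborel)"
    by (intro nn_integral_mono pw)
  also have "\<dots> = (\<Sum>k. \<integral>\<^sup>+y. ?a k y \<partial>lborel)" by (intro nn_integral_suminf borel_measurable_times_ennreal borel_measurable_const borel_measurable_indicator) auto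
  also have "\<dots> \<le> (\<Sum>k. ennreal (2 ^ ?N * 2 ^ ?n / R ^ ?n * (1/2) ^ k))"
  proof (rule suminf_le)
    fix k
    have "(\<integral>\<^sup>+y. ?a k y \<partial>lborel) = ennreal (2 ^ ?N * (1/2) ^ (k * ?N)) * emeasure lborel (cball x (2 ^ k / R))"
      by (simp add: nn_integral_cmult_indicator)
    also have "\<dots> \<le> ennreal (2 ^ ?N * (1/2) ^ (k * ?N)) * ennreal ((2 * (2 ^ k / R)) ^ ?n)"
      using assms by (intro mult_left_mono emeasure_cball_le) auto
    also have "\<dots> = ennreal (2 ^ ?N * (1/2) ^ (k * ?N) * (2 * (2 ^ k / R)) ^ ?n)"
      using assms by (subst ennreal_mult) auto
    also have "2 ^ ?N * (1/2) ^ (k * ?N) * (2 * (2 ^ k / R)) ^ ?n = 2 ^ ?N * 2 ^ ?n / R ^ ?n * ((1/2) ^ (k * ?N) * 2 ^ (k * ?n))"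
      by (simp add: power_mult_distrib power_divide power_mult mult_ac)
    also have "(1/2) ^ (k * ?N) * 2 ^ (k * ?n) = ((1/2) ^ k :: real)"
      by (simp add: power_add power_one_over)
    finally show "(\<integral>\<^sup>+y. ?a k y \<partial>lborel) \<le> ennreal (2 ^ ?N * 2 ^ ?n / R ^ ?n * (1/2) ^ k)" by simp
  qed auto
  also have "\<dots> = ennreal (\<Sum>k. 2 ^ ?N * 2 ^ ?n / R ^ ?n * (1/2) ^ k)"
    using assms by (intro suminf_ennreal2) (auto intro!: summable_mult summable_geometric)
  also have "(\<Sum>k. 2 ^ ?N * 2 ^ ?n / R ^ ?n * (1/2) ^ k) = 2 ^ (2 * ?n + 2) / R ^ ?n"
  proof -
    have "(\<Sum>k. a * (1/2) ^ k) = a * 2" for a :: real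
      using suminf_mult[OF summable_geometric[of "1/2::real"], of a] suminf_geometric[of "1/2::real"] by simp
    note this[of "2 ^ ?N * 2 ^ ?n / R ^ ?n"]
    moreover have "2 * ?n + 2 = ?N + ?n + 1" by simp
    then have "(2::real) ^ (2 * ?n + 2) = 2 ^ ?N * 2 ^ ?n * 2" by (simp only: power_add power_one_right)
    ultimately show ?thesis by (simp only: times_divide_eq_left)
  qed
  finally show ?thesis .
qed

lemma integrable_prod_mult:
  fixes u :: "_ \<Rightarrow> complex" and v :: "_ \<Rightarrow> complex"
  assumes "pair_sigma_finite M1 M2" and assms: "integrable M1 u" "integrable M2 v"
  shows "integrable (M1 \<Otimes>\<^sub>M M2) (\<lambda>(x, y). u x * v y)"
    and "integral\<^sup>L (M1 \<Otimes>\<^sub>M M2) (\<lambda>(x, y). u x * v y) = integral\<^sup>L M1 u * integral\<^sup>L M2 v"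
proof -
  interpret pair_sigma_finite M1 M2 by fact
  have [measurable]: "u \<in> borel_measurable M1" "v \<in> borel_measurable M2" using assms by auto
  show i: "integrable (M1 \<Otimes>\<^sub>M M2) (\<lambda>(x, y). u x * v y)"
  proof (rule integrableI_bounded)
    have "(\<integral>\<^sup>+z. ennreal (norm (case z of (x, y) \<Rightarrow> u x * v y)) \<partial>(M1 \<Otimes>\<^sub>M M2)) =
        (\<integral>\<^sup>+x. \<integral>\<^sup>+y. ennreal (norm (u x)) * ennreal (norm (v y)) \<partial>M2 \<partial>M1)"
      by (subst M2.nn_integral_fst[symmetric]) (auto simp: norm_mult ennreal_mult)
    also have "\<dots> = (\<integral>\<^sup>+x. ennreal (norm (u x)) \<partial>M1) * (\<integral>\<^sup>+y. ennreal (norm (v y)) \<partial>M2)"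
      by (simp add: nn_integral_cmult nn_integral_multc)
    also have "\<dots> < \<infinity>" using assms by (simp add: integrable_iff_bounded ennreal_mult_less_top)
    finally show "(\<integral>\<^sup>+z. ennreal (norm (case z of (x, y) \<Rightarrow> u x * v y)) \<partial>(M1 \<Otimes>\<^sub>M M2)) < \<infinity>" .
  qed measurable
  show "integral\<^sup>L (M1 \<Otimes>\<^sub>M M2) (\<lambda>(x, y). u x * v y) = integral\<^sup>L M1 u * integral\<^sup>L M2 v"
    using integral_fst[OF i] by simp
qed

text \<open>Derivatives are taken along \<open>\<rho> e\<^sub>i\<close>, which makes the constants \<open>c\<close> and \<open>A\<close> independent of the scale \<open>\<rho>\<close>.\<close>
definition nondeg_phase :: "real \<Rightarrow> real \<Rightarrow> (real^'n::finite \<Rightarrow> real^'n \<Rightarrow> real) \<Rightarrow> real^'n \<Rightarrow> real \<Rightarrow> bool" where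
  "nondeg_phase c A \<psi> \<xi>0 \<rho> \<longleftrightarrow>
     (\<forall>x. continuous_on (ball \<xi>0 (2 * \<rho>)) (\<psi> x)) \<and>
     (\<forall>x y. x \<noteq> y \<longrightarrow> (\<exists>i g.
        (\<forall>\<xi>\<in>ball \<xi>0 (2 * \<rho>). ((\<lambda>s. \<psi> x (\<xi> + s *\<^sub>R (\<rho> *\<^sub>R axis i 1)) - \<psi> y (\<xi> + s *\<^sub>R (\<rho> *\<^sub>R axis i 1)))
            has_real_derivative (c * \<rho> * norm (x - y)) * g \<xi>) (at 0)) \<and>
        (\<forall>\<xi>\<in>ball \<xi>0 (2 * \<rho>). 1 \<le> \<bar>g \<xi>\<bar>) \<and>
        dbd (ball \<xi>0 (2 * \<rho>)) (\<rho> *\<^sub>R axis i 1) (Suc CARD('n)) A (\<lambda>\<xi>. complex_of_real (g \<xi>))))"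

text \<open>For \<open>c * \<rho> * norm (x - y) \<le> 1\<close> the volume of the support suffices.
  Otherwise n + 1 integrations by parts are made with
  \<open>\<mu> = c * \<rho> * norm (x - y)\<close>; n + 1 is the first integer order whose decay is
  integrable in \<open>y\<close>. The exponent n + 2 of the bump provides these derivatives.\<close>

lemma kernel_bound:
  assumes c: "0 < c" and A: "0 \<le> A"
  shows "\<exists>C\<ge>0. \<forall>(\<psi>::real^'n::finite \<Rightarrow> real^'n \<Rightarrow> real) \<xi>0 \<rho> x y.
     0 < \<rho> \<longrightarrow> nondeg_phase c A \<psi> \<xi>0 \<rho> \<longrightarrow>
     norm (\<integral>\<xi>. complex_of_real (bump \<xi>0 \<rho> \<xi> ^ Suc (Suc CARD('n))) * exp (\<i> * complex_of_real (\<psi> x \<xi> - \<psi> y \<xi>)) \<partial>lborel)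
       \<le> C * \<rho> ^ CARD('n) * decay_weight (Suc CARD('n)) (c * \<rho> * norm (x - y))"
proof -
  let ?N = "Suc CARD('n)" and ?n = "CARD('n)"
  obtain C1 where C1: "C1 \<ge> 0" "\<And>(S::(real^'n) set) K v \<mu> \<Psi> g w W.
     open S \<Longrightarrow> compact K \<Longrightarrow> K \<subseteq> S \<Longrightarrow> 0 < \<mu> \<Longrightarrow> continuous_on S \<Psi> \<Longrightarrow>
     (\<forall>\<xi>\<in>S. ((\<lambda>s. \<Psi> (\<xi> + s *\<^sub>R v)) has_real_derivative \<mu> * g \<xi>) (at 0)) \<Longrightarrow>
     (\<forall>\<xi>\<in>S. 1 \<le> \<bar>g \<xi>\<bar>) \<Longrightarrow> dbd S v ?N A (\<lambda>\<xi>. complex_of_real (g \<xi>)) \<Longrightarrow>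
     dbd S v ?N W w \<Longrightarrow> (\<forall>\<xi>. \<xi> \<notin> K \<longrightarrow> w \<xi> = 0) \<Longrightarrow> 0 \<le> W \<Longrightarrow>
     norm (\<integral>\<xi>. w \<xi> * exp (\<i> * complex_of_real (\<Psi> \<xi>)) \<partial>lborel) \<le> C1 * W * (1/\<mu>)^?N * measure lborel K"
    using nonstationary_phase[OF A, of ?N] by blast
  obtain C2 where C2: "C2 \<ge> 0" "\<And>(\<xi>0::real^'n) \<rho> e. 0 < \<rho> \<Longrightarrow> norm e = 1 \<Longrightarrow>
     dbd UNIV (\<rho> *\<^sub>R e) ?N C2 (\<lambda>\<xi>. complex_of_real (bump \<xi>0 \<rho> \<xi> ^ Suc ?N * ((\<xi> - \<xi>0) \<bullet> e / \<rho>) ^ 0))"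
    using bump_dbd[of ?N "Suc ?N" 0] by blast
  define C where "C = (1 + C1 * C2) * 2 ^ ?n"
  have dim: "DIM(real^'n) = ?n" by simp
  show ?thesis
  proof (intro exI[of _ C] conjI allI impI)
    show "0 \<le> C" using C1(1) C2(1) by (simp add: C_def)
    fix \<psi> :: "real^'n \<Rightarrow> real^'n \<Rightarrow> real" and \<xi>0 \<rho> x y
    assume \<rho>: "0 < \<rho>" and nd: "nondeg_phase c A \<psi> \<xi>0 \<rho>"
    let ?w = "\<lambda>\<xi>. complex_of_real (bump \<xi>0 \<rho> \<xi> ^ Suc ?N)"
    let ?I = "(\<integral>\<xi>. ?w \<xi> * exp (\<i> * complex_of_real (\<psi> x \<xi> - \<psi> y \<xi>)) \<partial>lborel)"
    have w0: "\<forall>\<xi>. \<xi> \<notin> cball \<xi>0 \<rho> \<longrightarrow> ?w \<xi> = 0" using bump_eq_0[OF \<rho>] by auto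
    have "emeasure lborel (cball \<xi>0 \<rho>) \<le> ennreal ((2 * \<rho>) ^ ?n)"
      using emeasure_cball_le[of \<rho> \<xi>0] \<rho> dim by simp
    then have mK: "measure lborel (cball \<xi>0 \<rho>) \<le> 2 ^ ?n * \<rho> ^ ?n"
      unfolding measure_def using \<rho> by (intro enn2real_leI) (auto simp: power_mult_distrib)
    have triv: "norm ?I \<le> 2 ^ ?n * \<rho> ^ ?n"
    proof -
      have "norm ?I \<le> (\<integral>\<xi>. norm (?w \<xi> * exp (\<i> * complex_of_real (\<psi> x \<xi> - \<psi> y \<xi>))) \<partial>lborel)"
        by (rule integral_norm_bound)
      also have "\<dots> \<le> (\<integral>\<xi>. indicator (cball \<xi>0 \<rho>) \<xi> \<partial>lborel)"
      proof (rule integral_mono')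
        show "integrable lborel (indicator (cball \<xi>0 \<rho>) :: real^'n \<Rightarrow> real)"
          using emeasure_lborel_cball_finite[of \<xi>0 \<rho>] by (intro integrable_real_indicator) auto
        show "norm (?w \<xi> * exp (\<i> * complex_of_real (\<psi> x \<xi> - \<psi> y \<xi>))) \<le> indicator (cball \<xi>0 \<rho>) \<xi>" for \<xi>
        proof (cases "\<xi> \<in> cball \<xi>0 \<rho>")
          case True
          have "bump \<xi>0 \<rho> \<xi> ^ Suc ?N \<le> 1" by (intro power_le_one bump_bounds)
          then show ?thesis using True bump_bounds(1)[of \<xi>0 \<rho> \<xi>] by (simp add: norm_mult norm_power del: power_Suc)
        qed (use bump_eq_0[OF \<rho>] in auto)
      qed auto
      also have "\<dots> = measure lborel (cball \<xi>0 \<rho>)" by simp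
      finally show ?thesis using mK by simp
    qed
    show "norm ?I \<le> C * \<rho> ^ ?n * decay_weight ?N (c * \<rho> * norm (x - y))"
    proof (cases "c * \<rho> * norm (x - y) \<le> 1")
      case True
      have "norm ?I \<le> 1 * (2 ^ ?n * \<rho> ^ ?n)" using triv by simp
      also have "\<dots> \<le> (1 + C1 * C2) * (2 ^ ?n * \<rho> ^ ?n)" using C1 C2 \<rho> by (intro mult_right_mono) auto
      finally show ?thesis using True by (simp add: decay_weight_def C_def mult_ac)
    next
      case False
      then have xy: "x \<noteq> y" by auto
      then obtain i g where g: "\<forall>\<xi>\<in>ball \<xi>0 (2 * \<rho>). ((\<lambda>s. \<psi> x (\<xi> + s *\<^sub>R (\<rho> *\<^sub>R axis i 1)) - \<psi> y (\<xi> + s *\<^sub>R (\<rho> *\<^sub>R axis i 1)))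
            has_real_derivative (c * \<rho> * norm (x - y)) * g \<xi>) (at 0)"
        "\<forall>\<xi>\<in>ball \<xi>0 (2 * \<rho>). 1 \<le> \<bar>g \<xi>\<bar>"
        "dbd (ball \<xi>0 (2 * \<rho>)) (\<rho> *\<^sub>R axis i 1) ?N A (\<lambda>\<xi>. complex_of_real (g \<xi>))"
        using nd unfolding nondeg_phase_def by blast
      let ?\<mu> = "c * \<rho> * norm (x - y)"
      have dw: "dbd (ball \<xi>0 (2 * \<rho>)) (\<rho> *\<^sub>R axis i 1) ?N C2 ?w"
        using dbd_subset[OF C2(2)[OF \<rho>, of "axis i 1" \<xi>0], of "ball \<xi>0 (2 * \<rho>)"] by (simp add: norm_axis_1)
      have "norm ?I \<le> C1 * C2 * (1/?\<mu>)^?N * measure lborel (cball \<xi>0 \<rho>)"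
      proof (rule C1(2)[OF _ _ _ _ _ g dw w0 C2(1)])
        show "continuous_on (ball \<xi>0 (2 * \<rho>)) (\<lambda>\<xi>. \<psi> x \<xi> - \<psi> y \<xi>)"
          using nd unfolding nondeg_phase_def by (intro continuous_intros) auto
      qed (use False \<rho> in auto)
      also have "\<dots> \<le> C1 * C2 * (1/?\<mu>)^?N * (2 ^ ?n * \<rho> ^ ?n)"
        using C1 C2 c \<rho> by (intro mult_left_mono mK) auto
      also have "\<dots> \<le> (1 + C1 * C2) * (1/?\<mu>)^?N * (2 ^ ?n * \<rho> ^ ?n)"
        using C1 C2 c \<rho> by (intro mult_right_mono) auto
      also have "\<dots> = C * \<rho> ^ ?n * decay_weight ?N ?\<mu>"
        using False by (simp add: decay_weight_def C_def)
      finally show ?thesis .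
    qed
  qed
qed

lemma measurable_case_prod_compose:
  assumes "(\<lambda>(x, y). f x y) \<in> measurable (M \<Otimes>\<^sub>M N) L" "g \<in> measurable K M" "h \<in> measurable K N"
  shows "(\<lambda>z. f (g z) (h z)) \<in> measurable K L"
  using measurable_compose[OF measurable_Pair[OF assms(2,3)] assms(1)] by simp

text \<open>The square of the adjoint, weighted by a cutoff and integrated over \<xi>, is a double
  integral of \<open>cnj (g x) * g y\<close> against the kernel of \<open>kernel_bound\<close>.
  Schur's test applies: the factor \<rho>^n of the kernel cancels against the \<rho>^(-n) from the
  integral of the weight, so \<open>B\<close> is independent of the scale.\<close>

lemma TTstar_dual:
  assumes c: "0 < c" and A: "0 \<le> A"
  shows "\<exists>B>0. \<forall>(\<psi>::real^'n::finite \<Rightarrow> real^'n \<Rightarrow> real) \<xi>0 \<rho> g.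
     0 < \<rho> \<longrightarrow> (\<lambda>(x, \<xi>). \<psi> x \<xi>) \<in> borel_measurable (lborel \<Otimes>\<^sub>M lborel) \<longrightarrow> nondeg_phase c A \<psi> \<xi>0 \<rho> \<longrightarrow>
     integrable lborel g \<longrightarrow>
     (\<integral>\<^sup>+\<xi>. ennreal ((norm (\<integral>x. exp (- \<i> * complex_of_real (\<psi> x \<xi>)) * g x \<partial>lborel))\<^sup>2) * indicator (cball \<xi>0 (\<rho>/2)) \<xi> \<partial>lborel)
       \<le> ennreal B * (\<integral>\<^sup>+x. ennreal ((norm (g x))\<^sup>2) \<partial>lborel)"
proof -
  let ?N = "Suc CARD('n)" and ?n = "CARD('n)"
  obtain C where C: "C \<ge> 0" "\<And>(\<psi>::real^'n \<Rightarrow> real^'n \<Rightarrow> real) \<xi>0 \<rho> x y.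
     0 < \<rho> \<Longrightarrow> nondeg_phase c A \<psi> \<xi>0 \<rho> \<Longrightarrow>
     norm (\<integral>\<xi>. complex_of_real (bump \<xi>0 \<rho> \<xi> ^ Suc ?N) * exp (\<i> * complex_of_real (\<psi> x \<xi> - \<psi> y \<xi>)) \<partial>lborel)
       \<le> C * \<rho> ^ ?n * decay_weight ?N (c * \<rho> * norm (x - y))"
    using kernel_bound[OF c A] by blast
  define D where "D = 2 ^ (2 * ?n + 2) / c ^ ?n"
  \<comment> \<open>The lower bound of the cutoff on the half ball, by
    \<open>bump_ge\<close>.\<close>
  define q where "q = ((3/4)::real) ^ Suc ?N"
  have D0: "D > 0" and q0: "q > 0" using c by (auto simp: D_def q_def)
  define B where "B = (C * D + 1) / q"
  have dim: "DIM(real^'n) = ?n" by simp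
  have kwi: "(\<integral>\<^sup>+y. ennreal (decay_weight ?N (c * \<rho> * norm (x - y))) \<partial>lborel) \<le> ennreal (D / \<rho> ^ ?n)"
    if "0 < \<rho>" for \<rho> and x :: "real^'n"
  proof -
    have "(\<integral>\<^sup>+y. ennreal (decay_weight (Suc DIM(real^'n)) ((c * \<rho>) * norm (x - y))) \<partial>lborel) \<le> ennreal (2 ^ (2 * DIM(real^'n) + 2) / (c * \<rho>) ^ DIM(real^'n))"
      using that c by (intro decay_weight_integral) simp
    then show ?thesis unfolding dim by (simp add: D_def power_mult_distrib)
  qed
  show ?thesis
  proof (intro exI[of _ B] conjI allI impI)
    show "0 < B" using C(1) D0 q0 by (auto simp: B_def intro!: divide_pos_pos add_nonneg_pos)
    fix \<psi> :: "real^'n \<Rightarrow> real^'n \<Rightarrow> real" and \<xi>0 \<rho> and g :: "real^'n \<Rightarrow> complex"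
    assume \<rho>: "0 < \<rho>" and \<psi>m: "(\<lambda>(x, \<xi>). \<psi> x \<xi>) \<in> borel_measurable (lborel \<Otimes>\<^sub>M lborel)"
      and nd: "nondeg_phase c A \<psi> \<xi>0 \<rho>" and g: "integrable lborel g"
    have gm [measurable]: "g \<in> borel_measurable borel" using g by auto
    have gm' [measurable]: "g \<in> borel_measurable lborel" using g by auto
    have gm'' [measurable (raw)]: "(\<lambda>x. cnj (g (f x))) \<in> borel_measurable M" if "f \<in> measurable M lborel" for f and M :: "'m measure"
      using measurable_compose[OF that gm'] by (rule borel_measurable_continuous_on[OF continuous_on_cnj[OF continuous_on_id]])
    have gm3 [measurable (raw)]: "(\<lambda>x. g (f x)) \<in> borel_measurable M" if "f \<in> measurable M lborel" for f and M :: "'m measure"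
      using measurable_compose[OF that gm'] .
    note \<psi>m' [measurable (raw)] = measurable_case_prod_compose[OF \<psi>m]
    interpret PP: pair_sigma_finite "lborel \<Otimes>\<^sub>M lborel :: ((real^'n) \<times> (real^'n)) measure" "lborel :: (real^'n) measure"
      unfolding lborel_prod by (intro pair_sigma_finite.intro sigma_finite_lborel)
    define cut where "cut \<xi> = bump \<xi>0 \<rho> \<xi> ^ Suc ?N" for \<xi>
    have cut01: "0 \<le> cut \<xi>" "cut \<xi> \<le> indicator (cball \<xi>0 \<rho>) \<xi>" for \<xi>
    proof -
      show "0 \<le> cut \<xi>" by (simp add: cut_def bump_bounds)
      have "cut \<xi> \<le> 1" unfolding cut_def by (intro power_le_one bump_bounds)
      then show "cut \<xi> \<le> indicator (cball \<xi>0 \<rho>) \<xi>" using bump_eq_0[OF \<rho>, of \<xi>] by (auto simp: cut_def split: split_indicator)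
    qed
    have "continuous_on UNIV cut" unfolding cut_def by (intro continuous_intros continuous_bump \<rho>)
    then have [measurable]: "cut \<in> borel_measurable borel" by (rule borel_measurable_continuous_onI)
    have cbm [measurable]: "cball \<xi>0 (\<rho>/2) \<in> sets borel" by simp
    define S where "S \<xi> = (\<integral>x. exp (- \<i> * complex_of_real (\<psi> x \<xi>)) * g x \<partial>lborel)" for \<xi>
    have [measurable]: "S \<in> borel_measurable borel" unfolding S_def by measurable
    define H where "H z \<xi> = complex_of_real (cut \<xi>) * exp (\<i> * complex_of_real (\<psi> (fst z) \<xi> - \<psi> (snd z) \<xi>)) * (cnj (g (fst z)) * g (snd z))" for z \<xi>
    have gg: "integrable (lborel \<Otimes>\<^sub>M lborel) (\<lambda>z. cnj (g (fst z)) * g (snd z))"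
      using integrable_prod_mult(1)[OF lborel_pair.pair_sigma_finite_axioms, of "\<lambda>x. cnj (g x)" g] g by (simp add: split_beta')
    have cuti: "integrable lborel (\<lambda>\<xi>. complex_of_real (cut \<xi>))"
    proof (rule integrableI_bounded_set[where A = "cball \<xi>0 \<rho>" and B = 1])
      show "AE x in lborel. x \<notin> cball \<xi>0 \<rho> \<longrightarrow> complex_of_real (cut x) = 0"
        by (rule AE_I2) (metis cut01 indicator_simps(2) antisym of_real_0)
      show "AE x\<in>cball \<xi>0 \<rho> in lborel. norm (complex_of_real (cut x)) \<le> 1"
        using cut01 by (intro AE_I2) (auto intro: order_trans[OF cut01(2)] split: split_indicator)
      show "emeasure lborel (cball \<xi>0 \<rho>) < \<infinity>" using emeasure_lborel_cball_finite by auto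
    qed auto
    \<comment> \<open>As \<open>g\<close> is integrable, \<open>H\<close> is dominated by a product
      of integrable functions, which justifies both orders of integration.\<close>
    have Hi: "integrable ((lborel \<Otimes>\<^sub>M lborel) \<Otimes>\<^sub>M lborel) (\<lambda>(z, \<xi>). H z \<xi>)"
    proof (rule Bochner_Integration.integrable_bound[OF integrable_prod_mult(1)[OF PP.pair_sigma_finite_axioms gg cuti]])
      show "(\<lambda>(z, \<xi>). H z \<xi>) \<in> borel_measurable ((lborel \<Otimes>\<^sub>M lborel) \<Otimes>\<^sub>M lborel)"
        unfolding H_def split_beta' by measurable
      show "AE x in (lborel \<Otimes>\<^sub>M lborel) \<Otimes>\<^sub>M lborel. norm (case x of (z, \<xi>) \<Rightarrow> H z \<xi>)
          \<le> norm (case x of (x, y) \<Rightarrow> cnj (g (fst x)) * g (snd x) * complex_of_real (cut y))"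
        by (intro AE_I2) (auto simp: H_def norm_mult)
    qed
    have zint: "(\<integral>z. H z \<xi> \<partial>(lborel \<Otimes>\<^sub>M lborel)) = complex_of_real (cut \<xi> * (norm (S \<xi>))\<^sup>2)" for \<xi>
    proof -
      have gi: "integrable lborel (\<lambda>x. exp (- \<i> * complex_of_real (\<psi> x \<xi>)) * g x)"
        by (rule Bochner_Integration.integrable_bound[OF g]) (auto simp: norm_mult)
      then have gi': "integrable lborel (\<lambda>x. cnj (exp (- \<i> * complex_of_real (\<psi> x \<xi>)) * g x))"
        by (rule integrable_cnj)
      have "(\<integral>z. H z \<xi> \<partial>(lborel \<Otimes>\<^sub>M lborel)) = (\<integral>z. complex_of_real (cut \<xi>) *
          (case z of (x, y) \<Rightarrow> cnj (exp (- \<i> * complex_of_real (\<psi> x \<xi>)) * g x) * (exp (- \<i> * complex_of_real (\<psi> y \<xi>)) * g y)) \<partial>(lborel \<Otimes>\<^sub>M lborel))"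
      proof (rule Bochner_Integration.integral_cong[OF refl])
        fix z :: "(real^'n) \<times> (real^'n)"
        have 1: "cnj (exp (- \<i> * complex_of_real t)) = exp (\<i> * complex_of_real t)" for t by (simp add: exp_cnj)
        have 2: "exp (\<i> * complex_of_real (s - t)) = exp (\<i> * complex_of_real s) * exp (- \<i> * complex_of_real t)" for s t
          by (simp add: exp_add[symmetric] algebra_simps)
        show "H z \<xi> = complex_of_real (cut \<xi>) * (case z of (x, y) \<Rightarrow>
            cnj (exp (- \<i> * complex_of_real (\<psi> x \<xi>)) * g x) * (exp (- \<i> * complex_of_real (\<psi> y \<xi>)) * g y))"
          unfolding H_def split_beta' complex_cnj_mult 1 2 by (simp only: mult_ac)
      qed
      also have "\<dots> = complex_of_real (cut \<xi>) * (cnj (S \<xi>) * S \<xi>)"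
        by (simp only: integral_mult_right_zero integrable_prod_mult(2)[OF lborel_pair.pair_sigma_finite_axioms gi' gi] integral_bounded_linear[OF bounded_linear_cnj gi] S_def)
      also have "cnj (S \<xi>) * S \<xi> = complex_of_real ((norm (S \<xi>))\<^sup>2)"
        using complex_norm_square[of "S \<xi>"] by (metis mult.commute)
      finally show ?thesis by simp
    qed
    have Si: "integrable lborel (\<lambda>\<xi>. complex_of_real (cut \<xi> * (norm (S \<xi>))\<^sup>2))"
      using PP.integrable_snd[OF Hi] unfolding zint .
    have "ennreal q * (\<integral>\<^sup>+\<xi>. ennreal ((norm (S \<xi>))\<^sup>2) * indicator (cball \<xi>0 (\<rho>/2)) \<xi> \<partial>lborel) =
        (\<integral>\<^sup>+\<xi>. ennreal q * (ennreal ((norm (S \<xi>))\<^sup>2) * indicator (cball \<xi>0 (\<rho>/2)) \<xi>) \<partial>lborel)"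
      by (subst nn_integral_cmult) measurable
    also have "\<dots> \<le> (\<integral>\<^sup>+\<xi>. ennreal (cut \<xi> * (norm (S \<xi>))\<^sup>2) \<partial>lborel)"
    proof (rule nn_integral_mono)
      fix \<xi>
      have "q \<le> cut \<xi>" if "\<xi> \<in> cball \<xi>0 (\<rho>/2)"
        unfolding q_def cut_def using bump_ge[OF \<rho> that] by (intro power_mono) auto
      then show "ennreal q * (ennreal ((norm (S \<xi>))\<^sup>2) * indicator (cball \<xi>0 (\<rho>/2)) \<xi>) \<le> ennreal (cut \<xi> * (norm (S \<xi>))\<^sup>2)"
        using q0 by (auto simp: ennreal_mult[symmetric] cut01 intro!: ennreal_leI mult_right_mono split: split_indicator)
    qed
    also have "\<dots> = ennreal (\<integral>\<xi>. cut \<xi> * (norm (S \<xi>))\<^sup>2 \<partial>lborel)"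
      using integrable_Re[OF Si] cut01 by (intro nn_integral_eq_integral) auto
    also have "(\<integral>\<xi>. cut \<xi> * (norm (S \<xi>))\<^sup>2 \<partial>lborel) = norm (\<integral>\<xi>. complex_of_real (cut \<xi> * (norm (S \<xi>))\<^sup>2) \<partial>lborel)"
      using cut01 by (simp add: integral_nonneg del: of_real_mult)
    also have "(\<integral>\<xi>. complex_of_real (cut \<xi> * (norm (S \<xi>))\<^sup>2) \<partial>lborel) = (\<integral>z. (\<integral>\<xi>. H z \<xi> \<partial>lborel) \<partial>(lborel \<Otimes>\<^sub>M lborel))"
      unfolding zint[symmetric] by (rule PP.Fubini_integral[OF Hi])
    also have "ennreal (norm \<dots>) \<le> (\<integral>\<^sup>+z. ennreal (norm (\<integral>\<xi>. H z \<xi> \<partial>lborel)) \<partial>(lborel \<Otimes>\<^sub>M lborel))"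
      by (rule integral_norm_bound_ennreal[OF PP.integrable_fst[OF Hi]])
    also have "\<dots> \<le> (\<integral>\<^sup>+z. (ennreal ((norm (g (fst z)))\<^sup>2) + ennreal ((norm (g (snd z)))\<^sup>2)) * ennreal (C * \<rho> ^ ?n * decay_weight ?N (c * \<rho> * norm (fst z - snd z)) / 2) \<partial>(lborel \<Otimes>\<^sub>M lborel))"
    proof (rule nn_integral_mono)
      fix z :: "(real^'n) \<times> (real^'n)"
      let ?k = "C * \<rho> ^ ?n * decay_weight ?N (c * \<rho> * norm (fst z - snd z))"
      have k0: "0 \<le> ?k" using C(1) \<rho> decay_weight_nonneg by simp
      have "norm (\<integral>\<xi>. H z \<xi> \<partial>lborel) = norm (\<integral>\<xi>. complex_of_real (cut \<xi>) * exp (\<i> * complex_of_real (\<psi> (fst z) \<xi> - \<psi> (snd z) \<xi>)) \<partial>lborel) * (norm (g (fst z)) * norm (g (snd z)))"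
        unfolding H_def by (subst integral_mult_left_zero) (simp add: norm_mult)
      also have "\<dots> \<le> ?k * (norm (g (fst z)) * norm (g (snd z)))"
        unfolding cut_def by (intro mult_right_mono C(2)[OF \<rho> nd]) auto
      \<comment> \<open>Schur's test in elementary form: the product of the two values of
        \<open>g\<close> is split by the arithmetic-geometric mean, and both halves contribute
        equally because the weight is symmetric in \<open>x\<close> and \<open>y\<close>.\<close>
      also have "\<dots> \<le> ?k * (((norm (g (fst z)))\<^sup>2 + (norm (g (snd z)))\<^sup>2) / 2)"
        using sum_squares_bound[of "norm (g (fst z))" "norm (g (snd z))"] by (intro mult_left_mono k0) simp
      also have "\<dots> = ((norm (g (fst z)))\<^sup>2 + (norm (g (snd z)))\<^sup>2) * (?k / 2)" by (simp add: field_simps)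
      finally show "ennreal (norm (\<integral>\<xi>. H z \<xi> \<partial>lborel)) \<le> (ennreal ((norm (g (fst z)))\<^sup>2) + ennreal ((norm (g (snd z)))\<^sup>2)) * ennreal (?k / 2)"
        using k0 by (simp add: ennreal_plus[symmetric] ennreal_mult[symmetric] ennreal_leI del: ennreal_plus)
    qed
    also have "\<dots> = (\<integral>\<^sup>+z. ennreal ((norm (g (fst z)))\<^sup>2) * ennreal (C * \<rho> ^ ?n * decay_weight ?N (c * \<rho> * norm (fst z - snd z)) / 2) \<partial>(lborel \<Otimes>\<^sub>M lborel))
        + (\<integral>\<^sup>+z. ennreal ((norm (g (snd z)))\<^sup>2) * ennreal (C * \<rho> ^ ?n * decay_weight ?N (c * \<rho> * norm (fst z - snd z)) / 2) \<partial>(lborel \<Otimes>\<^sub>M lborel))"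
      by (subst nn_integral_add[symmetric]) (auto simp: distrib_right)
    also have "(\<integral>\<^sup>+z. ennreal ((norm (g (snd z)))\<^sup>2) * ennreal (C * \<rho> ^ ?n * decay_weight ?N (c * \<rho> * norm (fst z - snd z)) / 2) \<partial>(lborel \<Otimes>\<^sub>M lborel)) =
       (\<integral>\<^sup>+x. \<integral>\<^sup>+y. ennreal ((norm (g x))\<^sup>2) * ennreal (C * \<rho> ^ ?n * decay_weight ?N (c * \<rho> * norm (x - y)) / 2) \<partial>lborel \<partial>lborel)"
      by (subst lborel_pair.nn_integral_snd[symmetric]) (auto simp: norm_minus_commute)
    also have "(\<integral>\<^sup>+z. ennreal ((norm (g (fst z)))\<^sup>2) * ennreal (C * \<rho> ^ ?n * decay_weight ?N (c * \<rho> * norm (fst z - snd z)) / 2) \<partial>(lborel \<Otimes>\<^sub>M lborel)) =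
       (\<integral>\<^sup>+x. \<integral>\<^sup>+y. ennreal ((norm (g x))\<^sup>2) * ennreal (C * \<rho> ^ ?n * decay_weight ?N (c * \<rho> * norm (x - y)) / 2) \<partial>lborel \<partial>lborel)"
      by (subst lborel.nn_integral_fst[symmetric]) auto
    also have "(\<integral>\<^sup>+x. \<integral>\<^sup>+y. ennreal ((norm (g x))\<^sup>2) * ennreal (C * \<rho> ^ ?n * decay_weight ?N (c * \<rho> * norm (x - y)) / 2) \<partial>lborel \<partial>lborel)
       \<le> (\<integral>\<^sup>+x. ennreal (C * D / 2) * ennreal ((norm (g x))\<^sup>2) \<partial>lborel)"
    proof (rule nn_integral_mono)
      fix x
      have "(\<integral>\<^sup>+y. ennreal ((norm (g x))\<^sup>2) * ennreal (C * \<rho> ^ ?n * decay_weight ?N (c * \<rho> * norm (x - y)) / 2) \<partial>lborel)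
        = (\<integral>\<^sup>+y. (ennreal ((norm (g x))\<^sup>2) * ennreal (C * \<rho> ^ ?n / 2)) * ennreal (decay_weight ?N (c * \<rho> * norm (x - y))) \<partial>lborel)"
        using C(1) \<rho> decay_weight_nonneg by (intro nn_integral_cong) (simp add: ennreal_mult[symmetric] mult_ac)
      also have "\<dots> = ennreal ((norm (g x))\<^sup>2) * ennreal (C * \<rho> ^ ?n / 2) * (\<integral>\<^sup>+y. ennreal (decay_weight ?N (c * \<rho> * norm (x - y))) \<partial>lborel)"
        by (rule nn_integral_cmult) auto
      also have "\<dots> \<le> ennreal ((norm (g x))\<^sup>2) * ennreal (C * \<rho> ^ ?n / 2) * ennreal (D / \<rho> ^ ?n)"
        by (intro mult_left_mono kwi \<rho>) auto
      also have "\<dots> = ennreal (C * D / 2) * ennreal ((norm (g x))\<^sup>2)"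
        using C(1) \<rho> D0 by (simp add: ennreal_mult[symmetric] mult_ac)
      finally show "(\<integral>\<^sup>+y. ennreal ((norm (g x))\<^sup>2) * ennreal (C * \<rho> ^ ?n * decay_weight ?N (c * \<rho> * norm (x - y)) / 2) \<partial>lborel)
        \<le> ennreal (C * D / 2) * ennreal ((norm (g x))\<^sup>2)" .
    qed
    also have "\<dots> = ennreal (C * D / 2) * (\<integral>\<^sup>+x. ennreal ((norm (g x))\<^sup>2) \<partial>lborel)"
      by (rule nn_integral_cmult) auto
    finally have "ennreal q * (\<integral>\<^sup>+\<xi>. ennreal ((norm (S \<xi>))\<^sup>2) * indicator (cball \<xi>0 (\<rho>/2)) \<xi> \<partial>lborel)
        \<le> ennreal (C * D / 2) * (\<integral>\<^sup>+x. ennreal ((norm (g x))\<^sup>2) \<partial>lborel) + ennreal (C * D / 2) * (\<integral>\<^sup>+x. ennreal ((norm (g x))\<^sup>2) \<partial>lborel)"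
      by (simp add: add_mono)
    also have "\<dots> = ennreal (C * D) * (\<integral>\<^sup>+x. ennreal ((norm (g x))\<^sup>2) \<partial>lborel)"
      using C(1) D0 by (simp add: distrib_right[symmetric] ennreal_plus[symmetric] del: ennreal_plus)
    also have "\<dots> \<le> ennreal (C * D + 1) * (\<integral>\<^sup>+x. ennreal ((norm (g x))\<^sup>2) \<partial>lborel)"
      by (intro mult_right_mono ennreal_leI) auto
    finally have fin: "ennreal q * (\<integral>\<^sup>+\<xi>. ennreal ((norm (S \<xi>))\<^sup>2) * indicator (cball \<xi>0 (\<rho>/2)) \<xi> \<partial>lborel)
       \<le> ennreal (C * D + 1) * (\<integral>\<^sup>+x. ennreal ((norm (g x))\<^sup>2) \<partial>lborel)" .
    have "X \<le> ennreal B * Y" if "ennreal q * X \<le> ennreal (C * D + 1) * Y" for X Y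
    proof -
      have "ennreal (1/q) * (ennreal q * X) \<le> ennreal (1/q) * (ennreal (C * D + 1) * Y)"
        using that by (rule mult_left_mono) simp
      moreover have "ennreal (1/q) * (ennreal q * X) = X"
        using q0 by (simp add: mult.assoc[symmetric] ennreal_mult[symmetric])
      moreover have "ennreal (1/q) * (ennreal (C * D + 1) * Y) = ennreal B * Y"
        using q0 C(1) D0 by (simp add: mult.assoc[symmetric] ennreal_mult[symmetric] B_def del: ennreal_plus)
      ultimately show ?thesis by simp
    qed
    from this[OF fin] show "(\<integral>\<^sup>+\<xi>. ennreal ((norm (\<integral>x. exp (- \<i> * complex_of_real (\<psi> x \<xi>)) * g x \<partial>lborel))\<^sup>2) * indicator (cball \<xi>0 (\<rho>/2)) \<xi> \<partial>lborel)
       \<le> ennreal B * (\<integral>\<^sup>+x. ennreal ((norm (g x))\<^sup>2) \<partial>lborel)"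
      unfolding S_def .
  qed
qed

lemma integrable_of_L2_bounded_support:
  fixes F :: "'a::euclidean_space \<Rightarrow> complex"
  assumes [measurable]: "F \<in> borel_measurable borel" and F0: "\<And>\<xi>. \<xi> \<notin> K \<Longrightarrow> F \<xi> = 0"
    and K: "bounded K" and F2: "(\<integral>\<^sup>+\<xi>. ennreal ((norm (F \<xi>))\<^sup>2) \<partial>lborel) < \<infinity>"
  shows "integrable lborel F"
proof (rule integrableI_bounded)
  obtain R where R: "K \<subseteq> cball 0 R" using K bounded_subset_ballD[of K 0] ball_subset_cball by (metis subset_trans)
  have [measurable]: "cball 0 R \<in> sets (borel :: 'a measure)" by simp
  have "(\<integral>\<^sup>+x. ennreal (norm (F x)) \<partial>lborel) \<le> (\<integral>\<^sup>+x. ennreal ((norm (F x))\<^sup>2) + indicator (cball 0 R) x \<partial>lborel)"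
  proof (rule nn_integral_mono)
    fix x
    have "2 * norm (F x) \<le> (norm (F x))\<^sup>2 + 1"
      using sum_squares_bound[of "norm (F x)" 1] by simp
    then have 1: "norm (F x) \<le> (norm (F x))\<^sup>2 + 1" using norm_ge_zero[of "F x"] by linarith
    show "ennreal (norm (F x)) \<le> ennreal ((norm (F x))\<^sup>2) + indicator (cball 0 R) x"
    proof (cases "x \<in> cball 0 R")
      case True
      then show ?thesis using ennreal_leI[OF 1] by (simp add: ennreal_plus)
    next
      case False
      then have "F x = 0" using R F0 by blast
      then show ?thesis by simp
    qed
  qed
  also have "\<dots> = (\<integral>\<^sup>+x. ennreal ((norm (F x))\<^sup>2) \<partial>lborel) + emeasure lborel (cball (0::'a) R)"
    by (subst nn_integral_add) auto
  also have "\<dots> < \<infinity>" using F2 emeasure_lborel_cball_finite[of "0::'a" R] by (simp add: less_top)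
  finally show "(\<integral>\<^sup>+x. ennreal (norm (F x)) \<partial>lborel) < \<infinity>" .
qed simp

text \<open>Duality carried out by hand. The image of \<open>F\<close>, truncated to a ball, is used
  as its own test function \<open>g\<close>; its square norm \<open>X\<close> is then a pairing of
  \<open>F\<close> with the adjoint applied to \<open>g\<close>, and \<open>TTstar_dual\<close>
  bounds this by \<open>B/2 * f\<^sup>2 + X/2\<close>. Absorbing \<open>X/2\<close> bounds
  \<open>X\<close> independently of the truncation, which is then removed by monotone
  convergence.\<close>

lemma TTstar_primal:
  assumes c: "0 < c" and A: "0 \<le> A"
  shows "\<exists>B>0. \<forall>(\<psi>::real^'n::finite \<Rightarrow> real^'n \<Rightarrow> real) \<xi>0 \<rho> F f.
     0 < \<rho> \<longrightarrow> (\<lambda>(x, \<xi>). \<psi> x \<xi>) \<in> borel_measurable (lborel \<Otimes>\<^sub>M lborel) \<longrightarrow> nondeg_phase c A \<psi> \<xi>0 \<rho> \<longrightarrow>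
     (\<forall>\<xi>. \<xi> \<notin> cball \<xi>0 (\<rho>/2) \<longrightarrow> F \<xi> = 0) \<longrightarrow> Lr_le lborel 2 F f \<longrightarrow> 0 < f \<longrightarrow>
     Lr_le lborel 2 (\<lambda>x. \<integral>\<xi>. exp (\<i> * complex_of_real (\<psi> x \<xi>)) * F \<xi> \<partial>lborel) (B * f)"
proof -
  obtain B where B: "B > 0" "\<And>(\<psi>::real^'n::finite \<Rightarrow> real^'n \<Rightarrow> real) \<xi>0 \<rho> g.
     0 < \<rho> \<Longrightarrow> (\<lambda>(x, \<xi>). \<psi> x \<xi>) \<in> borel_measurable (lborel \<Otimes>\<^sub>M lborel) \<Longrightarrow> nondeg_phase c A \<psi> \<xi>0 \<rho> \<Longrightarrow>
     integrable lborel g \<Longrightarrow>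
     (\<integral>\<^sup>+\<xi>. ennreal ((norm (\<integral>x. exp (- \<i> * complex_of_real (\<psi> x \<xi>)) * g x \<partial>lborel))\<^sup>2) * indicator (cball \<xi>0 (\<rho>/2)) \<xi> \<partial>lborel)
       \<le> ennreal B * (\<integral>\<^sup>+x. ennreal ((norm (g x))\<^sup>2) \<partial>lborel)"
    using TTstar_dual[OF c A] by blast
  show ?thesis
  proof (intro exI[of _ "sqrt B"] conjI allI impI)
    show "0 < sqrt B" using B by simp
    fix \<psi> :: "real^'n \<Rightarrow> real^'n \<Rightarrow> real" and \<xi>0 \<rho> and F :: "real^'n \<Rightarrow> complex" and f :: real
    assume \<rho>: "0 < \<rho>" and \<psi>m: "(\<lambda>(x, \<xi>). \<psi> x \<xi>) \<in> borel_measurable (lborel \<Otimes>\<^sub>M lborel)"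
      and nd: "nondeg_phase c A \<psi> \<xi>0 \<rho>" and F0: "\<forall>\<xi>. \<xi> \<notin> cball \<xi>0 (\<rho>/2) \<longrightarrow> F \<xi> = 0"
      and F: "Lr_le lborel 2 F f" and f: "0 < f"
    note \<psi>m' [measurable (raw)] = measurable_case_prod_compose[OF \<psi>m]
    have Fm [measurable]: "F \<in> borel_measurable lborel" using F by (simp add: Lr_le_def)
    have F2: "(\<integral>\<^sup>+\<xi>. ennreal ((norm (F \<xi>))\<^sup>2) \<partial>lborel) \<le> ennreal (f\<^sup>2)"
      using F f by (simp add: Lr_le_def)
    have Fi: "integrable lborel F"
      by (rule integrable_of_L2_bounded_support[of F "cball \<xi>0 (\<rho>/2)"]) (use Fm F0 F2 in \<open>auto simp: less_top[symmetric] top_unique\<close>)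
    define G where "G x = (\<integral>\<xi>. exp (\<i> * complex_of_real (\<psi> x \<xi>)) * F \<xi> \<partial>lborel)" for x
    have Gm [measurable]: "G \<in> borel_measurable lborel" unfolding G_def by measurable
    define L where "L = (\<integral>\<xi>. norm (F \<xi>) \<partial>lborel)"
    have GL: "norm (G x) \<le> L" for x
    proof -
      have "norm (G x) \<le> (\<integral>\<xi>. norm (exp (\<i> * complex_of_real (\<psi> x \<xi>)) * F \<xi>) \<partial>lborel)"
        unfolding G_def by (rule integral_norm_bound)
      then show ?thesis by (simp add: norm_mult L_def)
    qed
    have key: "(\<integral>\<^sup>+x. ennreal ((norm (G x))\<^sup>2) * indicator (cball 0 R) x \<partial>lborel) \<le> ennreal (B * f\<^sup>2)" for R :: real
    proof -
      have cb [measurable]: "cball (0::real^'n) R \<in> sets borel" "cball \<xi>0 (\<rho>/2) \<in> sets borel" by simp_all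
      \<comment> \<open>Since the image of \<open>F\<close> is bounded by the L^1 norm of
        \<open>F\<close>, the truncation makes \<open>X\<close> finite. Only then can
        \<open>X/2\<close> be moved to the other side.\<close>
      define g where "g x = indicator (cball 0 R) x *\<^sub>R G x" for x
      have gm [measurable]: "g \<in> borel_measurable lborel" unfolding g_def by measurable
      have fin: "emeasure lborel (cball (0::real^'n) R) < \<infinity>" using emeasure_lborel_cball_finite by auto
      have gi: "integrable lborel g"
      proof (rule integrableI_bounded_set[where A = "cball 0 R" and B = L])
        show "AE x in lborel. x \<notin> cball 0 R \<longrightarrow> g x = 0" by (rule AE_I2) (simp add: g_def)
        show "AE x\<in>cball 0 R in lborel. norm (g x) \<le> L" by (rule AE_I2) (simp add: g_def GL)
      qed (use fin in auto)
      have g2i: "integrable lborel (\<lambda>x. (norm (g x))\<^sup>2)"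
      proof (rule integrableI_bounded_set[where A = "cball 0 R" and B = "L\<^sup>2"])
        show "AE x in lborel. x \<notin> cball 0 R \<longrightarrow> (norm (g x))\<^sup>2 = 0" by (rule AE_I2) (simp add: g_def)
        show "AE x\<in>cball 0 R in lborel. norm ((norm (g x))\<^sup>2) \<le> L\<^sup>2" by (rule AE_I2) (simp add: g_def GL power_mono)
      qed (use fin in auto)
      define X where "X = (\<integral>x. (norm (g x))\<^sup>2 \<partial>lborel)"
      have X0: "0 \<le> X" by (simp add: X_def)
      have gX: "(\<integral>\<^sup>+x. ennreal ((norm (g x))\<^sup>2) \<partial>lborel) = ennreal X"
        unfolding X_def using g2i by (intro nn_integral_eq_integral) auto
      define S where "S \<xi> = (\<integral>x. exp (- \<i> * complex_of_real (\<psi> x \<xi>)) * g x \<partial>lborel)" for \<xi>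
      have Sm [measurable]: "S \<in> borel_measurable lborel" unfolding S_def by measurable
      have S2: "(\<integral>\<^sup>+\<xi>. ennreal ((norm (S \<xi>))\<^sup>2) * indicator (cball \<xi>0 (\<rho>/2)) \<xi> \<partial>lborel) \<le> ennreal B * ennreal X"
        unfolding S_def gX[symmetric] by (rule B(2)[OF \<rho> \<psi>m nd gi])
      have gci: "integrable lborel (\<lambda>x. cnj (g x))" using gi by (rule integrable_cnj)
      define H where "H x \<xi> = cnj (g x) * (exp (\<i> * complex_of_real (\<psi> x \<xi>)) * F \<xi>)" for x \<xi>
      have Hi: "integrable (lborel \<Otimes>\<^sub>M lborel) (\<lambda>(x, \<xi>). H x \<xi>)"
      proof (rule Bochner_Integration.integrable_bound[OF integrable_prod_mult(1)[OF lborel_pair.pair_sigma_finite_axioms gci Fi]])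
        have [measurable]: "(\<lambda>x. cnj (g x)) \<in> borel_measurable lborel" using gci by (rule borel_measurable_integrable)
        show "(\<lambda>(x, \<xi>). H x \<xi>) \<in> borel_measurable (lborel \<Otimes>\<^sub>M lborel)"
          unfolding H_def split_beta' by measurable
      qed (auto simp: H_def norm_mult)
      have "complex_of_real X = (\<integral>x. complex_of_real ((norm (g x))\<^sup>2) \<partial>lborel)"
        unfolding X_def by (rule integral_complex_of_real[symmetric])
      also have "\<dots> = (\<integral>x. (\<integral>\<xi>. H x \<xi> \<partial>lborel) \<partial>lborel)"
      proof (rule Bochner_Integration.integral_cong[OF refl])
        fix x
        have "(\<integral>\<xi>. H x \<xi> \<partial>lborel) = cnj (g x) * G x" unfolding H_def G_def by (rule integral_mult_right_zero)
        also have "\<dots> = g x * cnj (g x)" by (auto simp: g_def split: split_indicator)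
        finally show "complex_of_real ((norm (g x))\<^sup>2) = (\<integral>\<xi>. H x \<xi> \<partial>lborel)" by (simp only: complex_norm_square)
      qed
      also have "\<dots> = (\<integral>\<xi>. (\<integral>x. H x \<xi> \<partial>lborel) \<partial>lborel)" by (rule lborel_pair.Fubini_integral[OF Hi, symmetric])
      also have "\<dots> = (\<integral>\<xi>. F \<xi> * cnj (S \<xi>) \<partial>lborel)"
      proof (rule Bochner_Integration.integral_cong[OF refl])
        fix \<xi>
        have i: "integrable lborel (\<lambda>x. exp (- \<i> * complex_of_real (\<psi> x \<xi>)) * g x)"
          by (rule Bochner_Integration.integrable_bound[OF gi]) (auto simp: norm_mult)
        have 1: "cnj (exp (- \<i> * complex_of_real t)) = exp (\<i> * complex_of_real t)" for t by (simp add: exp_cnj)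
        have "(\<integral>x. H x \<xi> \<partial>lborel) = (\<integral>x. F \<xi> * cnj (exp (- \<i> * complex_of_real (\<psi> x \<xi>)) * g x) \<partial>lborel)"
          unfolding H_def complex_cnj_mult 1 by (simp only: mult_ac)
        also have "\<dots> = F \<xi> * cnj (S \<xi>)"
          by (simp only: integral_mult_right_zero integral_bounded_linear[OF bounded_linear_cnj i] S_def)
        finally show "(\<integral>x. H x \<xi> \<partial>lborel) = F \<xi> * cnj (S \<xi>)" .
      qed
      finally have eq: "complex_of_real X = (\<integral>\<xi>. F \<xi> * cnj (S \<xi>) \<partial>lborel)" .
      have FSi: "integrable lborel (\<lambda>\<xi>. F \<xi> * cnj (S \<xi>))"
      proof -
        have "norm (S \<xi>) \<le> (\<integral>x. norm (g x) \<partial>lborel)" for \<xi>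
        proof -
          have "norm (S \<xi>) \<le> (\<integral>x. norm (exp (- \<i> * complex_of_real (\<psi> x \<xi>)) * g x) \<partial>lborel)"
            unfolding S_def by (rule integral_norm_bound)
          then show ?thesis by (simp add: norm_mult)
        qed
        from mult_left_mono[OF this norm_ge_zero]
        have "norm (F \<xi> * cnj (S \<xi>)) \<le> norm (complex_of_real (\<integral>x. norm (g x) \<partial>lborel) * F \<xi>)" for \<xi>
          by (simp add: norm_mult mult.commute)
        moreover have "(\<lambda>\<xi>. F \<xi> * cnj (S \<xi>)) \<in> borel_measurable lborel"
          using borel_measurable_continuous_on[OF continuous_on_cnj[OF continuous_on_id] Sm] by measurable
        ultimately show ?thesis
          by (intro Bochner_Integration.integrable_bound[OF integrable_mult_right[OF Fi, of "complex_of_real (\<integral>x. norm (g x) \<partial>lborel)"]]) auto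
      qed
      have "ennreal X = ennreal (norm (\<integral>\<xi>. F \<xi> * cnj (S \<xi>) \<partial>lborel))" using X0 by (simp add: eq[symmetric])
      also have "\<dots> \<le> (\<integral>\<^sup>+\<xi>. ennreal (norm (F \<xi> * cnj (S \<xi>))) \<partial>lborel)" by (rule integral_norm_bound_ennreal[OF FSi])
      also have "\<dots> \<le> (\<integral>\<^sup>+\<xi>. ennreal (B/2) * ennreal ((norm (F \<xi>))\<^sup>2) + ennreal (1/(2*B)) * (ennreal ((norm (S \<xi>))\<^sup>2) * indicator (cball \<xi>0 (\<rho>/2)) \<xi>) \<partial>lborel)"
      proof (rule nn_integral_mono)
        fix \<xi>
        \<comment> \<open>The weights are chosen so that the adjoint term contributes exactly
          \<open>X/2\<close>.\<close>
        have "norm (F \<xi>) * norm (S \<xi>) \<le> B/2 * (norm (F \<xi>))\<^sup>2 + 1/(2*B) * (norm (S \<xi>))\<^sup>2"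
        proof -
          have "0 \<le> (B * norm (F \<xi>) - norm (S \<xi>))\<^sup>2 / (2 * B)" using B(1) by simp
          also have "\<dots> = B/2 * (norm (F \<xi>))\<^sup>2 + 1/(2*B) * (norm (S \<xi>))\<^sup>2 - norm (F \<xi>) * norm (S \<xi>)"
            using B(1) by (simp add: power2_diff power_mult_distrib field_simps) (simp add: power2_eq_square field_simps)
          finally show ?thesis by simp
        qed
        then show "ennreal (norm (F \<xi> * cnj (S \<xi>))) \<le> ennreal (B/2) * ennreal ((norm (F \<xi>))\<^sup>2) + ennreal (1/(2*B)) * (ennreal ((norm (S \<xi>))\<^sup>2) * indicator (cball \<xi>0 (\<rho>/2)) \<xi>)"
          using F0 B(1) by (cases "\<xi> \<in> cball \<xi>0 (\<rho>/2)") (auto simp: norm_mult ennreal_mult[symmetric] ennreal_plus[symmetric] ennreal_leI simp del: ennreal_plus)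
      qed
      also have "\<dots> = ennreal (B/2) * (\<integral>\<^sup>+\<xi>. ennreal ((norm (F \<xi>))\<^sup>2) \<partial>lborel) + ennreal (1/(2*B)) * (\<integral>\<^sup>+\<xi>. ennreal ((norm (S \<xi>))\<^sup>2) * indicator (cball \<xi>0 (\<rho>/2)) \<xi> \<partial>lborel)"
        by (subst nn_integral_add) (auto simp: nn_integral_cmult)
      also have "\<dots> \<le> ennreal (B/2) * ennreal (f\<^sup>2) + ennreal (1/(2*B)) * (ennreal B * ennreal X)"
        by (intro add_mono mult_left_mono F2 S2) auto
      also have "\<dots> = ennreal (B/2 * f\<^sup>2 + X/2)"
        using B(1) X0 by (simp add: ennreal_mult[symmetric] ennreal_plus[symmetric] mult_ac del: ennreal_plus)
      finally have "X \<le> B/2 * f\<^sup>2 + X/2" using B(1) X0 by (subst (asm) ennreal_le_iff) auto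
      then have "X \<le> B * f\<^sup>2" by simp
      moreover have "(\<integral>\<^sup>+x. ennreal ((norm (G x))\<^sup>2) * indicator (cball 0 R) x \<partial>lborel) = ennreal X"
        unfolding gX[symmetric] by (intro nn_integral_cong) (auto simp: g_def split: split_indicator)
      ultimately show ?thesis by (simp add: ennreal_leI)
    qed
    have "(\<integral>\<^sup>+x. ennreal ((norm (G x))\<^sup>2) \<partial>lborel) = (\<integral>\<^sup>+x. (SUP k. ennreal ((norm (G x))\<^sup>2) * indicator (cball 0 (real k)) x) \<partial>lborel)"
    proof (rule nn_integral_cong)
      fix x :: "real^'n"
      obtain k0 where k0: "norm x \<le> real k0" using real_arch_simple by blast
      have "ennreal ((norm (G x))\<^sup>2) \<le> (SUP k. ennreal ((norm (G x))\<^sup>2) * indicator (cball 0 (real k)) x)"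
        using k0 by (intro SUP_upper2[of k0]) auto
      moreover have "(SUP k. ennreal ((norm (G x))\<^sup>2) * indicator (cball 0 (real k)) x) \<le> ennreal ((norm (G x))\<^sup>2)"
        by (intro SUP_least) (auto split: split_indicator)
      ultimately show "ennreal ((norm (G x))\<^sup>2) = (SUP k. ennreal ((norm (G x))\<^sup>2) * indicator (cball 0 (real k)) x)" by (rule antisym)
    qed
    also have "\<dots> = (SUP k. \<integral>\<^sup>+x. ennreal ((norm (G x))\<^sup>2) * indicator (cball 0 (real k)) x \<partial>lborel)"
    proof (rule nn_integral_monotone_convergence_SUP)
      show "incseq (\<lambda>k x. ennreal ((norm (G x))\<^sup>2) * indicator (cball 0 (real k)) x)"
        by (auto simp: incseq_def le_fun_def split: split_indicator)
      show "(\<lambda>x. ennreal ((norm (G x))\<^sup>2) * indicator (cball 0 (real k)) x) \<in> borel_measurable lborel" for k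
      proof -
        have [measurable]: "cball (0::real^'n) (real k) \<in> sets borel" by simp
        show ?thesis by measurable
      qed
    qed
    also have "\<dots> \<le> ennreal (B * f\<^sup>2)" by (intro SUP_least key)
    finally have "(\<integral>\<^sup>+x. ennreal (norm (G x) powr 2) \<partial>lborel) \<le> ennreal ((sqrt B * f) powr 2)"
      using B(1) f by (simp add: power_mult_distrib)
    then show "Lr_le lborel 2 (\<lambda>x. \<integral>\<xi>. exp (\<i> * complex_of_real (\<psi> x \<xi>)) * F \<xi> \<partial>lborel) (sqrt B * f)"
      unfolding Lr_le_def G_def[symmetric] using Gm by simp
  qed
qed

text \<open>For a phase linear in \<xi> the derivative of the phase difference is constant, so
  \<open>g\<close> is constant and no restriction on the ball arises. Some component of
  \<open>t x - t y\<close> carries at least the fraction 1/n of its norm. The lemma serves both the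
  Fourier transform and the linearised phases.\<close>

lemma nondeg_linear:
  fixes t :: "real^'n::finite \<Rightarrow> real^'n"
  assumes c: "0 < c" and t: "\<And>x y. c * norm (x - y) \<le> norm (t x - t y)" "\<And>x y. norm (t x - t y) \<le> L * norm (x - y)"
    and \<rho>: "0 < \<rho>"
  shows "nondeg_phase (c / CARD('n)) (L * CARD('n) / c) (\<lambda>x \<xi>. t x \<bullet> \<xi>) \<xi>0 \<rho>"
  unfolding nondeg_phase_def
proof (intro conjI allI impI)
  show "continuous_on (ball \<xi>0 (2 * \<rho>)) (\<lambda>\<xi>. t x \<bullet> \<xi>)" for x by (intro continuous_intros)
  fix x y :: "real^'n" assume xy: "x \<noteq> y"
  define d where "d = norm (x - y)"
  have d: "d > 0" using xy by (simp add: d_def)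
  let ?c = "c / CARD('n)"
  have n0: "real CARD('n) > 0" by simp
  obtain i where i: "?c * d \<le> \<bar>(t x - t y) $ i\<bar>"
  proof (rule ccontr)
    assume "\<not> thesis"
    then have "\<not> ?c * d \<le> \<bar>(t x - t y) $ i\<bar>" for i using that[of i] by blast
    then have "\<bar>(t x - t y) $ i\<bar> < ?c * d" for i by (simp only: not_le)
    then have "(\<Sum>i\<in>UNIV. \<bar>(t x - t y) $ i\<bar>) < (\<Sum>i\<in>(UNIV::'n set). ?c * d)" by (intro sum_strict_mono) auto
    then have "norm (t x - t y) < c * d" using norm_le_l1_cart[of "t x - t y"] by simp
    then show False using t(1)[of x y] by (simp add: d_def)
  qed
  define g where "g = (t x - t y) $ i / (?c * d)"
  have cd: "0 < ?c * d" using c d n0 by simp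
  have ag: "\<bar>g\<bar> = \<bar>(t x - t y) $ i\<bar> / (?c * d)" unfolding g_def abs_divide using cd by (simp only: abs_of_pos)
  have g1: "1 \<le> \<bar>g\<bar>" unfolding ag using i cd by (simp only: pos_le_divide_eq mult_1)
  have g2: "\<bar>g\<bar> \<le> L * CARD('n) / c"
  proof -
    have "\<bar>(t x - t y) $ i\<bar> \<le> norm (t x - t y)" by (rule component_le_norm_cart)
    also have "\<dots> \<le> L * d" using t(2)[of x y] by (simp add: d_def)
    finally have "\<bar>g\<bar> \<le> L * d / (?c * d)" unfolding ag using cd by (intro divide_right_mono) simp_all
    then show ?thesis using d by simp
  qed
  show "\<exists>i g. (\<forall>\<xi>\<in>ball \<xi>0 (2 * \<rho>). ((\<lambda>s. t x \<bullet> (\<xi> + s *\<^sub>R \<rho> *\<^sub>R axis i 1) - t y \<bullet> (\<xi> + s *\<^sub>R \<rho> *\<^sub>R axis i 1)) has_real_derivative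
            ?c * \<rho> * norm (x - y) * g \<xi>) (at 0)) \<and> (\<forall>\<xi>\<in>ball \<xi>0 (2 * \<rho>). 1 \<le> \<bar>g \<xi>\<bar>) \<and>
         dbd (ball \<xi>0 (2 * \<rho>)) (\<rho> *\<^sub>R axis i 1) (Suc CARD('n)) (L * CARD('n) / c) (\<lambda>\<xi>. complex_of_real (g \<xi>))"
  proof (intro exI[of _ i] exI[of _ "\<lambda>_. g"] conjI ballI)
    fix \<xi>
    have 1: "(\<lambda>s. t x \<bullet> (\<xi> + s *\<^sub>R \<rho> *\<^sub>R axis i 1) - t y \<bullet> (\<xi> + s *\<^sub>R \<rho> *\<^sub>R axis i 1)) = (\<lambda>s. (t x - t y) \<bullet> \<xi> + s * (\<rho> * (t x - t y) $ i))"
      by (auto simp: inner_add_right inner_diff_left inner_axis algebra_simps)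
    have 2: "?c * \<rho> * norm (x - y) * g = \<rho> * (t x - t y) $ i" using d c n0 by (simp add: g_def d_def[symmetric])
    show "((\<lambda>s. t x \<bullet> (\<xi> + s *\<^sub>R \<rho> *\<^sub>R axis i 1) - t y \<bullet> (\<xi> + s *\<^sub>R \<rho> *\<^sub>R axis i 1)) has_real_derivative ?c * \<rho> * norm (x - y) * g) (at 0)"
      unfolding 1 2 by (auto intro!: derivative_eq_intros)
  qed (use g1 g2 in \<open>auto intro!: dbd_const\<close>)
qed

section \<open>Removing the amplitude\<close>

definition freeze :: "real^'n \<Rightarrow> 'n set \<Rightarrow> real^'n \<Rightarrow> real^'n::finite" where
  "freeze \<sigma> P \<xi> = (\<chi> i. if i \<in> P then \<sigma> $ i else \<xi> $ i)"

definition vset :: "real^'n \<Rightarrow> 'n \<Rightarrow> real \<Rightarrow> real^'n::finite" where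
  "vset \<sigma> i t = (\<chi> j. if j = i then t else \<sigma> $ j)"

lemma measurable_vec_nth [measurable (raw)]:
  fixes \<xi> :: "'x \<Rightarrow> real^'n::finite"
  assumes "\<xi> \<in> measurable K lborel"
  shows "(\<lambda>z. \<xi> z $ i) \<in> borel_measurable K"
proof -
  have "(\<lambda>p::real^'n. p $ i) \<in> borel_measurable borel"
    by (intro borel_measurable_continuous_onI continuous_intros)
  then show ?thesis by (rule measurable_compose[rotated]) (use assms in simp)
qed

lemma measurable_freeze_vset [measurable (raw)]:
  fixes \<sigma> :: "real^'n::finite"
  assumes [measurable]: "s \<in> borel_measurable K" "\<xi> \<in> measurable K lborel"
  shows "(\<lambda>z. freeze (vset \<sigma> i (s z)) P (\<xi> z)) \<in> measurable K lborel"
proof -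
  have "continuous_on UNIV (\<lambda>p::real \<times> (real^'n). freeze (vset \<sigma> i (fst p)) P (snd p))"
    unfolding freeze_def vset_def
  proof (rule continuous_on_vec_lambda)
    show "continuous_on UNIV (\<lambda>p::real \<times> (real^'n). if j \<in> P then (\<chi> j. if j = i then fst p else \<sigma> $ j) $ j else snd p $ j)" for j
      by (cases "j \<in> P"; cases "j = i") (auto intro!: continuous_intros)
  qed
  then have c: "(\<lambda>p::real \<times> (real^'n). freeze (vset \<sigma> i (fst p)) P (snd p)) \<in> borel_measurable borel"
    by (rule borel_measurable_continuous_onI)
  have [measurable]: "\<xi> \<in> borel_measurable K" using assms(2) by simp
  have "(\<lambda>z. (s z, \<xi> z)) \<in> measurable K borel" unfolding borel_prod[symmetric] by measurable
  from measurable_compose[OF this c] show ?thesis by simp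
qed

lemma measurable_fz [measurable (raw)]:
  fixes \<sigma> :: "real^'n::finite"
  assumes "\<xi> \<in> measurable K lborel"
  shows "(\<lambda>z. freeze \<sigma> P (\<xi> z)) \<in> measurable K lborel"
proof -
  have "continuous_on UNIV (\<lambda>p::real^'n. freeze \<sigma> P p)"
    unfolding freeze_def
  proof (rule continuous_on_vec_lambda)
    show "continuous_on UNIV (\<lambda>x::real^'n. if i \<in> P then \<sigma> $ i else x $ i)" for i
      by (cases "i \<in> P") (auto intro!: continuous_intros)
  qed
  then have c: "(\<lambda>p::real^'n. freeze \<sigma> P p) \<in> borel_measurable borel"
    by (rule borel_measurable_continuous_onI)
  from measurable_compose[OF assms, of "\<lambda>p. freeze \<sigma> P p" lborel] c show ?thesis by simp
qed

definition cube :: "real^'n \<Rightarrow> real \<Rightarrow> (real^'n::finite) set" where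
  "cube c l = {\<xi>. \<forall>i. c $ i \<le> \<xi> $ i \<and> \<xi> $ i \<le> c $ i + l}"

lemma cube_eq_cbox: "cube c l = cbox c (c + (\<chi> i. l))"
  by (auto simp: cube_def mem_box_cart)

lemma compact_cube: "compact (cube c l)" by (simp add: cube_eq_cbox)

text \<open>The amplitude is removed one coordinate at a time: \<open>P\<close> is the set of coordinates that
  are already frozen, and the fundamental theorem of calculus freezes one more.\<close>
lemma amplitude_removal:
  fixes e :: "'x \<Rightarrow> real^'n::finite \<Rightarrow> complex" and b :: "'n list \<Rightarrow> 'x \<Rightarrow> real^'n \<Rightarrow> complex"
  assumes M: "sigma_finite_measure M" and r: "1 \<le> r" and l: "0 < l" and A: "0 < A" and B: "0 < B"
    and em: "(\<lambda>(x, \<xi>). e x \<xi>) \<in> borel_measurable (M \<Otimes>\<^sub>M lborel)" and e1: "\<And>x \<xi>. norm (e x \<xi>) \<le> 1"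
    and bm: "\<And>\<alpha>. (\<lambda>(x, \<xi>). b \<alpha> x \<xi>) \<in> borel_measurable (M \<Otimes>\<^sub>M lborel)"
    and bc: "\<And>\<alpha> x. x \<in> space M \<Longrightarrow> continuous_on (cube c l) (b \<alpha> x)"
    and bd: "\<And>\<alpha> i x \<xi>. x \<in> space M \<Longrightarrow> \<xi> \<in> cube c l \<Longrightarrow>
        ((\<lambda>s. b \<alpha> x (\<xi> + s *\<^sub>R axis i 1)) has_vector_derivative b (i # \<alpha>) x \<xi>) (at 0)"
    and E: "E \<subseteq> cube c l"
    and U: "\<And>F f. (\<And>\<xi>. \<xi> \<notin> E \<Longrightarrow> F \<xi> = 0) \<Longrightarrow> Lr_le lborel 2 F f \<Longrightarrow> 0 < f \<Longrightarrow>
        Lr_le M 2 (\<lambda>x. \<integral>\<xi>. e x \<xi> * F \<xi> \<partial>lborel) (B * f)"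
    and mult: "\<And>\<alpha> \<sigma> u f. length \<alpha> \<le> CARD('n) \<Longrightarrow> \<sigma> \<in> cube c l \<Longrightarrow> Lr_le M 2 u f \<Longrightarrow> 0 < f \<Longrightarrow>
        Lr_le M r (\<lambda>x. b \<alpha> x \<sigma> * u x) (A * (1/l) ^ length \<alpha> * f)"
    and F0: "\<And>\<xi>. \<xi> \<notin> E \<Longrightarrow> F \<xi> = 0" and F: "Lr_le lborel 2 F f" and f: "0 < f"
  shows "Lr_le M r (\<lambda>x. \<integral>\<xi>. e x \<xi> * b [] x \<xi> * F \<xi> \<partial>lborel) (2 ^ CARD('n) * A * B * f)"
proof -
  interpret M: sigma_finite_measure M by fact
  note em' [measurable (raw)] = measurable_case_prod_compose[OF em]
  note bm' [measurable (raw)] = measurable_case_prod_compose[OF bm]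
  let ?n = "CARD('n)"
  \<comment> \<open>Here \<open>k\<close> coordinates are still free and \<open>\<alpha>\<close>
    collects the derivatives taken so far. Freezing a coordinate yields a term on a face of the cube
    with the same \<open>\<alpha>\<close>, and an integral over an edge with one more derivative;
    the edge length \<open>l\<close> compensates the additional factor \<open>1/l\<close>. Both
    terms obey the same bound, whence \<open>2 ^ k\<close>. Each coordinate adds at most one
    derivative, so \<open>length \<alpha>\<close> never exceeds the dimension.\<close>
  have claim: "Lr_le M r (\<lambda>x. \<integral>\<xi>. e x \<xi> * b \<alpha> x (freeze \<sigma> P \<xi>) * F \<xi> \<partial>lborel) (2 ^ k * A * B * (1/l) ^ length \<alpha> * f)"
    if "card (UNIV - P) = k" "\<sigma> \<in> cube c l" "length \<alpha> + k \<le> ?n"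
      "\<And>\<xi>. \<xi> \<notin> E \<Longrightarrow> F \<xi> = 0" "Lr_le lborel 2 F f" "0 < f" for P k \<sigma> \<alpha> F f
    using that
  proof (induction k arbitrary: P \<sigma> \<alpha> F f)
    case 0
    then have "P = UNIV" by auto
    then have "freeze \<sigma> P \<xi> = \<sigma>" for \<xi> by (simp add: freeze_def)
    then have 1: "(\<lambda>x. \<integral>\<xi>. e x \<xi> * b \<alpha> x (freeze \<sigma> P \<xi>) * F \<xi> \<partial>lborel) = (\<lambda>x. b \<alpha> x \<sigma> * (\<integral>\<xi>. e x \<xi> * F \<xi> \<partial>lborel))"
      by (subst integral_mult_right_zero[symmetric]) (simp add: mult_ac)
    have "Lr_le M 2 (\<lambda>x. \<integral>\<xi>. e x \<xi> * F \<xi> \<partial>lborel) (B * f)" using 0 by (intro U) auto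
    then have "Lr_le M r (\<lambda>x. b \<alpha> x \<sigma> * (\<integral>\<xi>. e x \<xi> * F \<xi> \<partial>lborel)) (A * (1/l) ^ length \<alpha> * (B * f))"
      using 0 B by (intro mult) auto
    then show ?case unfolding 1 by (simp add: mult_ac)
  next
    case (Suc k)
    then obtain i where i: "i \<notin> P" by (metis Diff_eq_empty_iff card.empty nat.distinct(1) subsetI UNIV_I)
    let ?P = "insert i P"
    have cP: "card (UNIV - ?P) = k" using Suc.prems(1) i by (metis Diff_insert card_Diff_singleton DiffI UNIV_I diff_Suc_1)
    define C where "C = 2 ^ k * A * B * (1/l) ^ length \<alpha> * f"
    have C0: "C > 0" using A B l Suc.prems(6) by (simp add: C_def)
    have Fm [measurable]: "F \<in> borel_measurable lborel" using Suc.prems(5) by (simp add: Lr_le_def)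
    have Fi: "integrable lborel F"
    proof (rule integrable_of_L2_bounded_support[of F "cube c l"])
      show "(\<integral>\<^sup>+\<xi>. ennreal ((norm (F \<xi>))\<^sup>2) \<partial>lborel) < \<infinity>"
        using Suc.prems(5) by (auto simp: Lr_le_def intro: le_less_trans)
    qed (use Suc.prems(4) E compact_imp_bounded[OF compact_cube] in auto)
    have bnd: "\<exists>K\<ge>0. \<forall>\<xi>\<in>cube c l. norm (b \<beta> x \<xi>) \<le> K" if "x \<in> space M" for x \<beta>
    proof -
      have "bounded (b \<beta> x ` cube c l)" by (rule compact_imp_bounded[OF compact_continuous_image[OF bc[OF that] compact_cube]])
      then obtain K where "\<forall>y\<in>b \<beta> x ` cube c l. norm y \<le> K" by (auto simp: bounded_iff)
      then show ?thesis by (intro exI[of _ "max K 0"]) (auto simp: le_max_iff_disj)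
    qed
    define \<sigma>s where "\<sigma>s s = vset \<sigma> i (c $ i + l * s)" for s
    have inQ: "freeze (\<sigma>s s) ?P \<xi> \<in> cube c l" "\<sigma>s s \<in> cube c l" if "s \<in> {0..1}" "\<xi> \<in> cube c l" for s \<xi>
    proof -
      have 1: "0 \<le> l * s" "l * s \<le> l" using that l by (auto simp: mult_left_le)
      show "freeze (\<sigma>s s) ?P \<xi> \<in> cube c l" "\<sigma>s s \<in> cube c l"
        using 1 that Suc.prems(2) by (auto simp: cube_def freeze_def vset_def \<sigma>s_def)
    qed
    have inQ0: "freeze \<sigma> P \<xi> \<in> cube c l" if "\<xi> \<in> cube c l" for \<xi>
      using that Suc.prems(2) by (auto simp: cube_def freeze_def)
    \<comment> \<open>The upper limit of the integral along the edge depends on \<xi>. Exchanging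
      the integrals turns it into a restriction of \<open>F\<close> to a half space, which does not
      increase the norm of \<open>F\<close>, so the induction hypothesis applies to
      \<open>Fs s\<close>.\<close>
    define Fs where "Fs s \<xi> = (if c $ i + l * s \<le> \<xi> $ i then F \<xi> else 0)" for s \<xi>
    define W where "W s x = (\<integral>\<xi>. e x \<xi> * b (i # \<alpha>) x (freeze (\<sigma>s s) ?P \<xi>) * Fs s \<xi> \<partial>lborel)" for s x
    have Fs: "Lr_le lborel 2 (Fs s) f" for s
    proof (rule Lr_le_mono[OF Suc.prems(5)])
      show "Fs s \<in> borel_measurable lborel" unfolding Fs_def by measurable
    qed (use Suc.prems(6) in \<open>auto simp: Fs_def\<close>)
    have W: "Lr_le M r (W s) (C / l)" if "s \<in> {0..1}" for s
    proof -
      have "Lr_le M r (W s) (2 ^ k * A * B * (1/l) ^ length (i # \<alpha>) * f)"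
        unfolding W_def
      proof (rule Suc.IH[OF cP _ _ _ Fs Suc.prems(6)])
        show "\<sigma>s s \<in> cube c l" using that Suc.prems(2) inQ(2) by blast
      qed (use Suc.prems(3,4) in \<open>auto simp: Fs_def\<close>)
      then show ?thesis by (simp add: C_def)
    qed
    define T where "T \<beta> \<tau> R x = (\<integral>\<xi>. e x \<xi> * b \<beta> x (freeze \<tau> R \<xi>) * F \<xi> \<partial>lborel)" for \<beta> \<tau> R x
    have Tm [measurable]: "T \<beta> \<tau> R \<in> borel_measurable M" for \<beta> \<tau> R unfolding T_def by measurable
    have T0: "Lr_le M r (T \<alpha> (\<sigma>s 0) ?P) C"
      unfolding T_def C_def
    proof (rule Suc.IH[OF cP _ _ Suc.prems(4-6)])
      show "\<sigma>s 0 \<in> cube c l" using inQ(2)[of 0 \<sigma>] Suc.prems(2) by auto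
    qed (use Suc.prems(3) in auto)
    \<comment> \<open>The edge term; the face term \<open>T \<alpha> (\<sigma>s 0) ?P\<close> is
      covered by the induction hypothesis.\<close>
    define u where "u x = T \<alpha> \<sigma> P x - T \<alpha> (\<sigma>s 0) ?P x" for x
    let ?N = "restrict_space lborel {0..1::real}"
    have u: "Lr_le M r u C"
    proof (rule minkowski_integral[where N = ?N and h = "\<lambda>x s. norm (complex_of_real l * W s x)" and A = "\<lambda>_. C"])
      show "sigma_finite_measure ?N"
      proof -
        have "finite_measure ?N" by (rule finite_measureI) (simp add: emeasure_restrict_space)
        then show ?thesis by (rule finite_measure.axioms(1))
      qed
      show "u \<in> borel_measurable M" unfolding u_def by measurable
      have "(\<lambda>z. norm (complex_of_real l * W (snd z) (fst z))) \<in> borel_measurable (M \<Otimes>\<^sub>M lborel)"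
        unfolding W_def Fs_def \<sigma>s_def by measurable
      moreover have "(\<lambda>z. (fst z, snd z)) \<in> measurable (M \<Otimes>\<^sub>M ?N) (M \<Otimes>\<^sub>M lborel)"
        by (intro measurable_Pair measurable_fst measurable_compose[OF measurable_snd] measurable_restrict_space1) auto
      ultimately show "(\<lambda>(x, s). norm (complex_of_real l * W s x)) \<in> borel_measurable (M \<Otimes>\<^sub>M ?N)"
        using measurable_compose[of "\<lambda>z. (fst z, snd z)" "M \<Otimes>\<^sub>M ?N" "M \<Otimes>\<^sub>M lborel" "\<lambda>z. norm (complex_of_real l * W (snd z) (fst z))" borel]
        by (simp add: split_beta')
      show "(\<integral>\<^sup>+ s. ennreal C \<partial>?N) \<le> ennreal C" by (simp add: emeasure_restrict_space)
      show "(\<integral>\<^sup>+ x. ennreal (norm (complex_of_real l * W s x) powr r) \<partial>M) \<le> ennreal (C powr r)" if "s \<in> space ?N" for s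
      proof -
        have s: "s \<in> {0..1}" using that by (simp add: space_restrict_space)
        have "Lr_le M r (\<lambda>x. complex_of_real l * W s x) (norm (complex_of_real l) * (C / l))"
          by (rule Lr_le_scale[OF W[OF s]]) (use C0 l in auto)
        then show ?thesis using l by (simp add: Lr_le_def)
      qed
      show "AE x in M. ennreal (norm (u x)) \<le> (\<integral>\<^sup>+ s. ennreal (norm (complex_of_real l * W s x)) \<partial>?N)"
      proof (rule AE_I2)
        fix x assume x: "x \<in> space M"
        have ex [measurable]: "(\<lambda>\<xi>. e x \<xi>) \<in> borel_measurable lborel" using measurable_Pair2[OF em x] by simp
        have bx [measurable]: "(\<lambda>\<xi>. b \<beta> x \<xi>) \<in> borel_measurable lborel" for \<beta> using measurable_Pair2[OF bm x] by simp
        note bx' [measurable (raw)] = measurable_compose[OF _ bx]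
        have fzm: "freeze \<tau> R \<in> borel_measurable borel" for \<tau> :: "real^'n" and R
          using measurable_fz[of "\<lambda>\<xi>. \<xi>" lborel \<tau> R] by simp
        have int: "integrable lborel (\<lambda>\<xi>. e x \<xi> * b \<beta> x (q \<xi>) * F \<xi>)"
          if "\<And>\<xi>. \<xi> \<in> cube c l \<Longrightarrow> q \<xi> \<in> cube c l" "q \<in> measurable lborel lborel" for \<beta> q
        proof -
          obtain K where K: "K \<ge> 0" "\<forall>\<xi>\<in>cube c l. norm (b \<beta> x \<xi>) \<le> K" using bnd[OF x] by blast
          have "norm (e x \<xi> * b \<beta> x (q \<xi>) * F \<xi>) \<le> norm (complex_of_real K * F \<xi>)" for \<xi>
          proof (cases "\<xi> \<in> E")
            case True
            then have "norm (e x \<xi>) * norm (b \<beta> x (q \<xi>)) \<le> 1 * K" using E K that(1) e1 by (intro mult_mono) auto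
            then show ?thesis using K(1) by (simp add: norm_mult mult_right_mono)
          qed (use Suc.prems(4) in auto)
          then show ?thesis
            by (intro Bochner_Integration.integrable_bound[OF integrable_mult_right[OF Fi, of "complex_of_real K"]])
               (use that(2) in auto)
        qed
        define J where "J s \<xi> = (indicator {0..1} s *\<^sub>R (if c $ i + l * s \<le> \<xi> $ i then 1 else 0 :: complex)) * complex_of_real l *
            (e x \<xi> * b (i # \<alpha>) x (freeze (\<sigma>s s) ?P \<xi>) * F \<xi>)" for s \<xi>
        obtain K where K: "K \<ge> 0" "\<forall>\<xi>\<in>cube c l. norm (b (i # \<alpha>) x \<xi>) \<le> K" using bnd[OF x] by blast
        have ii: "integrable lborel (\<lambda>s. complex_of_real (l * K * indicator {0..1::real} s))"
          by (intro integrable_of_real integrable_mult_right integrable_real_indicator) auto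
        have J: "integrable (lborel \<Otimes>\<^sub>M lborel) (\<lambda>(s, \<xi>). J s \<xi>)"
        proof (rule Bochner_Integration.integrable_bound[OF integrable_prod_mult(1)[OF lborel_pair.pair_sigma_finite_axioms ii Fi]])
          show "(\<lambda>(s, \<xi>). J s \<xi>) \<in> borel_measurable (lborel \<Otimes>\<^sub>M lborel)"
            unfolding J_def \<sigma>s_def split_beta' by measurable
          have "norm (J s \<xi>) \<le> norm (complex_of_real (l * K * indicator {0..1} s) * F \<xi>)" for s \<xi>
          proof (cases "s \<in> {0..1} \<and> \<xi> \<in> E")
            case True
            then have "norm (e x \<xi>) * norm (b (i # \<alpha>) x (freeze (\<sigma>s s) ?P \<xi>)) \<le> 1 * K"
              using E K inQ(1)[of s \<xi>] e1 by (intro mult_mono) auto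
            then have "l * (norm (e x \<xi>) * norm (b (i # \<alpha>) x (freeze (\<sigma>s s) ?P \<xi>)) * norm (F \<xi>)) \<le> l * (1 * K * norm (F \<xi>))"
              using l by (intro mult_left_mono mult_right_mono) auto
            then show ?thesis using True K(1) l by (auto simp: J_def norm_mult mult_ac)
          next
            case False
            then show ?thesis using Suc.prems(4) by (auto simp: J_def)
          qed
          then show "AE z in lborel \<Otimes>\<^sub>M lborel. norm (case z of (s, \<xi>) \<Rightarrow> J s \<xi>) \<le> norm (case z of (s, \<xi>) \<Rightarrow> complex_of_real (l * K * indicator {0..1} s) * F \<xi>)"
            by (intro AE_I2) (simp add: split_beta')
        qed
        have JW: "(\<integral>\<xi>. J s \<xi> \<partial>lborel) = indicator {0..1} s *\<^sub>R (complex_of_real l * W s x)" for s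
        proof -
          have "(\<integral>\<xi>. J s \<xi> \<partial>lborel) = (\<integral>\<xi>. (indicator {0..1} s *\<^sub>R complex_of_real l) * (e x \<xi> * b (i # \<alpha>) x (freeze (\<sigma>s s) ?P \<xi>) * Fs s \<xi>) \<partial>lborel)"
            by (rule Bochner_Integration.integral_cong) (auto simp: J_def Fs_def mult_ac)
          then show ?thesis unfolding W_def integral_mult_right_zero by (simp only: scaleR_conv_of_real mult.assoc)
        qed
        have ux: "u x = (\<integral>\<xi>. (\<integral>s. J s \<xi> \<partial>lborel) \<partial>lborel)"
        proof -
          have "u x = (\<integral>\<xi>. e x \<xi> * b \<alpha> x (freeze \<sigma> P \<xi>) * F \<xi> - e x \<xi> * b \<alpha> x (freeze (\<sigma>s 0) ?P \<xi>) * F \<xi> \<partial>lborel)"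
            unfolding u_def T_def
            by (rule Bochner_Integration.integral_diff[symmetric]; rule int) (use inQ0 inQ(1)[of 0] fzm in auto)
          also have "\<dots> = (\<integral>\<xi>. (\<integral>s. J s \<xi> \<partial>lborel) \<partial>lborel)"
          proof (rule Bochner_Integration.integral_cong[OF refl])
            fix \<xi>
            show "e x \<xi> * b \<alpha> x (freeze \<sigma> P \<xi>) * F \<xi> - e x \<xi> * b \<alpha> x (freeze (\<sigma>s 0) ?P \<xi>) * F \<xi> = (\<integral>s. J s \<xi> \<partial>lborel)"
            proof (cases "\<xi> \<in> E")
              case False
              then show ?thesis using Suc.prems(4) by (simp add: J_def)
            next
              case True
              then have \<xi>: "\<xi> \<in> cube c l" using E by auto
              \<comment> \<open>The parameter at which the moving coordinate reaches that of \<xi>;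
                the condition in \<open>J\<close> says precisely \<open>s \<le> s1\<close>.\<close>
              define s1 where "s1 = (\<xi> $ i - c $ i) / l"
              have s1: "0 \<le> s1" "s1 \<le> 1" using \<xi> l by (auto simp: s1_def cube_def field_simps)
              have e1': "freeze (\<sigma>s s1) ?P \<xi> = freeze \<sigma> P \<xi>"
                using i l by (auto simp: freeze_def \<sigma>s_def vset_def s1_def vec_eq_iff)
              have shift: "freeze (\<sigma>s s) ?P \<xi> + t *\<^sub>R axis i 1 = freeze (\<sigma>s (s + t / l)) ?P \<xi>" for s t
                using l by (auto simp: freeze_def \<sigma>s_def vset_def vec_eq_iff axis_def field_simps)
              have dv: "((\<lambda>s. b \<alpha> x (freeze (\<sigma>s s) ?P \<xi>)) has_vector_derivative l *\<^sub>R b (i # \<alpha>) x (freeze (\<sigma>s s) ?P \<xi>)) (at s within {0..s1})"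
                if "0 \<le> s" "s \<le> s1" for s
              proof -
                have "((\<lambda>t. b \<alpha> x (freeze (\<sigma>s s) ?P \<xi> + t *\<^sub>R axis i 1)) has_vector_derivative b (i # \<alpha>) x (freeze (\<sigma>s s) ?P \<xi>)) (at ((\<lambda>t. l * (t - s)) s))"
                  using bd[OF x inQ(1)[OF _ \<xi>], of s \<alpha> i] that s1 by simp
                moreover have "((\<lambda>t. l * (t - s)) has_vector_derivative l) (at s)"
                  by (auto intro!: derivative_eq_intros simp: has_real_derivative_iff_has_vector_derivative[symmetric])
                ultimately have "((\<lambda>t. b \<alpha> x (freeze (\<sigma>s s) ?P \<xi> + t *\<^sub>R axis i 1)) \<circ> (\<lambda>t. l * (t - s)) has_vector_derivative l *\<^sub>R b (i # \<alpha>) x (freeze (\<sigma>s s) ?P \<xi>)) (at s)"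
                  by (intro vector_diff_chain_at)
                moreover have "(\<lambda>t. b \<alpha> x (freeze (\<sigma>s s) ?P \<xi> + t *\<^sub>R axis i 1)) \<circ> (\<lambda>t. l * (t - s)) = (\<lambda>s. b \<alpha> x (freeze (\<sigma>s s) ?P \<xi>))"
                  unfolding shift using l by (auto simp: o_def)
                ultimately show ?thesis by (auto intro: has_vector_derivative_at_within)
              qed
              have co: "continuous_on {0..s1} (\<lambda>s. l *\<^sub>R b (i # \<alpha>) x (freeze (\<sigma>s s) ?P \<xi>))"
              proof (intro continuous_intros continuous_on_compose2[OF bc[OF x, of "i # \<alpha>"]])
                show "continuous_on {0..s1} (\<lambda>s. freeze (\<sigma>s s) ?P \<xi>)"
                proof -
                  have eq: "(\<lambda>s. freeze (\<sigma>s s) ?P \<xi>) = (\<lambda>s. freeze (\<sigma>s 0) ?P \<xi> + (l * s) *\<^sub>R axis i 1)"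
                    unfolding shift using l by simp
                  show ?thesis unfolding eq by (intro continuous_intros)
                qed
                show "(\<lambda>s. freeze (\<sigma>s s) ?P \<xi>) ` {0..s1} \<subseteq> cube c l" using inQ(1)[OF _ \<xi>] s1 by auto
              qed
              have "(\<integral>s. indicator {0..s1} s *\<^sub>R (l *\<^sub>R b (i # \<alpha>) x (freeze (\<sigma>s s) ?P \<xi>)) \<partial>lborel) = b \<alpha> x (freeze (\<sigma>s s1) ?P \<xi>) - b \<alpha> x (freeze (\<sigma>s 0) ?P \<xi>)"
                by (rule integral_FTC_Icc[OF s1(1) dv co])
              moreover have Js: "J s \<xi> = (e x \<xi> * F \<xi>) * (indicator {0..s1} s *\<^sub>R (l *\<^sub>R b (i # \<alpha>) x (freeze (\<sigma>s s) ?P \<xi>)))" for s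
              proof -
                have "c $ i + l * s \<le> \<xi> $ i \<longleftrightarrow> s \<le> s1" using l by (auto simp: s1_def field_simps)
                then show ?thesis using s1 by (auto simp: J_def scaleR_conv_of_real split: split_indicator)
              qed
              have "(\<integral>s. J s \<xi> \<partial>lborel) = (e x \<xi> * F \<xi>) * (\<integral>s. indicator {0..s1} s *\<^sub>R (l *\<^sub>R b (i # \<alpha>) x (freeze (\<sigma>s s) ?P \<xi>)) \<partial>lborel)"
                unfolding Js by (rule integral_mult_right_zero)
              ultimately show ?thesis by (simp only: e1') (simp add: algebra_simps)
            qed
          qed
          finally show ?thesis .
        qed
        also have "\<dots> = (\<integral>s. (\<integral>\<xi>. J s \<xi> \<partial>lborel) \<partial>lborel)" by (rule lborel_pair.Fubini_integral[OF J])
        finally have "ennreal (norm (u x)) = ennreal (norm (\<integral>s. (\<integral>\<xi>. J s \<xi> \<partial>lborel) \<partial>lborel))" by simp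
        also have "\<dots> \<le> (\<integral>\<^sup>+s. ennreal (norm (\<integral>\<xi>. J s \<xi> \<partial>lborel)) \<partial>lborel)"
          by (rule integral_norm_bound_ennreal[OF lborel_pair.integrable_fst[OF J]])
        also have "\<dots> = (\<integral>\<^sup>+s. ennreal (norm (complex_of_real l * W s x)) * indicator {0..1} s \<partial>lborel)"
          unfolding JW by (intro nn_integral_cong) (auto split: split_indicator)
        also have "\<dots> = (\<integral>\<^sup>+ s. ennreal (norm (complex_of_real l * W s x)) \<partial>?N)"
          by (subst nn_integral_restrict_space) auto
        finally show "ennreal (norm (u x)) \<le> (\<integral>\<^sup>+ s. ennreal (norm (complex_of_real l * W s x)) \<partial>?N)" .
      qed
    qed (use M r C0 in auto)
    have "Lr_le M r (T \<alpha> \<sigma> P) (\<Sum>j\<in>{0,1::nat}. C)"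
    proof (rule Lr_le_sum[where u = "\<lambda>j. if j = 0 then u else T \<alpha> (\<sigma>s 0) ?P"])
      show "AE x in M. norm (T \<alpha> \<sigma> P x) \<le> (\<Sum>j\<in>{0,1::nat}. norm ((if j = 0 then u else T \<alpha> (\<sigma>s 0) ?P) x))"
      proof (rule AE_I2)
        fix x
        show "norm (T \<alpha> \<sigma> P x) \<le> (\<Sum>j\<in>{0,1::nat}. norm ((if j = 0 then u else T \<alpha> (\<sigma>s 0) ?P) x))"
          using norm_triangle_ineq[of "u x" "T \<alpha> (\<sigma>s 0) ?P x"] by (simp add: u_def)
      qed
    qed (use M r u T0 C0 in auto)
    then show ?case unfolding T_def by (simp add: C_def mult.assoc)
  qed
  have "freeze c {} \<xi> = \<xi>" for \<xi> :: "real^'n" by (simp add: freeze_def)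
  with claim[of "{}" ?n c "[]" F f] show ?thesis
    using F0 F f l by (auto simp: cube_def)
qed

section \<open>A global inverse function theorem\<close>

text \<open>Hadamard's global inverse function theorem, in the quantitative form needed below: uniform
  local inverses make the map a covering of a simply connected space.\<close>
lemma expansive_local:
  fixes t :: "'a::euclidean_space \<Rightarrow> 'a"
  assumes D: "\<And>x. (t has_derivative D x) (at x)"
    and lip: "\<And>x y v. norm (D x v - D y v) \<le> L * norm (x - y) * norm v"
    and lower: "\<And>x v. c * norm v \<le> norm (D x v)" and c: "0 < c" and \<delta>: "0 < \<delta>" "2 * L * \<delta> \<le> c / 2"
    and L: "0 \<le> L"
    and xy: "x \<in> cball z \<delta>" "y \<in> cball z \<delta>"
  shows "c / 2 * norm (x - y) \<le> norm (t x - t y)"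
proof -
  have "norm ((t x - D z x) - (t y - D z y)) \<le> (L * \<delta>) * norm (x - y)"
  proof (rule differentiable_bound[where S = "cball z \<delta>" and f' = "\<lambda>x v. D x v - D z v"])
    have bl: "bounded_linear (D z)" using D has_derivative_bounded_linear by blast
    show "((\<lambda>x. t x - D z x) has_derivative (\<lambda>v. D x v - D z v)) (at x within cball z \<delta>)" if "x \<in> cball z \<delta>" for x
      using D[of x] bl by (auto intro!: derivative_eq_intros bounded_linear_imp_has_derivative intro: has_derivative_at_withinI)
    show "onorm (\<lambda>v. D x v - D z v) \<le> L * \<delta>" if "x \<in> cball z \<delta>" for x
    proof (rule onorm_le)
      fix v
      have "norm (D x v - D z v) \<le> L * norm (x - z) * norm v" by (rule lip)
      also have "\<dots> \<le> L * \<delta> * norm v" using that L by (intro mult_right_mono mult_left_mono) (auto simp: dist_norm norm_minus_commute)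
      finally show "norm (D x v - D z v) \<le> L * \<delta> * norm v" .
    qed
  qed (use xy in auto)
  moreover have "D z x - D z y = D z (x - y)"
    using has_derivative_bounded_linear[OF D[of z]] by (simp add: linear_diff bounded_linear.linear)
  moreover have "c * norm (x - y) \<le> norm (D z (x - y))" by (rule lower)
  moreover have "norm (D z (x - y)) \<le> norm (t x - t y) + norm ((t x - D z x) - (t y - D z y))"
    using norm_triangle_ineq4[of "t x - t y" "(t x - D z x) - (t y - D z y)"] calculation(2)
    by (simp add: algebra_simps)
  moreover have "L * \<delta> * norm (x - y) \<le> c / 2 * norm (x - y)"
  proof (rule mult_right_mono)
    have "0 \<le> L * \<delta>" using L \<delta> by simp
    then show "L * \<delta> \<le> c / 2" using \<delta>(2) by linarith
  qed auto
  ultimately show ?thesis by (simp add: algebra_simps)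
qed

text \<open>By invariance of domain the image of the open ball is open. The bounding sphere is
  mapped outside the target ball, so inside it the images of the open and of the closed ball
  coincide, and the latter is compact. Connectedness of the target ball finishes the
  argument.\<close>

lemma expansive_ball_subset_image:
  fixes t :: "'a::euclidean_space \<Rightarrow> 'a"
  assumes t: "continuous_on (cball z \<delta>) t" and \<delta>: "0 < \<delta>" and c: "0 < c"
    and exp: "\<And>x y. x \<in> cball z \<delta> \<Longrightarrow> y \<in> cball z \<delta> \<Longrightarrow> c * norm (x - y) \<le> norm (t x - t y)"
  shows "ball (t z) (c * \<delta>) \<subseteq> t ` ball z \<delta>"
proof -
  let ?B = "ball (t z) (c * \<delta>)" and ?I = "t ` ball z \<delta>"
  have inj: "inj_on t (cball z \<delta>)"
  proof (rule inj_onI)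
    fix x y assume "x \<in> cball z \<delta>" "y \<in> cball z \<delta>" "t x = t y"
    then have "c * norm (x - y) \<le> 0" using exp[of x y] by simp
    then show "x = y" using c by (simp add: mult_le_0_iff)
  qed
  have op: "open ?I"
    by (rule invariance_of_domain[OF continuous_on_subset[OF t ball_subset_cball] open_ball inj_on_subset[OF inj ball_subset_cball]])
  have eq: "?B \<inter> t ` cball z \<delta> = ?B \<inter> ?I"
  proof -
    have "t x \<notin> ?B" if "dist z x = \<delta>" for x
      using exp[of x z] that \<delta> by (auto simp: dist_norm norm_minus_commute)
    then have "t x \<in> ?I" if "x \<in> cball z \<delta>" "t x \<in> ?B" for x
      using that by (metis imageI le_less mem_ball mem_cball)
    moreover have "ball z \<delta> \<subseteq> cball z \<delta>" by (rule ball_subset_cball)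
    ultimately show ?thesis by blast
  qed
  have cl: "closed (t ` cball z \<delta>)" using t by (intro compact_imp_closed compact_continuous_image) auto
  have "connected ?B" by simp
  moreover have "openin (top_of_set ?B) (?B \<inter> ?I)" using op by (auto simp: openin_open)
  moreover have "closedin (top_of_set ?B) (?B \<inter> ?I)" unfolding eq[symmetric] using cl by (auto simp: closedin_closed)
  moreover have "t z \<in> ?B \<inter> ?I" using \<delta> c by auto
  ultimately have "?B \<inter> ?I = ?B" unfolding connected_clopen by blast
  then show ?thesis by blast
qed

text \<open>The Lipschitz bound on the derivative gives one radius \<delta> on which
  \<open>t\<close> is expansive around every point, and the covering property yields a global
  inverse. Locally only the constant \<open>c / 2\<close> is available; the full constant comes from
  the mean value inequality for the inverse map.\<close>

theorem expansive_global:
  fixes t :: "'a::euclidean_space \<Rightarrow> 'a"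
  assumes D: "\<And>x. (t has_derivative D x) (at x)"
    and lip: "\<And>x y v. norm (D x v - D y v) \<le> L * norm (x - y) * norm v"
    and lower: "\<And>x v. c * norm v \<le> norm (D x v)" and c: "0 < c"
  shows "c * norm (x - y) \<le> norm (t x - t y)"
proof -
  define L' where "L' = max L 1"
  have L': "0 < L'" "norm (D x v - D y v) \<le> L' * norm (x - y) * norm v" for x y v
  proof -
    have "L * norm (x - y) * norm v \<le> L' * norm (x - y) * norm v"
      by (intro mult_right_mono) (auto simp: L'_def)
    then show "0 < L'" "norm (D x v - D y v) \<le> L' * norm (x - y) * norm v"
      using lip[of x v y] by (simp_all add: L'_def)
  qed
  define \<delta> where "\<delta> = c / (4 * L')"
  have \<delta>: "0 < \<delta>" "2 * L' * \<delta> \<le> c / 2" using c L' by (auto simp: \<delta>_def)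
  have ct: "continuous_on S t" for S
    by (rule continuous_at_imp_continuous_on) (use has_derivative_continuous[OF D] in blast)
  have loc: "c / 2 * norm (x - y) \<le> norm (t x - t y)" if "x \<in> cball z \<delta>" "y \<in> cball z \<delta>" for x y z
    using expansive_local[OF D L'(2) lower c \<delta> less_imp_le[OF L'(1)] that] .
  have sub: "ball (t z) (c / 2 * \<delta>) \<subseteq> t ` ball z \<delta>" for z
    using expansive_ball_subset_image[OF ct \<delta>(1) _ loc, of z] c by simp
  \<comment> \<open>A quarter of the radius in \<open>sub\<close>. If two sheets over a ball of
    radius \<open>e\<close> share a point, this point is within \<delta>/4 of both centres, so the
    centres lie in a common ball on which \<open>t\<close> is injective and the sheets are
    equal.\<close>
  define e where "e = c / 2 * \<delta> / 4"
  have e: "0 < e" "4 * e = c / 2 * \<delta>" using c \<delta> by (auto simp: e_def)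
  \<comment> \<open>Every value is the centre of a ball of fixed radius contained in the range,
    which is therefore both open and closed.\<close>
  have surj: "t ` UNIV = UNIV"
  proof -
    have "open (t ` UNIV)"
      unfolding open_contains_ball
    proof
      fix y assume "y \<in> t ` UNIV"
      then obtain z where "y = t z" by auto
      then have "ball y (c / 2 * \<delta>) \<subseteq> range t" using sub[of z] by auto
      then show "\<exists>e>0. ball y e \<subseteq> range t" using c \<delta> by (intro exI[of _ "c / 2 * \<delta>"]) auto
    qed
    moreover have "closed (t ` UNIV)"
    proof -
      have "y \<in> range t" if yc: "y \<in> closure (range t)" for y
      proof -
        have "0 < c / 2 * \<delta>" using c \<delta> by simp
        then obtain z where "dist (t z) y < c / 2 * \<delta>"
          using yc unfolding closure_approachable by blast
        then show ?thesis using sub[of z] by auto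
      qed
      then show ?thesis by (metis closure_subset_eq subsetI)
    qed
    ultimately show ?thesis using clopen[of "t ` UNIV"] by auto
  qed
  have cov: "covering_space UNIV t UNIV"
  proof
    show "continuous_on UNIV t" by (rule ct)
    show "t ` UNIV = UNIV" by (rule surj)
    fix y :: 'a
    let ?T = "ball y e"
    define V where "V z = ball z \<delta> \<inter> t -` ?T" for z
    have Vopen: "open (V z)" for z
      unfolding V_def by (rule open_Int[OF open_ball open_vimage[OF open_ball ct]])
    have imgV: "t ` V z = ?T" if "t z = y" for z
    proof
      show "?T \<subseteq> t ` V z"
      proof
        fix w assume w: "w \<in> ?T"
        then have "w \<in> ball (t z) (c / 2 * \<delta>)" using that e by auto
        then obtain x where "x \<in> ball z \<delta>" "w = t x" using sub[of z] by blast
        then show "w \<in> t ` V z" using w by (auto simp: V_def)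
      qed
    qed (auto simp: V_def)
    have injV: "inj_on t (V z)" for z
    proof (rule inj_onI)
      fix x y assume "x \<in> V z" "y \<in> V z" "t x = t y"
      then have "c / 2 * norm (x - y) \<le> 0" using loc[of x z y] by (auto simp: V_def)
      then show "x = y" using c by (simp add: mult_le_0_iff)
    qed
    have homeo: "\<exists>q. homeomorphism (V z) ?T t q" if "t z = y" for z
      using invariance_of_domain_homeomorphism[OF Vopen ct _ injV] imgV[OF that] by (metis order_refl)
    show "\<exists>T. y \<in> T \<and> openin (top_of_set UNIV) T \<and> (\<exists>v. \<Union> v = UNIV \<inter> t -` T \<and> (\<forall>u\<in>v. openin (top_of_set UNIV) u) \<and>
        pairwise disjnt v \<and> (\<forall>u\<in>v. \<exists>q. homeomorphism u T t q))"
    proof (intro exI[of _ ?T] conjI exI[of _ "V ` (t -` {y})"])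
      show "\<Union> (V ` (t -` {y})) = UNIV \<inter> t -` ?T"
      proof
        show "UNIV \<inter> t -` ?T \<subseteq> \<Union> (V ` (t -` {y}))"
        proof
          fix x assume x: "x \<in> UNIV \<inter> t -` ?T"
          then have "y \<in> ball (t x) (c / 2 * \<delta>)" using e by (auto simp: dist_commute)
          then obtain z where "z \<in> ball x \<delta>" "t z = y" using sub[of x] by auto
          then show "x \<in> \<Union> (V ` (t -` {y}))" using x by (auto simp: V_def dist_commute)
        qed
      qed (auto simp: V_def)
      show "pairwise disjnt (V ` (t -` {y}))"
      proof (rule pairwiseI)
        fix u1 u2 assume u: "u1 \<in> V ` (t -` {y})" "u2 \<in> V ` (t -` {y})" "u1 \<noteq> u2"
        then obtain z1 z2 where u12: "u1 = V z1" "u2 = V z2" "t z1 = y" "t z2 = y" by auto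
        then have z: "t z1 = t z2" "y = t z2" "V z1 \<noteq> V z2" using u by auto
        show "disjnt u1 u2" unfolding u12
        proof (rule ccontr)
          assume "\<not> disjnt (V z1) (V z2)"
          then obtain w where w: "w \<in> V z1" "w \<in> V z2" by (auto simp: disjnt_def)
          have "c / 2 * norm (w - z1) \<le> norm (t w - t z1)" "c / 2 * norm (w - z2) \<le> norm (t w - t z2)"
            using loc[of w z1 z1] loc[of w z2 z2] w \<delta> by (simp_all add: V_def)
          moreover have "norm (t w - t z2) < e" using w z by (auto simp: V_def dist_norm norm_minus_commute)
          ultimately have "c / 2 * norm (w - z1) < c / 2 * (\<delta> / 4)" "c / 2 * norm (w - z2) < c / 2 * (\<delta> / 4)" using e z(1) by auto
          then have "norm (w - z1) < \<delta> / 4" "norm (w - z2) < \<delta> / 4" using c mult_less_cancel_left_pos[of "c/2"] by auto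
          then have "norm (z1 - z2) < \<delta>" using norm_triangle_ineq4[of "w - z2" "w - z1"] \<delta> by (simp add: norm_minus_commute)
          then have "c / 2 * norm (z1 - z2) \<le> norm (t z1 - t z2)" using \<delta> by (intro loc[of _ z1]) (auto simp: dist_norm)
          then have "z1 = z2" using z(1) c by (simp add: mult_le_0_iff)
          then show False using z by simp
        qed
      qed
    qed (use e Vopen homeo in auto)
  qed
  have inj: "x = y" if "t x = t y" for x y
  proof -
    \<comment> \<open>The identity is lifted through \<open>t\<close> with
      \<open>g (t x) = x\<close>. Then \<open>g \<circ> t\<close> and the identity are lifts of
      \<open>t\<close> that agree at \<open>x\<close>, hence everywhere, and \<open>t\<close> is
      injective.\<close>
    obtain g where g: "continuous_on UNIV g" "g \<in> UNIV \<rightarrow> UNIV" "g (t x) = x" "\<And>z. z \<in> UNIV \<Longrightarrow> t (g z) = z"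
      using covering_space_lift_strong[OF cov, of x "t x" UNIV "\<lambda>z. z"]
      by (metis UNIV_I continuous_on_id convex_UNIV convex_imp_locally_path_connected convex_imp_simply_connected funcsetI)
    have "g (t w) = w" for w
    proof -
      have gt: "continuous_on UNIV (g \<circ> t)"
        using continuous_on_compose[OF ct continuous_on_subset[OF g(1) subset_UNIV]] by blast
      have "(g \<circ> t) w = id w"
        by (rule covering_space_lift_unique[OF cov, where f = t and a = x and T = UNIV and ?g1.0 = "g \<circ> t" and ?g2.0 = id])
           (simp_all add: g(3,4) ct gt gt[unfolded o_def] continuous_on_id convex_connected[OF convex_UNIV])
      then show ?thesis by simp
    qed
    then show ?thesis using that by metis
  qed
  then have bij: "bij t" using surj by (auto simp: bij_def inj_def)
  define g where "g = inv t"
  have tg: "t (g z) = z" "g (t z) = z" for z using bij by (auto simp: g_def bij_is_surj surj_f_inv_f bij_is_inj)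
  have gl: "norm (g z - g w) \<le> (2 / c) * norm (z - w)" if "norm (z - w) < c / 2 * \<delta>" for z w
  proof -
    have "w \<in> ball (t (g z)) (c / 2 * \<delta>)" using that tg by (simp add: dist_norm)
    then obtain v where v: "v \<in> ball (g z) \<delta>" "t v = w" using sub[of "g z"] by blast
    then have "v = g w" using tg by metis
    then have "c / 2 * norm (g z - g w) \<le> norm (t (g z) - t (g w))" using v \<delta> by (intro loc[of _ "g z"]) auto
    then show ?thesis using tg c by (simp add: field_simps)
  qed
  have cg: "isCont g z" for z
    unfolding continuous_at_eps_delta
  proof (intro allI impI)
    fix \<epsilon> :: real assume "0 < \<epsilon>"
    show "\<exists>d>0. \<forall>x'. dist x' z < d \<longrightarrow> dist (g x') (g z) < \<epsilon>"
    proof (intro exI[of _ "min (c / 2 * \<delta>) (c / 2 * \<epsilon>)"] conjI allI impI)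
      fix w assume w: "dist w z < min (c / 2 * \<delta>) (c / 2 * \<epsilon>)"
      then have "norm (g w - g z) \<le> (2 / c) * norm (w - z)" by (intro gl) (auto simp: dist_norm)
      also have "\<dots> < (2 / c) * (c / 2 * \<epsilon>)" using w c by (intro mult_strict_left_mono) (auto simp: dist_norm)
      finally show "dist (g w) (g z) < \<epsilon>" using c by (simp add: dist_norm)
    qed (use c \<delta> \<open>0 < \<epsilon>\<close> in auto)
  qed
  have Dinj: "inj (D z)" for z
  proof -
    have "D z v = 0 \<Longrightarrow> v = 0" for v using lower[of v z] c by (simp add: mult_le_0_iff)
    then show ?thesis using has_derivative_bounded_linear[OF D[of z]] linear_injective_0 bounded_linear.linear by blast
  qed
  define D' where "D' z = inv (D (g z))" for z
  have D': "D (g z) (D' z v) = v" "D' z (D (g z) v) = v" "linear (D' z)" for z v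
  proof -
    have l: "linear (D (g z))" using has_derivative_bounded_linear[OF D] bounded_linear.linear by blast
    have s: "surj (D (g z))" using linear_injective_imp_surjective[OF l Dinj] by simp
    show "D (g z) (D' z v) = v" "D' z (D (g z) v) = v" using s Dinj by (auto simp: D'_def surj_f_inv_f)
    show "linear (D' z)" unfolding D'_def using l Dinj s by (simp add: inj_linear_imp_inv_linear)
  qed
  have dg: "(g has_derivative D' z) (at z)" for z
  proof (rule has_derivative_inverse_basic[where f = t and f' = "D (g z)" and T = UNIV])
    show "(t has_derivative D (g z)) (at (g z))" by (rule D)
    show "bounded_linear (D' z)" using D'(3) by (simp add: linear_conv_bounded_linear)
    show "D' z \<circ> D (g z) = id" using D'(2) by auto
    show "continuous (at z) g" using cg .
  qed (use tg in auto)
  \<comment> \<open>The whole space is convex, so the pointwise bound \<open>1 / c\<close> on the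
    derivative of the inverse is a global Lipschitz constant.\<close>
  have "norm (g (t x) - g (t y)) \<le> (1 / c) * norm (t x - t y)"
  proof (rule differentiable_bound[where S = UNIV and f' = D'])
    show "(g has_derivative D' z) (at z within UNIV)" for z using dg by simp
    show "onorm (D' z) \<le> 1 / c" for z
    proof (rule onorm_le)
      fix v
      have "c * norm (D' z v) \<le> norm v" using lower[of "D' z v" "g z"] D'(1) by simp
      then show "norm (D' z v) \<le> 1 / c * norm v" using c by (simp add: field_simps)
    qed
  qed auto
  then show ?thesis using tg c by (simp add: field_simps)
qed

section \<open>Homogeneous phases\<close>

lemma dderiv_has_derivative:
  assumes "smooth_on S f" "x \<in> S"
  shows "(dderiv vs f has_derivative (\<lambda>v. dderiv (v # vs) f x)) (at x)"
  using assms frechet_derivative_works[of "dderiv vs f" "at x"] by (simp add: smooth_on_def)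

text \<open>The mean value theorem in direction \<open>u\<close> turns the second difference into
  \<open>t\<close> times a difference of values of \<open>G\<close>, and differentiability of
  \<open>G\<close> at \<open>x\<close> expands this to t^2 L v up to o(t^2). The quotient is
  symmetric in \<open>u\<close> and \<open>v\<close>, which is the source of Schwarz's
  theorem.\<close>

lemma second_difference_tendsto:
  fixes g G :: "'a::real_normed_vector \<Rightarrow> real"
  assumes S: "open S" "x \<in> S"
    and dg: "\<And>y. y \<in> S \<Longrightarrow> (g has_derivative g' y) (at y)" and G: "\<And>y. y \<in> S \<Longrightarrow> G y = g' y u"
    and dG: "(G has_derivative L) (at x)"
  shows "((\<lambda>t. (g (x + t *\<^sub>R u + t *\<^sub>R v) - g (x + t *\<^sub>R u) - g (x + t *\<^sub>R v) + g x) / t\<^sup>2) \<longlongrightarrow> L v) (at_right 0)"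
proof (rule tendstoI)
  fix \<epsilon> :: real assume \<epsilon>: "0 < \<epsilon>"
  define m where "m = norm u + norm v + 1"
  have m: "m > 0" "norm u \<le> m" "norm v \<le> m" by (auto simp: m_def add_nonneg_pos)
  \<comment> \<open>The two expansions of \<open>G\<close> have errors at most
    \<open>2 * m * t * \<epsilon>'\<close> and \<open>m * t * \<epsilon>'\<close>, together three
    quarters of \<open>\<epsilon> * t\<close>.\<close>
  define \<epsilon>' where "\<epsilon>' = \<epsilon> / (4 * m)"
  have \<epsilon>': "\<epsilon>' > 0" using \<epsilon> m by (simp add: \<epsilon>'_def)
  interpret L: bounded_linear L using dG by (rule has_derivative_bounded_linear)
  obtain d1 where d1: "d1 > 0" "\<And>y. norm (y - x) < d1 \<Longrightarrow> norm (G y - G x - L (y - x)) \<le> \<epsilon>' * norm (y - x)"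
    using dG \<epsilon>' unfolding has_derivative_at_alt by blast
  obtain d2 where d2: "d2 > 0" "ball x d2 \<subseteq> S" using S open_contains_ball by blast
  define d where "d = min d1 d2 / (2 * m)"
  have d: "d > 0" using d1 d2 m by (simp add: d_def)
  have near: "norm (a *\<^sub>R u + b *\<^sub>R v) < min d1 d2" if "0 \<le> a" "a \<le> t" "0 \<le> b" "b \<le> t" "t < d" "0 < t" for a b t
  proof -
    have "norm (a *\<^sub>R u + b *\<^sub>R v) \<le> \<bar>a\<bar> * norm u + \<bar>b\<bar> * norm v" by (metis norm_scaleR norm_triangle_ineq)
    also have "\<dots> \<le> t * m + t * m" using that m by (intro add_mono mult_mono) auto
    also have "\<dots> < d * m + d * m" using that m by (intro add_strict_mono mult_strict_right_mono) auto
    also have "\<dots> = min d1 d2" using m by (simp add: d_def field_simps)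
    finally show ?thesis .
  qed
  have main: "dist ((g (x + t *\<^sub>R u + t *\<^sub>R v) - g (x + t *\<^sub>R u) - g (x + t *\<^sub>R v) + g x) / t\<^sup>2) (L v) < \<epsilon>"
    if t: "0 < t" "t < d" for t
  proof -
    have inS: "x + a *\<^sub>R u + b *\<^sub>R v \<in> S" if "0 \<le> a" "a \<le> t" "0 \<le> b" "b \<le> t" for a b
    proof -
      have "norm (a *\<^sub>R u + b *\<^sub>R v) < d2" using near[OF that t(2,1)] by simp
      moreover have "dist x (x + w) = norm w" for w by (simp add: dist_norm)
      ultimately have "x + (a *\<^sub>R u + b *\<^sub>R v) \<in> ball x d2" by (simp only: mem_ball)
      then show ?thesis using d2 by (auto simp: add.assoc)
    qed
    have der: "((\<lambda>s. g (x + s *\<^sub>R u + b *\<^sub>R v)) has_real_derivative G (x + a *\<^sub>R u + b *\<^sub>R v)) (at a)"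
      if "0 \<le> a" "a \<le> t" "0 \<le> b" "b \<le> t" for a b
    proof -
      have y: "x + a *\<^sub>R u + b *\<^sub>R v \<in> S" by (rule inS[OF that])
      have "((\<lambda>s. x + s *\<^sub>R u + b *\<^sub>R v) has_derivative (\<lambda>h. h *\<^sub>R u)) (at a)"
        by (auto intro!: derivative_eq_intros)
      from has_derivative_compose[OF this dg[OF y]]
      have "((\<lambda>s. g (x + s *\<^sub>R u + b *\<^sub>R v)) has_derivative (\<lambda>h. g' (x + a *\<^sub>R u + b *\<^sub>R v) (h *\<^sub>R u))) (at a)" .
      moreover have "g' (x + a *\<^sub>R u + b *\<^sub>R v) (h *\<^sub>R u) = G (x + a *\<^sub>R u + b *\<^sub>R v) * h" for h
        using has_derivative_bounded_linear[OF dg[OF y]] by (simp add: G[OF y] linear_cmul bounded_linear.linear)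
      ultimately show ?thesis by (simp add: has_field_derivative_def)
    qed
    obtain s where s: "0 < s" "s < t"
      and mv: "(g (x + t *\<^sub>R u + t *\<^sub>R v) - g (x + t *\<^sub>R u)) - (g (x + 0 *\<^sub>R u + t *\<^sub>R v) - g (x + 0 *\<^sub>R u)) =
         (t - 0) * (G (x + s *\<^sub>R u + t *\<^sub>R v) - G (x + s *\<^sub>R u))"
    proof -
      have "((\<lambda>s. g (x + s *\<^sub>R u + t *\<^sub>R v) - g (x + s *\<^sub>R u)) has_real_derivative (G (x + a *\<^sub>R u + t *\<^sub>R v) - G (x + a *\<^sub>R u))) (at a)"
        if "0 \<le> a" "a \<le> t" for a
        using DERIV_diff[OF der[of a t] der[of a 0]] that t by simp
      from MVT2[OF t(1) this] that show ?thesis by blast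
    qed
    let ?a = "s *\<^sub>R u + t *\<^sub>R v" and ?b = "s *\<^sub>R u"
    have na: "norm ?a < d1" "norm ?b < d1" using near[of s t t] near[of s t 0] s t by auto
    have "norm (G (x + ?a) - G x - L ?a) \<le> \<epsilon>' * norm ?a" "norm (G (x + ?b) - G x - L ?b) \<le> \<epsilon>' * norm ?b"
      using d1(2)[of "x + ?a"] d1(2)[of "x + ?b"] na by auto
    moreover have "norm ?a \<le> 2 * m * t"
    proof -
      have "norm ?a \<le> \<bar>s\<bar> * norm u + \<bar>t\<bar> * norm v" by (metis norm_scaleR norm_triangle_ineq)
      also have "\<dots> \<le> t * m + t * m" using s t m by (intro add_mono mult_mono) auto
      finally show ?thesis by (simp add: mult_ac)
    qed
    moreover have "norm ?b \<le> m * t"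
    proof -
      have "s * norm u \<le> t * m" using s t m by (intro mult_mono) auto
      then show ?thesis using s by (simp add: mult.commute)
    qed
    ultimately have "norm (G (x + ?a) - G x - L ?a) \<le> \<epsilon>' * (2 * m * t)" "norm (G (x + ?b) - G x - L ?b) \<le> \<epsilon>' * (m * t)"
      using \<epsilon>' by (smt (verit) mult_left_mono)+
    moreover have "L ?a - L ?b = t * L v" by (simp add: L.add L.scaleR)
    ultimately have "\<bar>(G (x + ?a) - G (x + ?b)) - t * L v\<bar> \<le> \<epsilon>' * (2 * m * t) + \<epsilon>' * (m * t)" by (simp add: abs_le_iff)
    also have "\<dots> = (3/4 * \<epsilon>) * t" using m by (simp add: \<epsilon>'_def field_simps)
    finally have 1: "\<bar>(G (x + ?a) - G (x + ?b)) - t * L v\<bar> \<le> (3/4 * \<epsilon>) * t" .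
    have "(g (x + t *\<^sub>R u + t *\<^sub>R v) - g (x + t *\<^sub>R u) - g (x + t *\<^sub>R v) + g x) / t\<^sup>2 - L v = ((G (x + ?a) - G (x + ?b)) - t * L v) / t"
    proof -
      have q: "g (x + t *\<^sub>R u + t *\<^sub>R v) - g (x + t *\<^sub>R u) - g (x + t *\<^sub>R v) + g x = t * (G (x + ?a) - G (x + ?b))"
        using mv by (simp add: add.assoc)
      show ?thesis unfolding q using t by (simp add: power2_eq_square field_simps)
    qed
    then have "dist ((g (x + t *\<^sub>R u + t *\<^sub>R v) - g (x + t *\<^sub>R u) - g (x + t *\<^sub>R v) + g x) / t\<^sup>2) (L v) = \<bar>(G (x + ?a) - G (x + ?b)) - t * L v\<bar> / t"
      using t by (simp add: dist_real_def abs_divide)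
    also have "\<dots> \<le> (3/4 * \<epsilon>) * t / t" using 1 t by (intro divide_right_mono) auto
    also have "\<dots> < \<epsilon>" using t \<epsilon> by simp
    finally show ?thesis .
  qed
  show "\<forall>\<^sub>F t in at_right 0. dist ((g (x + t *\<^sub>R u + t *\<^sub>R v) - g (x + t *\<^sub>R u) - g (x + t *\<^sub>R v) + g x) / t\<^sup>2) (L v) < \<epsilon>"
    unfolding eventually_at_right_field using d main by blast
qed

text \<open>Both mixed derivatives are limits of the same symmetric second difference.\<close>

lemma dderiv_swap:
  fixes f :: "'a::real_normed_vector \<Rightarrow> real"
  assumes f: "smooth_on S f" and x: "x \<in> S"
  shows "dderiv (u # v # ws) f x = dderiv (v # u # ws) f x"
proof -
  let ?g = "dderiv ws f"
  have S: "open S" using f by (simp add: smooth_on_def)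
  have 1: "((\<lambda>t. (?g (x + t *\<^sub>R u + t *\<^sub>R v) - ?g (x + t *\<^sub>R u) - ?g (x + t *\<^sub>R v) + ?g x) / t\<^sup>2) \<longlongrightarrow> dderiv (v # u # ws) f x) (at_right 0)"
    by (rule second_difference_tendsto[OF S x dderiv_has_derivative[OF f] refl dderiv_has_derivative[OF f x]])
  have 2: "((\<lambda>t. (?g (x + t *\<^sub>R v + t *\<^sub>R u) - ?g (x + t *\<^sub>R v) - ?g (x + t *\<^sub>R u) + ?g x) / t\<^sup>2) \<longlongrightarrow> dderiv (u # v # ws) f x) (at_right 0)"
    by (rule second_difference_tendsto[OF S x dderiv_has_derivative[OF f] refl dderiv_has_derivative[OF f x]])
  have "(\<lambda>t. (?g (x + t *\<^sub>R v + t *\<^sub>R u) - ?g (x + t *\<^sub>R v) - ?g (x + t *\<^sub>R u) + ?g x) / t\<^sup>2) =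
     (\<lambda>t. (?g (x + t *\<^sub>R u + t *\<^sub>R v) - ?g (x + t *\<^sub>R u) - ?g (x + t *\<^sub>R v) + ?g x) / t\<^sup>2)"
    by (auto simp: algebra_simps)
  with 2 have "((\<lambda>t. (?g (x + t *\<^sub>R u + t *\<^sub>R v) - ?g (x + t *\<^sub>R u) - ?g (x + t *\<^sub>R v) + ?g x) / t\<^sup>2) \<longlongrightarrow> dderiv (u # v # ws) f x) (at_right 0)"
    by simp
  from tendsto_unique[OF _ this 1] show ?thesis by simp
qed

lemma dderiv_cong_on:
  assumes "open S" "\<And>x. x \<in> S \<Longrightarrow> dderiv vs f x = dderiv ws f x" "x \<in> S"
  shows "dderiv (v # vs) f x = dderiv (v # ws) f x"
proof -
  have "(dderiv vs f has_derivative D) (at x) \<longleftrightarrow> (dderiv ws f has_derivative D) (at x)" for D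
    using has_derivative_transform_within_open[OF _ assms(1,3), of "dderiv vs f" D UNIV "dderiv ws f"]
      has_derivative_transform_within_open[OF _ assms(1,3), of "dderiv ws f" D UNIV "dderiv vs f"] assms(2) by auto
  then show ?thesis by (simp add: frechet_derivative_def)
qed

text \<open>In \<open>pdxxi\<close> the \<xi>-directions stand in front of the x-directions.
  Differentiating in \<open>x\<close> puts a new direction at the very front, and it has to be moved
  past the \<xi>-directions.\<close>

lemma dderiv_move:
  fixes f :: "'a::real_normed_vector \<Rightarrow> real"
  assumes f: "smooth_on S f" and x: "x \<in> S"
  shows "dderiv (u # vs @ ws) f x = dderiv (vs @ u # ws) f x"
  using x
proof (induction vs arbitrary: x)
  case (Cons v vs)
  have "dderiv (u # (v # vs) @ ws) f x = dderiv (v # u # vs @ ws) f x"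
    using dderiv_swap[OF f Cons.prems, of u v "vs @ ws"] by simp
  also have "\<dots> = dderiv (v # vs @ u # ws) f x"
    by (rule dderiv_cong_on[OF _ Cons.IH Cons.prems]) (use f in \<open>simp add: smooth_on_def\<close>)
  finally show ?case by simp
qed simp

lemma linear_expand:
  fixes L :: "'a::real_vector \<Rightarrow> real"
  assumes "linear L" "v = (\<Sum>j\<in>J. c j *\<^sub>R w j)"
  shows "L v = (\<Sum>j\<in>J. c j * L (w j))"
  unfolding assms(2) linear_sum[OF assms(1)] linear_cmul[OF assms(1)] by simp

lemma vec_eq_sum_axis: "(h :: real^'n::finite) = (\<Sum>j\<in>UNIV. h $ j *\<^sub>R axis j 1)"
  by (simp add: vec_eq_iff axis_def if_distrib cong: if_cong)

section \<open>Size, homogeneity and gradient of the phase\<close>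

locale phase =
  fixes \<phi> :: "real^'n::finite \<Rightarrow> real^'n \<Rightarrow> real"
  assumes Phi2: "PhiK 2 \<phi>"
begin

definition G :: "'n list \<Rightarrow> 'n list \<Rightarrow> real^'n \<Rightarrow> real^'n \<Rightarrow> real" where
  "G \<alpha> \<beta> x \<xi> = pdxxi \<alpha> \<beta> \<phi> x \<xi>"

lemma smooth: "smooth_on (UNIV \<times> (UNIV - {0})) (\<lambda>z. \<phi> (fst z) (snd z))"
  using Phi2 by (simp add: PhiK_def)

lemma G_Nil: "G [] [] x \<xi> = \<phi> x \<xi>" by (simp add: G_def pdxxi_def)

lemma G_has_derivative:
  assumes "\<xi> \<noteq> 0"
  shows "((\<lambda>z. G \<alpha> \<beta> (fst z) (snd z)) has_derivative
    (\<lambda>v. dderiv (v # map (\<lambda>i. (0, axis i 1)) \<alpha> @ map (\<lambda>i. (axis i 1, 0)) \<beta>) (\<lambda>z. \<phi> (fst z) (snd z)) (x, \<xi>))) (at (x, \<xi>))"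
  unfolding G_def pdxxi_def prod.collapse
  by (rule dderiv_has_derivative[OF smooth]) (use assms in auto)

lemma G_deriv_\<xi>:
  assumes "\<xi> \<noteq> 0"
  shows "((\<lambda>s. G \<alpha> \<beta> x (\<xi> + (s * \<rho>) *\<^sub>R axis i 1)) has_real_derivative \<rho> * G (i # \<alpha>) \<beta> x \<xi>) (at 0)"
proof -
  have 1: "((\<lambda>s. (x, \<xi> + (s * \<rho>) *\<^sub>R axis i 1)) has_derivative (\<lambda>h. (0, (h * \<rho>) *\<^sub>R axis i 1))) (at (0::real))"
    by (auto intro!: derivative_eq_intros)
  let ?L = "\<lambda>v. dderiv (v # map (\<lambda>i. (0, axis i 1)) \<alpha> @ map (\<lambda>i. (axis i 1, 0)) \<beta>) (\<lambda>z. \<phi> (fst z) (snd z)) (x, \<xi>)"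
  have d: "((\<lambda>z. G \<alpha> \<beta> (fst z) (snd z)) has_derivative ?L) (at (x, \<xi> + (0 * \<rho>) *\<^sub>R axis i 1))"
    using G_has_derivative[OF assms, of \<alpha> \<beta> x] by simp
  have "linear ?L" using has_derivative_bounded_linear[OF d] bounded_linear.linear by blast
  then have "?L (0, (h * \<rho>) *\<^sub>R axis i 1) = (h * \<rho>) * ?L (0, axis i 1)" for h
    using linear_cmul[of ?L "h * \<rho>" "(0, axis i 1)"] by simp
  then have "?L (0, (h * \<rho>) *\<^sub>R axis i 1) = \<rho> * G (i # \<alpha>) \<beta> x \<xi> * h" for h
    by (simp add: G_def pdxxi_def)
  then show ?thesis using has_derivative_compose[OF 1 d] by (simp add: has_field_derivative_def)
qed

lemma G_deriv_x:
  assumes "\<xi> \<noteq> 0"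
  shows "((\<lambda>x. G \<alpha> \<beta> x \<xi>) has_derivative (\<lambda>h. \<Sum>j\<in>UNIV. h $ j * G \<alpha> (j # \<beta>) x \<xi>)) (at x)"
proof -
  have 1: "((\<lambda>x. (x, \<xi>)) has_derivative (\<lambda>h. (h, 0))) (at x)"
    by (auto intro!: derivative_eq_intros)
  let ?\<Phi> = "\<lambda>z. \<phi> (fst z) (snd z)"
  let ?L = "\<lambda>v. dderiv (v # map (\<lambda>i. (0, axis i 1)) \<alpha> @ map (\<lambda>i. (axis i 1, 0)) \<beta>) ?\<Phi> (x, \<xi>)"
  have lin: "linear ?L" using has_derivative_bounded_linear[OF G_has_derivative[OF assms]] bounded_linear.linear by blast
  have "?L (h, 0) = (\<Sum>j\<in>UNIV. h $ j * G \<alpha> (j # \<beta>) x \<xi>)" for h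
  proof -
    have "(h, 0) = (\<Sum>j\<in>UNIV. h $ j *\<^sub>R (axis j 1, 0 :: real^'n))"
      by (subst (1) vec_eq_sum_axis) (simp add: prod_eq_iff fst_sum snd_sum)
    then have "?L (h, 0) = (\<Sum>j\<in>UNIV. h $ j * ?L (axis j 1, 0))"
      by (rule linear_expand[OF lin])
    moreover have "?L (axis j 1, 0) = G \<alpha> (j # \<beta>) x \<xi>" for j
      unfolding G_def pdxxi_def using dderiv_move[OF smooth, of "(x, \<xi>)" "(axis j 1, 0)"] assms by simp
    ultimately show ?thesis by simp
  qed
  then show ?thesis using has_derivative_compose[OF 1 G_has_derivative[OF assms, of \<alpha> \<beta> x]] by simp
qed

lemma continuous_G: "continuous_on (UNIV \<times> (UNIV - {0})) (\<lambda>z. G \<alpha> \<beta> (fst z) (snd z))"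
proof (rule continuous_at_imp_continuous_on, rule ballI)
  fix z :: "(real^'n) \<times> (real^'n)" assume "z \<in> UNIV \<times> (UNIV - {0})"
  then have "snd z \<noteq> 0" by auto
  from has_derivative_continuous[OF G_has_derivative[OF this, of \<alpha> \<beta> "fst z"]]
  show "isCont (\<lambda>z. G \<alpha> \<beta> (fst z) (snd z)) z" by simp
qed

lemma continuous_G_\<xi>: "0 \<notin> T \<Longrightarrow> continuous_on T (G \<alpha> \<beta> x)"
proof -
  assume "0 \<notin> T"
  then have "(\<lambda>\<xi>. (x, \<xi>)) ` T \<subseteq> UNIV \<times> (UNIV - {0})" by auto
  moreover have "continuous_on T (\<lambda>\<xi>. (x, \<xi>))" by (intro continuous_on_Pair continuous_on_const continuous_on_id)
  ultimately show ?thesis using continuous_on_compose2[OF continuous_G, of T "\<lambda>\<xi>. (x, \<xi>)" \<alpha> \<beta>] by simp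
qed

lemma G_bound:
  "length \<alpha> + length \<beta> \<ge> 2 \<Longrightarrow> \<exists>C\<ge>0. \<forall>x \<xi>. \<xi> \<noteq> 0 \<longrightarrow> \<bar>G \<alpha> \<beta> x \<xi>\<bar> \<le> C * norm \<xi> powr (1 - real (length \<alpha>))"
proof -
  assume "length \<alpha> + length \<beta> \<ge> 2"
  then obtain C where C: "\<And>x \<xi>. \<xi> \<noteq> 0 \<Longrightarrow> norm \<xi> powr (-1 + real (length \<alpha>)) * \<bar>G \<alpha> \<beta> x \<xi>\<bar> \<le> C"
    using Phi2 unfolding PhiK_def G_def by blast
  have "\<bar>G \<alpha> \<beta> x \<xi>\<bar> \<le> max C 0 * norm \<xi> powr (1 - real (length \<alpha>))" if "\<xi> \<noteq> 0" for x \<xi>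
  proof -
    have p: "norm \<xi> powr (-1 + real (length \<alpha>)) > 0" using that by simp
    have "\<bar>G \<alpha> \<beta> x \<xi>\<bar> \<le> C / norm \<xi> powr (-1 + real (length \<alpha>))" using C[OF that] p by (simp add: field_simps)
    also have "\<dots> = C * norm \<xi> powr (1 - real (length \<alpha>))" by (simp add: powr_minus_divide[symmetric] divide_powr_uminus)
    also have "\<dots> \<le> max C 0 * norm \<xi> powr (1 - real (length \<alpha>))" by (intro mult_right_mono) auto
    finally show ?thesis .
  qed
  then show ?thesis by (intro exI[of _ "max C 0"]) auto
qed

text \<open>One differentiation in \<open>x\<close> raises the total order to at least two, where
  \<open>PhiK 2\<close> gives bounds. Thus every \<xi>-derivative of positive order of
  \<open>\<phi> x - \<phi> y\<close> is controlled by \<open>norm (x - y)\<close>, although the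
  derivatives of order one themselves may be unbounded.\<close>

lemma G_lipschitz_x:
  assumes "length \<alpha> + length \<beta> \<ge> 1"
  shows "\<exists>C\<ge>0. \<forall>x y \<xi>. \<xi> \<noteq> 0 \<longrightarrow> \<bar>G \<alpha> \<beta> x \<xi> - G \<alpha> \<beta> y \<xi>\<bar> \<le> C * norm (x - y) * norm \<xi> powr (1 - real (length \<alpha>))"
proof -
  have "\<forall>j. \<exists>C\<ge>0. \<forall>x \<xi>. \<xi> \<noteq> 0 \<longrightarrow> \<bar>G \<alpha> (j # \<beta>) x \<xi>\<bar> \<le> C * norm \<xi> powr (1 - real (length \<alpha>))"
    using G_bound[of \<alpha> "j # \<beta>" for j] assms by simp
  then obtain C where C: "\<And>j. C j \<ge> 0" "\<And>j x \<xi>. \<xi> \<noteq> 0 \<Longrightarrow> \<bar>G \<alpha> (j # \<beta>) x \<xi>\<bar> \<le> C j * norm \<xi> powr (1 - real (length \<alpha>))"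
    by metis
  show ?thesis
  proof (intro exI[of _ "sum C UNIV"] conjI allI impI)
    show "0 \<le> sum C UNIV" using C(1) by (simp add: sum_nonneg)
    fix x y \<xi> :: "real^'n" assume \<xi>: "\<xi> \<noteq> 0"
    have "norm (G \<alpha> \<beta> x \<xi> - G \<alpha> \<beta> y \<xi>) \<le> (sum C UNIV * norm \<xi> powr (1 - real (length \<alpha>))) * norm (x - y)"
    proof (rule differentiable_bound[where S = UNIV and f' = "\<lambda>x h. \<Sum>j\<in>UNIV. h $ j * G \<alpha> (j # \<beta>) x \<xi>"])
      show "onorm (\<lambda>h. \<Sum>j\<in>UNIV. h $ j * G \<alpha> (j # \<beta>) x \<xi>) \<le> sum C UNIV * norm \<xi> powr (1 - real (length \<alpha>))" for x
      proof (rule onorm_le)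
        fix h :: "real^'n"
        have "norm (\<Sum>j\<in>UNIV. h $ j * G \<alpha> (j # \<beta>) x \<xi>) \<le> (\<Sum>j\<in>UNIV. norm h * (C j * norm \<xi> powr (1 - real (length \<alpha>))))"
          by (rule sum_norm_le) (auto simp: abs_mult intro!: mult_mono C \<xi> component_le_norm_cart)
        then show "norm (\<Sum>j\<in>UNIV. h $ j * G \<alpha> (j # \<beta>) x \<xi>) \<le> sum C UNIV * norm \<xi> powr (1 - real (length \<alpha>)) * norm h"
          by (simp add: sum_distrib_left[symmetric] sum_distrib_right[symmetric] mult_ac)
      qed
    qed (use G_deriv_x[OF \<xi>] in auto)
    then show "\<bar>G \<alpha> \<beta> x \<xi> - G \<alpha> \<beta> y \<xi>\<bar> \<le> sum C UNIV * norm (x - y) * norm \<xi> powr (1 - real (length \<alpha>))"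
      by (simp add: mult_ac)
  qed
qed

lemma homog: "\<xi> \<noteq> 0 \<Longrightarrow> 0 < t \<Longrightarrow> \<phi> x (t *\<^sub>R \<xi>) = t * \<phi> x \<xi>"
  using Phi2 by (simp add: PhiK_def)

text \<open>The homogeneity relation is differentiated in \<xi>. Degree 0 means that a linearisation
  depends only on the direction of its base point.\<close>

lemma G_homog: "\<xi> \<noteq> 0 \<Longrightarrow> 0 < t \<Longrightarrow> G [i] [] x (t *\<^sub>R \<xi>) = G [i] [] x \<xi>"
proof -
  assume \<xi>: "\<xi> \<noteq> 0" and t: "0 < t"
  have 1: "((\<lambda>s. \<phi> x (t *\<^sub>R \<xi> + (s * t) *\<^sub>R axis i 1)) has_real_derivative t * G [i] [] x (t *\<^sub>R \<xi>)) (at 0)"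
    using G_deriv_\<xi>[of "t *\<^sub>R \<xi>" "[]" "[]" x t i] \<xi> t by (simp add: G_Nil)
  have 2: "((\<lambda>s. t * \<phi> x (\<xi> + s *\<^sub>R axis i 1)) has_real_derivative t * G [i] [] x \<xi>) (at 0)"
    using DERIV_cmult[OF G_deriv_\<xi>[OF \<xi>, of "[]" "[]" x 1 i], of t] by (simp add: G_Nil)
  have "eventually (\<lambda>s. \<xi> + s *\<^sub>R axis i 1 \<in> - {0}) (nhds (0::real))"
    by (rule eventually_line_in(2)) (use \<xi> in auto)
  then have "eventually (\<lambda>s. \<phi> x (t *\<^sub>R \<xi> + (s * t) *\<^sub>R axis i 1) = t * \<phi> x (\<xi> + s *\<^sub>R axis i 1)) (nhds 0)"
  proof eventually_elim
    case (elim s)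
    then show ?case using homog[of "\<xi> + s *\<^sub>R axis i 1" t x] t by (simp add: scaleR_add_right mult.commute)
  qed
  from DERIV_cong_ev[OF refl this refl] 1
  have "((\<lambda>s. t * \<phi> x (\<xi> + s *\<^sub>R axis i 1)) has_real_derivative t * G [i] [] x (t *\<^sub>R \<xi>)) (at 0)" by simp
  from DERIV_unique[OF this 2] show ?thesis using t by simp
qed

text \<open>The derivative of \<open>\<phi> x (t *\<^sub>R \<xi>)\<close> at \<open>t = 1\<close> is
  computed in two ways. Consequently the phase coincides at \<xi> with its linearisation based at
  \<xi>, and the error of another linearisation comes only from the increment of the
  gradient.\<close>

lemma Euler: "\<xi> \<noteq> 0 \<Longrightarrow> \<phi> x \<xi> = (\<Sum>i\<in>UNIV. \<xi> $ i * G [i] [] x \<xi>)"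
proof -
  assume \<xi>: "\<xi> \<noteq> 0"
  let ?L = "\<lambda>v. dderiv [v] (\<lambda>z. \<phi> (fst z) (snd z)) (x, \<xi>)"
  have d: "((\<lambda>z. \<phi> (fst z) (snd z)) has_derivative ?L) (at (x, 1 *\<^sub>R \<xi>))"
    using G_has_derivative[OF \<xi>, of "[]" "[]" x] by (simp add: G_Nil)
  have lin: "linear ?L" using has_derivative_bounded_linear[OF d] bounded_linear.linear by blast
  have "((\<lambda>t. (x, t *\<^sub>R \<xi>)) has_derivative (\<lambda>h. (0, h *\<^sub>R \<xi>))) (at (1::real))"
    by (auto intro!: derivative_eq_intros)
  from has_derivative_compose[OF this d]
  have "((\<lambda>t. \<phi> x (t *\<^sub>R \<xi>)) has_derivative (\<lambda>h. ?L (0, h *\<^sub>R \<xi>))) (at 1)" by simp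
  moreover have "?L (0, h *\<^sub>R \<xi>) = ?L (0, \<xi>) * h" for h using linear_cmul[OF lin, of h "(0, \<xi>)"] by simp
  ultimately have 1: "((\<lambda>t. \<phi> x (t *\<^sub>R \<xi>)) has_real_derivative ?L (0, \<xi>)) (at 1)"
    by (simp add: has_field_derivative_def)
  have "((\<lambda>t. t * \<phi> x \<xi>) has_real_derivative \<phi> x \<xi>) (at 1)" by (auto intro!: derivative_eq_intros)
  then have "((\<lambda>t. \<phi> x (t *\<^sub>R \<xi>)) has_real_derivative \<phi> x \<xi>) (at 1)"
    by (rule has_field_derivative_transform_within_open[of _ _ _ "{0<..}"]) (use homog[OF \<xi>] in auto)
  from DERIV_unique[OF this 1] have "\<phi> x \<xi> = ?L (0, \<xi>)" .
  also have "\<dots> = (\<Sum>j\<in>UNIV. \<xi> $ j * ?L (0, axis j 1))"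
  proof (rule linear_expand[OF lin])
    show "(0, \<xi>) = (\<Sum>j\<in>UNIV. \<xi> $ j *\<^sub>R (0 :: real^'n, axis j 1))"
      by (subst (1) vec_eq_sum_axis) (simp add: prod_eq_iff fst_sum snd_sum)
  qed
  finally show ?thesis by (simp add: G_def pdxxi_def)
qed

definition grad :: "real^'n \<Rightarrow> real^'n \<Rightarrow> real^'n" where
  "grad \<xi> x = (\<chi> i. G [i] [] x \<xi>)"

lemma grad_upper: "\<exists>L\<ge>0. \<forall>\<xi> x y. \<xi> \<noteq> 0 \<longrightarrow> norm (grad \<xi> x - grad \<xi> y) \<le> L * norm (x - y)"
proof -
  have "\<forall>i. \<exists>C\<ge>0. \<forall>x y \<xi>. \<xi> \<noteq> 0 \<longrightarrow> \<bar>G [i] [] x \<xi> - G [i] [] y \<xi>\<bar> \<le> C * norm (x - y)"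
  proof
    fix i
    obtain C where "C \<ge> 0" "\<forall>x y \<xi>. \<xi> \<noteq> 0 \<longrightarrow> \<bar>G [i] [] x \<xi> - G [i] [] y \<xi>\<bar> \<le> C * norm (x - y) * norm \<xi> powr (1 - real (length [i]))"
      using G_lipschitz_x[of "[i]" "[]"] by auto
    then show "\<exists>C\<ge>0. \<forall>x y \<xi>. \<xi> \<noteq> 0 \<longrightarrow> \<bar>G [i] [] x \<xi> - G [i] [] y \<xi>\<bar> \<le> C * norm (x - y)" by (intro exI[of _ C]) simp
  qed
  then obtain C where C: "\<And>i. C i \<ge> 0" "\<And>i x y \<xi>. \<xi> \<noteq> 0 \<Longrightarrow> \<bar>G [i] [] x \<xi> - G [i] [] y \<xi>\<bar> \<le> C i * norm (x - y)" by metis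
  have "norm (grad \<xi> x - grad \<xi> y) \<le> sum C UNIV * norm (x - y)" if "\<xi> \<noteq> 0" for \<xi> x y
  proof -
    have "norm (grad \<xi> x - grad \<xi> y) \<le> (\<Sum>i\<in>UNIV. \<bar>(grad \<xi> x - grad \<xi> y) $ i\<bar>)" by (rule norm_le_l1_cart)
    also have "\<dots> \<le> (\<Sum>i\<in>UNIV. C i * norm (x - y))" by (rule sum_mono) (simp add: grad_def C that)
    finally show ?thesis by (simp add: sum_distrib_right)
  qed
  then show ?thesis using C(1) by (intro exI[of _ "sum C UNIV"]) (auto intro: sum_nonneg)
qed

end

section \<open>From the determinant condition to non-degenerate phases on balls\<close>

lemma dbd_seqI:
  assumes "\<And>j. j \<le> k \<Longrightarrow> continuous_on S (h j)" "\<And>j \<xi>. j \<le> k \<Longrightarrow> \<xi> \<in> S \<Longrightarrow> norm (h j \<xi>) \<le> A"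
    "\<And>j \<xi>. j < k \<Longrightarrow> \<xi> \<in> S \<Longrightarrow> ((\<lambda>s. h j (\<xi> + s *\<^sub>R v)) has_vector_derivative h (Suc j) \<xi>) (at 0)"
  shows "dbd S v k A (h 0)"
  using assms
proof (induction k arbitrary: h)
  case (Suc k)
  have "dbd S v k A (\<lambda>\<xi>. h (Suc 0) \<xi>)"
    by (rule Suc.IH[of "\<lambda>j. h (Suc j)"]) (use Suc.prems in auto)
  then show ?case by (intro dbd_SucI[where w' = "h (Suc 0)"]) (use Suc.prems in auto)
qed auto

text \<open>Cramer's rule. In each term of the Leibniz expansion of the numerator the replaced
  column occurs exactly once and contributes a component of \<open>A *v v\<close>; the other n - 1
  factors are at most \<open>K\<close>.\<close>

lemma matrix_vector_lower_bound:
  fixes A :: "real^'n::finite^'n" and K :: real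
  assumes K: "\<And>i j. \<bar>A $ i $ j\<bar> \<le> K" "1 \<le> K" and c: "0 < c" "c \<le> \<bar>det A\<bar>"
  shows "norm v \<le> CARD('n) * (card {p. p permutes (UNIV::'n set)} * K ^ CARD('n) / c) * norm (A *v v)"
proof -
  let ?P = "{p. p permutes (UNIV::'n set)}"
  define b where "b = A *v v"
  have d0: "det A \<noteq> 0" using c by auto
  have v: "v = (\<chi> k. det (\<chi> i j. if j = k then b $ i else A $ i $ j) / det A)"
    using cramer[OF d0, of v b] b_def by simp
  have comp: "\<bar>v $ k\<bar> \<le> card ?P * K ^ CARD('n) / c * norm b" for k
  proof -
    let ?B = "\<chi> i j. if j = k then b $ i else A $ i $ j"
    have one: "\<bar>of_int (sign p) * (\<Prod>i\<in>UNIV. ?B $ i $ p i)\<bar> \<le> K ^ CARD('n) * norm b" if p: "p permutes UNIV" for p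
    proof -
      obtain i0 where i0: "p i0 = k" using permutes_surj[OF p] by (metis surjD)
      have inj: "p i \<noteq> k" if "i \<noteq> i0" for i using permutes_inj[OF p] i0 that by (metis injD)
      have "\<bar>of_int (sign p) * (\<Prod>i\<in>UNIV. ?B $ i $ p i)\<bar> = (\<Prod>i\<in>UNIV. \<bar>?B $ i $ p i\<bar>)"
        by (simp add: abs_mult abs_prod sign_def)
      also have "\<dots> = \<bar>?B $ i0 $ p i0\<bar> * (\<Prod>i\<in>UNIV - {i0}. \<bar>?B $ i $ p i\<bar>)"
        by (rule prod.remove) auto
      also have "\<dots> \<le> norm b * (\<Prod>i\<in>UNIV - {i0}. K)"
        using K by (intro mult_mono prod_mono prod_nonneg) (auto simp: i0 inj component_le_norm_cart)
      also have "\<dots> = norm b * K ^ (CARD('n) - 1)" by (simp add: card_Diff_singleton)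
      also have "\<dots> \<le> norm b * K ^ CARD('n)" using K(2) by (intro mult_left_mono power_increasing) auto
      finally show ?thesis by (simp add: mult.commute)
    qed
    have "\<bar>det ?B\<bar> \<le> (\<Sum>p\<in>?P. K ^ CARD('n) * norm b)"
      unfolding det_def by (rule order_trans[OF sum_abs sum_mono]) (use one in auto)
    then have dB: "\<bar>det ?B\<bar> \<le> card ?P * K ^ CARD('n) * norm b" by simp
    have "\<bar>v $ k\<bar> = \<bar>det ?B\<bar> / \<bar>det A\<bar>" by (subst v) (simp add: abs_divide)
    also have "\<dots> \<le> (card ?P * K ^ CARD('n) * norm b) / c"
      by (rule frac_le) (use dB c K in auto)
    finally show ?thesis by simp
  qed
  have "norm v \<le> (\<Sum>k\<in>UNIV. \<bar>v $ k\<bar>)" by (rule norm_le_l1_cart)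
  also have "\<dots> \<le> (\<Sum>k\<in>(UNIV::'n set). card ?P * K ^ CARD('n) / c * norm b)" by (rule sum_mono) (rule comp)
  finally show ?thesis by (simp add: b_def)
qed

lemma exists_large_component:
  fixes w :: "real^'n::finite"
  shows "\<exists>i. norm w / CARD('n) \<le> \<bar>w $ i\<bar>"
proof (rule ccontr)
  assume "\<not> ?thesis"
  then have "(\<Sum>i\<in>UNIV. \<bar>w $ i\<bar>) < (\<Sum>i\<in>(UNIV::'n set). norm w / CARD('n))" by (intro sum_strict_mono) (auto simp: not_le)
  then show False using norm_le_l1_cart[of w] by simp
qed

lemma (in phase) G_has_derivative_\<xi>:
  assumes "\<xi> \<noteq> 0"
  shows "((\<lambda>\<xi>. G \<alpha> \<beta> x \<xi>) has_derivative (\<lambda>h. \<Sum>j\<in>UNIV. h $ j * G (j # \<alpha>) \<beta> x \<xi>)) (at \<xi>)"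
proof -
  have 1: "((\<lambda>\<xi>. (x, \<xi>)) has_derivative (\<lambda>h. (0, h))) (at \<xi>)"
    by (auto intro!: derivative_eq_intros)
  let ?L = "\<lambda>v. dderiv (v # map (\<lambda>i. (0, axis i 1)) \<alpha> @ map (\<lambda>i. (axis i 1, 0)) \<beta>) (\<lambda>z. \<phi> (fst z) (snd z)) (x, \<xi>)"
  have lin: "linear ?L" using has_derivative_bounded_linear[OF G_has_derivative[OF assms]] bounded_linear.linear by blast
  have "?L (0, h) = (\<Sum>j\<in>UNIV. h $ j * G (j # \<alpha>) \<beta> x \<xi>)" for h
  proof -
    have "?L (0, h) = (\<Sum>j\<in>UNIV. h $ j * ?L (0, axis j 1))"
    proof (rule linear_expand[OF lin])
      show "(0, h) = (\<Sum>j\<in>UNIV. h $ j *\<^sub>R (0 :: real^'n, axis j 1))"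
        by (subst (1) vec_eq_sum_axis) (simp add: prod_eq_iff fst_sum snd_sum)
    qed
    then show ?thesis by (simp add: G_def pdxxi_def)
  qed
  then show ?thesis using has_derivative_compose[OF 1 G_has_derivative[OF assms, of \<alpha> \<beta> x]] by simp
qed

locale snd_phase = phase \<phi> for \<phi> :: "real^'n::finite \<Rightarrow> real^'n \<Rightarrow> real" +
  assumes snd: "SND \<phi>"
begin

text \<open>The mixed second derivatives have degree 0 in \<xi> and are bounded, so with the
  determinant condition \<open>matrix_vector_lower_bound\<close> bounds the Jacobian of
  \<open>grad \<xi>\<close> from below. Third derivatives make this Jacobian Lipschitz in
  \<open>x\<close>. All constants are uniform in \<xi>, and \<open>expansive_global\<close>
  applies.\<close>

lemma grad_lower: "\<exists>c>0. \<forall>\<xi> x y. \<xi> \<noteq> 0 \<longrightarrow> c * norm (x - y) \<le> norm (grad \<xi> x - grad \<xi> y)"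
proof -
  obtain c where c: "c > 0" "\<And>x \<xi>. \<xi> \<noteq> 0 \<Longrightarrow> \<bar>det (\<chi> j k. G [k] [j] x \<xi>)\<bar> \<ge> c"
    using snd unfolding SND_def G_def by blast
  have "\<forall>i j. \<exists>C\<ge>0. \<forall>x \<xi>. \<xi> \<noteq> 0 \<longrightarrow> \<bar>G [i] [j] x \<xi>\<bar> \<le> C"
  proof (intro allI)
    fix i j
    obtain C where "C \<ge> 0" "\<forall>x \<xi>. \<xi> \<noteq> 0 \<longrightarrow> \<bar>G [i] [j] x \<xi>\<bar> \<le> C * norm \<xi> powr (1 - real (length [i]))"
      using G_bound[of "[i]" "[j]"] by auto
    then show "\<exists>C\<ge>0. \<forall>x \<xi>. \<xi> \<noteq> 0 \<longrightarrow> \<bar>G [i] [j] x \<xi>\<bar> \<le> C" by (intro exI[of _ C]) auto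
  qed
  then obtain C where C: "\<And>i j. C i j \<ge> 0" "\<And>i j x \<xi>. \<xi> \<noteq> 0 \<Longrightarrow> \<bar>G [i] [j] x \<xi>\<bar> \<le> C i j" by metis
  define K where "K = 1 + (\<Sum>i\<in>UNIV. \<Sum>j\<in>UNIV. C i j)"
  have K1: "1 \<le> K" using C(1) by (simp add: K_def sum_nonneg)
  have K: "\<bar>G [i] [j] x \<xi>\<bar> \<le> K" if "\<xi> \<noteq> 0" for i j x \<xi>
  proof -
    have "C i j \<le> (\<Sum>j\<in>UNIV. C i j)" using C(1) by (intro member_le_sum) auto
    also have "\<dots> \<le> (\<Sum>i\<in>UNIV. \<Sum>j\<in>UNIV. C i j)" using C(1) by (intro member_le_sum[of i UNIV "\<lambda>i. \<Sum>j\<in>UNIV. C i j"]) (auto intro: sum_nonneg)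
    finally show ?thesis using C(2)[OF that, of i j x] by (simp add: K_def)
  qed
  have "\<forall>i j. \<exists>C\<ge>0. \<forall>x y \<xi>. \<xi> \<noteq> 0 \<longrightarrow> \<bar>G [i] [j] x \<xi> - G [i] [j] y \<xi>\<bar> \<le> C * norm (x - y)"
  proof (intro allI)
    fix i j
    obtain C where "C \<ge> 0" "\<forall>x y \<xi>. \<xi> \<noteq> 0 \<longrightarrow> \<bar>G [i] [j] x \<xi> - G [i] [j] y \<xi>\<bar> \<le> C * norm (x - y) * norm \<xi> powr (1 - real (length [i]))"
      using G_lipschitz_x[of "[i]" "[j]"] by auto
    then show "\<exists>C\<ge>0. \<forall>x y \<xi>. \<xi> \<noteq> 0 \<longrightarrow> \<bar>G [i] [j] x \<xi> - G [i] [j] y \<xi>\<bar> \<le> C * norm (x - y)" by (intro exI[of _ C]) auto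
  qed
  then obtain E where E: "\<And>i j. E i j \<ge> 0" "\<And>i j x y \<xi>. \<xi> \<noteq> 0 \<Longrightarrow> \<bar>G [i] [j] x \<xi> - G [i] [j] y \<xi>\<bar> \<le> E i j * norm (x - y)" by metis
  define L where "L = (\<Sum>i\<in>UNIV. \<Sum>j\<in>UNIV. E i j)"
  define Q where "Q = CARD('n) * (card {p. p permutes (UNIV::'n set)} * K ^ CARD('n) / c) + 1"
  have Q0: "Q > 0" using K1 c by (auto simp: Q_def intro!: add_nonneg_pos mult_nonneg_nonneg divide_nonneg_pos)
  have "(1 / Q) * norm (x - y) \<le> norm (grad \<xi> x - grad \<xi> y)" if \<xi>: "\<xi> \<noteq> 0" for \<xi> x y
  proof (rule expansive_global[where D = "\<lambda>x v. \<chi> i. \<Sum>j\<in>UNIV. v $ j * G [i] [j] x \<xi>" and L = L])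
    show "(grad \<xi> has_derivative (\<lambda>v. \<chi> i. \<Sum>j\<in>UNIV. v $ j * G [i] [j] x \<xi>)) (at x)" for x
      unfolding has_derivative_componentwise_within[of "grad \<xi>"]
    proof
      fix b :: "real^'n" assume "b \<in> Basis"
      then obtain i where b: "b = axis i 1" by (auto simp: Basis_vec_def)
      have "(\<lambda>x. grad \<xi> x \<bullet> b) = (\<lambda>x. G [i] [] x \<xi>)" by (simp add: b inner_axis grad_def)
      then show "((\<lambda>x. grad \<xi> x \<bullet> b) has_derivative (\<lambda>v. (\<chi> i. \<Sum>j\<in>UNIV. v $ j * G [i] [j] x \<xi>) \<bullet> b)) (at x)"
        using G_deriv_x[OF \<xi>, of "[i]" "[]" x] by (simp add: b inner_axis)
    qed
    show "norm ((\<chi> i. \<Sum>j\<in>UNIV. v $ j * G [i] [j] x \<xi>) - (\<chi> i. \<Sum>j\<in>UNIV. v $ j * G [i] [j] y \<xi>)) \<le> L * norm (x - y) * norm v" for x y v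
    proof -
      have "norm ((\<chi> i. \<Sum>j\<in>UNIV. v $ j * G [i] [j] x \<xi>) - (\<chi> i. \<Sum>j\<in>UNIV. v $ j * G [i] [j] y \<xi>))
         \<le> (\<Sum>i\<in>UNIV. \<bar>\<Sum>j\<in>UNIV. v $ j * (G [i] [j] x \<xi> - G [i] [j] y \<xi>)\<bar>)"
        by (rule order_trans[OF norm_le_l1_cart]) (simp add: sum_subtractf algebra_simps)
      also have "\<dots> \<le> (\<Sum>i\<in>UNIV. \<Sum>j\<in>UNIV. norm v * (E i j * norm (x - y)))"
        by (intro sum_mono order_trans[OF sum_abs]) (auto simp: abs_mult intro!: mult_mono E \<xi> component_le_norm_cart)
      also have "\<dots> = L * norm (x - y) * norm v"
        by (simp add: L_def sum_distrib_left[symmetric] sum_distrib_right[symmetric] mult_ac)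
      finally show ?thesis .
    qed
    show "1 / Q * norm v \<le> norm (\<chi> i. \<Sum>j\<in>UNIV. v $ j * G [i] [j] x \<xi>)" for x v
    proof -
      let ?N = "\<chi> j k. G [k] [j] x \<xi>"
      \<comment> \<open>In the matrix of \<open>SND\<close> the rows belong to \<open>x\<close> and
        the columns to \<xi>; the Jacobian of \<open>grad \<xi>\<close> has them exchanged.\<close>
      have eq: "(\<chi> i. \<Sum>j\<in>UNIV. v $ j * G [i] [j] x \<xi>) = transpose ?N *v v"
        by (simp add: matrix_vector_mult_def transpose_def mult.commute)
      have "norm v \<le> CARD('n) * (card {p. p permutes (UNIV::'n set)} * K ^ CARD('n) / c) * norm (transpose ?N *v v)"
      proof (rule matrix_vector_lower_bound)
        show "\<bar>transpose ?N $ i $ j\<bar> \<le> K" for i j using K[OF \<xi>] by (simp add: transpose_def)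
        show "c \<le> \<bar>det (transpose ?N)\<bar>" using c(2)[OF \<xi>, of x] by (simp add: det_transpose)
      qed (use K1 c in auto)
      also have "\<dots> \<le> Q * norm (transpose ?N *v v)" by (intro mult_right_mono) (auto simp: Q_def)
      finally show ?thesis unfolding eq using Q0 by (simp add: field_simps)
    qed
  qed (use Q0 in auto)
  then show ?thesis using Q0 by (intro exI[of _ "1/Q"]) auto
qed

text \<open>Nothing is assumed about \<open>\<phi> x 0\<close>; the value \<open>0\<close> makes the phase jointly Borel.\<close>
definition \<phi>0 :: "real^'n \<Rightarrow> real^'n \<Rightarrow> real" where
  "\<phi>0 x \<xi> = (if \<xi> = 0 then 0 else \<phi> x \<xi>)"

text \<open>Interpolates between the phase linearised at \<open>\<zeta>\<close> (for \<open>s = 0\<close>) and \<open>\<phi>\<close> itself (for \<open>s = 1\<close>).\<close>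
definition \<phi>s :: "real^'n \<Rightarrow> real \<Rightarrow> real^'n \<Rightarrow> real^'n \<Rightarrow> real" where
  "\<phi>s \<zeta> s x \<xi> = (1 - s) * (grad \<zeta> x \<bullet> \<xi>) + s * \<phi>0 x \<xi>"

lemma norm_in_ball:
  fixes \<zeta> \<xi> :: "real^'n"
  assumes "\<xi> \<in> ball \<zeta> (2 * (\<delta> * norm \<zeta>))" "0 < \<delta>" "\<delta> \<le> 1/4" "\<zeta> \<noteq> 0"
  shows "norm \<zeta> / 2 \<le> norm \<xi>" "\<xi> \<noteq> 0"
proof -
  have "\<delta> * norm \<zeta> \<le> 1/4 * norm \<zeta>" using assms(3) by (rule mult_right_mono) simp
  then have "norm (\<zeta> - \<xi>) \<le> norm \<zeta> / 2" using assms(1) by (simp add: dist_norm)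
  then show 1: "norm \<zeta> / 2 \<le> norm \<xi>" using norm_triangle_sub[of \<zeta> \<xi>] by linarith
  then show "\<xi> \<noteq> 0" using assms(4) by auto
qed

text \<open>At the centre some component of \<open>grad \<zeta> x - grad \<zeta> y\<close> is at
  least a fixed multiple of \<open>norm (x - y)\<close>. Its derivative in \<xi> is of order
  \<open>norm (x - y) / norm \<zeta>\<close>, so for small \<delta> it keeps its sign and half of
  its size on the ball, and so does every interpolation between its values at \<zeta> and at \<xi>.
  Derivatives of order j decay like |\<xi>|^(-j), which the scale \<rho>^j compensates.\<close>

lemma nondeg_cells:
  "\<exists>\<delta> c A. 0 < \<delta> \<and> \<delta> \<le> 1/4 \<and> 0 < c \<and> 0 \<le> A \<and>
     (\<forall>\<zeta> s. \<zeta> \<noteq> 0 \<longrightarrow> s \<in> {0..1} \<longrightarrow> nondeg_phase c A (\<phi>s \<zeta> s) \<zeta> (\<delta> * norm \<zeta>))"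
proof -
  let ?n = "CARD('n)"
  have n0: "real ?n > 0" by simp
  obtain c0 where c0: "c0 > 0" "\<And>\<xi> x y. \<xi> \<noteq> 0 \<Longrightarrow> c0 * norm (x - y) \<le> norm (grad \<xi> x - grad \<xi> y)"
    using grad_lower by blast
  have "\<forall>\<alpha>. \<exists>C\<ge>0. \<forall>x y \<xi>. length \<alpha> \<ge> 1 \<longrightarrow> \<xi> \<noteq> 0 \<longrightarrow> \<bar>G \<alpha> [] x \<xi> - G \<alpha> [] y \<xi>\<bar> \<le> C * norm (x - y) * norm \<xi> powr (1 - real (length \<alpha>))"
  proof
    fix \<alpha> show "\<exists>C\<ge>0. \<forall>x y \<xi>. length \<alpha> \<ge> 1 \<longrightarrow> \<xi> \<noteq> 0 \<longrightarrow> \<bar>G \<alpha> [] x \<xi> - G \<alpha> [] y \<xi>\<bar> \<le> C * norm (x - y) * norm \<xi> powr (1 - real (length \<alpha>))"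
      using G_lipschitz_x[of \<alpha> "[]"] by (cases "length \<alpha> \<ge> 1") auto
  qed
  then obtain C where C: "\<And>\<alpha>. C \<alpha> \<ge> 0" "\<And>\<alpha> x y \<xi>. length \<alpha> \<ge> 1 \<Longrightarrow> \<xi> \<noteq> 0 \<Longrightarrow> \<bar>G \<alpha> [] x \<xi> - G \<alpha> [] y \<xi>\<bar> \<le> C \<alpha> * norm (x - y) * norm \<xi> powr (1 - real (length \<alpha>))"
    by metis
  define L2 where "L2 = (\<Sum>i\<in>UNIV. \<Sum>k\<in>UNIV. C [k, i])"
  have L2: "L2 \<ge> 0" using C(1) by (auto simp: L2_def intro!: sum_nonneg)
  \<comment> \<open>Over a distance \<open>2 * \<delta> * norm \<zeta>\<close> the selected
    component changes by at most half of its lower bound at \<zeta>. The value 1/4 keeps the ball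
    away from the origin, and \<open>+ 1\<close> prevents division by zero.\<close>
  define \<delta> where "\<delta> = min (1/4) (c0 / (2 * ?n) / (4 * L2 + 1))"
  have \<delta>: "0 < \<delta>" "\<delta> \<le> 1/4"
  proof -
    have "0 < c0 / (2 * ?n) / (4 * L2 + 1)" using c0(1) L2 n0 by (intro divide_pos_pos) auto
    then show "0 < \<delta>" by (simp add: \<delta>_def)
    show "\<delta> \<le> 1/4" unfolding \<delta>_def by (rule min.cobounded1)
  qed
  have \<delta>2: "4 * L2 * \<delta> \<le> c0 / (2 * ?n)"
  proof -
    have "4 * L2 * \<delta> \<le> (4 * L2 + 1) * \<delta>" using \<delta> by (intro mult_right_mono) auto
    also have "\<dots> \<le> (4 * L2 + 1) * (c0 / (2 * ?n) / (4 * L2 + 1))" using L2 by (intro mult_left_mono) (auto simp: \<delta>_def)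
    also have "\<dots> = c0 / (2 * ?n)" using L2 by simp
    finally show ?thesis .
  qed
  define c where "c = c0 / (2 * ?n)"
  have c: "c > 0" using c0 n0 by (simp add: c_def)
  \<comment> \<open>A bound for the scaled derivative of order \<open>j\<close>; the power of 2
    comes from \<rho> / |\<xi>| being at most 2 on the ball.\<close>
  define cc where "cc i j = C (replicate (Suc j) i) * 2 ^ j" for i j
  have cc: "0 \<le> cc i j" for i j unfolding cc_def using C(1) by (intro mult_nonneg_nonneg) auto
  define A where "A = (\<Sum>i\<in>UNIV. \<Sum>j\<le>Suc ?n. cc i j) / c"
  have Ai: "C (replicate (Suc j) i) * 2 ^ j / c \<le> A" if "j \<le> Suc ?n" for i j
  proof -
    have "cc i j \<le> (\<Sum>j\<le>Suc ?n. cc i j)" using that cc by (intro member_le_sum) auto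
    also have "\<dots> \<le> (\<Sum>i\<in>UNIV. \<Sum>j\<le>Suc ?n. cc i j)"
      using sum_nonneg[OF cc] by (intro member_le_sum[of i UNIV "\<lambda>i. \<Sum>j\<le>Suc ?n. cc i j"]) (simp_all only: UNIV_I finite_code)
    finally show ?thesis unfolding A_def cc_def[symmetric] using c by (intro divide_right_mono) auto
  qed
  have A0: "0 \<le> A" unfolding A_def using c cc by (intro divide_nonneg_pos sum_nonneg) auto
  have "nondeg_phase c A (\<phi>s \<zeta> s) \<zeta> (\<delta> * norm \<zeta>)" if \<zeta>: "\<zeta> \<noteq> 0" and s: "s \<in> {0..1}" for \<zeta> s
    unfolding nondeg_phase_def
  proof (intro conjI allI impI)
    let ?S = "ball \<zeta> (2 * (\<delta> * norm \<zeta>))"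
    have S: "norm \<zeta> / 2 \<le> norm \<xi>" "\<xi> \<noteq> 0" if "\<xi> \<in> ?S" for \<xi>
      using norm_in_ball[OF that \<delta> \<zeta>] by auto
    have S0: "0 \<notin> ?S" using S(2) by blast
    show "continuous_on ?S (\<phi>s \<zeta> s x)" for x
    proof -
      have "continuous_on ?S (\<lambda>\<xi>. (1 - s) * (grad \<zeta> x \<bullet> \<xi>) + s * G [] [] x \<xi>)"
        by (intro continuous_intros continuous_G_\<xi> S0)
      then show ?thesis by (rule continuous_on_eq) (auto simp: \<phi>s_def \<phi>0_def G_Nil S(2))
    qed
    fix x y :: "real^'n" assume xy: "x \<noteq> y"
    define d where "d = norm (x - y)"
    have d: "d > 0" using xy by (simp add: d_def)
    obtain i where i: "norm (grad \<zeta> x - grad \<zeta> y) / ?n \<le> \<bar>(grad \<zeta> x - grad \<zeta> y) $ i\<bar>"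
      using exists_large_component by blast
    define \<rho> where "\<rho> = \<delta> * norm \<zeta>"
    have \<rho>: "\<rho> > 0" using \<delta> \<zeta> by (simp add: \<rho>_def)
    define f where "f \<alpha> \<xi> = G \<alpha> [] x \<xi> - G \<alpha> [] y \<xi>" for \<alpha> \<xi>
    have fb: "\<bar>f \<alpha> \<xi>\<bar> \<le> C \<alpha> * d * norm \<xi> powr (1 - real (length \<alpha>))" if "length \<alpha> \<ge> 1" "\<xi> \<in> ?S" for \<alpha> \<xi>
      unfolding f_def d_def using C(2) S(2) that by blast
    have f\<zeta>: "2 * c * d \<le> \<bar>f [i] \<zeta>\<bar>"
    proof -
      have "2 * c * d = c0 * d / ?n" by (simp add: c_def)
      also have "\<dots> \<le> norm (grad \<zeta> x - grad \<zeta> y) / ?n" using c0(2)[OF \<zeta>, of x y] by (intro divide_right_mono) (auto simp: d_def)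
      also have "\<dots> \<le> \<bar>f [i] \<zeta>\<bar>" using i by (simp add: f_def grad_def)
      finally show ?thesis .
    qed
    have close: "\<bar>f [i] \<xi> - f [i] \<zeta>\<bar> \<le> c * d" if \<xi>: "\<xi> \<in> ?S" for \<xi>
    proof -
      have "norm (f [i] \<xi> - f [i] \<zeta>) \<le> (L2 * d * (2 / norm \<zeta>)) * norm (\<xi> - \<zeta>)"
      proof (rule differentiable_bound[where S = ?S and f' = "\<lambda>\<xi> h. \<Sum>k\<in>UNIV. h $ k * f [k, i] \<xi>"])
        fix \<eta> assume \<eta>: "\<eta> \<in> ?S"
        have "((\<lambda>\<xi>. G [i] [] x \<xi> - G [i] [] y \<xi>) has_derivative (\<lambda>h. (\<Sum>k\<in>UNIV. h $ k * G [k, i] [] x \<eta>) - (\<Sum>k\<in>UNIV. h $ k * G [k, i] [] y \<eta>))) (at \<eta>)"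
          by (intro has_derivative_diff G_has_derivative_\<xi> S(2)[OF \<eta>])
        then have "(f [i] has_derivative (\<lambda>h. \<Sum>k\<in>UNIV. h $ k * f [k, i] \<eta>)) (at \<eta>)"
          by (simp add: f_def[abs_def] sum_subtractf algebra_simps)
        then show "(f [i] has_derivative (\<lambda>h. \<Sum>k\<in>UNIV. h $ k * f [k, i] \<eta>)) (at \<eta> within ?S)"
          by (rule has_derivative_at_withinI)
        show "onorm (\<lambda>h. \<Sum>k\<in>UNIV. h $ k * f [k, i] \<eta>) \<le> L2 * d * (2 / norm \<zeta>)"
        proof (rule onorm_le)
          fix h :: "real^'n"
          have "\<bar>f [k, i] \<eta>\<bar> \<le> C [k, i] * d * (2 / norm \<zeta>)" for k
          proof -
            have "\<bar>f [k, i] \<eta>\<bar> \<le> C [k, i] * d * norm \<eta> powr (1 - real (length [k, i]))" by (rule fb) (use \<eta> in auto)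
            also have "norm \<eta> powr (1 - real (length [k, i])) = 1 / norm \<eta>" using S(2)[OF \<eta>] by (simp add: powr_minus_divide)
            also have "C [k, i] * d * (1 / norm \<eta>) \<le> C [k, i] * d * (2 / norm \<zeta>)"
              using S[OF \<eta>] C(1)[of "[k, i]"] d \<zeta> by (intro mult_left_mono) (auto simp: field_simps)
            finally show ?thesis .
          qed
          then have "norm (\<Sum>k\<in>UNIV. h $ k * f [k, i] \<eta>) \<le> (\<Sum>k\<in>UNIV. norm h * (C [k, i] * d * (2 / norm \<zeta>)))"
          proof (intro sum_norm_le)
            fix k
            show "norm (h $ k * f [k, i] \<eta>) \<le> norm h * (C [k, i] * d * (2 / norm \<zeta>))"
              unfolding real_norm_def abs_mult by (intro mult_mono component_le_norm_cart) (use \<open>\<And>k. \<bar>f [k, i] \<eta>\<bar> \<le> C [k, i] * d * (2 / norm \<zeta>)\<close> in auto)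
          qed
          also have "\<dots> = (\<Sum>k\<in>UNIV. C [k, i]) * (d * (2 / norm \<zeta>) * norm h)"
            unfolding sum_distrib_right by (rule sum.cong) (simp_all add: mult_ac)
          also have "\<dots> \<le> L2 * (d * (2 / norm \<zeta>) * norm h)"
          proof (rule mult_right_mono)
            show "(\<Sum>k\<in>UNIV. C [k, i]) \<le> L2" unfolding L2_def
              using C(1) by (intro member_le_sum[of i UNIV "\<lambda>i. \<Sum>k\<in>UNIV. C [k, i]"]) (auto intro!: sum_nonneg)
          qed (use d in auto)
          finally show "norm (\<Sum>k\<in>UNIV. h $ k * f [k, i] \<eta>) \<le> L2 * d * (2 / norm \<zeta>) * norm h" by (simp add: mult_ac)
        qed
      qed (use \<xi> \<rho> \<rho>_def in auto)
      also have "\<dots> \<le> (L2 * d * (2 / norm \<zeta>)) * (2 * (\<delta> * norm \<zeta>))"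
        using \<xi> L2 d by (intro mult_left_mono) (auto simp: dist_norm norm_minus_commute)
      also have "\<dots> = (4 * L2 * \<delta>) * d" using \<zeta> by simp
      also have "\<dots> \<le> c * d" using \<delta>2 d unfolding c_def by (intro mult_right_mono) auto
      finally show ?thesis by simp
    qed
    define g where "g \<xi> = ((1 - s) * f [i] \<zeta> + s * f [i] \<xi>) / (c * d)" for \<xi>
    \<comment> \<open>The successive derivatives of \<open>g\<close> along \<rho> e_i. The part of
      \<open>g\<close> frozen at \<zeta> is constant, so from order 1 on only the part with the
      factor \<open>s\<close> remains.\<close>
    define h where "h j \<xi> = (if j = 0 then g \<xi> else s * \<rho> ^ j * f (replicate (Suc j) i) \<xi> / (c * d))" for j \<xi>
    have cd: "c * d > 0" using c d by simp
    show "\<exists>i g. (\<forall>\<xi>\<in>?S. ((\<lambda>t. \<phi>s \<zeta> s x (\<xi> + t *\<^sub>R ((\<delta> * norm \<zeta>) *\<^sub>R axis i 1)) - \<phi>s \<zeta> s y (\<xi> + t *\<^sub>R ((\<delta> * norm \<zeta>) *\<^sub>R axis i 1)))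
            has_real_derivative (c * (\<delta> * norm \<zeta>) * norm (x - y)) * g \<xi>) (at 0)) \<and>
        (\<forall>\<xi>\<in>?S. 1 \<le> \<bar>g \<xi>\<bar>) \<and>
        dbd ?S ((\<delta> * norm \<zeta>) *\<^sub>R axis i 1) (Suc ?n) A (\<lambda>\<xi>. complex_of_real (g \<xi>))"
      unfolding \<rho>_def[symmetric] d_def[symmetric]
    proof (intro exI[of _ i] exI[of _ g] conjI ballI)
      fix \<xi> assume \<xi>: "\<xi> \<in> ball \<zeta> (2 * \<rho>)"
      then have \<xi>S: "\<xi> \<in> ?S" by (simp add: \<rho>_def)
      have "((\<lambda>t. (1 - s) * ((grad \<zeta> x - grad \<zeta> y) \<bullet> \<xi> + t * (\<rho> * f [i] \<zeta>)) + s * (G [] [] x (\<xi> + (t * \<rho>) *\<^sub>R axis i 1) - G [] [] y (\<xi> + (t * \<rho>) *\<^sub>R axis i 1)))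
          has_real_derivative (1 - s) * (\<rho> * f [i] \<zeta>) + s * (\<rho> * G [i] [] x \<xi> - \<rho> * G [i] [] y \<xi>)) (at 0)"
      proof -
        have "((\<lambda>t. (grad \<zeta> x - grad \<zeta> y) \<bullet> \<xi> + t * (\<rho> * f [i] \<zeta>)) has_real_derivative \<rho> * f [i] \<zeta>) (at 0)"
          by (auto intro!: derivative_eq_intros)
        from DERIV_add[OF DERIV_cmult[OF this] DERIV_cmult[OF DERIV_diff[OF G_deriv_\<xi>[OF S(2)[OF \<xi>S], of "[]" "[]" x \<rho> i] G_deriv_\<xi>[OF S(2)[OF \<xi>S], of "[]" "[]" y \<rho> i]]]]
        show ?thesis .
      qed
      moreover have "(1 - s) * (\<rho> * f [i] \<zeta>) + s * (\<rho> * G [i] [] x \<xi> - \<rho> * G [i] [] y \<xi>) = c * \<rho> * d * g \<xi>"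
      proof -
        have "(c * d) * g \<xi> = (1 - s) * f [i] \<zeta> + s * f [i] \<xi>" using c d by (simp add: g_def)
        then have "c * \<rho> * d * g \<xi> = \<rho> * ((1 - s) * f [i] \<zeta> + s * f [i] \<xi>)" by (simp add: mult_ac)
        then show ?thesis by (simp add: f_def algebra_simps)
      qed
      ultimately have 1: "((\<lambda>t. (1 - s) * ((grad \<zeta> x - grad \<zeta> y) \<bullet> \<xi> + t * (\<rho> * f [i] \<zeta>)) + s * (G [] [] x (\<xi> + (t * \<rho>) *\<^sub>R axis i 1) - G [] [] y (\<xi> + (t * \<rho>) *\<^sub>R axis i 1)))
          has_real_derivative c * \<rho> * d * g \<xi>) (at 0)" by simp
      have "eventually (\<lambda>t. \<xi> + t *\<^sub>R (\<rho> *\<^sub>R axis i 1) \<in> ball \<zeta> (2 * \<rho>)) (nhds (0::real))"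
        by (rule eventually_line_in(2)) (use \<xi> in auto)
      then have "eventually (\<lambda>t. (1 - s) * ((grad \<zeta> x - grad \<zeta> y) \<bullet> \<xi> + t * (\<rho> * f [i] \<zeta>)) + s * (G [] [] x (\<xi> + (t * \<rho>) *\<^sub>R axis i 1) - G [] [] y (\<xi> + (t * \<rho>) *\<^sub>R axis i 1))
        = \<phi>s \<zeta> s x (\<xi> + t *\<^sub>R (\<rho> *\<^sub>R axis i 1)) - \<phi>s \<zeta> s y (\<xi> + t *\<^sub>R (\<rho> *\<^sub>R axis i 1))) (nhds 0)"
      proof eventually_elim
        case (elim t)
        then have "\<xi> + (t * \<rho>) *\<^sub>R axis i 1 \<noteq> 0" using S(2) by (simp add: \<rho>_def)
        then show ?case
          by (simp add: \<phi>s_def \<phi>0_def G_Nil inner_add_right inner_diff_left inner_axis f_def grad_def algebra_simps)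
      qed
      from DERIV_cong_ev[OF refl this refl] 1
      show "((\<lambda>t. \<phi>s \<zeta> s x (\<xi> + t *\<^sub>R (\<rho> *\<^sub>R axis i 1)) - \<phi>s \<zeta> s y (\<xi> + t *\<^sub>R (\<rho> *\<^sub>R axis i 1))) has_real_derivative c * \<rho> * d * g \<xi>) (at 0)" by simp
      have "\<bar>(1 - s) * f [i] \<zeta> + s * f [i] \<xi>\<bar> \<ge> c * d"
      proof -
        have "\<bar>s * (f [i] \<xi> - f [i] \<zeta>)\<bar> \<le> 1 * (c * d)" unfolding abs_mult using s close[OF \<xi>S] by (intro mult_mono) auto
        moreover have "(1 - s) * f [i] \<zeta> + s * f [i] \<xi> = f [i] \<zeta> + s * (f [i] \<xi> - f [i] \<zeta>)" by (simp add: algebra_simps)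
        ultimately show ?thesis using f\<zeta> cd by linarith
      qed
      then show "1 \<le> \<bar>g \<xi>\<bar>" unfolding g_def abs_divide abs_of_pos[OF cd] using cd by (simp only: pos_le_divide_eq mult_1)
    next
      have Seq: "ball \<zeta> (2 * \<rho>) = ?S" by (simp add: \<rho>_def)
      have "dbd ?S (\<rho> *\<^sub>R axis i 1) (Suc ?n) A (\<lambda>\<xi>. complex_of_real (h 0 \<xi>))"
      proof (rule dbd_seqI[of _ _ "\<lambda>j \<xi>. complex_of_real (h j \<xi>)"])
        fix j assume j: "j \<le> Suc ?n"
        show "continuous_on ?S (\<lambda>\<xi>. complex_of_real (h j \<xi>))"
          unfolding h_def g_def f_def using cd by (cases "j = 0") (auto intro!: continuous_intros continuous_G_\<xi> S0)
        fix \<xi> assume \<xi>: "\<xi> \<in> ?S"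
        have fr: "\<rho> ^ j * \<bar>f (replicate (Suc j) i) \<xi>\<bar> \<le> C (replicate (Suc j) i) * 2 ^ j * d"
        proof -
          have "\<bar>f (replicate (Suc j) i) \<xi>\<bar> \<le> C (replicate (Suc j) i) * d * norm \<xi> powr (1 - real (length (replicate (Suc j) i)))"
            by (rule fb) (use \<xi> in auto)
          also have "norm \<xi> powr (1 - real (length (replicate (Suc j) i))) = (1 / norm \<xi>) ^ j"
            using S(2)[OF \<xi>] by (simp add: powr_minus_divide powr_realpow power_one_over)
          finally have "\<rho> ^ j * \<bar>f (replicate (Suc j) i) \<xi>\<bar> \<le> \<rho> ^ j * (C (replicate (Suc j) i) * d * (1 / norm \<xi>) ^ j)"
            using \<rho> by (intro mult_left_mono) auto
          also have "\<dots> = C (replicate (Suc j) i) * d * (\<rho> / norm \<xi>) ^ j" by (simp add: power_divide)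
          also have "\<dots> \<le> C (replicate (Suc j) i) * d * 2 ^ j"
          proof (intro mult_left_mono power_mono)
            have "\<rho> \<le> 1 * norm \<zeta>" unfolding \<rho>_def using \<delta> by (intro mult_right_mono) auto
            then show "\<rho> / norm \<xi> \<le> 2" using S[OF \<xi>] by (simp add: divide_le_eq)
          qed (use \<rho> C(1) d in auto)
          finally show ?thesis by (simp add: mult_ac)
        qed
        show "norm (complex_of_real (h j \<xi>)) \<le> A"
        proof (cases "j = 0")
          case True
          have \<zeta>S: "\<zeta> \<in> ?S" using \<rho> \<rho>_def by simp
          have b1: "\<bar>f [i] \<xi>\<bar> \<le> C [i] * d" "\<bar>f [i] \<zeta>\<bar> \<le> C [i] * d" using fb[of "[i]"] \<xi> \<zeta>S S(2) by auto
          have "\<bar>(1 - s) * f [i] \<zeta> + s * f [i] \<xi>\<bar> \<le> (1 - s) * (C [i] * d) + s * (C [i] * d)"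
            using s b1 by (intro order_trans[OF abs_triangle_ineq] add_mono) (auto simp: abs_mult intro!: mult_left_mono)
          also have "\<dots> = C [i] * d" by (simp add: algebra_simps)
          finally have "\<bar>g \<xi>\<bar> \<le> C [i] * d / (c * d)" unfolding g_def abs_divide abs_of_pos[OF cd] using cd by (intro divide_right_mono) auto
          then have "\<bar>g \<xi>\<bar> \<le> C [i] / c" using d by simp
          then show ?thesis using True Ai[of 0 i] by (simp add: h_def)
        next
          case False
          have "\<bar>h j \<xi>\<bar> = s * (\<rho> ^ j * \<bar>f (replicate (Suc j) i) \<xi>\<bar>) / (c * d)" using False s \<rho> c d by (simp add: h_def abs_mult)
          also have "\<dots> \<le> 1 * (C (replicate (Suc j) i) * 2 ^ j * d) / (c * d)"
            by (rule divide_right_mono[OF mult_mono]) (use s fr cd \<rho> in simp_all)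
          also have "\<dots> = C (replicate (Suc j) i) * 2 ^ j / c" using d by simp
          also have "\<dots> \<le> A" by (rule Ai[OF j])
          finally show ?thesis by simp
        qed
      next
        fix j \<xi> assume j: "j < Suc ?n" and \<xi>: "\<xi> \<in> ?S"
        have fd: "((\<lambda>t. f \<alpha> (\<xi> + (t * \<rho>) *\<^sub>R axis i 1)) has_real_derivative \<rho> * f (i # \<alpha>) \<xi>) (at 0)" for \<alpha>
          unfolding f_def right_diff_distrib by (intro DERIV_diff G_deriv_\<xi> S(2)[OF \<xi>])
        have "((\<lambda>t. h j (\<xi> + t *\<^sub>R (\<rho> *\<^sub>R axis i 1))) has_real_derivative h (Suc j) \<xi>) (at 0)"
        proof (cases "j = 0")
          case True
          have "((\<lambda>t. ((1 - s) * f [i] \<zeta> + s * f [i] (\<xi> + (t * \<rho>) *\<^sub>R axis i 1)) / (c * d)) has_real_derivative (s * (\<rho> * f (i # [i]) \<xi>)) / (c * d)) (at 0)"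
            using cd by (intro DERIV_cdivide) (auto intro!: derivative_eq_intros fd)
          then show ?thesis using True by (simp add: h_def g_def mult_ac)
        next
          case False
          have "((\<lambda>t. s * \<rho> ^ j * f (replicate (Suc j) i) (\<xi> + (t * \<rho>) *\<^sub>R axis i 1) / (c * d)) has_real_derivative (s * \<rho> ^ j * (\<rho> * f (i # replicate (Suc j) i) \<xi>)) / (c * d)) (at 0)"
            by (intro DERIV_cdivide DERIV_cmult fd)
          then show ?thesis using False by (simp add: h_def mult_ac)
        qed
        then show "((\<lambda>t. complex_of_real (h j (\<xi> + t *\<^sub>R (\<rho> *\<^sub>R axis i 1)))) has_vector_derivative complex_of_real (h (Suc j) \<xi>)) (at 0)"
          by (rule has_vector_derivative_of_real)
      qed
      then show "dbd (ball \<zeta> (2 * \<rho>)) (\<rho> *\<^sub>R axis i 1) (Suc ?n) A (\<lambda>\<xi>. complex_of_real (g \<xi>))"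
        unfolding Seq by (simp add: h_def)
    qed
  qed
  then show ?thesis using \<delta> c A0 by blast
qed

end

section \<open>Decomposition of the frequency space\<close>

lemma norm_integral_cells:
  fixes h :: "'a::euclidean_space \<Rightarrow> complex"
  assumes N: "finite N" and m: "\<And>\<nu>. \<nu> \<in> N \<Longrightarrow> {\<xi>. \<kappa> \<xi> = \<nu>} \<in> sets borel"
    and h: "\<And>\<xi>. h \<xi> \<noteq> 0 \<Longrightarrow> \<kappa> \<xi> \<in> N"
  shows "norm (\<integral>\<xi>. h \<xi> \<partial>lborel) \<le> (\<Sum>\<nu>\<in>N. norm (\<integral>\<xi>. (if \<kappa> \<xi> = \<nu> then h \<xi> else 0) \<partial>lborel))"
proof (cases "integrable lborel h")
  case False
  then show ?thesis by (simp add: not_integrable_integral_eq sum_nonneg)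
next
  case True
  have "h \<xi> = (\<Sum>\<nu>\<in>N. if \<kappa> \<xi> = \<nu> then h \<xi> else 0)" for \<xi>
    using h[of \<xi>] N by (cases "h \<xi> = 0") auto
  then have "(\<integral>\<xi>. h \<xi> \<partial>lborel) = (\<integral>\<xi>. (\<Sum>\<nu>\<in>N. if \<kappa> \<xi> = \<nu> then h \<xi> else 0) \<partial>lborel)" by simp
  also have "\<dots> = (\<Sum>\<nu>\<in>N. \<integral>\<xi>. (if \<kappa> \<xi> = \<nu> then h \<xi> else 0) \<partial>lborel)"
  proof (rule Bochner_Integration.integral_sum)
    fix \<nu> assume \<nu>: "\<nu> \<in> N"
    have "(\<lambda>\<xi>. if \<kappa> \<xi> = \<nu> then h \<xi> else 0) = (\<lambda>\<xi>. indicator {\<xi>. \<kappa> \<xi> = \<nu>} \<xi> *\<^sub>R h \<xi>)"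
      by (auto split: split_indicator)
    then show "integrable lborel (\<lambda>\<xi>. if \<kappa> \<xi> = \<nu> then h \<xi> else 0)"
      using integrable_mult_indicator[OF _ True, of "{\<xi>. \<kappa> \<xi> = \<nu>}"] m[OF \<nu>] by simp
  qed
  finally show ?thesis by (simp add: norm_sum)
qed

text \<open>For non-integrable \<open>h\<close> the left side is 0 by the convention for the Bochner
  integral. The bound can thus be used at every \<open>x\<close>, even where the symbol is not
  integrable against \<open>F\<close>.\<close>

lemma norm_integral_shells:
  fixes h :: "'a::euclidean_space \<Rightarrow> complex" and \<kappa> :: "'a \<Rightarrow> nat"
  assumes m: "\<And>k. {\<xi>. \<kappa> \<xi> = k} \<in> sets borel"
  shows "ennreal (norm (\<integral>\<xi>. h \<xi> \<partial>lborel)) \<le> (\<Sum>k. ennreal (norm (\<integral>\<xi>. (if \<kappa> \<xi> = k then h \<xi> else 0) \<partial>lborel)))"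
proof (cases "integrable lborel h")
  case False
  then show ?thesis by (simp add: not_integrable_integral_eq)
next
  case True
  let ?h = "\<lambda>k \<xi>. if \<kappa> \<xi> = k then h \<xi> else 0"
  have eq: "?h k = (\<lambda>\<xi>. indicator {\<xi>. \<kappa> \<xi> = k} \<xi> *\<^sub>R h \<xi>)" for k by (auto split: split_indicator)
  have i: "integrable lborel (?h k)" for k
    unfolding eq using integrable_mult_indicator[OF _ True, of "{\<xi>. \<kappa> \<xi> = k}"] m by simp
  have [measurable]: "h \<in> borel_measurable borel" using True by auto
  have [measurable]: "{\<xi>. \<kappa> \<xi> = k} \<in> sets borel" for k by (rule m)
  have s1: "(\<lambda>k. ?h k \<xi>) sums h \<xi>" for \<xi> using sums_single[of "\<kappa> \<xi>" "\<lambda>_. h \<xi>"] by (simp add: eq_commute)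
  have s2: "(\<lambda>k. norm (?h k \<xi>)) sums norm (h \<xi>)" for \<xi>
    using sums_single[of "\<kappa> \<xi>" "\<lambda>_. norm (h \<xi>)"] by (simp add: eq_commute if_distrib cong: if_cong)
  have "(\<Sum>k. ennreal (\<integral>\<xi>. norm (?h k \<xi>) \<partial>lborel)) = (\<Sum>k. \<integral>\<^sup>+\<xi>. ennreal (norm (?h k \<xi>)) \<partial>lborel)"
    using i by (intro suminf_cong nn_integral_eq_integral[symmetric]) auto
  also have "\<dots> = (\<integral>\<^sup>+\<xi>. (\<Sum>k. ennreal (norm (?h k \<xi>))) \<partial>lborel)"
  proof (rule nn_integral_suminf[symmetric])
    fix k
    have "?h k \<in> borel_measurable lborel" using i by (rule borel_measurable_integrable)
    then show "(\<lambda>\<xi>. ennreal (norm (?h k \<xi>))) \<in> borel_measurable lborel" by measurable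
  qed
  also have "\<dots> = (\<integral>\<^sup>+\<xi>. ennreal (norm (h \<xi>)) \<partial>lborel)"
    using s2 by (intro nn_integral_cong) (simp add: suminf_ennreal2 sums_iff)
  also have "\<dots> < \<infinity>" using True by (simp add: integrable_iff_bounded)
  finally have sn: "summable (\<lambda>k. \<integral>\<xi>. norm (?h k \<xi>) \<partial>lborel)"
    by (intro summable_suminf_not_top) auto
  have "(\<integral>\<xi>. h \<xi> \<partial>lborel) = (\<integral>\<xi>. (\<Sum>k. ?h k \<xi>) \<partial>lborel)" using s1 by (simp add: sums_iff)
  also have "\<dots> = (\<Sum>k. \<integral>\<xi>. ?h k \<xi> \<partial>lborel)"
    by (rule integral_suminf[OF i _ sn]) (use s2 in \<open>auto simp: sums_iff\<close>)
  finally have e: "(\<integral>\<xi>. h \<xi> \<partial>lborel) = (\<Sum>k. \<integral>\<xi>. ?h k \<xi> \<partial>lborel)" .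
  have sn': "summable (\<lambda>k. norm (\<integral>\<xi>. ?h k \<xi> \<partial>lborel))"
    by (rule summable_comparison_test'[OF sn, of 0]) (simp add: integral_norm_bound)
  have "norm (\<integral>\<xi>. h \<xi> \<partial>lborel) \<le> (\<Sum>k. norm (\<integral>\<xi>. ?h k \<xi> \<partial>lborel))"
    unfolding e by (rule summable_norm[OF sn'])
  then show ?thesis using sn' by (subst suminf_ennreal2) (auto intro: ennreal_leI)
qed

lemma Lr_le_2_real:
  assumes "Lr_le M 2 F f" "0 < f"
  obtains q where "0 \<le> q" "q \<le> f\<^sup>2" "(\<integral>\<^sup>+\<xi>. ennreal ((norm (F \<xi>))\<^sup>2) \<partial>M) = ennreal q"
proof -
  have le: "(\<integral>\<^sup>+\<xi>. ennreal ((norm (F \<xi>))\<^sup>2) \<partial>M) \<le> ennreal (f\<^sup>2)" using assms by (simp add: Lr_le_def)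
  then have fin: "(\<integral>\<^sup>+\<xi>. ennreal ((norm (F \<xi>))\<^sup>2) \<partial>M) \<noteq> top" by (auto simp: top_unique)
  define q where "q = enn2real (\<integral>\<^sup>+\<xi>. ennreal ((norm (F \<xi>))\<^sup>2) \<partial>M)"
  have eq: "(\<integral>\<^sup>+\<xi>. ennreal ((norm (F \<xi>))\<^sup>2) \<partial>M) = ennreal q" using fin by (simp add: q_def ennreal_enn2real_if)
  have "ennreal q \<le> ennreal (f\<^sup>2)" using le unfolding eq .
  then have "q \<le> f\<^sup>2" by (subst (asm) ennreal_le_iff) auto
  moreover have "0 \<le> q" unfolding q_def by (rule enn2real_nonneg)
  ultimately show thesis using eq that by blast
qed

text \<open>Only the pieces of \<open>F\<close> are orthogonal. Their images are added by the
  triangle inequality, and Cauchy-Schwarz over the pieces costs the square root of their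
  number.\<close>

lemma Lr_le_cells:
  fixes F :: "'a::euclidean_space \<Rightarrow> complex" and \<kappa> :: "'a \<Rightarrow> 'i"
  assumes M: "sigma_finite_measure M" and r: "1 \<le> r" and v: "v \<in> borel_measurable M"
    and N: "finite N" "N \<noteq> {}" and F: "Lr_le lborel 2 F f" and f: "0 < f" and A: "0 < A"
    and m: "\<And>\<nu>. \<nu> \<in> N \<Longrightarrow> {\<xi>. \<kappa> \<xi> = \<nu>} \<in> sets borel"
    and u: "\<And>\<nu> f'. \<nu> \<in> N \<Longrightarrow> 0 < f' \<Longrightarrow> Lr_le lborel 2 (\<lambda>\<xi>. if \<kappa> \<xi> = \<nu> then F \<xi> else 0) f' \<Longrightarrow> Lr_le M r (u \<nu>) (A * f')"
    and le: "AE x in M. norm (v x) \<le> (\<Sum>\<nu>\<in>N. norm (u \<nu> x))"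
  shows "Lr_le M r v (2 * A * sqrt (card N) * f)"
proof -
  let ?F = "\<lambda>\<nu> \<xi>. if \<kappa> \<xi> = \<nu> then F \<xi> else 0"
  have [measurable]: "F \<in> borel_measurable lborel" using F by (simp add: Lr_le_def)
  have eq: "?F \<nu> = (\<lambda>\<xi>. indicator {\<xi>. \<kappa> \<xi> = \<nu>} \<xi> *\<^sub>R F \<xi>)" for \<nu> by (auto split: split_indicator)
  have Fm: "?F \<nu> \<in> borel_measurable lborel" if "\<nu> \<in> N" for \<nu>
  proof -
    have [measurable]: "{\<xi>. \<kappa> \<xi> = \<nu>} \<in> sets borel" by (rule m[OF that])
    show ?thesis unfolding eq by measurable
  qed
  have FL: "Lr_le lborel 2 (?F \<nu>) f" if "\<nu> \<in> N" for \<nu>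
    by (rule Lr_le_mono[OF F Fm[OF that]]) (use f in auto)
  have "\<forall>\<nu>\<in>N. \<exists>q\<ge>0. (\<integral>\<^sup>+\<xi>. ennreal ((norm (?F \<nu> \<xi>))\<^sup>2) \<partial>lborel) = ennreal q"
    using Lr_le_2_real[OF FL f] by metis
  then obtain q where q: "\<And>\<nu>. \<nu> \<in> N \<Longrightarrow> q \<nu> \<ge> 0" "\<And>\<nu>. \<nu> \<in> N \<Longrightarrow> (\<integral>\<^sup>+\<xi>. ennreal ((norm (?F \<nu> \<xi>))\<^sup>2) \<partial>lborel) = ennreal (q \<nu>)"
    by metis
  have sq: "sum q N \<le> f\<^sup>2"
  proof -
    have "ennreal (sum q N) = (\<Sum>\<nu>\<in>N. ennreal (q \<nu>))" using q(1) by (intro sum_ennreal[symmetric]) auto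
    also have "\<dots> = (\<Sum>\<nu>\<in>N. \<integral>\<^sup>+\<xi>. ennreal ((norm (?F \<nu> \<xi>))\<^sup>2) \<partial>lborel)" by (intro sum.cong refl) (simp add: q(2))
    also have "\<dots> = (\<integral>\<^sup>+\<xi>. (\<Sum>\<nu>\<in>N. ennreal ((norm (?F \<nu> \<xi>))\<^sup>2)) \<partial>lborel)"
    proof (rule nn_integral_sum[symmetric])
      fix \<nu> assume "\<nu> \<in> N"
      from Fm[OF this] show "(\<lambda>\<xi>. ennreal ((norm (?F \<nu> \<xi>))\<^sup>2)) \<in> borel_measurable lborel" by measurable
    qed
    also have "\<dots> \<le> (\<integral>\<^sup>+\<xi>. ennreal ((norm (F \<xi>))\<^sup>2) \<partial>lborel)"
    proof (rule nn_integral_mono)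
      fix \<xi>
      have "(\<Sum>\<nu>\<in>N. ennreal ((norm (?F \<nu> \<xi>))\<^sup>2)) = (\<Sum>\<nu>\<in>N. if \<kappa> \<xi> = \<nu> then ennreal ((norm (F \<xi>))\<^sup>2) else 0)"
        by (intro sum.cong) auto
      also have "\<dots> \<le> ennreal ((norm (F \<xi>))\<^sup>2)" using N by simp
      finally show "(\<Sum>\<nu>\<in>N. ennreal ((norm (?F \<nu> \<xi>))\<^sup>2)) \<le> ennreal ((norm (F \<xi>))\<^sup>2)" .
    qed
    also have "\<dots> \<le> ennreal (f\<^sup>2)" using F f by (simp add: Lr_le_def)
    finally show ?thesis by (subst (asm) ennreal_le_iff) auto
  qed
  define c where "c = sqrt (card N)"
  have c: "c > 0" "c * c = card N" using N by (auto simp: c_def card_gt_0_iff)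
  \<comment> \<open>The summand \<open>f\<^sup>2 / card N\<close> makes every bound positive, as
    \<open>u\<close> demands, even if \<open>F\<close> vanishes on the cell. In total it adds only
    \<open>f\<^sup>2\<close> to the sum of squares.\<close>
  define F' where "F' \<nu> = sqrt (q \<nu> + f\<^sup>2 / card N)" for \<nu>
  have n0: "real (card N) > 0" using N by (simp add: card_gt_0_iff)
  have F'0: "F' \<nu> > 0" if "\<nu> \<in> N" for \<nu> using q(1)[OF that] f n0 by (auto simp: F'_def intro!: add_nonneg_pos)
  have F'2: "(F' \<nu>)\<^sup>2 = q \<nu> + f\<^sup>2 / card N" if "\<nu> \<in> N" for \<nu>
    using q(1)[OF that] f n0 unfolding F'_def by (intro real_sqrt_pow2) (auto intro!: add_nonneg_nonneg)
  have "Lr_le lborel 2 (?F \<nu>) (F' \<nu>)" if "\<nu> \<in> N" for \<nu>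
    using Fm[OF that] q(2)[OF that] F'2[OF that] F'0[OF that] f by (simp add: Lr_le_def ennreal_leI)
  then have "Lr_le M r (u \<nu>) (A * F' \<nu>)" if "\<nu> \<in> N" for \<nu> using u that F'0 by blast
  then have L: "Lr_le M r v (\<Sum>\<nu>\<in>N. A * F' \<nu>)"
    using A F'0 by (intro Lr_le_sum[OF M r v N le]) auto
  \<comment> \<open>Cauchy-Schwarz as a weighted arithmetic-geometric mean. Since the squares add up
    to at most \<open>2 * f\<^sup>2\<close>, summation gives \<open>3/2 * c * f\<close>, rounded up
    to \<open>2 * c * f\<close>.\<close>
  have "F' \<nu> \<le> (c * (F' \<nu>)\<^sup>2 / f + f / c) / 2" if "\<nu> \<in> N" for \<nu>
  proof -
    have "0 \<le> (c * F' \<nu> - f)\<^sup>2 / (c * f)" using c f by simp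
    also have "\<dots> = c * (F' \<nu>)\<^sup>2 / f + f / c - 2 * F' \<nu>" using c(1) f by (simp add: power2_eq_square field_simps)
    finally show ?thesis by simp
  qed
  then have "sum F' N \<le> (\<Sum>\<nu>\<in>N. (c * (F' \<nu>)\<^sup>2 / f + f / c) / 2)" by (rule sum_mono)
  also have "\<dots> = (c * (\<Sum>\<nu>\<in>N. (F' \<nu>)\<^sup>2) / f + card N * (f / c)) / 2"
    by (simp add: sum_divide_distrib[symmetric] sum.distrib sum_distrib_left)
  also have "(\<Sum>\<nu>\<in>N. (F' \<nu>)\<^sup>2) = sum q N + f\<^sup>2"
    using n0 by (simp add: F'2 sum.distrib)
  also have "(c * (sum q N + f\<^sup>2) / f + card N * (f / c)) / 2 \<le> (c * (2 * f\<^sup>2) / f + card N * (f / c)) / 2"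
    using sq c f by (intro divide_right_mono add_right_mono mult_left_mono) auto
  also have "\<dots> = 3/2 * c * f" using c f by (simp add: c(2)[symmetric] power2_eq_square field_simps)
  also have "\<dots> \<le> 2 * c * f" using c f by simp
  finally have "(\<Sum>\<nu>\<in>N. A * F' \<nu>) \<le> A * (2 * c * f)" using A by (simp add: sum_distrib_left[symmetric])
  then have "(\<Sum>\<nu>\<in>N. A * F' \<nu>) \<le> 2 * A * sqrt (card N) * f" by (simp add: c_def mult_ac)
  moreover have "0 \<le> (\<Sum>\<nu>\<in>N. A * F' \<nu>)"
    by (intro sum_nonneg mult_nonneg_nonneg) (use A F'0 less_imp_le in blast)+
  ultimately show ?thesis
    using Lr_le_mono[OF L v _ _ _ order_trans[OF zero_le_one r], of "2 * A * sqrt (card N) * f"] by simp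
qed

lemma norm_cube_diff:
  fixes \<xi> :: "real^'n::finite" and l :: real
  assumes "\<xi> \<in> cube c l"
  shows "norm (\<xi> - c) \<le> CARD('n) * l"
proof -
  have "norm (\<xi> - c) \<le> (\<Sum>i\<in>UNIV. \<bar>(\<xi> - c) $ i\<bar>)" by (rule norm_le_l1_cart)
  also have "\<dots> \<le> (\<Sum>i\<in>(UNIV::'n set). l)"
  proof (rule sum_mono)
    fix i
    have "c $ i \<le> \<xi> $ i \<and> \<xi> $ i \<le> c $ i + l" using assms by (simp add: cube_def)
    then show "\<bar>(\<xi> - c) $ i\<bar> \<le> l" by auto
  qed
  finally show ?thesis by simp
qed

definition cell :: "real \<Rightarrow> real^'n \<Rightarrow> ('n::finite \<Rightarrow> int)" where
  "cell l \<xi> = (\<lambda>i. \<lfloor>\<xi> $ i / l\<rfloor>)"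

definition corner :: "real \<Rightarrow> ('n \<Rightarrow> int) \<Rightarrow> real^'n::finite" where
  "corner l \<nu> = (\<chi> i. l * \<nu> i)"

lemma cell_in_cube: "0 < l \<Longrightarrow> \<xi> \<in> cube (corner l (cell l \<xi>)) l"
proof -
  assume l: "0 < l"
  have "l * \<lfloor>\<xi> $ i / l\<rfloor> \<le> \<xi> $ i \<and> \<xi> $ i \<le> l * \<lfloor>\<xi> $ i / l\<rfloor> + l" for i
  proof -
    have "of_int \<lfloor>\<xi> $ i / l\<rfloor> \<le> \<xi> $ i / l" "\<xi> $ i / l \<le> of_int \<lfloor>\<xi> $ i / l\<rfloor> + 1" by linarith+
    then have "of_int \<lfloor>\<xi> $ i / l\<rfloor> * l \<le> \<xi> $ i" "\<xi> $ i \<le> (of_int \<lfloor>\<xi> $ i / l\<rfloor> + 1) * l"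
      using l by (simp_all only: pos_le_divide_eq pos_divide_le_eq)
    then show ?thesis by (simp add: distrib_left mult.commute[of _ l])
  qed
  then show ?thesis by (simp add: cube_def corner_def cell_def)
qed

text \<open>The window of indices met by the ball whose radius is \<open>q\<close> times the side of
  a cell, generous by one at the lower end.\<close>

definition cells :: "real \<Rightarrow> ('n::finite \<Rightarrow> int) set" where
  "cells q = PiE UNIV (\<lambda>_. {-\<lceil>q\<rceil> - 1..\<lceil>q\<rceil>})"

lemma finite_cells: "finite (cells q)" by (auto simp: cells_def intro!: finite_PiE)

lemma card_cells: "0 \<le> q \<Longrightarrow> real (card (cells q :: ('n::finite \<Rightarrow> int) set)) \<le> (2 * q + 4) ^ CARD('n)"
proof -
  assume q: "0 \<le> q"
  have "0 \<le> \<lceil>q\<rceil>" using q by simp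
  then have "card (cells q :: ('n \<Rightarrow> int) set) = nat (2 * \<lceil>q\<rceil> + 2) ^ CARD('n)"
    unfolding cells_def by (subst card_PiE) (auto simp: prod_constant add.commute)
  moreover have "real (nat (2 * \<lceil>q\<rceil> + 2)) \<le> 2 * q + 4" using \<open>0 \<le> \<lceil>q\<rceil>\<close> by (simp, linarith)
  ultimately show ?thesis by (simp add: power_mono)
qed

lemma cells_nonempty: "0 \<le> q \<Longrightarrow> cells q \<noteq> {}"
proof -
  assume "0 \<le> q"
  then have "0 \<le> \<lceil>q\<rceil>" by simp
  then have "0 \<in> {-\<lceil>q\<rceil> - 1..\<lceil>q\<rceil>}" unfolding atLeastAtMost_iff by linarith
  then have "(\<lambda>_. 0) \<in> cells q" unfolding cells_def by (intro PiE_I) blast+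
  then show ?thesis by blast
qed

lemma cell_in_cells:
  assumes "0 < l" "norm \<xi> \<le> q * l" shows "cell l \<xi> \<in> cells q"
proof -
  have "- \<lceil>q\<rceil> - 1 \<le> \<lfloor>\<xi> $ i / l\<rfloor> \<and> \<lfloor>\<xi> $ i / l\<rfloor> \<le> \<lceil>q\<rceil>" for i
  proof -
    have "\<bar>\<xi> $ i\<bar> \<le> q * l" using component_le_norm_cart[of \<xi> i] assms(2) by linarith
    then have "\<bar>\<xi> $ i / l\<bar> \<le> q" using assms(1) by (simp add: abs_divide divide_le_eq)
    then show ?thesis by linarith
  qed
  then show ?thesis by (auto simp: cells_def cell_def)
qed

lemma cell_measurable: "{\<xi>::real^'n::finite. cell l \<xi> = \<nu>} \<in> sets borel"
proof -
  have eq: "{\<xi>::real^'n. cell l \<xi> = \<nu>} = (\<Inter>i\<in>UNIV. {\<xi>. \<lfloor>\<xi> $ i / l\<rfloor> = \<nu> i})"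
    by (auto simp: cell_def fun_eq_iff)
  have "{\<xi>::real^'n. \<lfloor>\<xi> $ i / l\<rfloor> = \<nu> i} \<in> sets borel" for i
  proof -
    have [measurable]: "(\<lambda>p::real^'n. p $ i) \<in> borel_measurable borel"
      by (intro borel_measurable_continuous_onI continuous_intros)
    show ?thesis by measurable
  qed
  then show ?thesis unfolding eq by (intro sets.finite_INT) auto
qed

section \<open>Comparison with the linearised phase\<close>

text \<open>Minkowski's inequality on the unit interval, used for the parameter that interpolates
  between two phases.\<close>

lemma Lr_le_average:
  assumes M: "sigma_finite_measure M" and r: "1 \<le> r" and C: "0 < C" and u: "u \<in> borel_measurable M"
    and Wm: "(\<lambda>(x, s). W s x) \<in> borel_measurable (M \<Otimes>\<^sub>M lborel)"
    and W: "\<And>s. s \<in> {0..1::real} \<Longrightarrow> Lr_le M r (W s) C"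
    and le: "AE x in M. ennreal (norm (u x)) \<le> (\<integral>\<^sup>+s. ennreal (norm (W s x)) * indicator {0..1} s \<partial>lborel)"
  shows "Lr_le M r u C"
proof -
  let ?N = "restrict_space lborel {0..1::real}"
  show ?thesis
  proof (rule minkowski_integral[where N = ?N and h = "\<lambda>x s. norm (W s x)" and A = "\<lambda>_. C"])
    show "sigma_finite_measure ?N"
    proof -
      have "finite_measure ?N" by (rule finite_measureI) (simp add: emeasure_restrict_space)
      then show ?thesis by (rule finite_measure.axioms(1))
    qed
    note W' [measurable (raw)] = measurable_case_prod_compose[OF Wm]
    have "(\<lambda>z. norm (W (snd z) (fst z))) \<in> borel_measurable (M \<Otimes>\<^sub>M lborel)" by measurable
    moreover have "(\<lambda>z. (fst z, snd z)) \<in> measurable (M \<Otimes>\<^sub>M ?N) (M \<Otimes>\<^sub>M lborel)"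
      by (intro measurable_Pair measurable_fst measurable_compose[OF measurable_snd] measurable_restrict_space1) auto
    ultimately show "(\<lambda>(x, s). norm (W s x)) \<in> borel_measurable (M \<Otimes>\<^sub>M ?N)"
      using measurable_compose[of "\<lambda>z. (fst z, snd z)" "M \<Otimes>\<^sub>M ?N" "M \<Otimes>\<^sub>M lborel" "\<lambda>z. norm (W (snd z) (fst z))" borel]
      by (simp add: split_beta')
    show "(\<integral>\<^sup>+ s. ennreal C \<partial>?N) \<le> ennreal C" by (simp add: emeasure_restrict_space)
    show "(\<integral>\<^sup>+ x. ennreal (norm (W s x) powr r) \<partial>M) \<le> ennreal (C powr r)" if "s \<in> space ?N" for s
      using W[of s] that by (simp add: space_restrict_space Lr_le_def)
    show "AE x in M. ennreal (norm (u x)) \<le> (\<integral>\<^sup>+ s. ennreal (norm (W s x)) \<partial>?N)"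
      using le by (simp add: nn_integral_restrict_space)
  qed (use M r C u in auto)
qed

lemma Lr_le_0: "0 \<le> r \<Longrightarrow> 0 \<le> A \<Longrightarrow> Lr_le M r (\<lambda>_. 0) A"
  by (simp add: Lr_le_def)

lemma Lr_le_mult_bounded:
  assumes u: "Lr_le M r u f" and f: "0 \<le> f" and r: "0 \<le> r" and b: "b \<in> borel_measurable M" "\<And>x. norm (b x) \<le> D"
  shows "Lr_le M r (\<lambda>x. b x * u x) (D * f)"
proof -
  have D: "0 \<le> D" using b(2) norm_ge_zero order_trans by blast
  have [measurable]: "u \<in> borel_measurable M" "b \<in> borel_measurable M" using u b by (auto simp: Lr_le_def)
  have "Lr_le M r (\<lambda>x. complex_of_real D * u x) (D * f)" using Lr_le_scale[OF u f, of "complex_of_real D"] D by simp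
  then show ?thesis
    by (rule Lr_le_mono) (use D f r b(2) in \<open>auto simp: norm_mult intro!: mult_right_mono\<close>)
qed

lemma floor_log_bounds:
  assumes "0 < x" shows "2 powr \<lfloor>log 2 x\<rfloor> \<le> x" "x < 2 powr (\<lfloor>log 2 x\<rfloor> + 1)"
proof -
  have "2 powr \<lfloor>log 2 x\<rfloor> \<le> 2 powr (log 2 x)" by (intro powr_mono) auto
  then show "2 powr \<lfloor>log 2 x\<rfloor> \<le> x" using assms by simp
  have "2 powr (log 2 x) < 2 powr (\<lfloor>log 2 x\<rfloor> + 1)" by (intro powr_less_mono) linarith+
  then show "x < 2 powr (\<lfloor>log 2 x\<rfloor> + 1)" using assms by simp
qed

definition low_shell :: "'a::real_normed_vector \<Rightarrow> nat" where
  "low_shell \<xi> = nat (- \<lfloor>log 2 (norm \<xi>)\<rfloor>)"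

lemma low_shell_bounds:
  assumes "0 < norm \<xi>" "norm \<xi> < 1"
  shows "(1/2) ^ low_shell \<xi> \<le> norm \<xi>" "norm \<xi> < 2 * (1/2) ^ low_shell \<xi>"
proof -
  have "log 2 (norm \<xi>) < 0" using assms by simp
  then have n: "\<lfloor>log 2 (norm \<xi>)\<rfloor> < 0" by simp
  have eq: "(1/2) ^ low_shell \<xi> = 2 powr \<lfloor>log 2 (norm \<xi>)\<rfloor>"
  proof -
    have "real (low_shell \<xi>) = - of_int \<lfloor>log 2 (norm \<xi>)\<rfloor>" using n by (simp add: low_shell_def)
    then have "2 powr \<lfloor>log 2 (norm \<xi>)\<rfloor> = 2 powr (- real (low_shell \<xi>))" by simp
    also have "\<dots> = (1/2) ^ low_shell \<xi>" by (simp add: powr_minus powr_realpow power_one_over inverse_eq_divide)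
    finally show ?thesis by simp
  qed
  show "(1/2) ^ low_shell \<xi> \<le> norm \<xi>" using floor_log_bounds(1)[OF assms(1)] eq by simp
  show "norm \<xi> < 2 * (1/2) ^ low_shell \<xi>" using floor_log_bounds(2)[OF assms(1)] eq by (simp add: powr_add)
qed

lemma low_shell_measurable: "{\<xi>::'a::euclidean_space. low_shell \<xi> = k} \<in> sets borel"
  unfolding low_shell_def by measurable

text \<open>Second \<xi>-derivatives are of order 1 / |\<zeta>| on a ball of radius |\<zeta>| / 2,
  so the gradient varies by a bounded amount there, uniformly in \<open>x\<close>. The condition on
  \<open>E\<close> stands inside the quantifiers so that \<open>choice\<close> yields a family over
  \<open>i\<close> directly.\<close>

lemma (in phase) G_increment_bound:
  "\<exists>E. \<forall>\<zeta> \<sigma> x. 0 \<le> E \<and> (\<zeta> \<noteq> 0 \<longrightarrow> norm (\<sigma> - \<zeta>) < norm \<zeta> / 2 \<longrightarrow> \<bar>G [i] [] x \<sigma> - G [i] [] x \<zeta>\<bar> \<le> E)"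
proof -
  have "\<forall>k. \<exists>C\<ge>0. \<forall>x \<xi>. \<xi> \<noteq> 0 \<longrightarrow> \<bar>G [k, i] [] x \<xi>\<bar> \<le> C * norm \<xi> powr (1 - real (length [k, i]))"
    using G_bound[of "[k, i]" "[]" for k] by simp
  then obtain C where C: "\<And>k. C k \<ge> 0" "\<And>k x \<xi>. \<xi> \<noteq> 0 \<Longrightarrow> \<bar>G [k, i] [] x \<xi>\<bar> \<le> C k * norm \<xi> powr (1 - real (length [k, i]))"
    by metis
  define E where "E = sum C UNIV"
  have E: "0 \<le> E" unfolding E_def using C(1) by (intro sum_nonneg) auto
  have "\<bar>G [i] [] x \<sigma> - G [i] [] x \<zeta>\<bar> \<le> E" if \<zeta>: "\<zeta> \<noteq> 0" and \<sigma>: "norm (\<sigma> - \<zeta>) < norm \<zeta> / 2" for \<zeta> \<sigma> x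
  proof -
    let ?S = "ball \<zeta> (norm \<zeta> / 2)"
    have S: "norm \<zeta> / 2 \<le> norm \<eta>" "\<eta> \<noteq> 0" if "\<eta> \<in> ?S" for \<eta>
    proof -
      have "norm \<zeta> \<le> norm \<eta> + norm (\<zeta> - \<eta>)" using norm_triangle_sub[of \<zeta> \<eta>] by simp
      then show "norm \<zeta> / 2 \<le> norm \<eta>" using that by (simp add: dist_norm)
      then show "\<eta> \<noteq> 0" using \<zeta> by auto
    qed
    have "norm (G [i] [] x \<sigma> - G [i] [] x \<zeta>) \<le> (E * (2 / norm \<zeta>)) * norm (\<sigma> - \<zeta>)"
    proof (rule differentiable_bound[where S = ?S and f' = "\<lambda>\<eta> h. \<Sum>k\<in>UNIV. h $ k * G [k, i] [] x \<eta>"])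
      fix \<eta> assume \<eta>: "\<eta> \<in> ?S"
      show "(G [i] [] x has_derivative (\<lambda>h. \<Sum>k\<in>UNIV. h $ k * G [k, i] [] x \<eta>)) (at \<eta> within ?S)"
        using G_has_derivative_\<xi>[OF S(2)[OF \<eta>], of "[i]" "[]" x] by (rule has_derivative_at_withinI)
      show "onorm (\<lambda>h. \<Sum>k\<in>UNIV. h $ k * G [k, i] [] x \<eta>) \<le> E * (2 / norm \<zeta>)"
      proof (rule onorm_le)
        fix h :: "real^'n"
        have b: "\<bar>G [k, i] [] x \<eta>\<bar> \<le> C k * (2 / norm \<zeta>)" for k
        proof -
          have "\<bar>G [k, i] [] x \<eta>\<bar> \<le> C k * norm \<eta> powr (1 - real (length [k, i]))" by (rule C(2)[OF S(2)[OF \<eta>]])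
          also have "norm \<eta> powr (1 - real (length [k, i])) = 1 / norm \<eta>" using S(2)[OF \<eta>] by (simp add: powr_minus_divide)
          also have "C k * (1 / norm \<eta>) \<le> C k * (2 / norm \<zeta>)"
            using S[OF \<eta>] C(1)[of k] \<zeta> by (intro mult_left_mono) (auto simp: field_simps)
          finally show ?thesis .
        qed
        have "norm (\<Sum>k\<in>UNIV. h $ k * G [k, i] [] x \<eta>) \<le> (\<Sum>k\<in>UNIV. norm h * (C k * (2 / norm \<zeta>)))"
        proof (rule sum_norm_le)
          fix k show "norm (h $ k * G [k, i] [] x \<eta>) \<le> norm h * (C k * (2 / norm \<zeta>))"
            unfolding real_norm_def abs_mult by (intro mult_mono component_le_norm_cart b) auto
        qed
        also have "\<dots> = E * (2 / norm \<zeta>) * norm h"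
          unfolding E_def sum_distrib_right by (rule sum.cong) (simp_all add: mult_ac)
        finally show "norm (\<Sum>k\<in>UNIV. h $ k * G [k, i] [] x \<eta>) \<le> E * (2 / norm \<zeta>) * norm h" .
      qed
    qed (use \<sigma> \<zeta> in \<open>auto simp: dist_norm norm_minus_commute\<close>)
    also have "\<dots> \<le> (E * (2 / norm \<zeta>)) * (norm \<zeta> / 2)" using \<sigma> E by (intro mult_left_mono) auto
    also have "\<dots> = E" using \<zeta> by simp
    finally show ?thesis by simp
  qed
  then show ?thesis using E by blast
qed

context snd_phase
begin

definition G0 :: "'n list \<Rightarrow> real^'n \<Rightarrow> real^'n \<Rightarrow> real" where
  "G0 \<alpha> x \<xi> = (if \<xi> = 0 then 0 else G \<alpha> [] x \<xi>)"

lemma G0_Nil: "G0 [] = \<phi>0"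
  by (auto simp: fun_eq_iff G0_def \<phi>0_def G_Nil)

lemma G0_measurable: "(\<lambda>(x, \<xi>). G0 \<alpha> x \<xi>) \<in> borel_measurable (lborel \<Otimes>\<^sub>M lborel)"
proof -
  let ?S = "UNIV \<times> (UNIV - {0}) :: ((real^'n) \<times> (real^'n)) set"
  have "(\<lambda>z. indicator ?S z *\<^sub>R G \<alpha> [] (fst z) (snd z)) \<in> borel_measurable borel"
    by (rule borel_measurable_continuous_on_indicator[OF _ continuous_G]) (auto intro!: borel_open open_Times)
  moreover have "(\<lambda>z. indicator ?S z *\<^sub>R G \<alpha> [] (fst z) (snd z)) = (\<lambda>(x, \<xi>). G0 \<alpha> x \<xi>)"
    by (auto simp: G0_def split: split_indicator)
  ultimately show ?thesis unfolding lborel_prod by simp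
qed

lemmas G0_measurable' [measurable (raw)] = measurable_case_prod_compose[OF G0_measurable]

lemma \<phi>0_measurable' [measurable (raw)]:
  "x \<in> measurable K lborel \<Longrightarrow> \<xi> \<in> measurable K lborel \<Longrightarrow> (\<lambda>z. \<phi>0 (x z) (\<xi> z)) \<in> borel_measurable K"
  using G0_measurable'[of x K \<xi> "[]"] by (simp add: G0_Nil)

lemma grad_nth_measurable' [measurable (raw)]:
  assumes "\<zeta> \<noteq> 0" and [measurable]: "x \<in> measurable K lborel"
  shows "(\<lambda>z. grad \<zeta> (x z) $ i) \<in> borel_measurable K"
proof -
  have "(\<lambda>z. grad \<zeta> (x z) $ i) = (\<lambda>z. G0 [i] (x z) \<zeta>)" using assms by (simp add: grad_def G0_def)
  then show ?thesis by simp
qed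

lemma grad_inner_measurable':
  assumes "\<zeta> \<noteq> 0" and [measurable]: "x \<in> measurable K lborel" "\<xi> \<in> measurable K lborel"
  shows "(\<lambda>z. grad \<zeta> (x z) \<bullet> \<xi> z) \<in> borel_measurable K"
  using assms(1) unfolding inner_vec_def by measurable

lemma \<phi>s_measurable':
  assumes "\<zeta> \<noteq> 0" and [measurable]: "s \<in> borel_measurable K" "x \<in> measurable K lborel" "\<xi> \<in> measurable K lborel"
  shows "(\<lambda>z. \<phi>s \<zeta> (s z) (x z) (\<xi> z)) \<in> borel_measurable K"
proof -
  note [measurable] = grad_inner_measurable'[OF assms(1,3,4)]
  show ?thesis unfolding \<phi>s_def by measurable
qed

text \<open>The radius \<open>\<delta> * norm \<zeta> / 2\<close> is that of the half ball on which
  the cutoff of the dual estimate is bounded below.\<close>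

lemma cell_operator_bound:
  "\<exists>\<delta> B. 0 < \<delta> \<and> \<delta> \<le> 1/4 \<and> 0 < B \<and> (\<forall>\<zeta> s F f. \<zeta> \<noteq> 0 \<longrightarrow> s \<in> {0..1} \<longrightarrow> (\<forall>\<xi>. \<xi> \<notin> cball \<zeta> (\<delta> * norm \<zeta> / 2) \<longrightarrow> F \<xi> = 0) \<longrightarrow>
      Lr_le lborel 2 F f \<longrightarrow> 0 < f \<longrightarrow> Lr_le lborel 2 (\<lambda>x. \<integral>\<xi>. exp (\<i> * complex_of_real (\<phi>s \<zeta> s x \<xi>)) * F \<xi> \<partial>lborel) (B * f))"
proof -
  obtain \<delta> c A where \<delta>: "0 < \<delta>" "\<delta> \<le> 1/4" and c: "0 < c" and A: "0 \<le> A"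
    and nd: "\<And>\<zeta> s. \<zeta> \<noteq> 0 \<Longrightarrow> s \<in> {0..1} \<Longrightarrow> nondeg_phase c A (\<phi>s \<zeta> s) \<zeta> (\<delta> * norm \<zeta>)"
    using nondeg_cells by blast
  obtain B where B: "B > 0" "\<And>(\<psi>::real^'n \<Rightarrow> real^'n \<Rightarrow> real) \<xi>0 \<rho> F f.
     0 < \<rho> \<Longrightarrow> (\<lambda>(x, \<xi>). \<psi> x \<xi>) \<in> borel_measurable (lborel \<Otimes>\<^sub>M lborel) \<Longrightarrow> nondeg_phase c A \<psi> \<xi>0 \<rho> \<Longrightarrow>
     (\<forall>\<xi>. \<xi> \<notin> cball \<xi>0 (\<rho>/2) \<longrightarrow> F \<xi> = 0) \<Longrightarrow> Lr_le lborel 2 F f \<Longrightarrow> 0 < f \<Longrightarrow>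
     Lr_le lborel 2 (\<lambda>x. \<integral>\<xi>. exp (\<i> * complex_of_real (\<psi> x \<xi>)) * F \<xi> \<partial>lborel) (B * f)"
    using TTstar_primal[OF c A] by blast
  have "Lr_le lborel 2 (\<lambda>x. \<integral>\<xi>. exp (\<i> * complex_of_real (\<phi>s \<zeta> s x \<xi>)) * F \<xi> \<partial>lborel) (B * f)"
    if "\<zeta> \<noteq> 0" "s \<in> {0..1}" "\<forall>\<xi>. \<xi> \<notin> cball \<zeta> (\<delta> * norm \<zeta> / 2) \<longrightarrow> F \<xi> = 0" "Lr_le lborel 2 F f" "0 < f" for \<zeta> s F f
  proof (rule B(2)[OF _ _ nd[OF that(1,2)] that(3,4,5)])
    show "0 < \<delta> * norm \<zeta>" using \<delta> that by simp
    show "(\<lambda>(x, \<xi>). \<phi>s \<zeta> s x \<xi>) \<in> borel_measurable (lborel \<Otimes>\<^sub>M lborel)"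
      unfolding split_beta' by (rule \<phi>s_measurable'[OF that(1)]) auto
  qed
  then show ?thesis using \<delta> B(1) by blast
qed

text \<open>The \<xi>-derivatives of the linearised phase, indexed by the same lists as
  \<open>G0\<close>. The differences of the two families then form an amplitude with all its
  derivatives, as \<open>amplitude_removal\<close> expects.\<close>

fun lin :: "real^'n \<Rightarrow> 'n list \<Rightarrow> real^'n \<Rightarrow> real^'n \<Rightarrow> real" where
  "lin \<zeta> [] x \<xi> = grad \<zeta> x \<bullet> \<xi>"
| "lin \<zeta> [i] x \<xi> = grad \<zeta> x $ i"
| "lin \<zeta> (i # j # \<alpha>) x \<xi> = 0"

lemma lin_deriv: "((\<lambda>s. lin \<zeta> \<alpha> x (\<xi> + s *\<^sub>R axis i 1)) has_real_derivative lin \<zeta> (i # \<alpha>) x \<xi>) (at 0)"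
  by (cases "(\<zeta>, \<alpha>, x, \<xi>)" rule: lin.cases) (auto intro!: derivative_eq_intros simp: inner_add_right inner_axis)

lemma continuous_lin: "continuous_on S (lin \<zeta> \<alpha> x)"
proof -
  consider "\<alpha> = []" | i where "\<alpha> = [i]" | i j \<beta> where "\<alpha> = i # j # \<beta>" by (metis neq_Nil_conv)
  then show ?thesis by cases (auto intro!: continuous_intros)
qed

lemma lin_measurable:
  assumes "\<zeta> \<noteq> 0" shows "(\<lambda>(x, \<xi>). lin \<zeta> \<alpha> x \<xi>) \<in> borel_measurable (lborel \<Otimes>\<^sub>M lborel)"
proof -
  consider "\<alpha> = []" | i where "\<alpha> = [i]" | i j \<beta> where "\<alpha> = i # j # \<beta>" by (metis neq_Nil_conv)
  then show ?thesis unfolding split_beta'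
    by cases (auto intro!: grad_inner_measurable' grad_nth_measurable' assms)
qed

text \<open>The remainder is a symbol of size |\<zeta>| at every scale
  \<open>l \<le> norm \<zeta>\<close>. At order 0 this is Euler's relation with bounded gradient
  increments; at order 1 the increment itself, since |\<zeta>| / l is at least 1; from order 2 on
  the linear part is gone and |\<sigma>|^(1-j) is comparable to |\<zeta>|^(1-j), which is at most
  |\<zeta>| l^(-j).\<close>

lemma remainder_symbol_bound:
  "\<exists>C>0. \<forall>\<zeta> l \<sigma> x \<alpha>. \<zeta> \<noteq> 0 \<longrightarrow> 0 < l \<longrightarrow> l \<le> norm \<zeta> \<longrightarrow> norm (\<sigma> - \<zeta>) < norm \<zeta> / 2 \<longrightarrow> length \<alpha> \<le> CARD('n) \<longrightarrow>
     \<bar>G0 \<alpha> x \<sigma> - lin \<zeta> \<alpha> x \<sigma>\<bar> \<le> C * norm \<zeta> * (1/l) ^ length \<alpha>"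
proof -
  have "\<exists>E. \<forall>i. 0 \<le> E i \<and> (\<forall>\<zeta> \<sigma> x. \<zeta> \<noteq> 0 \<longrightarrow> norm (\<sigma> - \<zeta>) < norm \<zeta> / 2 \<longrightarrow> \<bar>G [i] [] x \<sigma> - G [i] [] x \<zeta>\<bar> \<le> E i)"
    by (rule choice) (use G_increment_bound in blast)
  then obtain E where E: "\<And>i. 0 \<le> E i" "\<And>i \<zeta> \<sigma> x. \<zeta> \<noteq> 0 \<Longrightarrow> norm (\<sigma> - \<zeta>) < norm \<zeta> / 2 \<Longrightarrow> \<bar>G [i] [] x \<sigma> - G [i] [] x \<zeta>\<bar> \<le> E i"
    by blast
  have "\<forall>\<alpha>. \<exists>C\<ge>0. \<forall>\<zeta> l \<sigma> x. \<zeta> \<noteq> 0 \<longrightarrow> 0 < l \<longrightarrow> l \<le> norm \<zeta> \<longrightarrow> norm (\<sigma> - \<zeta>) < norm \<zeta> / 2 \<longrightarrow>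
     \<bar>G0 \<alpha> x \<sigma> - lin \<zeta> \<alpha> x \<sigma>\<bar> \<le> C * norm \<zeta> * (1/l) ^ length \<alpha>"
  proof
    fix \<alpha> :: "'n list"
    have near: "norm \<zeta> / 2 \<le> norm \<sigma>" "norm \<sigma> \<le> 2 * norm \<zeta>" "\<sigma> \<noteq> 0" if "\<zeta> \<noteq> 0" "norm (\<sigma> - \<zeta>) < norm \<zeta> / 2" for \<zeta> \<sigma> :: "real^'n"
    proof -
      have "norm \<zeta> \<le> norm \<sigma> + norm (\<zeta> - \<sigma>)" using norm_triangle_sub[of \<zeta> \<sigma>] by simp
      then show 1: "norm \<zeta> / 2 \<le> norm \<sigma>" using that by (simp add: norm_minus_commute)
      show "norm \<sigma> \<le> 2 * norm \<zeta>" using that norm_triangle_sub[of \<sigma> \<zeta>] norm_ge_zero[of \<zeta>] by linarith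
      show "\<sigma> \<noteq> 0" using 1 that by auto
    qed
    consider "\<alpha> = []" | i where "\<alpha> = [i]" | i j \<beta> where "\<alpha> = i # j # \<beta>" by (metis neq_Nil_conv)
    then show "\<exists>C\<ge>0. \<forall>\<zeta> l \<sigma> x. \<zeta> \<noteq> 0 \<longrightarrow> 0 < l \<longrightarrow> l \<le> norm \<zeta> \<longrightarrow> norm (\<sigma> - \<zeta>) < norm \<zeta> / 2 \<longrightarrow>
     \<bar>G0 \<alpha> x \<sigma> - lin \<zeta> \<alpha> x \<sigma>\<bar> \<le> C * norm \<zeta> * (1/l) ^ length \<alpha>"
    proof cases
      case 1
      show ?thesis
      proof (intro exI[of _ "2 * sum E UNIV"] conjI allI impI)
        show "0 \<le> 2 * sum E UNIV" using E(1) by (simp add: sum_nonneg)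
        fix \<zeta> \<sigma> x :: "real^'n" and l :: real assume \<zeta>: "\<zeta> \<noteq> 0" and \<sigma>: "norm (\<sigma> - \<zeta>) < norm \<zeta> / 2"
        have "G0 \<alpha> x \<sigma> - lin \<zeta> \<alpha> x \<sigma> = (\<Sum>i\<in>UNIV. \<sigma> $ i * (G [i] [] x \<sigma> - G [i] [] x \<zeta>))"
          using near(3)[OF \<zeta> \<sigma>] by (simp add: 1 G0_Nil \<phi>0_def Euler[of \<sigma> x] inner_vec_def grad_def sum_subtractf algebra_simps)
        also have "\<bar>\<dots>\<bar> \<le> (\<Sum>i\<in>UNIV. (2 * norm \<zeta>) * E i)"
        proof (rule order_trans[OF sum_abs sum_mono])
          fix i show "\<bar>\<sigma> $ i * (G [i] [] x \<sigma> - G [i] [] x \<zeta>)\<bar> \<le> (2 * norm \<zeta>) * E i"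
            unfolding abs_mult using near(2)[OF \<zeta> \<sigma>] component_le_norm_cart[of \<sigma> i] E(2)[OF \<zeta> \<sigma>]
            by (intro mult_mono) auto
        qed
        finally show "\<bar>G0 \<alpha> x \<sigma> - lin \<zeta> \<alpha> x \<sigma>\<bar> \<le> 2 * sum E UNIV * norm \<zeta> * (1/l) ^ length \<alpha>"
          by (simp add: 1 sum_distrib_left[symmetric] sum_distrib_right[symmetric] mult_ac)
      qed
    next
      case (2 i)
      show ?thesis
      proof (intro exI[of _ "E i"] conjI allI impI)
        fix \<zeta> \<sigma> x :: "real^'n" and l :: real assume \<zeta>: "\<zeta> \<noteq> 0" and \<sigma>: "norm (\<sigma> - \<zeta>) < norm \<zeta> / 2" and l: "0 < l" "l \<le> norm \<zeta>"
        have "\<bar>G0 \<alpha> x \<sigma> - lin \<zeta> \<alpha> x \<sigma>\<bar> \<le> E i"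
          using near(3)[OF \<zeta> \<sigma>] E(2)[OF \<zeta> \<sigma>, of i x] by (simp add: 2 G0_def grad_def)
        also have "\<dots> \<le> E i * (norm \<zeta> * (1/l))"
        proof -
          have "1 \<le> norm \<zeta> * (1/l)" using l by simp
          from mult_left_mono[OF this E(1)[of i]] show ?thesis by simp
        qed
        finally show "\<bar>G0 \<alpha> x \<sigma> - lin \<zeta> \<alpha> x \<sigma>\<bar> \<le> E i * norm \<zeta> * (1/l) ^ length \<alpha>" by (simp add: 2)
      qed (rule E(1))
    next
      case (3 i j \<beta>)
      obtain C where C: "C \<ge> 0" "\<And>x \<xi>. \<xi> \<noteq> 0 \<Longrightarrow> \<bar>G \<alpha> [] x \<xi>\<bar> \<le> C * norm \<xi> powr (1 - real (length \<alpha>))"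
        using G_bound[of \<alpha> "[]"] 3 by auto
      define k where "k = length \<beta> + 1"
      have len: "length \<alpha> = Suc k" by (simp add: k_def 3)
      show ?thesis
      proof (intro exI[of _ "C * 2 ^ k"] conjI allI impI)
        fix \<zeta> \<sigma> x :: "real^'n" and l :: real assume \<zeta>: "\<zeta> \<noteq> 0" and \<sigma>: "norm (\<sigma> - \<zeta>) < norm \<zeta> / 2" and l: "0 < l" "l \<le> norm \<zeta>"
        have "\<bar>G0 \<alpha> x \<sigma> - lin \<zeta> \<alpha> x \<sigma>\<bar> = \<bar>G \<alpha> [] x \<sigma>\<bar>" using near(3)[OF \<zeta> \<sigma>] by (simp add: 3 G0_def)
        also have "\<dots> \<le> C * norm \<sigma> powr (1 - real (length \<alpha>))" by (rule C(2)[OF near(3)[OF \<zeta> \<sigma>]])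
        also have "norm \<sigma> powr (1 - real (length \<alpha>)) = (1 / norm \<sigma>) ^ k"
          using near(3)[OF \<zeta> \<sigma>] by (simp add: len powr_minus_divide powr_realpow power_one_over)
        also have "C * (1 / norm \<sigma>) ^ k \<le> C * (2 / norm \<zeta>) ^ k"
          using C(1) near[OF \<zeta> \<sigma>] \<zeta> by (intro mult_left_mono power_mono) (auto simp: field_simps)
        also have "\<dots> = C * 2 ^ k * norm \<zeta> * (1 / norm \<zeta>) ^ Suc k" using \<zeta> by (simp add: power_divide)
        also have "\<dots> \<le> C * 2 ^ k * norm \<zeta> * (1 / l) ^ Suc k"
          using C(1) l \<zeta> by (intro mult_left_mono power_mono divide_left_mono) auto
        finally show "\<bar>G0 \<alpha> x \<sigma> - lin \<zeta> \<alpha> x \<sigma>\<bar> \<le> C * 2 ^ k * norm \<zeta> * (1/l) ^ length \<alpha>" by (simp only: len)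
      qed (use C in auto)
    qed
  qed
  then obtain C where C: "\<And>\<alpha>. C \<alpha> \<ge> 0" "\<And>\<alpha> \<zeta> l \<sigma> x. \<zeta> \<noteq> 0 \<Longrightarrow> 0 < l \<Longrightarrow> l \<le> norm \<zeta> \<Longrightarrow> norm (\<sigma> - \<zeta>) < norm \<zeta> / 2 \<Longrightarrow>
     \<bar>G0 \<alpha> x \<sigma> - lin \<zeta> \<alpha> x \<sigma>\<bar> \<le> C \<alpha> * norm \<zeta> * (1/l) ^ length \<alpha>"
    by metis
  let ?L = "{\<alpha> :: 'n list. length \<alpha> \<le> CARD('n)}"
  have fin: "finite ?L" using finite_lists_length_le[of "UNIV :: 'n set" "CARD('n)"] by simp
  show ?thesis
  proof (intro exI[of _ "sum C ?L + 1"] conjI allI impI)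
    show "0 < sum C ?L + 1" using sum_nonneg[of ?L C] C(1) by (simp add: add_nonneg_pos)
    fix \<zeta> \<sigma> x :: "real^'n" and l :: real and \<alpha> :: "'n list"
    assume a: "\<zeta> \<noteq> 0" "0 < l" "l \<le> norm \<zeta>" "norm (\<sigma> - \<zeta>) < norm \<zeta> / 2" and len: "length \<alpha> \<le> CARD('n)"
    have "\<bar>G0 \<alpha> x \<sigma> - lin \<zeta> \<alpha> x \<sigma>\<bar> \<le> C \<alpha> * norm \<zeta> * (1/l) ^ length \<alpha>" by (rule C(2)[OF a])
    also have "\<dots> \<le> (sum C ?L + 1) * norm \<zeta> * (1/l) ^ length \<alpha>"
    proof (intro mult_right_mono)
      have "C \<alpha> \<le> sum C ?L" using len C(1) fin by (intro member_le_sum) auto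
      then show "C \<alpha> \<le> sum C ?L + 1" by simp
    qed (use a in auto)
    finally show "\<bar>G0 \<alpha> x \<sigma> - lin \<zeta> \<alpha> x \<sigma>\<bar> \<le> (sum C ?L + 1) * norm \<zeta> * (1/l) ^ length \<alpha>" .
  qed
qed

text \<open>The difference of the two exponentials is the integral over \<open>s\<close> of the
  derivative of \<open>exp (\<i> * \<phi>s)\<close>, in which the difference of the phases appears
  as an amplitude of size |\<zeta>|. Each interpolated phase is non-degenerate near \<zeta>, so
  removing that amplitude and averaging over \<open>s\<close> gains |\<zeta>|. The first bound is
  the case \<open>s = 1\<close>.\<close>

lemma remainder_cell:
  "\<exists>\<delta> B K. 0 < \<delta> \<and> \<delta> \<le> 1/4 \<and> 0 < B \<and> 0 < K \<and>
     (\<forall>\<zeta> F f. \<zeta> \<noteq> 0 \<longrightarrow> (\<forall>\<xi>. \<xi> \<notin> cball \<zeta> (\<delta> * norm \<zeta> / 2) \<longrightarrow> F \<xi> = 0) \<longrightarrow> Lr_le lborel 2 F f \<longrightarrow> 0 < f \<longrightarrow>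
        Lr_le lborel 2 (\<lambda>x. \<integral>\<xi>. exp (\<i> * complex_of_real (\<phi>0 x \<xi>)) * F \<xi> \<partial>lborel) (B * f)) \<and>
     (\<forall>\<zeta> (l::real) F f. \<zeta> \<noteq> 0 \<longrightarrow> 0 < l \<longrightarrow> CARD('n) * l \<le> \<delta> * norm \<zeta> / 2 \<longrightarrow> (\<forall>\<xi>. \<xi> \<notin> cube \<zeta> l \<longrightarrow> F \<xi> = 0) \<longrightarrow> Lr_le lborel 2 F f \<longrightarrow> 0 < f \<longrightarrow>
        Lr_le lborel 2 (\<lambda>x. \<integral>\<xi>. (exp (\<i> * complex_of_real (\<phi>0 x \<xi>)) - exp (\<i> * complex_of_real (grad \<zeta> x \<bullet> \<xi>))) * F \<xi> \<partial>lborel) (K * norm \<zeta> * f))"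
proof -
  let ?n = "CARD('n)"
  obtain \<delta> B where \<delta>: "0 < \<delta>" "\<delta> \<le> 1/4" and B: "0 < B"
    and U: "\<And>\<zeta> s F f. \<zeta> \<noteq> 0 \<Longrightarrow> s \<in> {0..1} \<Longrightarrow> (\<forall>\<xi>. \<xi> \<notin> cball \<zeta> (\<delta> * norm \<zeta> / 2) \<longrightarrow> F \<xi> = 0) \<Longrightarrow>
      Lr_le lborel 2 F f \<Longrightarrow> 0 < f \<Longrightarrow> Lr_le lborel 2 (\<lambda>x. \<integral>\<xi>. exp (\<i> * complex_of_real (\<phi>s \<zeta> s x \<xi>)) * F \<xi> \<partial>lborel) (B * f)"
    using cell_operator_bound by blast
  obtain C where C: "C > 0" "\<And>\<zeta> l \<sigma> x \<alpha>. \<zeta> \<noteq> 0 \<Longrightarrow> 0 < l \<Longrightarrow> l \<le> norm \<zeta> \<Longrightarrow> norm (\<sigma> - \<zeta>) < norm \<zeta> / 2 \<Longrightarrow> length \<alpha> \<le> ?n \<Longrightarrow>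
     \<bar>G0 \<alpha> x \<sigma> - lin \<zeta> \<alpha> x \<sigma>\<bar> \<le> C * norm \<zeta> * (1/l) ^ length \<alpha>"
    using remainder_symbol_bound by blast
  define K where "K = 2 ^ ?n * C * B"
  have K: "K > 0" using B C(1) by (simp add: K_def)
  have part1: "Lr_le lborel 2 (\<lambda>x. \<integral>\<xi>. exp (\<i> * complex_of_real (\<phi>0 x \<xi>)) * F \<xi> \<partial>lborel) (B * f)"
    if "\<zeta> \<noteq> 0" "\<forall>\<xi>. \<xi> \<notin> cball \<zeta> (\<delta> * norm \<zeta> / 2) \<longrightarrow> F \<xi> = 0" "Lr_le lborel 2 F f" "0 < f" for \<zeta> F f
    using U[OF that(1), of 1, OF _ that(2-4)] by (simp add: \<phi>s_def)
  have part2: "Lr_le lborel 2 (\<lambda>x. \<integral>\<xi>. (exp (\<i> * complex_of_real (\<phi>0 x \<xi>)) - exp (\<i> * complex_of_real (grad \<zeta> x \<bullet> \<xi>))) * F \<xi> \<partial>lborel) (K * norm \<zeta> * f)"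
    if \<zeta>: "\<zeta> \<noteq> 0" and l: "0 < l" "?n * l \<le> \<delta> * norm \<zeta> / 2" and F0: "\<forall>\<xi>. \<xi> \<notin> cube \<zeta> l \<longrightarrow> F \<xi> = 0"
      and F: "Lr_le lborel 2 F f" and f: "0 < f" for \<zeta> F f and l :: real
  proof -
    have Fm [measurable]: "F \<in> borel_measurable lborel" using F by (simp add: Lr_le_def)
    have d4: "\<delta> * norm \<zeta> \<le> 1/4 * norm \<zeta>" using \<delta>(2) by (rule mult_right_mono) simp
    have nz: "norm \<zeta> > 0" using \<zeta> by simp
    have l2: "l \<le> norm \<zeta>"
    proof -
      have "1 * l \<le> ?n * l" using l by (intro mult_right_mono) (auto simp: Suc_le_eq)
      then show ?thesis using l d4 nz by linarith
    qed
    have cub: "norm (\<xi> - \<zeta>) \<le> \<delta> * norm \<zeta> / 2" if "\<xi> \<in> cube \<zeta> l" for \<xi>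
      using norm_cube_diff[OF that] l by simp
    have cub': "norm (\<xi> - \<zeta>) < norm \<zeta> / 2" if "\<xi> \<in> cube \<zeta> l" for \<xi>
      using cub[OF that] d4 nz by linarith
    have cub0: "\<xi> \<noteq> 0" if "\<xi> \<in> cube \<zeta> l" for \<xi>
      using cub'[OF that] nz by (auto simp: norm_minus_commute)
    define b where "b \<alpha> x \<xi> = complex_of_real (G0 \<alpha> x \<xi> - lin \<zeta> \<alpha> x \<xi>)" for \<alpha> x \<xi>
    note lm [measurable (raw)] = measurable_case_prod_compose[OF lin_measurable[OF \<zeta>]]
    have bm: "(\<lambda>(x, \<xi>). b \<alpha> x \<xi>) \<in> borel_measurable (lborel \<Otimes>\<^sub>M lborel)" for \<alpha>
      unfolding b_def split_beta' by measurable
    note bm' [measurable (raw)] = measurable_case_prod_compose[OF bm]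
    note \<phi>sm [measurable (raw)] = \<phi>s_measurable'[OF \<zeta>]
    note gm [measurable (raw)] = grad_inner_measurable'[OF \<zeta>]
    define W where "W s x = (\<integral>\<xi>. exp (\<i> * complex_of_real (\<phi>s \<zeta> s x \<xi>)) * b [] x \<xi> * F \<xi> \<partial>lborel)" for s x
    have W: "Lr_le lborel 2 (W s) (K * norm \<zeta> * f)" if s: "s \<in> {0..1}" for s
    proof -
      have "Lr_le lborel 2 (W s) (2 ^ ?n * (C * norm \<zeta>) * B * f)"
        unfolding W_def
      \<comment> \<open>This amplitude is bounded in \<open>x\<close>, so the target exponent is 2
        and multiplication by a bounded function takes the place of Hoelder's inequality.\<close>
      proof (rule amplitude_removal[where E = "cube \<zeta> l" and c = \<zeta> and l = l])
        show "sigma_finite_measure (lborel :: (real^'n) measure)" by (rule sigma_finite_lborel)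
        show "(\<lambda>(x, \<xi>). exp (\<i> * complex_of_real (\<phi>s \<zeta> s x \<xi>))) \<in> borel_measurable (lborel \<Otimes>\<^sub>M lborel)"
          unfolding split_beta' by measurable
        show "continuous_on (cube \<zeta> l) (b \<alpha> x)" for \<alpha> x
        proof -
          have "continuous_on (cube \<zeta> l) (\<lambda>\<xi>. complex_of_real (G \<alpha> [] x \<xi> - lin \<zeta> \<alpha> x \<xi>))"
            by (intro continuous_intros continuous_G_\<xi> continuous_lin) (use cub0 in blast)
          then show ?thesis by (rule continuous_on_eq) (use cub0 in \<open>auto simp: b_def G0_def\<close>)
        qed
        show "((\<lambda>s. b \<alpha> x (\<xi> + s *\<^sub>R axis i 1)) has_vector_derivative b (i # \<alpha>) x \<xi>) (at 0)" if "\<xi> \<in> cube \<zeta> l" for \<alpha> i x \<xi>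
        proof -
          have "((\<lambda>s. G \<alpha> [] x (\<xi> + (s * 1) *\<^sub>R axis i 1) - lin \<zeta> \<alpha> x (\<xi> + s *\<^sub>R axis i 1)) has_real_derivative 1 * G (i # \<alpha>) [] x \<xi> - lin \<zeta> (i # \<alpha>) x \<xi>) (at 0)"
            by (intro DERIV_diff G_deriv_\<xi> lin_deriv cub0[OF that])
          then have d: "((\<lambda>s. complex_of_real (G \<alpha> [] x (\<xi> + s *\<^sub>R axis i 1) - lin \<zeta> \<alpha> x (\<xi> + s *\<^sub>R axis i 1))) has_vector_derivative b (i # \<alpha>) x \<xi>) (at 0)"
            using has_vector_derivative_of_real cub0[OF that] by (fastforce simp: b_def G0_def)
          show ?thesis
            by (rule has_vector_derivative_line_cong[where S = "- {0}", OF _ _ _ d]) (use cub0[OF that] in \<open>auto simp: b_def G0_def\<close>)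
        qed
        show "Lr_le lborel 2 (\<lambda>x. \<integral>\<xi>. exp (\<i> * complex_of_real (\<phi>s \<zeta> s x \<xi>)) * F' \<xi> \<partial>lborel) (B * f')"
          if "\<And>\<xi>. \<xi> \<notin> cube \<zeta> l \<Longrightarrow> F' \<xi> = 0" "Lr_le lborel 2 F' f'" "0 < f'" for F' f'
        proof (rule U[OF \<zeta> s _ that(2,3)], intro allI impI)
          fix \<xi> assume "\<xi> \<notin> cball \<zeta> (\<delta> * norm \<zeta> / 2)"
          then show "F' \<xi> = 0" using that(1)[of \<xi>] cub[of \<xi>] by (auto simp: dist_norm norm_minus_commute)
        qed
        show "Lr_le lborel 2 (\<lambda>x. b \<alpha> x \<sigma> * u x) (C * norm \<zeta> * (1/l) ^ length \<alpha> * f')"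
          if "length \<alpha> \<le> ?n" "\<sigma> \<in> cube \<zeta> l" "Lr_le lborel 2 u f'" "0 < f'" for \<alpha> \<sigma> u f'
        proof (rule Lr_le_mult_bounded[OF that(3)])
          show "(\<lambda>x. b \<alpha> x \<sigma>) \<in> borel_measurable lborel" by measurable
          show "norm (b \<alpha> x \<sigma>) \<le> C * norm \<zeta> * (1/l) ^ length \<alpha>" for x
            unfolding b_def norm_of_real by (rule C(2)[OF \<zeta> l(1) l2 cub'[OF that(2)] that(1)])
        qed (use that in auto)
      qed (use bm F F0 f l B C(1) nz in auto)
      then show ?thesis by (simp add: K_def mult_ac)
    qed
    have Fi: "integrable lborel F"
    proof (rule integrable_of_L2_bounded_support[of F "cube \<zeta> l"])
      show "(\<integral>\<^sup>+\<xi>. ennreal ((norm (F \<xi>))\<^sup>2) \<partial>lborel) < \<infinity>"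
        using F by (auto simp: Lr_le_def intro: le_less_trans)
    qed (use F0 compact_imp_bounded[OF compact_cube] in auto)
    show ?thesis
    proof (rule Lr_le_average[where W = W, OF sigma_finite_lborel _ _ _ _ W])
      show "0 < K * norm \<zeta> * f" using K nz f by simp
      show "(\<lambda>x. \<integral>\<xi>. (exp (\<i> * complex_of_real (\<phi>0 x \<xi>)) - exp (\<i> * complex_of_real (grad \<zeta> x \<bullet> \<xi>))) * F \<xi> \<partial>lborel) \<in> borel_measurable lborel"
        by measurable
      show "(\<lambda>(x, s). W s x) \<in> borel_measurable (lborel \<Otimes>\<^sub>M lborel)"
        unfolding W_def split_beta' by measurable
      show "AE x in lborel. ennreal (norm (\<integral>\<xi>. (exp (\<i> * complex_of_real (\<phi>0 x \<xi>)) - exp (\<i> * complex_of_real (grad \<zeta> x \<bullet> \<xi>))) * F \<xi> \<partial>lborel))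
          \<le> (\<integral>\<^sup>+s. ennreal (norm (W s x)) * indicator {0..1} s \<partial>lborel)"
      proof (rule AE_I2)
        fix x :: "real^'n"
        \<comment> \<open>The derivative in \<open>s\<close> of the interpolated exponential, times
          \<open>F\<close>. Integrated over \<open>s\<close> first it gives the difference of
          exponentials, integrated over \<xi> first it gives \<open>W s x\<close> up to the factor
          \<open>\<i>\<close>.\<close>
        define J where "J s \<xi> = indicator {0..1} s *\<^sub>R (\<i> * (exp (\<i> * complex_of_real (\<phi>s \<zeta> s x \<xi>)) * b [] x \<xi> * F \<xi>))" for s \<xi>
        have ii: "integrable lborel (\<lambda>s. complex_of_real (C * norm \<zeta> * indicator {0..1::real} s))"
          by (intro integrable_of_real integrable_mult_right integrable_real_indicator) auto
        have J: "integrable (lborel \<Otimes>\<^sub>M lborel) (\<lambda>(s, \<xi>). J s \<xi>)"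
        proof (rule Bochner_Integration.integrable_bound[OF integrable_prod_mult(1)[OF lborel_pair.pair_sigma_finite_axioms ii Fi]])
          show "(\<lambda>(s, \<xi>). J s \<xi>) \<in> borel_measurable (lborel \<Otimes>\<^sub>M lborel)"
            unfolding J_def split_beta' by measurable
          have "norm (J s \<xi>) \<le> norm (complex_of_real (C * norm \<zeta> * indicator {0..1} s) * F \<xi>)" for s \<xi>
          proof (cases "\<xi> \<in> cube \<zeta> l")
            case True
            have "norm (b [] x \<xi>) \<le> C * norm \<zeta>"
              using C(2)[OF \<zeta> l(1) l2 cub'[OF True], of "[]" x] by (simp add: b_def del: of_real_diff)
            then have "norm (b [] x \<xi>) * norm (F \<xi>) \<le> C * norm \<zeta> * norm (F \<xi>)" by (rule mult_right_mono) simp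
            then show ?thesis using C(1) nz by (auto simp: J_def norm_mult split: split_indicator)
          next
            case False
            then show ?thesis using F0 by (simp add: J_def)
          qed
          then show "AE z in lborel \<Otimes>\<^sub>M lborel. norm (case z of (s, \<xi>) \<Rightarrow> J s \<xi>) \<le> norm (case z of (s, \<xi>) \<Rightarrow> complex_of_real (C * norm \<zeta> * indicator {0..1} s) * F \<xi>)"
            by (intro AE_I2) (simp add: split_beta')
        qed
        have JW: "(\<integral>\<xi>. J s \<xi> \<partial>lborel) = indicator {0..1} s *\<^sub>R (\<i> * W s x)" for s
          unfolding J_def W_def integral_scaleR_right integral_mult_right_zero by simp
        have "(\<integral>\<xi>. (exp (\<i> * complex_of_real (\<phi>0 x \<xi>)) - exp (\<i> * complex_of_real (grad \<zeta> x \<bullet> \<xi>))) * F \<xi> \<partial>lborel) = (\<integral>\<xi>. (\<integral>s. J s \<xi> \<partial>lborel) \<partial>lborel)"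
        proof (rule Bochner_Integration.integral_cong[OF refl])
          fix \<xi> :: "real^'n"
          let ?\<theta> = "\<phi>0 x \<xi> - grad \<zeta> x \<bullet> \<xi>"
          have e: "\<phi>s \<zeta> s x \<xi> = grad \<zeta> x \<bullet> \<xi> + s * ?\<theta>" for s by (simp add: \<phi>s_def algebra_simps)
          have d: "((\<lambda>s. exp (\<i> * complex_of_real (\<phi>s \<zeta> s x \<xi>))) has_vector_derivative \<i> * complex_of_real ?\<theta> * exp (\<i> * complex_of_real (\<phi>s \<zeta> s x \<xi>))) (at s within {0..1})" for s
          proof -
            have "((\<lambda>s. complex_of_real (\<phi>s \<zeta> s x \<xi>)) has_vector_derivative complex_of_real ?\<theta>) (at s within {0..1})"
              unfolding e by (rule has_vector_derivative_of_real) (auto intro!: derivative_eq_intros)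
            then have "((\<lambda>s. \<i> * complex_of_real (\<phi>s \<zeta> s x \<xi>)) has_vector_derivative \<i> * complex_of_real ?\<theta>) (at s within {0..1})"
              by (rule has_vector_derivative_mult_right)
            from field_vector_diff_chain_within[OF this, of exp "exp (\<i> * complex_of_real (\<phi>s \<zeta> s x \<xi>))"]
            show ?thesis by (auto simp: o_def intro: DERIV_exp has_field_derivative_at_within)
          qed
          have "(\<integral>s. indicator {0..1} s *\<^sub>R (\<i> * complex_of_real ?\<theta> * exp (\<i> * complex_of_real (\<phi>s \<zeta> s x \<xi>))) \<partial>lborel) =
              exp (\<i> * complex_of_real (\<phi>s \<zeta> 1 x \<xi>)) - exp (\<i> * complex_of_real (\<phi>s \<zeta> 0 x \<xi>))"
            by (rule integral_FTC_Icc[OF _ d]) (auto simp: e intro!: continuous_intros)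
          moreover have "(\<integral>s. J s \<xi> \<partial>lborel) = (\<integral>s. indicator {0..1} s *\<^sub>R (\<i> * complex_of_real ?\<theta> * exp (\<i> * complex_of_real (\<phi>s \<zeta> s x \<xi>))) \<partial>lborel) * F \<xi>"
            unfolding J_def by (subst integral_mult_left_zero[symmetric]) (simp add: b_def G0_Nil mult_ac)
          ultimately show "(exp (\<i> * complex_of_real (\<phi>0 x \<xi>)) - exp (\<i> * complex_of_real (grad \<zeta> x \<bullet> \<xi>))) * F \<xi> = (\<integral>s. J s \<xi> \<partial>lborel)"
            by (simp add: \<phi>s_def)
        qed
        also have "\<dots> = (\<integral>s. (\<integral>\<xi>. J s \<xi> \<partial>lborel) \<partial>lborel)" by (rule lborel_pair.Fubini_integral[OF J])
        finally have "ennreal (norm (\<integral>\<xi>. (exp (\<i> * complex_of_real (\<phi>0 x \<xi>)) - exp (\<i> * complex_of_real (grad \<zeta> x \<bullet> \<xi>))) * F \<xi> \<partial>lborel)) = ennreal (norm (\<integral>s. (\<integral>\<xi>. J s \<xi> \<partial>lborel) \<partial>lborel))" by simp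
        also have "\<dots> \<le> (\<integral>\<^sup>+s. ennreal (norm (\<integral>\<xi>. J s \<xi> \<partial>lborel)) \<partial>lborel)"
          by (rule integral_norm_bound_ennreal[OF lborel_pair.integrable_fst[OF J]])
        also have "\<dots> = (\<integral>\<^sup>+s. ennreal (norm (W s x)) * indicator {0..1} s \<partial>lborel)"
          unfolding JW by (intro nn_integral_cong) (auto simp: norm_mult split: split_indicator)
        finally show "ennreal (norm (\<integral>\<xi>. (exp (\<i> * complex_of_real (\<phi>0 x \<xi>)) - exp (\<i> * complex_of_real (grad \<zeta> x \<bullet> \<xi>))) * F \<xi> \<partial>lborel))
          \<le> (\<integral>\<^sup>+s. ennreal (norm (W s x)) * indicator {0..1} s \<partial>lborel)" .
      qed
    qed auto
  qed
  show ?thesis using \<delta> B K part1 part2 by blast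
qed

end

section \<open>The operator on frequencies below 1\<close>

lemma corner_scaleR: "corner l \<nu> = l *\<^sub>R corner 1 \<nu>"
  by (simp add: corner_def vec_eq_iff)

lemma Lr_le_restrict:
  assumes F: "Lr_le lborel 2 F f" and f: "0 \<le> f" and m: "{\<xi>. P \<xi>} \<in> sets borel"
  shows "Lr_le lborel 2 (\<lambda>\<xi>. if P \<xi> then F \<xi> else 0) f"
proof -
  have [measurable]: "F \<in> borel_measurable lborel" "{\<xi>. P \<xi>} \<in> sets borel" using F m by (auto simp: Lr_le_def)
  have eq: "(\<lambda>\<xi>. if P \<xi> then F \<xi> else 0) = (\<lambda>\<xi>. indicator {\<xi>. P \<xi>} \<xi> *\<^sub>R F \<xi>)" by (auto split: split_indicator)
  have "(\<lambda>\<xi>. if P \<xi> then F \<xi> else 0) \<in> borel_measurable lborel"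
    unfolding eq using m by (intro borel_measurable_scaleR borel_measurable_indicator) auto
  then show ?thesis by (rule Lr_le_mono[OF F]) (use f in auto)
qed

context snd_phase
begin

text \<open>In every shell the cubes are proportional to the shell, so one finite set of indices
  serves all shells, and the corners with a given index lie on one ray. For a fixed index a single
  linear phase is subtracted in all shells; the linear part is bounded on the unit ball at once, and
  the remainders form a geometric series.\<close>

lemma low_frequency_bound:
  "\<exists>B>0. \<forall>F f. (\<forall>\<xi>. F \<xi> \<noteq> 0 \<longrightarrow> norm \<xi> < 1) \<longrightarrow> Lr_le lborel 2 F f \<longrightarrow> 0 < f \<longrightarrow>
     Lr_le lborel 2 (\<lambda>x. \<integral>\<xi>. exp (\<i> * complex_of_real (\<phi>0 x \<xi>)) * F \<xi> \<partial>lborel) (B * f)"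
proof -
  let ?n = "CARD('n)"
  have n0: "real ?n \<ge> 1" by (simp add: Suc_le_eq)
  obtain \<delta> K where \<delta>: "0 < \<delta>" "\<delta> \<le> 1/4" and K: "0 < K"
    and R: "\<And>\<zeta> (l::real) F f. \<zeta> \<noteq> 0 \<Longrightarrow> 0 < l \<Longrightarrow> ?n * l \<le> \<delta> * norm \<zeta> / 2 \<Longrightarrow> (\<forall>\<xi>. \<xi> \<notin> cube \<zeta> l \<longrightarrow> F \<xi> = 0) \<Longrightarrow> Lr_le lborel 2 F f \<Longrightarrow> 0 < f \<Longrightarrow>
        Lr_le lborel 2 (\<lambda>x. \<integral>\<xi>. (exp (\<i> * complex_of_real (\<phi>0 x \<xi>)) - exp (\<i> * complex_of_real (grad \<zeta> x \<bullet> \<xi>))) * F \<xi> \<partial>lborel) (K * norm \<zeta> * f)"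
    using remainder_cell by blast
  obtain c0 where c0: "c0 > 0" "\<And>\<xi> x y. \<xi> \<noteq> 0 \<Longrightarrow> c0 * norm (x - y) \<le> norm (grad \<xi> x - grad \<xi> y)"
    using grad_lower by blast
  obtain L where L: "L \<ge> 0" "\<And>\<xi> x y. \<xi> \<noteq> 0 \<Longrightarrow> norm (grad \<xi> x - grad \<xi> y) \<le> L * norm (x - y)"
    using grad_upper by blast
  have "0 < c0 / ?n" "0 \<le> L * ?n / c0" using c0 L n0 by auto
  from TTstar_primal[OF this] obtain B where B: "B > 0" "\<And>(\<psi>::real^'n \<Rightarrow> real^'n \<Rightarrow> real) \<xi>0 \<rho> F f.
     0 < \<rho> \<Longrightarrow> (\<lambda>(x, \<xi>). \<psi> x \<xi>) \<in> borel_measurable (lborel \<Otimes>\<^sub>M lborel) \<Longrightarrow> nondeg_phase (c0 / ?n) (L * ?n / c0) \<psi> \<xi>0 \<rho> \<Longrightarrow>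
     (\<forall>\<xi>. \<xi> \<notin> cball \<xi>0 (\<rho>/2) \<longrightarrow> F \<xi> = 0) \<Longrightarrow> Lr_le lborel 2 F f \<Longrightarrow> 0 < f \<Longrightarrow>
     Lr_le lborel 2 (\<lambda>x. \<integral>\<xi>. exp (\<i> * complex_of_real (\<psi> x \<xi>)) * F \<xi> \<partial>lborel) (B * f)"
    by blast
  \<comment> \<open>A cube of side \<eta> 2^(-k) has diameter at most \<delta> 2^(-k) / 8, whereas
    its corner has norm at least 2^(-k) / 2. This is the smallness that
    \<open>remainder_cell\<close> requires.\<close>
  define \<eta> where "\<eta> = \<delta> / (8 * ?n)"
  have \<eta>: "\<eta> > 0" "?n * \<eta> = \<delta> / 8" using \<delta> n0 by (auto simp: \<eta>_def)
  define l where "l k = \<eta> * (1/2) ^ k" for k :: nat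
  have l: "l k > 0" "?n * l k = \<delta> / 8 * (1/2) ^ k" for k
  proof -
    show "l k > 0" using \<eta> by (simp add: l_def)
    have "?n * l k = (?n * \<eta>) * (1/2) ^ k" by (simp add: l_def)
    then show "?n * l k = \<delta> / 8 * (1/2) ^ k" unfolding \<eta>(2) .
  qed
  \<comment> \<open>The index alone, without the shell: cubes of different shells with the same
    index are dilates of each other and are treated together.\<close>
  define \<kappa> where "\<kappa> \<xi> = cell (l (low_shell \<xi>)) \<xi>" for \<xi> :: "real^'n"
  have \<kappa>m: "{\<xi>. \<kappa> \<xi> = \<nu>} \<in> sets borel" for \<nu>
  proof -
    have "{\<xi>. \<kappa> \<xi> = \<nu>} = (\<Union>k. {\<xi>. low_shell \<xi> = k} \<inter> {\<xi>. cell (l k) \<xi> = \<nu>})" by (auto simp: \<kappa>_def)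
    also have "\<dots> \<in> sets borel"
      by (rule sets.countable_UN) (use sets.Int[OF low_shell_measurable cell_measurable] in blast)
    finally show ?thesis .
  qed
  \<comment> \<open>In shell k the norm is below 2 * 2^(-k), which equals \<open>q * l k\<close>
    whatever the shell.\<close>
  define q where "q = 2 / \<eta>"
  have q: "0 \<le> q" using \<eta> by (simp add: q_def)
  let ?N = "cells q :: ('n \<Rightarrow> int) set"
  \<comment> \<open>\<open>B\<close> belongs to the linear phase, and \<open>6 * K\<close> is the
    sum of \<open>3 * K * (1/2) ^ k\<close> over all shells, with \<open>3 * (1/2) ^ k\<close>
    bounding the norm of the corner.\<close>
  define A where "A = B + 6 * K"
  have A: "A > 0" using B K by (simp add: A_def)
  have geo: "corner (l k) \<nu> \<noteq> 0 \<and> ?n * l k \<le> \<delta> * norm (corner (l k) \<nu>) / 2 \<and> norm (corner (l k) \<nu>) \<le> 3 * (1/2) ^ k \<and> \<xi> \<in> cube (corner (l k) \<nu>) (l k)"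
    if \<xi>: "\<xi> \<noteq> 0" "norm \<xi> < 1" "low_shell \<xi> = k" "\<kappa> \<xi> = \<nu>" for \<xi> k \<nu>
  proof -
    let ?\<zeta> = "corner (l k) \<nu>"
    have nx: "(1/2) ^ k \<le> norm \<xi>" "norm \<xi> < 2 * (1/2) ^ k" using low_shell_bounds[of \<xi>] \<xi> by auto
    have inc: "\<xi> \<in> cube ?\<zeta> (l k)" using cell_in_cube[OF l(1)[of k], of \<xi>] \<xi> by (simp add: \<kappa>_def)
    have d: "norm (\<xi> - ?\<zeta>) \<le> \<delta> / 8 * (1/2) ^ k" using norm_cube_diff[OF inc] l(2)[of k] by simp
    have "\<delta> / 8 * (1/2) ^ k \<le> 1/2 * (1/2) ^ k" using \<delta> by (intro mult_right_mono) auto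
    then have d2: "norm (\<xi> - ?\<zeta>) \<le> 1/2 * (1/2) ^ k" using d by linarith
    have lo: "norm ?\<zeta> \<ge> 1/2 * (1/2) ^ k" using norm_triangle_ineq2[of \<xi> "\<xi> - ?\<zeta>"] d2 nx by simp
    have p: "(1/2::real) ^ k > 0" by simp
    have "norm ?\<zeta> \<le> norm \<xi> + norm (\<xi> - ?\<zeta>)" using norm_triangle_sub[of ?\<zeta> \<xi>] by (simp add: norm_minus_commute)
    then have hi: "norm ?\<zeta> \<le> 3 * (1/2) ^ k" using d2 nx p by linarith
    have "?\<zeta> \<noteq> 0" using lo p by (metis less_le_not_le mult_pos_pos norm_zero zero_less_divide_1_iff zero_less_numeral)
    moreover have "?n * l k \<le> \<delta> * norm ?\<zeta> / 2"
    proof -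
      have "\<delta> * (1/2 * (1/2) ^ k) \<le> \<delta> * norm ?\<zeta>" using lo \<delta> by (intro mult_left_mono) auto
      moreover have "0 \<le> \<delta> * (1/2) ^ k" using \<delta> by simp
      ultimately show ?thesis using l(2)[of k] by linarith
    qed
    ultimately show ?thesis using hi inc by simp
  qed
  have main: "Lr_le lborel 2 (\<lambda>x. \<integral>\<xi>. exp (\<i> * complex_of_real (\<phi>0 x \<xi>)) * F \<xi> \<partial>lborel) (2 * A * sqrt (card ?N) * f)"
    if F0: "\<And>\<xi>. F \<xi> \<noteq> 0 \<Longrightarrow> \<xi> \<noteq> 0 \<and> norm \<xi> < 1" and F: "Lr_le lborel 2 F f" and f: "0 < f" for F f
  proof (rule Lr_le_cells[where \<kappa> = \<kappa> and N = ?N and F = F, OF sigma_finite_lborel])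
    have Fm [measurable]: "F \<in> borel_measurable lborel" using F by (simp add: Lr_le_def)
    show "(\<lambda>x. \<integral>\<xi>. exp (\<i> * complex_of_real (\<phi>0 x \<xi>)) * F \<xi> \<partial>lborel) \<in> borel_measurable lborel" by measurable
    show "finite ?N" by (rule finite_cells)
    show "?N \<noteq> {}" by (rule cells_nonempty[OF q])
    show "AE x in lborel. norm (\<integral>\<xi>. exp (\<i> * complex_of_real (\<phi>0 x \<xi>)) * F \<xi> \<partial>lborel) \<le>
        (\<Sum>\<nu>\<in>?N. norm (\<integral>\<xi>. exp (\<i> * complex_of_real (\<phi>0 x \<xi>)) * (if \<kappa> \<xi> = \<nu> then F \<xi> else 0) \<partial>lborel))"
    proof (rule AE_I2)
      fix x :: "real^'n"
      have "norm (\<integral>\<xi>. exp (\<i> * complex_of_real (\<phi>0 x \<xi>)) * F \<xi> \<partial>lborel) \<le>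
        (\<Sum>\<nu>\<in>?N. norm (\<integral>\<xi>. (if \<kappa> \<xi> = \<nu> then exp (\<i> * complex_of_real (\<phi>0 x \<xi>)) * F \<xi> else 0) \<partial>lborel))"
      proof (rule norm_integral_cells[OF finite_cells \<kappa>m])
        fix \<xi> assume "exp (\<i> * complex_of_real (\<phi>0 x \<xi>)) * F \<xi> \<noteq> 0"
        then have \<xi>: "\<xi> \<noteq> 0" "norm \<xi> < 1" using F0[of \<xi>] by auto
        then have "norm \<xi> \<le> 2 * (1/2) ^ low_shell \<xi>" using low_shell_bounds(2)[of \<xi>] by simp
        also have "\<dots> = q * l (low_shell \<xi>)" using \<eta> by (simp add: q_def l_def)
        finally show "\<kappa> \<xi> \<in> ?N" unfolding \<kappa>_def by (rule cell_in_cells[OF l(1)])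
      qed
      also have "\<dots> = (\<Sum>\<nu>\<in>?N. norm (\<integral>\<xi>. exp (\<i> * complex_of_real (\<phi>0 x \<xi>)) * (if \<kappa> \<xi> = \<nu> then F \<xi> else 0) \<partial>lborel))"
        by (intro sum.cong refl arg_cong[where f = norm] Bochner_Integration.integral_cong) auto
      finally show "norm (\<integral>\<xi>. exp (\<i> * complex_of_real (\<phi>0 x \<xi>)) * F \<xi> \<partial>lborel) \<le> \<dots>" .
    qed
    fix \<nu> f' assume f': "0 < f'" and FL: "Lr_le lborel 2 (\<lambda>\<xi>. if \<kappa> \<xi> = \<nu> then F \<xi> else 0) f'"
    define H where "H \<xi> = (if \<kappa> \<xi> = \<nu> then F \<xi> else 0)" for \<xi>
    have H: "Lr_le lborel 2 H f'" using FL by (simp add: H_def[abs_def])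
    have Hm [measurable]: "H \<in> borel_measurable lborel" using H by (simp add: Lr_le_def)
    have H0: "H \<xi> \<noteq> 0 \<Longrightarrow> \<xi> \<noteq> 0 \<and> norm \<xi> < 1 \<and> \<kappa> \<xi> = \<nu>" for \<xi> using F0[of \<xi>] by (auto simp: H_def split: if_splits)
    have "Lr_le lborel 2 (\<lambda>x. \<integral>\<xi>. exp (\<i> * complex_of_real (\<phi>0 x \<xi>)) * H \<xi> \<partial>lborel) (A * f')"
    proof (cases "\<exists>\<xi>. H \<xi> \<noteq> 0")
      case False
      then have "(\<lambda>x. \<integral>\<xi>. exp (\<i> * complex_of_real (\<phi>0 x \<xi>)) * H \<xi> \<partial>lborel) = (\<lambda>_. 0)" by auto
      then show ?thesis using A f' by (simp add: Lr_le_0)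
    next
      case True
      define \<zeta> :: "real^'n" where "\<zeta> = corner 1 \<nu>"
      have \<zeta>: "\<zeta> \<noteq> 0"
      proof -
        obtain \<xi> where "H \<xi> \<noteq> 0" using True by blast
        from geo[OF _ _ refl] H0[OF this] have "corner (l (low_shell \<xi>)) \<nu> \<noteq> (0 :: real^'n)" by blast
        then show ?thesis unfolding \<zeta>_def by (metis corner_scaleR scaleR_zero_right)
      qed
      \<comment> \<open>All corners with index \<nu> are positive multiples of \<zeta>, and the
        gradient has degree 0.\<close>
      have gr: "grad (corner (l k) \<nu>) = grad \<zeta>" for k
        unfolding corner_scaleR[of "l k"] \<zeta>_def[symmetric] by (auto simp: fun_eq_iff grad_def G_homog[OF \<zeta> l(1)])
      note gm [measurable (raw)] = grad_inner_measurable'[OF \<zeta>]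
      have Hi: "integrable lborel H"
      proof (rule integrable_of_L2_bounded_support[of H "cball 0 1"])
        show "(\<integral>\<^sup>+\<xi>. ennreal ((norm (H \<xi>))\<^sup>2) \<partial>lborel) < \<infinity>"
          using H by (auto simp: Lr_le_def intro: le_less_trans)
        show "H \<xi> = 0" if "\<xi> \<notin> cball 0 1" for \<xi> using H0[of \<xi>] that by auto
      qed auto
      define u0 where "u0 x = (\<integral>\<xi>. exp (\<i> * complex_of_real (grad \<zeta> x \<bullet> \<xi>)) * H \<xi> \<partial>lborel)" for x
      define u1 where "u1 x = (\<integral>\<xi>. (exp (\<i> * complex_of_real (\<phi>0 x \<xi>)) - exp (\<i> * complex_of_real (grad \<zeta> x \<bullet> \<xi>))) * H \<xi> \<partial>lborel)" for x
      have L0: "Lr_le lborel 2 u0 (B * f')"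
        unfolding u0_def
      proof (rule B(2)[of 2 "\<lambda>x \<xi>. grad \<zeta> x \<bullet> \<xi>" 0 H f', OF _ _ _ _ H f'])
        show "(\<lambda>(x, \<xi>). grad \<zeta> x \<bullet> \<xi>) \<in> borel_measurable (lborel \<Otimes>\<^sub>M lborel)" unfolding split_beta' by measurable
        show "nondeg_phase (c0 / ?n) (L * ?n / c0) (\<lambda>x \<xi>. grad \<zeta> x \<bullet> \<xi>) 0 2"
          by (rule nondeg_linear[OF c0(1) c0(2)[OF \<zeta>] L(2)[OF \<zeta>]]) simp
        show "\<forall>\<xi>. \<xi> \<notin> cball 0 (2/2) \<longrightarrow> H \<xi> = 0" using H0 by force
      qed simp
      have "Lr_le lborel 2 u1 (\<Sum>k. 3 * K * f' * (1/2) ^ k)"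
      proof (rule Lr_le_series[where u = "\<lambda>k x. \<integral>\<xi>. (exp (\<i> * complex_of_real (\<phi>0 x \<xi>)) - exp (\<i> * complex_of_real (grad \<zeta> x \<bullet> \<xi>))) * (if low_shell \<xi> = k then H \<xi> else 0) \<partial>lborel", OF sigma_finite_lborel])
        show "u1 \<in> borel_measurable lborel" unfolding u1_def by measurable
        show "AE x in lborel. ennreal (norm (u1 x)) \<le> (\<Sum>k. ennreal (norm (\<integral>\<xi>. (exp (\<i> * complex_of_real (\<phi>0 x \<xi>)) - exp (\<i> * complex_of_real (grad \<zeta> x \<bullet> \<xi>))) * (if low_shell \<xi> = k then H \<xi> else 0) \<partial>lborel)))"
        proof (rule AE_I2)
          fix x
          have eq: "(if low_shell \<xi> = k then (exp (\<i> * complex_of_real (\<phi>0 x \<xi>)) - exp (\<i> * complex_of_real (grad \<zeta> x \<bullet> \<xi>))) * H \<xi> else 0) =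
              (exp (\<i> * complex_of_real (\<phi>0 x \<xi>)) - exp (\<i> * complex_of_real (grad \<zeta> x \<bullet> \<xi>))) * (if low_shell \<xi> = k then H \<xi> else 0)" for k \<xi> by simp
          show "ennreal (norm (u1 x)) \<le> (\<Sum>k. ennreal (norm (\<integral>\<xi>. (exp (\<i> * complex_of_real (\<phi>0 x \<xi>)) - exp (\<i> * complex_of_real (grad \<zeta> x \<bullet> \<xi>))) * (if low_shell \<xi> = k then H \<xi> else 0) \<partial>lborel)))"
            using norm_integral_shells[OF low_shell_measurable, of "\<lambda>\<xi>. (exp (\<i> * complex_of_real (\<phi>0 x \<xi>)) - exp (\<i> * complex_of_real (grad \<zeta> x \<bullet> \<xi>))) * H \<xi>"]
            unfolding eq u1_def .
        qed
        show "summable (\<lambda>k. 3 * K * f' * (1/2) ^ k)" by (intro summable_mult summable_geometric) simp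
        show "0 < 3 * K * f' * (1/2) ^ k" for k using K f' by simp
        fix k
        show "Lr_le lborel 2 (\<lambda>x. \<integral>\<xi>. (exp (\<i> * complex_of_real (\<phi>0 x \<xi>)) - exp (\<i> * complex_of_real (grad \<zeta> x \<bullet> \<xi>))) * (if low_shell \<xi> = k then H \<xi> else 0) \<partial>lborel) (3 * K * f' * (1/2) ^ k)"
        proof (cases "\<exists>\<xi>. low_shell \<xi> = k \<and> H \<xi> \<noteq> 0")
          case False
          then have "(if low_shell \<xi> = k then H \<xi> else 0) = 0" for \<xi> by auto
          then show ?thesis using K f' by (simp add: Lr_le_0)
        next
          case True
          then obtain \<xi>1 where \<xi>1: "low_shell \<xi>1 = k" "H \<xi>1 \<noteq> 0" by blast
          have g: "corner (l k) \<nu> \<noteq> (0 :: real^'n)" "?n * l k \<le> \<delta> * norm (corner (l k) \<nu> :: real^'n) / 2" "norm (corner (l k) \<nu> :: real^'n) \<le> 3 * (1/2) ^ k"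
            using geo[of \<xi>1 k \<nu>] H0[OF \<xi>1(2)] \<xi>1(1) by auto
          have HL: "Lr_le lborel 2 (\<lambda>\<xi>. if low_shell \<xi> = k then H \<xi> else 0) f'"
            by (rule Lr_le_restrict[OF H _ low_shell_measurable]) (use f' in simp)
          have supp: "\<forall>\<xi>. \<xi> \<notin> cube (corner (l k) \<nu>) (l k) \<longrightarrow> (if low_shell \<xi> = k then H \<xi> else 0) = 0"
            using geo[of _ k \<nu>] H0 by (metis (full_types))
          have 1: "Lr_le lborel 2 (\<lambda>x. \<integral>\<xi>. (exp (\<i> * complex_of_real (\<phi>0 x \<xi>)) - exp (\<i> * complex_of_real (grad \<zeta> x \<bullet> \<xi>))) * (if low_shell \<xi> = k then H \<xi> else 0) \<partial>lborel) (K * norm (corner (l k) \<nu> :: real^'n) * f')"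
            using R[OF g(1) l(1) g(2) supp HL f'] unfolding gr .
          have "K * norm (corner (l k) \<nu> :: real^'n) * f' \<le> K * (3 * (1/2) ^ k) * f'"
            using g(3) K f' by (intro mult_right_mono mult_left_mono) auto
          then show ?thesis
            by (intro Lr_le_mono[OF 1]) (use 1 K f' in \<open>auto simp: Lr_le_def mult_ac\<close>)
        qed
      qed simp
      moreover have "(\<Sum>k. 3 * K * f' * (1/2) ^ k) = 6 * K * f'"
        using suminf_mult[OF summable_geometric[of "1/2::real"], of "3 * K * f'"] suminf_geometric[of "1/2::real"] by simp
      ultimately have L1: "Lr_le lborel 2 u1 (6 * K * f')" by simp
      have "Lr_le lborel 2 (\<lambda>x. \<integral>\<xi>. exp (\<i> * complex_of_real (\<phi>0 x \<xi>)) * H \<xi> \<partial>lborel) (\<Sum>j\<in>{0,1::nat}. if j = 0 then B * f' else 6 * K * f')"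
      proof (rule Lr_le_sum[where u = "\<lambda>j. if j = 0 then u0 else u1", OF sigma_finite_lborel])
        show "(\<lambda>x. \<integral>\<xi>. exp (\<i> * complex_of_real (\<phi>0 x \<xi>)) * H \<xi> \<partial>lborel) \<in> borel_measurable lborel" by measurable
        show "AE x in lborel. norm (\<integral>\<xi>. exp (\<i> * complex_of_real (\<phi>0 x \<xi>)) * H \<xi> \<partial>lborel) \<le> (\<Sum>j\<in>{0,1::nat}. norm ((if j = 0 then u0 else u1) x))"
        proof (rule AE_I2)
          fix x :: "real^'n"
          have i1: "integrable lborel (\<lambda>\<xi>. exp (\<i> * complex_of_real (\<phi>0 x \<xi>)) * H \<xi>)" "integrable lborel (\<lambda>\<xi>. exp (\<i> * complex_of_real (grad \<zeta> x \<bullet> \<xi>)) * H \<xi>)"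
            by (rule Bochner_Integration.integrable_bound[OF Hi]; auto simp: norm_mult)+
          have "u1 x = (\<integral>\<xi>. exp (\<i> * complex_of_real (\<phi>0 x \<xi>)) * H \<xi> \<partial>lborel) - u0 x"
            unfolding u1_def u0_def left_diff_distrib by (rule Bochner_Integration.integral_diff[OF i1])
          then show "norm (\<integral>\<xi>. exp (\<i> * complex_of_real (\<phi>0 x \<xi>)) * H \<xi> \<partial>lborel) \<le> (\<Sum>j\<in>{0,1::nat}. norm ((if j = 0 then u0 else u1) x))"
            using norm_triangle_ineq[of "u0 x" "u1 x"] by simp
        qed
      qed (use L0 L1 B(1) K f' in auto)
      then show ?thesis by (simp add: A_def distrib_right)
    qed
    then show "Lr_le lborel 2 (\<lambda>x. \<integral>\<xi>. exp (\<i> * complex_of_real (\<phi>0 x \<xi>)) * (if \<kappa> \<xi> = \<nu> then F \<xi> else 0) \<partial>lborel) (A * f')"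
      unfolding H_def .
  qed (use F f A \<kappa>m in auto)
  have cN: "card ?N > 0" using finite_cells cells_nonempty[OF q] by (metis card_gt_0_iff)
  show ?thesis
  proof (intro exI[of _ "2 * A * sqrt (card ?N)"] conjI allI impI)
    show "0 < 2 * A * sqrt (card ?N)" using A cN by simp
    fix F :: "real^'n \<Rightarrow> complex" and f :: real
    assume F0: "\<forall>\<xi>. F \<xi> \<noteq> 0 \<longrightarrow> norm \<xi> < 1" and F: "Lr_le lborel 2 F f" and f: "0 < f"
    have [measurable]: "F \<in> borel_measurable lborel" using F by (simp add: Lr_le_def)
    \<comment> \<open>The origin belongs to no dyadic shell; removing it does not change the
      integrals.\<close>
    have F': "Lr_le lborel 2 (\<lambda>\<xi>. if \<xi> \<noteq> 0 then F \<xi> else 0) f"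
      by (rule Lr_le_restrict[OF F]) (use f in auto)
    have ae: "AE \<xi> in lborel. \<xi> \<noteq> (0::real^'n)" by (rule AE_lborel_singleton)
    have eq: "(\<integral>\<xi>. exp (\<i> * complex_of_real (\<phi>0 x \<xi>)) * (if \<xi> \<noteq> 0 then F \<xi> else 0) \<partial>lborel) = (\<integral>\<xi>. exp (\<i> * complex_of_real (\<phi>0 x \<xi>)) * F \<xi> \<partial>lborel)" for x
    proof (rule integral_cong_AE)
      show "AE \<xi> in lborel. exp (\<i> * complex_of_real (\<phi>0 x \<xi>)) * (if \<xi> \<noteq> 0 then F \<xi> else 0) = exp (\<i> * complex_of_real (\<phi>0 x \<xi>)) * F \<xi>"
        using ae by eventually_elim simp
    qed auto
    have nz: "\<xi> \<noteq> 0 \<and> norm \<xi> < 1" if "(if \<xi> \<noteq> 0 then F \<xi> else 0) \<noteq> 0" for \<xi>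
      using F0 that by (auto split: if_splits)
    show "Lr_le lborel 2 (\<lambda>x. \<integral>\<xi>. exp (\<i> * complex_of_real (\<phi>0 x \<xi>)) * F \<xi> \<partial>lborel) (2 * A * sqrt (card ?N) * f)"
      using main[OF nz F' f] unfolding eq .
  qed
qed

end

text \<open>Plancherel's inequality up to a constant, as the dual estimate for the phase
  \<open>x \<bullet> \<xi>\<close>. The identity map is expansive and Lipschitz with constant 1, and
  the bound is uniform in the radius, so balls exhaust the space.\<close>

lemma fourier_L2:
  "\<exists>C>0. \<forall>g::real^'n::finite \<Rightarrow> complex. integrable lborel g \<longrightarrow>
     (\<integral>\<^sup>+\<xi>. ennreal ((norm (\<integral>x. exp (- \<i> * complex_of_real (x \<bullet> \<xi>)) * g x \<partial>lborel))\<^sup>2) \<partial>lborel)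
       \<le> ennreal C * (\<integral>\<^sup>+x. ennreal ((norm (g x))\<^sup>2) \<partial>lborel)"
proof -
  have "(0::real) < 1 / CARD('n)" "(0::real) \<le> 1 * real CARD('n) / 1" by auto
  from TTstar_dual[OF this] obtain B where B: "B > 0" "\<And>(\<psi>::real^'n::finite \<Rightarrow> real^'n \<Rightarrow> real) \<xi>0 \<rho> g.
     0 < \<rho> \<Longrightarrow> (\<lambda>(x, \<xi>). \<psi> x \<xi>) \<in> borel_measurable (lborel \<Otimes>\<^sub>M lborel) \<Longrightarrow> nondeg_phase (1 / CARD('n)) (1 * real CARD('n) / 1) \<psi> \<xi>0 \<rho> \<Longrightarrow>
     integrable lborel g \<Longrightarrow>
     (\<integral>\<^sup>+\<xi>. ennreal ((norm (\<integral>x. exp (- \<i> * complex_of_real (\<psi> x \<xi>)) * g x \<partial>lborel))\<^sup>2) * indicator (cball \<xi>0 (\<rho>/2)) \<xi> \<partial>lborel)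
       \<le> ennreal B * (\<integral>\<^sup>+x. ennreal ((norm (g x))\<^sup>2) \<partial>lborel)"
    by blast
  show ?thesis
  proof (intro exI[of _ B] conjI allI impI)
    fix g :: "real^'n \<Rightarrow> complex" assume g: "integrable lborel g"
    have [measurable]: "g \<in> borel_measurable lborel" using g by auto
    define S where "S \<xi> = (\<integral>x. exp (- \<i> * complex_of_real (x \<bullet> \<xi>)) * g x \<partial>lborel)" for \<xi>
    have [measurable]: "S \<in> borel_measurable lborel" unfolding S_def by measurable
    have key: "(\<integral>\<^sup>+\<xi>. ennreal ((norm (S \<xi>))\<^sup>2) * indicator (cball 0 (real k)) \<xi> \<partial>lborel) \<le> ennreal B * (\<integral>\<^sup>+x. ennreal ((norm (g x))\<^sup>2) \<partial>lborel)" for k :: nat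
    proof -
      have "(\<integral>\<^sup>+\<xi>. ennreal ((norm (S \<xi>))\<^sup>2) * indicator (cball 0 (real k)) \<xi> \<partial>lborel) \<le> (\<integral>\<^sup>+\<xi>. ennreal ((norm (S \<xi>))\<^sup>2) * indicator (cball 0 ((2 * real k + 2)/2)) \<xi> \<partial>lborel)"
        by (intro nn_integral_mono) (auto split: split_indicator)
      also have "\<dots> \<le> ennreal B * (\<integral>\<^sup>+x. ennreal ((norm (g x))\<^sup>2) \<partial>lborel)"
        unfolding S_def
      proof (rule B(2)[where \<psi> = "\<lambda>x \<xi>. x \<bullet> \<xi>", OF _ _ _ g])
        show "(\<lambda>(x, \<xi>). x \<bullet> \<xi>) \<in> borel_measurable (lborel \<Otimes>\<^sub>M (lborel :: (real^'n) measure))" unfolding split_beta' by measurable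
        show "nondeg_phase (1 / CARD('n)) (1 * real CARD('n) / 1) (\<lambda>x \<xi>::real^'n. x \<bullet> \<xi>) 0 (2 * real k + 2)"
          by (rule nondeg_linear[of 1 "\<lambda>x. x" 1]) auto
      qed auto
      finally show ?thesis .
    qed
    have "(\<integral>\<^sup>+\<xi>. ennreal ((norm (S \<xi>))\<^sup>2) \<partial>lborel) = (\<integral>\<^sup>+\<xi>. (SUP k. ennreal ((norm (S \<xi>))\<^sup>2) * indicator (cball 0 (real k)) \<xi>) \<partial>lborel)"
    proof (rule nn_integral_cong)
      fix \<xi> :: "real^'n"
      obtain k0 where k0: "norm \<xi> \<le> real k0" using real_arch_simple by blast
      have "ennreal ((norm (S \<xi>))\<^sup>2) \<le> (SUP k. ennreal ((norm (S \<xi>))\<^sup>2) * indicator (cball 0 (real k)) \<xi>)"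
        using k0 by (intro SUP_upper2[of k0]) auto
      moreover have "(SUP k. ennreal ((norm (S \<xi>))\<^sup>2) * indicator (cball 0 (real k)) \<xi>) \<le> ennreal ((norm (S \<xi>))\<^sup>2)"
        by (intro SUP_least) (auto split: split_indicator)
      ultimately show "ennreal ((norm (S \<xi>))\<^sup>2) = (SUP k. ennreal ((norm (S \<xi>))\<^sup>2) * indicator (cball 0 (real k)) \<xi>)" by (rule antisym)
    qed
    also have "\<dots> = (SUP k. \<integral>\<^sup>+\<xi>. ennreal ((norm (S \<xi>))\<^sup>2) * indicator (cball 0 (real k)) \<xi> \<partial>lborel)"
    proof (rule nn_integral_monotone_convergence_SUP)
      show "incseq (\<lambda>k \<xi>. ennreal ((norm (S \<xi>))\<^sup>2) * indicator (cball 0 (real k)) \<xi>)"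
        by (auto simp: incseq_def le_fun_def split: split_indicator)
      show "(\<lambda>\<xi>. ennreal ((norm (S \<xi>))\<^sup>2) * indicator (cball 0 (real k)) \<xi>) \<in> borel_measurable lborel" for k
      proof -
        have [measurable]: "cball (0::real^'n) (real k) \<in> sets borel" by simp
        show ?thesis by measurable
      qed
    qed
    also have "\<dots> \<le> ennreal B * (\<integral>\<^sup>+x. ennreal ((norm (g x))\<^sup>2) \<partial>lborel)" by (intro SUP_least key)
    finally show "(\<integral>\<^sup>+\<xi>. ennreal ((norm (\<integral>x. exp (- \<i> * complex_of_real (x \<bullet> \<xi>)) * g x \<partial>lborel))\<^sup>2) \<partial>lborel)
       \<le> ennreal B * (\<integral>\<^sup>+x. ennreal ((norm (g x))\<^sup>2) \<partial>lborel)" unfolding S_def .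
  qed (rule B(1))
qed

section \<open>Summation over all frequencies\<close>

text \<open>On the shell the bracket lies between R/4 and 4R; the absolute value in the exponent
  covers both signs of \<open>e\<close>.\<close>

lemma japan_bounds:
  assumes "0 < R" "1 \<le> R" "R / 2 \<le> norm \<sigma>" "norm \<sigma> \<le> 3 * R"
  shows "japan \<sigma> powr e \<le> 4 powr \<bar>e\<bar> * R powr e"
proof -
  have j0: "japan \<sigma> > 0" by (simp add: japan_def add_pos_nonneg)
  have "R / 4 \<le> japan \<sigma>"
  proof -
    have "norm \<sigma> \<le> japan \<sigma>" unfolding japan_def by (rule real_le_rsqrt) simp
    then show ?thesis using assms by linarith
  qed
  moreover have "japan \<sigma> \<le> 4 * R"
  proof -
    have "1 \<le> R\<^sup>2" using assms(2) by (simp add: one_le_power)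
    moreover have "(norm \<sigma>)\<^sup>2 \<le> (3 * R)\<^sup>2" using assms by (intro power_mono) auto
    ultimately have "1 + (norm \<sigma>)\<^sup>2 \<le> (4 * R)\<^sup>2" by (simp add: power_mult_distrib)
    then show ?thesis unfolding japan_def using assms by (intro real_le_lsqrt) auto
  qed
  ultimately have t: "1/4 \<le> japan \<sigma> / R" "japan \<sigma> / R \<le> 4" using assms by (auto simp: field_simps)
  have "(japan \<sigma> / R) powr e \<le> 4 powr \<bar>e\<bar>"
  proof (cases "e \<ge> 0")
    case True
    then show ?thesis using t j0 assms by (auto intro!: powr_mono2)
  next
    case False
    then have "(japan \<sigma> / R) powr e \<le> (1/4) powr e" using t by (intro powr_mono2') auto
    then show ?thesis using False by (simp add: powr_divide powr_minus_divide)
  qed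
  moreover have "japan \<sigma> powr e = (japan \<sigma> / R) powr e * R powr e"
    using j0 assms by (simp add: powr_mult[symmetric])
  ultimately show ?thesis by (simp add: mult_right_mono)
qed

text \<open>Index 0 is the open unit ball, so the dyadic shell from 2^k to 2^(k+1) has index
  \<open>Suc k\<close>.\<close>

definition high_shell :: "'a::real_normed_vector \<Rightarrow> nat" where
  "high_shell \<xi> = (if norm \<xi> < 1 then 0 else Suc (nat \<lfloor>log 2 (norm \<xi>)\<rfloor>))"

lemma high_shell_measurable: "{\<xi>::'a::euclidean_space. high_shell \<xi> = k} \<in> sets borel"
  unfolding high_shell_def by measurable

lemma high_shell_bounds:
  assumes "high_shell \<xi> = Suc k" shows "2 ^ k \<le> norm \<xi>" "norm \<xi> < 2 * 2 ^ k"
proof -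
  have n: "norm \<xi> \<ge> 1" "nat \<lfloor>log 2 (norm \<xi>)\<rfloor> = k" using assms by (auto simp: high_shell_def split: if_splits)
  have pos: "norm \<xi> > 0" using n(1) by linarith
  have "0 \<le> log 2 (norm \<xi>)" using zero_le_log_cancel_iff[of 2 "norm \<xi>"] n(1) pos by simp
  then have k: "\<lfloor>log 2 (norm \<xi>)\<rfloor> = int k" using n(2) by linarith
  have "real k \<le> log 2 (norm \<xi>)" "log 2 (norm \<xi>) < real (Suc k)" using k by linarith+
  then have "2 powr real k \<le> norm \<xi>" "norm \<xi> < 2 powr real (Suc k)"
    using le_log_iff[of 2 "norm \<xi>" "real k"] log_less_iff[of 2 "norm \<xi>" "real (Suc k)"] pos by auto
  then show "2 ^ k \<le> norm \<xi>" "norm \<xi> < 2 * 2 ^ k"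
    by (simp_all add: powr_realpow powr_add)
qed

lemma high_shell_0: "high_shell \<xi> = 0 \<longleftrightarrow> norm \<xi> < 1"
  by (simp add: high_shell_def)

context snd_phase
begin

text \<open>The family \<open>b\<close> consists of the derivatives \<open>\<partial>\<^sup>\<alpha>\<close> of the symbol \<open>b []\<close>.\<close>
lemma operator_bound:
  fixes p :: ennreal and b :: "'n list \<Rightarrow> real^'n \<Rightarrow> real^'n \<Rightarrow> complex"
  assumes p: "2 \<le> p" and r: "r = (if p = \<infinity> then 2 else 2 * enn2real p / (enn2real p + 2))" and r1: "1 \<le> r"
    and \<rho>: "0 \<le> \<rho>" "\<rho> \<le> 1" and m: "m < real CARD('n) * (\<rho> - 1) / 2"
    and bm: "\<And>\<alpha>. (\<lambda>(x, \<xi>). b \<alpha> x \<xi>) \<in> borel_measurable (lborel \<Otimes>\<^sub>M lborel)"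
    and bc: "\<And>\<alpha> x S. continuous_on S (b \<alpha> x)"
    and bd: "\<And>\<alpha> i x \<xi>. ((\<lambda>s. b \<alpha> x (\<xi> + s *\<^sub>R axis i 1)) has_vector_derivative b (i # \<alpha>) x \<xi>) (at 0)"
    and bn: "\<And>\<alpha>. \<exists>C. \<forall>\<sigma>. Lp_norm p (\<lambda>x. b \<alpha> x \<sigma>) lborel \<le> ennreal (C * japan \<sigma> powr (m - \<rho> * real (length \<alpha>)))"
  shows "\<exists>C>0. \<forall>F f. Lr_le lborel 2 F f \<longrightarrow> 0 < f \<longrightarrow>
     Lr_le lborel r (\<lambda>x. \<integral>\<xi>. exp (\<i> * complex_of_real (\<phi>0 x \<xi>)) * b [] x \<xi> * F \<xi> \<partial>lborel) (C * f)"
proof -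
  let ?n = "CARD('n)"
  have n0: "real ?n \<ge> 1" by (simp add: Suc_le_eq)
  obtain \<delta> B where \<delta>: "0 < \<delta>" "\<delta> \<le> 1/4" and B: "0 < B"
    and U: "\<And>\<zeta> F f. \<zeta> \<noteq> 0 \<Longrightarrow> (\<forall>\<xi>. \<xi> \<notin> cball \<zeta> (\<delta> * norm \<zeta> / 2) \<longrightarrow> F \<xi> = 0) \<Longrightarrow> Lr_le lborel 2 F f \<Longrightarrow> 0 < f \<Longrightarrow>
        Lr_le lborel 2 (\<lambda>x. \<integral>\<xi>. exp (\<i> * complex_of_real (\<phi>0 x \<xi>)) * F \<xi> \<partial>lborel) (B * f)"
    using remainder_cell by blast
  obtain B0 where B0: "B0 > 0" and U0: "\<And>F f. (\<forall>\<xi>. F \<xi> \<noteq> 0 \<longrightarrow> norm \<xi> < 1) \<Longrightarrow> Lr_le lborel 2 F f \<Longrightarrow> 0 < f \<Longrightarrow>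
     Lr_le lborel 2 (\<lambda>x. \<integral>\<xi>. exp (\<i> * complex_of_real (\<phi>0 x \<xi>)) * F \<xi> \<partial>lborel) (B0 * f)"
    using low_frequency_bound by blast
  obtain C where C: "\<And>\<alpha> \<sigma>. Lp_norm p (\<lambda>x. b \<alpha> x \<sigma>) lborel \<le> ennreal (C \<alpha> * japan \<sigma> powr (m - \<rho> * real (length \<alpha>)))"
    using bn by metis
  let ?L = "{\<alpha> :: 'n list. length \<alpha> \<le> ?n}"
  have fin: "finite ?L" using finite_lists_length_le[of "UNIV :: 'n set" ?n] by simp
  \<comment> \<open>Only multi-indices of length at most n occur in
    \<open>amplitude_removal\<close>; as there are finitely many, one constant serves all, and the
    summand 1 makes it positive.\<close>
  define C0 where "C0 = 1 + (\<Sum>\<alpha>\<in>?L. \<bar>C \<alpha>\<bar>)"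
  have C0: "C0 > 0" unfolding C0_def by (intro add_pos_nonneg sum_nonneg) auto
  have CC0: "C \<alpha> \<le> C0" if "length \<alpha> \<le> ?n" for \<alpha>
  proof -
    have "\<bar>C \<alpha>\<bar> \<le> (\<Sum>\<alpha>\<in>?L. \<bar>C \<alpha>\<bar>)" using that fin by (intro member_le_sum) auto
    then show ?thesis by (simp add: C0_def)
  qed
  have japan0: "japan \<sigma> > 0" for \<sigma> :: "real^'n" by (simp add: japan_def add_pos_nonneg)
  note bm' [measurable (raw)] = measurable_case_prod_compose[OF bm]
  have mult: "Lr_le lborel r (\<lambda>x. b \<alpha> x \<sigma> * u x) (2 * D * f)"
    if "length \<alpha> \<le> ?n" "C0 * japan \<sigma> powr (m - \<rho> * real (length \<alpha>)) \<le> D" "Lr_le lborel 2 u f" "0 < f" for \<alpha> \<sigma> u f D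
  proof (rule Lr_le_holder[OF p r _ _ _ that(3,4)])
    show "(\<lambda>x. b \<alpha> x \<sigma>) \<in> borel_measurable lborel" by measurable
    have "C \<alpha> * japan \<sigma> powr (m - \<rho> * real (length \<alpha>)) \<le> C0 * japan \<sigma> powr (m - \<rho> * real (length \<alpha>))"
      using CC0[OF that(1)] by (intro mult_right_mono) auto
    then show "Lp_norm p (\<lambda>x. b \<alpha> x \<sigma>) lborel \<le> ennreal D"
      using that(2) by (intro order_trans[OF C] ennreal_leI) linarith
    have "0 < C0 * japan \<sigma> powr (m - \<rho> * real (length \<alpha>))" using C0 japan0[of \<sigma>] by simp
    then show "0 < D" using that(2) by linarith
  qed
  have em: "(\<lambda>(x, \<xi>). exp (\<i> * complex_of_real (\<phi>0 x \<xi>))) \<in> borel_measurable (lborel \<Otimes>\<^sub>M lborel)"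
    unfolding split_beta' by measurable
  have eexp: "\<bar>m - \<rho> * real (length \<alpha>)\<bar> \<le> \<bar>m\<bar> + ?n" if "length \<alpha> \<le> ?n" for \<alpha> :: "'n list"
  proof -
    have "\<rho> * real (length \<alpha>) \<le> 1 * real ?n" using that \<rho> by (intro mult_mono) auto
    moreover have "0 \<le> \<rho> * real (length \<alpha>)" using \<rho> by simp
    ultimately show ?thesis by linarith
  qed
  \<comment> \<open>The unit ball is covered by one cube of side 2, on which the bracket is at most
    1 + n. The power \<open>2 ^ ?n\<close> undoes the factors 1/2 per derivative, and the leading 2
    comes from \<open>Lr_le_holder\<close>.\<close>
  define M0 where "M0 = 2 * (C0 * (1 + real ?n) powr (\<bar>m\<bar> + ?n) * 2 ^ ?n)"
  have M0: "M0 > 0" unfolding M0_def using C0 by simp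
  have low: "Lr_le lborel r (\<lambda>x. \<integral>\<xi>. exp (\<i> * complex_of_real (\<phi>0 x \<xi>)) * b [] x \<xi> * F \<xi> \<partial>lborel) (2 ^ ?n * M0 * B0 * f)"
    if F: "Lr_le lborel 2 F f" and f: "0 < f" and F0: "\<And>\<xi>. F \<xi> \<noteq> 0 \<Longrightarrow> norm \<xi> < 1" for F f
  proof (rule amplitude_removal[where E = "ball 0 1" and c = "\<chi> i. -1" and l = 2 and F = F and f = f, OF sigma_finite_lborel r1 _ M0 B0 em _ bm bc bd])
    show "(ball 0 1 :: (real^'n) set) \<subseteq> cube (\<chi> i. -1) 2"
    proof
      fix \<xi> :: "real^'n" assume \<xi>: "\<xi> \<in> ball 0 1"
      have "\<bar>\<xi> $ i\<bar> \<le> 1" for i using component_le_norm_cart[of \<xi> i] \<xi> by simp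
      then have "-1 \<le> \<xi> $ i \<and> \<xi> $ i \<le> 1" for i by (smt (verit))
      then show "\<xi> \<in> cube (\<chi> i. -1) 2" by (simp add: cube_def)
    qed
    show "Lr_le lborel 2 (\<lambda>x. \<integral>\<xi>. exp (\<i> * complex_of_real (\<phi>0 x \<xi>)) * F' \<xi> \<partial>lborel) (B0 * f')"
      if "\<And>\<xi>. \<xi> \<notin> ball 0 1 \<Longrightarrow> F' \<xi> = 0" "Lr_le lborel 2 F' f'" "0 < f'" for F' f'
      by (rule U0[OF _ that(2,3)]) (use that(1) in force)
    show "Lr_le lborel r (\<lambda>x. b \<alpha> x \<sigma> * u x) (M0 * (1/2) ^ length \<alpha> * f')"
      if "length \<alpha> \<le> ?n" "\<sigma> \<in> cube (\<chi> i. -1) 2" "Lr_le lborel 2 u f'" "0 < f'" for \<alpha> \<sigma> u f'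
    proof -
      let ?e = "m - \<rho> * real (length \<alpha>)"
      have "norm \<sigma> \<le> (\<Sum>i\<in>UNIV. \<bar>\<sigma> $ i\<bar>)" by (rule norm_le_l1_cart)
      also have "\<dots> \<le> (\<Sum>i\<in>(UNIV::'n set). 1)"
      proof (rule sum_mono)
        fix i
        have "-1 \<le> \<sigma> $ i \<and> \<sigma> $ i \<le> -1 + 2" using that(2) unfolding cube_def by (auto dest: spec[of _ i])
        then show "\<bar>\<sigma> $ i\<bar> \<le> 1" by (simp add: abs_le_iff)
      qed
      finally have "norm \<sigma> \<le> ?n" by simp
      then have "(norm \<sigma>)\<^sup>2 \<le> (real ?n)\<^sup>2" by (intro power_mono) auto
      then have "1 + (norm \<sigma>)\<^sup>2 \<le> (1 + real ?n)\<^sup>2"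
        unfolding power2_sum one_power2 mult_1_right using of_nat_0_le_iff[of ?n, where 'a = real] by linarith
      then have j1: "japan \<sigma> \<le> 1 + real ?n" unfolding japan_def by (intro real_le_lsqrt) auto
      have j2: "1 \<le> japan \<sigma>" unfolding japan_def by simp
      have "japan \<sigma> powr ?e \<le> japan \<sigma> powr (\<bar>m\<bar> + ?n)" using j2 eexp[OF that(1)] by (intro powr_mono) auto
      also have "\<dots> \<le> (1 + real ?n) powr (\<bar>m\<bar> + ?n)" using j1 j2 by (intro powr_mono2) auto
      finally have j: "japan \<sigma> powr ?e \<le> (1 + real ?n) powr (\<bar>m\<bar> + ?n)" .
      have "(1::real) \<le> 2 ^ ?n * (1/2) ^ length \<alpha>"
      proof -
        have "(2::real) ^ ?n = 2 ^ (?n - length \<alpha>) * 2 ^ length \<alpha>" using that(1) by (simp add: power_add[symmetric])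
        then have "(2::real) ^ ?n * (1/2) ^ length \<alpha> = 2 ^ (?n - length \<alpha>)" by (simp add: power_one_over)
        then show ?thesis by simp
      qed
      then have "C0 * japan \<sigma> powr ?e * 1 \<le> C0 * (1 + real ?n) powr (\<bar>m\<bar> + ?n) * (2 ^ ?n * (1/2) ^ length \<alpha>)"
        using j C0 by (intro mult_mono mult_left_mono) auto
      then have "Lr_le lborel r (\<lambda>x. b \<alpha> x \<sigma> * u x) (2 * (C0 * (1 + real ?n) powr (\<bar>m\<bar> + ?n) * (2 ^ ?n * (1/2) ^ length \<alpha>)) * f')"
        by (intro mult[OF that(1) _ that(3,4)]) simp
      then show ?thesis by (simp add: M0_def mult_ac)
    qed
    show "F \<xi> = 0" if "\<xi> \<notin> ball 0 1" for \<xi> using F0[of \<xi>] that by auto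
  qed (use F f in auto)
  define \<eta> where "\<eta> = \<delta> / (8 * ?n)"
  have \<eta>: "\<eta> > 0" "?n * \<eta> = \<delta> / 8" "\<eta> \<le> 1"
  proof -
    show "\<eta> > 0" "?n * \<eta> = \<delta> / 8" using \<delta> n0 by (auto simp: \<eta>_def)
    have "1 * \<eta> \<le> ?n * \<eta>" using n0 \<open>\<eta> > 0\<close> by (intro mult_right_mono) auto
    then show "\<eta> \<le> 1" using \<open>?n * \<eta> = \<delta> / 8\<close> \<delta> by simp
  qed
  \<comment> \<open>The side on which the amplitude varies by a bounded factor: a derivative costs
    2^(-k\<rho>), which is at most \<open>1 / l k\<close>. As \<rho> is at most 1, the cube still
    fits into the ball on which the phase is non-degenerate.\<close>
  define l where "l k = \<eta> * (2 ^ k) powr \<rho>" for k :: nat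
  have l0: "l k > 0" for k using \<eta> by (simp add: l_def)
  have l1: "?n * l k \<le> \<delta> / 8 * 2 ^ k" for k
  proof -
    have "(2 ^ k) powr \<rho> \<le> (2 ^ k) powr (1::real)" using \<rho> by (intro powr_mono) auto
    then have "?n * \<eta> * (2 ^ k) powr \<rho> \<le> ?n * \<eta> * 2 ^ k" using \<eta> by (intro mult_left_mono) auto
    moreover have "?n * l k = ?n * \<eta> * (2 ^ k) powr \<rho>" by (simp add: l_def)
    ultimately show ?thesis unfolding \<eta>(2) by linarith
  qed
  define M1 where "M1 = 2 * (C0 * 4 powr (\<bar>m\<bar> + ?n))"
  have M1: "M1 > 0" using C0 by (simp add: M1_def)
  define q where "q k = 2 * 2 ^ k / l k" for k :: nat
  have q0: "0 \<le> q k" for k using l0[of k] by (simp add: q_def)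
  define N where "N k = (cells (q k) :: ('n \<Rightarrow> int) set)" for k
  \<comment> \<open>The bound for a single cube, whose amplitude has size
    \<open>M1 * (2 ^ k) powr m\<close> by the symbol estimate.\<close>
  define A1 where "A1 k = 2 ^ ?n * (M1 * (2 ^ k) powr m) * B" for k :: nat
  have A1: "A1 k > 0" for k using M1 B by (simp add: A1_def)
  have shell: "Lr_le lborel r (\<lambda>x. \<integral>\<xi>. exp (\<i> * complex_of_real (\<phi>0 x \<xi>)) * b [] x \<xi> * F \<xi> \<partial>lborel) (2 * A1 k * sqrt (card (N k)) * f)"
    if F: "Lr_le lborel 2 F f" and f: "0 < f" and F0: "\<And>\<xi>. F \<xi> \<noteq> 0 \<Longrightarrow> high_shell \<xi> = Suc k" for F f k
  proof (rule Lr_le_cells[where \<kappa> = "cell (l k)" and N = "N k" and F = F, OF sigma_finite_lborel r1])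
    have Fm [measurable]: "F \<in> borel_measurable lborel" using F by (simp add: Lr_le_def)
    show "(\<lambda>x. \<integral>\<xi>. exp (\<i> * complex_of_real (\<phi>0 x \<xi>)) * b [] x \<xi> * F \<xi> \<partial>lborel) \<in> borel_measurable lborel" by measurable
    show "finite (N k)" "N k \<noteq> {}" unfolding N_def using finite_cells cells_nonempty[OF q0] by auto
    show "AE x in lborel. norm (\<integral>\<xi>. exp (\<i> * complex_of_real (\<phi>0 x \<xi>)) * b [] x \<xi> * F \<xi> \<partial>lborel) \<le>
        (\<Sum>\<nu>\<in>N k. norm (\<integral>\<xi>. exp (\<i> * complex_of_real (\<phi>0 x \<xi>)) * b [] x \<xi> * (if cell (l k) \<xi> = \<nu> then F \<xi> else 0) \<partial>lborel))"
    proof (rule AE_I2)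
      fix x :: "real^'n"
      have "norm (\<integral>\<xi>. exp (\<i> * complex_of_real (\<phi>0 x \<xi>)) * b [] x \<xi> * F \<xi> \<partial>lborel) \<le>
        (\<Sum>\<nu>\<in>N k. norm (\<integral>\<xi>. (if cell (l k) \<xi> = \<nu> then exp (\<i> * complex_of_real (\<phi>0 x \<xi>)) * b [] x \<xi> * F \<xi> else 0) \<partial>lborel))"
        unfolding N_def
      proof (rule norm_integral_cells[OF finite_cells cell_measurable])
        fix \<xi> assume "exp (\<i> * complex_of_real (\<phi>0 x \<xi>)) * b [] x \<xi> * F \<xi> \<noteq> 0"
        then have "norm \<xi> \<le> 2 * 2 ^ k" using high_shell_bounds(2)[OF F0[of \<xi>]] by auto
        also have "\<dots> = q k * l k" using l0[of k] by (simp add: q_def)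
        finally show "cell (l k) \<xi> \<in> cells (q k)" by (rule cell_in_cells[OF l0])
      qed
      also have "\<dots> = (\<Sum>\<nu>\<in>N k. norm (\<integral>\<xi>. exp (\<i> * complex_of_real (\<phi>0 x \<xi>)) * b [] x \<xi> * (if cell (l k) \<xi> = \<nu> then F \<xi> else 0) \<partial>lborel))"
        by (intro sum.cong refl arg_cong[where f = norm] Bochner_Integration.integral_cong) auto
      finally show "norm (\<integral>\<xi>. exp (\<i> * complex_of_real (\<phi>0 x \<xi>)) * b [] x \<xi> * F \<xi> \<partial>lborel) \<le> \<dots>" .
    qed
    fix \<nu> f' assume f': "0 < f'" and FL: "Lr_le lborel 2 (\<lambda>\<xi>. if cell (l k) \<xi> = \<nu> then F \<xi> else 0) f'"
    define H where "H \<xi> = (if cell (l k) \<xi> = \<nu> then F \<xi> else 0)" for \<xi>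
    have H: "Lr_le lborel 2 H f'" using FL by (simp add: H_def[abs_def])
    have "Lr_le lborel r (\<lambda>x. \<integral>\<xi>. exp (\<i> * complex_of_real (\<phi>0 x \<xi>)) * b [] x \<xi> * H \<xi> \<partial>lborel) (A1 k * f')"
    proof (cases "\<exists>\<xi>. H \<xi> \<noteq> 0")
      case False
      then have "(\<lambda>x. \<integral>\<xi>. exp (\<i> * complex_of_real (\<phi>0 x \<xi>)) * b [] x \<xi> * H \<xi> \<partial>lborel) = (\<lambda>_. 0)" by auto
      then show ?thesis using A1[of k] f' r1 by (simp add: Lr_le_0)
    next
      case True
      then obtain \<xi>1 where \<xi>1: "H \<xi>1 \<noteq> 0" by blast
      define \<zeta> :: "real^'n" where "\<zeta> = corner (l k) \<nu>"
      have inc: "\<xi> \<in> cube \<zeta> (l k)" if "H \<xi> \<noteq> 0" for \<xi>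
        using cell_in_cube[OF l0[of k], of \<xi>] that by (auto simp: H_def \<zeta>_def split: if_splits)
      have near: "norm (\<sigma> - \<zeta>) \<le> \<delta> / 8 * 2 ^ k" if "\<sigma> \<in> cube \<zeta> (l k)" for \<sigma>
        using norm_cube_diff[OF that] l1[of k] by simp
      have d32: "\<delta> / 8 * 2 ^ k \<le> 1/32 * 2 ^ k" using \<delta> by (intro mult_right_mono) auto
      have h1: "2 ^ k \<le> norm \<xi>1" "norm \<xi>1 < 2 * 2 ^ k"
        using high_shell_bounds[OF F0[of \<xi>1]] \<xi>1 by (auto simp: H_def split: if_splits)
      have z1: "norm (\<xi>1 - \<zeta>) \<le> 1/32 * 2 ^ k" using near[OF inc[OF \<xi>1]] d32 by linarith
      have p: "(2::real) ^ k > 0" "(1::real) \<le> 2 ^ k" by auto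
      \<comment> \<open>With this lower bound the radius \<delta> |\<zeta>| / 2 exceeds the diameter
        bound \<delta> 2^k / 8 of the cube. Together with \<open>zhi\<close> it also places all
        points of the cube in the range of \<open>japan_bounds\<close>.\<close>
      have zlo: "3/4 * 2 ^ k \<le> norm \<zeta>" using norm_triangle_ineq2[of \<xi>1 "\<xi>1 - \<zeta>"] z1 h1 p by simp
      have zhi: "norm \<zeta> \<le> 5/2 * 2 ^ k"
        using norm_triangle_sub[of \<zeta> \<xi>1] z1 h1 p unfolding norm_minus_commute[of \<zeta> \<xi>1] by linarith
      have "0 < norm \<zeta>" using zlo p(1) by linarith
      then have \<zeta>0: "\<zeta> \<noteq> 0" by simp
      have sig: "2 ^ k / 2 \<le> norm \<sigma> \<and> norm \<sigma> \<le> 3 * 2 ^ k" if "\<sigma> \<in> cube \<zeta> (l k)" for \<sigma>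
      proof -
        have a: "norm (\<sigma> - \<zeta>) \<le> 1/32 * 2 ^ k" using near[OF that] d32 by linarith
        have "norm \<zeta> \<le> norm \<sigma> + norm (\<sigma> - \<zeta>)" using norm_triangle_sub[of \<zeta> \<sigma>] by (simp add: norm_minus_commute)
        moreover have "norm \<sigma> \<le> norm \<zeta> + norm (\<sigma> - \<zeta>)" by (rule norm_triangle_sub)
        ultimately show ?thesis using a zlo zhi p by linarith
      qed
      have "Lr_le lborel r (\<lambda>x. \<integral>\<xi>. exp (\<i> * complex_of_real (\<phi>0 x \<xi>)) * b [] x \<xi> * H \<xi> \<partial>lborel) (2 ^ ?n * (M1 * (2 ^ k) powr m) * B * f')"
      proof (rule amplitude_removal[where E = "cube \<zeta> (l k)" and c = \<zeta> and l = "l k" and F = H and f = f', OF sigma_finite_lborel r1 l0 _ B em _ bm bc bd order_refl])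
        show "Lr_le lborel 2 (\<lambda>x. \<integral>\<xi>. exp (\<i> * complex_of_real (\<phi>0 x \<xi>)) * F' \<xi> \<partial>lborel) (B * f'')"
          if "\<And>\<xi>. \<xi> \<notin> cube \<zeta> (l k) \<Longrightarrow> F' \<xi> = 0" "Lr_le lborel 2 F' f''" "0 < f''" for F' f''
        proof (rule U[OF \<zeta>0 _ that(2,3)], intro allI impI)
          fix \<xi> assume x: "\<xi> \<notin> cball \<zeta> (\<delta> * norm \<zeta> / 2)"
          have "\<delta> * (3/4 * 2 ^ k) \<le> \<delta> * norm \<zeta>" using zlo \<delta> by (intro mult_left_mono) auto
          moreover have "0 < \<delta> * 2 ^ k" using \<delta> by simp
          ultimately have "\<delta> / 8 * 2 ^ k \<le> \<delta> * norm \<zeta> / 2" by linarith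
          then have "\<xi> \<notin> cube \<zeta> (l k)" using near[of \<xi>] x by (auto simp: dist_norm norm_minus_commute)
          then show "F' \<xi> = 0" by (rule that(1))
        qed
        show "Lr_le lborel r (\<lambda>x. b \<alpha> x \<sigma> * u x) (M1 * (2 ^ k) powr m * (1 / l k) ^ length \<alpha> * f'')"
          if "length \<alpha> \<le> ?n" "\<sigma> \<in> cube \<zeta> (l k)" "Lr_le lborel 2 u f''" "0 < f''" for \<alpha> \<sigma> u f''
        proof -
          let ?e = "m - \<rho> * real (length \<alpha>)"
          have "japan \<sigma> powr ?e \<le> 4 powr \<bar>?e\<bar> * (2 ^ k) powr ?e"
            by (rule japan_bounds) (use sig[OF that(2)] p in auto)
          also have "\<dots> \<le> 4 powr (\<bar>m\<bar> + ?n) * (2 ^ k) powr ?e"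
            using eexp[OF that(1)] by (intro mult_right_mono powr_mono) auto
          also have "(2 ^ k) powr ?e = (2 ^ k) powr m * (1 / (2 ^ k) powr \<rho>) ^ length \<alpha>"
            by (simp add: powr_diff power_one_over powr_powr[symmetric] powr_realpow[symmetric] divide_inverse power_inverse)
          also have "\<dots> \<le> (2 ^ k) powr m * (1 / l k) ^ length \<alpha>"
          proof (intro mult_left_mono power_mono divide_left_mono)
            show "l k \<le> (2 ^ k) powr \<rho>" unfolding l_def using \<eta> mult_right_mono[of \<eta> 1 "(2 ^ k) powr \<rho>"] by simp
          qed (use l0[of k] in auto)
          finally have "japan \<sigma> powr ?e \<le> 4 powr (\<bar>m\<bar> + ?n) * ((2 ^ k) powr m * (1 / l k) ^ length \<alpha>)"
            by (simp add: mult_left_mono)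
          then have "C0 * japan \<sigma> powr ?e \<le> C0 * (4 powr (\<bar>m\<bar> + ?n) * ((2 ^ k) powr m * (1 / l k) ^ length \<alpha>))"
            using C0 by (intro mult_left_mono) auto
          from mult[OF that(1) this that(3,4)] show ?thesis by (simp add: M1_def mult_ac)
        qed
        show "H \<xi> = 0" if "\<xi> \<notin> cube \<zeta> (l k)" for \<xi> using inc[of \<xi>] that by blast
      qed (use H f' M1 in auto)
      then show ?thesis by (simp add: A1_def)
    qed
    then show "Lr_le lborel r (\<lambda>x. \<integral>\<xi>. exp (\<i> * complex_of_real (\<phi>0 x \<xi>)) * b [] x \<xi> * (if cell (l k) \<xi> = \<nu> then F \<xi> else 0) \<partial>lborel) (A1 k * f')"
      unfolding H_def .
  qed (use F f A1 cell_measurable in auto)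
  \<comment> \<open>The number of indices per coordinate is at most \<open>2 * q k + 4\<close>, that
    is (4/\<eta>) w + 4 with w = 2^(k(1-\<rho>)); as w is at least 1, this is at most Q w.\<close>
  define Q where "Q = 4 / \<eta> + 4"
  have Q: "Q > 0" using \<eta> by (simp add: Q_def add_pos_pos)
  \<comment> \<open>The ratio of consecutive shell bounds; it is below 1 exactly when the hypothesis
    on \<open>m\<close> holds.\<close>
  define \<gamma> where "\<gamma> = 2 powr (m - real ?n * (\<rho> - 1) / 2)"
  have \<gamma>: "0 < \<gamma>" "\<gamma> < 1" using m by (auto simp: \<gamma>_def powr_less_one)
  define D where "D = 2 * (2 ^ ?n * M1 * B) * sqrt (Q ^ ?n)"
  have D: "D > 0" using M1 B Q by (simp add: D_def)
  have sumb: "2 * A1 k * sqrt (card (N k)) \<le> D * \<gamma> ^ k" for k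
  proof -
    let ?w = "(2 ^ k) powr (1 - \<rho>) :: real"
    have w1: "1 \<le> ?w" using \<rho> by (intro ge_one_powr_ge_zero) auto
    have qk: "q k = 2 / \<eta> * ?w"
    proof -
      have P: "((2::real) ^ k) powr \<rho> > 0" by simp
      have "(2::real) ^ k = (2 ^ k) powr 1" by simp
      also have "\<dots> = ?w * (2 ^ k) powr \<rho>" by (simp add: powr_add[symmetric])
      finally have "q k = 2 * (?w * (2 ^ k) powr \<rho>) / (\<eta> * (2 ^ k) powr \<rho>)" by (simp add: q_def l_def)
      then show ?thesis using P \<eta>(1) by (simp only: mult.assoc[symmetric] nonzero_mult_divide_mult_cancel_right) simp
    qed
    have "real (card (N k)) \<le> (2 * q k + 4) ^ ?n" unfolding N_def by (rule card_cells[OF q0])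
    also have "\<dots> \<le> (Q * ?w) ^ ?n"
      using w1 q0[of k] by (intro power_mono) (auto simp: qk Q_def distrib_right)
    finally have "sqrt (card (N k)) \<le> sqrt ((Q * ?w) ^ ?n)" by simp
    also have "\<dots> = sqrt (Q ^ ?n) * sqrt (?w ^ ?n)" by (simp add: power_mult_distrib real_sqrt_mult)
    also have "sqrt (?w ^ ?n) = (2 ^ k) powr (real ?n * (1 - \<rho>) / 2)"
    proof -
      have "?w ^ ?n = (2 ^ k) powr (real ?n * (1 - \<rho>))"
        by (simp add: powr_realpow[symmetric] powr_powr mult_ac)
      then show ?thesis by (simp add: powr_half_sqrt[symmetric] powr_powr)
    qed
    finally have s: "sqrt (card (N k)) \<le> sqrt (Q ^ ?n) * (2 ^ k) powr (real ?n * (1 - \<rho>) / 2)" .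
    have "2 * A1 k * sqrt (card (N k)) \<le> 2 * A1 k * (sqrt (Q ^ ?n) * (2 ^ k) powr (real ?n * (1 - \<rho>) / 2))"
      using A1[of k] by (intro mult_left_mono s) auto
    also have "\<dots> = D * ((2 ^ k) powr m * (2 ^ k) powr (real ?n * (1 - \<rho>) / 2))"
      by (simp add: A1_def D_def mult_ac)
    also have "(2 ^ k) powr m * (2 ^ k) powr (real ?n * (1 - \<rho>) / 2) = \<gamma> ^ k"
    proof -
      have "(2 ^ k) powr m * (2 ^ k) powr (real ?n * (1 - \<rho>) / 2) = (2 ^ k) powr (m - real ?n * (\<rho> - 1) / 2)"
        by (simp add: powr_add[symmetric] algebra_simps add_divide_distrib diff_divide_distrib)
      also have "\<dots> = \<gamma> ^ k"
        unfolding \<gamma>_def by (simp add: powr_realpow[symmetric] powr_powr mult_ac)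
      finally show ?thesis .
    qed
    finally show ?thesis .
  qed
  define Ak where "Ak k = (case k of 0 \<Rightarrow> 2 ^ ?n * M0 * B0 | Suc j \<Rightarrow> D * \<gamma> ^ j)" for k
  have Ak: "Ak k > 0" for k using M0 B0 D \<gamma> by (auto simp: Ak_def split: nat.split)
  have sAk: "summable Ak"
  proof (subst summable_Suc_iff[symmetric])
    show "summable (\<lambda>k. Ak (Suc k))" unfolding Ak_def using \<gamma> by (auto intro!: summable_mult summable_geometric)
  qed
  show ?thesis
  proof (intro exI[of _ "suminf Ak"] conjI allI impI)
    show "0 < suminf Ak" using Ak sAk by (intro suminf_pos) auto
    fix F :: "real^'n \<Rightarrow> complex" and f :: real assume F: "Lr_le lborel 2 F f" and f: "0 < f"
    have Fm [measurable]: "F \<in> borel_measurable lborel" using F by (simp add: Lr_le_def)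
    let ?F = "\<lambda>k \<xi>. if high_shell \<xi> = k then F \<xi> else 0"
    have FL: "Lr_le lborel 2 (?F k) f" for k
      by (rule Lr_le_restrict[OF F _ high_shell_measurable]) (use f in simp)
    have "Lr_le lborel r (\<lambda>x. \<integral>\<xi>. exp (\<i> * complex_of_real (\<phi>0 x \<xi>)) * b [] x \<xi> * F \<xi> \<partial>lborel) (\<Sum>k. Ak k * f)"
    proof (rule Lr_le_series[where u = "\<lambda>k x. \<integral>\<xi>. exp (\<i> * complex_of_real (\<phi>0 x \<xi>)) * b [] x \<xi> * ?F k \<xi> \<partial>lborel", OF sigma_finite_lborel r1])
      show "(\<lambda>x. \<integral>\<xi>. exp (\<i> * complex_of_real (\<phi>0 x \<xi>)) * b [] x \<xi> * F \<xi> \<partial>lborel) \<in> borel_measurable lborel" by measurable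
      show "AE x in lborel. ennreal (norm (\<integral>\<xi>. exp (\<i> * complex_of_real (\<phi>0 x \<xi>)) * b [] x \<xi> * F \<xi> \<partial>lborel)) \<le>
        (\<Sum>k. ennreal (norm (\<integral>\<xi>. exp (\<i> * complex_of_real (\<phi>0 x \<xi>)) * b [] x \<xi> * ?F k \<xi> \<partial>lborel)))"
      proof (rule AE_I2)
        fix x
        have eq: "(if high_shell \<xi> = k then exp (\<i> * complex_of_real (\<phi>0 x \<xi>)) * b [] x \<xi> * F \<xi> else 0) = exp (\<i> * complex_of_real (\<phi>0 x \<xi>)) * b [] x \<xi> * ?F k \<xi>" for k \<xi> by simp
        show "ennreal (norm (\<integral>\<xi>. exp (\<i> * complex_of_real (\<phi>0 x \<xi>)) * b [] x \<xi> * F \<xi> \<partial>lborel)) \<le>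
          (\<Sum>k. ennreal (norm (\<integral>\<xi>. exp (\<i> * complex_of_real (\<phi>0 x \<xi>)) * b [] x \<xi> * ?F k \<xi> \<partial>lborel)))"
          using norm_integral_shells[OF high_shell_measurable, of "\<lambda>\<xi>. exp (\<i> * complex_of_real (\<phi>0 x \<xi>)) * b [] x \<xi> * F \<xi>"]
          unfolding eq .
      qed
      show "0 < Ak k * f" for k using Ak f by simp
      show "summable (\<lambda>k. Ak k * f)" using sAk by (rule summable_mult2)
      fix k
      show "Lr_le lborel r (\<lambda>x. \<integral>\<xi>. exp (\<i> * complex_of_real (\<phi>0 x \<xi>)) * b [] x \<xi> * ?F k \<xi> \<partial>lborel) (Ak k * f)"
      proof (cases k)
        case 0
        have z: "norm \<xi> < 1" if "?F 0 \<xi> \<noteq> 0" for \<xi> using that by (auto simp: high_shell_0 split: if_splits)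
        show ?thesis using low[OF FL f z] 0 by (simp add: Ak_def)
      next
        case (Suc j)
        have 1: "Lr_le lborel r (\<lambda>x. \<integral>\<xi>. exp (\<i> * complex_of_real (\<phi>0 x \<xi>)) * b [] x \<xi> * ?F k \<xi> \<partial>lborel) (2 * A1 j * sqrt (card (N j)) * f)"
          by (rule shell[OF FL f]) (auto simp: Suc split: if_splits)
        show ?thesis
          by (rule Lr_le_mono[OF 1]) (use 1 sumb[of j] f r1 A1[of j] in \<open>auto simp: Lr_le_def Ak_def Suc intro!: mult_right_mono\<close>)
      qed
    qed
    then show "Lr_le lborel r (\<lambda>x. \<integral>\<xi>. exp (\<i> * complex_of_real (\<phi>0 x \<xi>)) * b [] x \<xi> * F \<xi> \<partial>lborel) (suminf Ak * f)"
      using suminf_mult2[OF sAk, of f] by simp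
  qed
qed

end

section \<open>Measurability and the final estimate\<close>

text \<open>The second argument is replaced by simple functions converging to the identity. With
  finitely many values in that slot joint measurability is clear, and continuity of
  \<open>b x\<close> passes to the limit.\<close>

lemma caratheodory_measurable:
  fixes b :: "'x \<Rightarrow> 'a::euclidean_space \<Rightarrow> complex"
  assumes m: "\<And>\<xi>. (\<lambda>x. b x \<xi>) \<in> borel_measurable M" and c: "\<And>x. x \<in> space M \<Longrightarrow> continuous_on UNIV (b x)"
  shows "(\<lambda>(x, \<xi>). b x \<xi>) \<in> borel_measurable (M \<Otimes>\<^sub>M lborel)"
proof -
  obtain S :: "nat \<Rightarrow> 'a \<Rightarrow> 'a" where S: "\<And>i. simple_function lborel (S i)" "\<And>\<xi>. (\<lambda>i. S i \<xi>) \<longlonglongrightarrow> \<xi>"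
    using borel_measurable_implies_sequence_metric[of "\<lambda>\<xi>::'a. \<xi>" lborel 0] by auto
  have "(\<lambda>z. b (fst z) (snd z)) \<in> borel_measurable (M \<Otimes>\<^sub>M lborel)"
  proof (rule borel_measurable_LIMSEQ_metric[where f = "\<lambda>i z. b (fst z) (S i (snd z))"])
    fix i
    have fin: "finite (range (S i))" using simple_functionD(1)[OF S(1)[of i]] by simp
    show "(\<lambda>z. b (fst z) (S i (snd z))) \<in> borel_measurable (M \<Otimes>\<^sub>M lborel)"
    proof (rule measurable_compose_countable'[where I = "range (S i)"])
      show "(\<lambda>z. b (fst z) \<xi>) \<in> borel_measurable (M \<Otimes>\<^sub>M lborel)" for \<xi>
        by (rule measurable_compose[OF measurable_fst m])
      have "S i \<in> measurable lborel (count_space (range (S i)))"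
        using S(1)[of i] fin by (auto simp: measurable_count_space_eq2 simple_function_def)
      then show "(\<lambda>z. S i (snd z)) \<in> measurable (M \<Otimes>\<^sub>M lborel) (count_space (range (S i)))"
        by (rule measurable_compose[OF measurable_snd])
      show "countable (range (S i))" using fin by (rule countable_finite)
    qed
  next
    fix z :: "'x \<times> 'a" assume "z \<in> space (M \<Otimes>\<^sub>M lborel)"
    then have "isCont (b (fst z)) (snd z)"
      using c[of "fst z"] by (auto simp: space_pair_measure continuous_on_eq_continuous_at)
    then show "(\<lambda>i. b (fst z) (S i (snd z))) \<longlonglongrightarrow> b (fst z) (snd z)"
      using S(2) by (rule isCont_tendsto_compose)
  qed
  then show ?thesis by (simp add: split_beta')
qed

lemma difference_quotient_tendsto:
  fixes f :: "real \<Rightarrow> complex"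
  assumes "(f has_vector_derivative D) (at 0)"
  shows "(\<lambda>k. (f (1 / real (Suc k)) - f 0) * complex_of_real (real (Suc k))) \<longlonglongrightarrow> D"
proof -
  have t: "(\<lambda>h. norm (f (0 + h) - f 0 - h *\<^sub>R D) / norm h) \<midarrow>0\<rightarrow> 0"
    using assms unfolding has_vector_derivative_def has_derivative_at by simp
  have "filterlim (\<lambda>k. 1 / real (Suc k)) (at 0) sequentially"
    unfolding filterlim_at using LIMSEQ_Suc[OF lim_1_over_n[where 'a = real]] by auto
  from filterlim_compose[OF t this]
  have "(\<lambda>k. norm (f (1 / real (Suc k)) - f 0 - (1 / real (Suc k)) *\<^sub>R D) / norm (1 / real (Suc k))) \<longlonglongrightarrow> 0" by simp
  moreover have "norm (f (1 / real (Suc k)) - f 0 - (1 / real (Suc k)) *\<^sub>R D) / norm (1 / real (Suc k))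
      = norm ((f (1 / real (Suc k)) - f 0) * complex_of_real (real (Suc k)) - D)" for k
  proof -
    have "(f (1 / real (Suc k)) - f 0) * complex_of_real (real (Suc k)) - D =
        (f (1 / real (Suc k)) - f 0 - (1 / real (Suc k)) *\<^sub>R D) * complex_of_real (real (Suc k))"
      unfolding scaleR_conv_of_real left_diff_distrib by (simp del: of_nat_Suc)
    then show ?thesis by (simp only: norm_mult norm_of_real) (simp add: field_simps)
  qed
  ultimately have "(\<lambda>k. norm ((f (1 / real (Suc k)) - f 0) * complex_of_real (real (Suc k)) - D)) \<longlonglongrightarrow> 0" by simp
  then show ?thesis using LIM_zero_cancel tendsto_norm_zero_iff by blast
qed

lemma lebesgue_borel_version:
  fixes u :: "'a::euclidean_space \<Rightarrow> complex"
  assumes "u \<in> borel_measurable lebesgue"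
  shows "\<exists>v\<in>borel_measurable lborel. AE x in lborel. u x = v x"
proof -
  have "(\<lambda>x. Re (u x)) \<in> borel_measurable lebesgue" "(\<lambda>x. Im (u x)) \<in> borel_measurable lebesgue"
    using assms by auto
  from this[THEN completion_ex_borel_measurable_real]
  obtain v w where v: "v \<in> borel_measurable lborel" "AE x in lborel. Re (u x) = v x"
    and w: "w \<in> borel_measurable lborel" "AE x in lborel. Im (u x) = w x"
    by blast
  show ?thesis
  proof (rule bexI[of _ "\<lambda>x. Complex (v x) (w x)"])
    show "AE x in lborel. u x = Complex (v x) (w x)"
      using v(2) w(2) by eventually_elim (simp add: complex_eq_iff)
    show "(\<lambda>x. Complex (v x) (w x)) \<in> borel_measurable lborel"
      unfolding Complex_eq using v(1) w(1) by (intro borel_measurable_add borel_measurable_times) auto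
  qed
qed

lemma Lp_norm_lebesgue:
  assumes "AE x in lborel. u x = v x"
  shows "Lp_norm p u lebesgue = Lp_norm p v lborel"
proof -
  have "(\<integral>\<^sup>+x. ennreal (norm (u x) powr q) \<partial>lebesgue) = (\<integral>\<^sup>+x. ennreal (norm (v x) powr q) \<partial>lborel)" for q
    unfolding nn_integral_completion using assms by (intro nn_integral_cong_AE) (auto elim: eventually_mono)
  moreover have "(AE x in lebesgue. ennreal (norm (u x)) \<le> C) \<longleftrightarrow> (AE x in lborel. ennreal (norm (v x)) \<le> C)" for C
    unfolding AE_completion_iff using assms by (auto elim: eventually_elim2)
  ultimately show ?thesis by (simp add: Lp_norm_def)
qed

lemma pd_has_vector_derivative:
  fixes f :: "real^'n::finite \<Rightarrow> 'b::real_normed_vector"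
  assumes "smooth_on UNIV f"
  shows "((\<lambda>s. pd \<alpha> f (\<xi> + s *\<^sub>R axis i 1)) has_vector_derivative pd (i # \<alpha>) f \<xi>) (at 0)"
proof -
  let ?D = "\<lambda>v. dderiv (v # map (\<lambda>i. axis i 1) \<alpha>) f \<xi>"
  have d: "(dderiv (map (\<lambda>i. axis i 1) \<alpha>) f has_derivative ?D) (at \<xi>)"
    by (rule dderiv_has_derivative[OF assms]) simp
  then have lin: "linear ?D" by (rule has_derivative_linear)
  have "((\<lambda>s. \<xi> + s *\<^sub>R axis i 1) has_derivative (\<lambda>s. s *\<^sub>R axis i 1)) (at (0::real))"
    by (auto intro!: derivative_eq_intros)
  from has_derivative_compose[OF this, of "dderiv (map (\<lambda>i. axis i 1) \<alpha>) f" ?D] d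
  show ?thesis unfolding has_vector_derivative_def pd_def
    using linear_cmul[OF lin, of _ "axis i 1"] by simp
qed

lemma pd_continuous_on:
  assumes "smooth_on UNIV f" shows "continuous_on S (pd \<alpha> f)"
  using dderiv_has_derivative[OF assms, of _ "map (\<lambda>i. axis i 1) \<alpha>"] unfolding pd_def
  by (intro continuous_at_imp_continuous_on) (auto dest: has_derivative_continuous)

text \<open>A Borel version of \<open>a\<close> at a fixed \<xi> differs from it on a null set that
  depends on \<xi>. Only a countable dense set of frequencies is used, which gives a single null set
  \<open>N\<close>; off \<open>N\<close> continuity determines \<open>a x\<close> everywhere.
  Derivatives are measurable as limits of difference quotients, and on \<open>N\<close> the symbol
  is replaced by 0, so that continuity and the derivative relations hold at every
  \<open>x\<close>.\<close>

lemma symbol_borel_version: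
  fixes a :: "real^'n::finite \<Rightarrow> real^'n \<Rightarrow> complex"
  assumes m: "\<And>\<xi>. (\<lambda>x. a x \<xi>) \<in> borel_measurable lebesgue" and s: "AE x in lebesgue. smooth_on UNIV (a x)"
  obtains b N where "N \<in> null_sets lborel" "\<And>x \<alpha>. x \<notin> N \<Longrightarrow> b \<alpha> x = pd \<alpha> (a x)"
    "\<And>\<alpha>. (\<lambda>(x, \<xi>). b \<alpha> x \<xi>) \<in> borel_measurable (lborel \<Otimes>\<^sub>M lborel)" "\<And>\<alpha> x S. continuous_on S (b \<alpha> x)"
    "\<And>\<alpha> i x \<xi>. ((\<lambda>s. b \<alpha> x (\<xi> + s *\<^sub>R axis i 1)) has_vector_derivative b (i # \<alpha>) x \<xi>) (at 0)"
proof -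
  obtain D :: "(real^'n) set" where D: "countable D" "\<And>X. open X \<Longrightarrow> X \<noteq> {} \<Longrightarrow> \<exists>d\<in>D. d \<in> X"
    using countable_dense_exists[where 'a = "real^'n"] by blast
  obtain v where v: "\<And>\<xi>. v \<xi> \<in> borel_measurable lborel" "\<And>\<xi>. AE x in lborel. a x \<xi> = v \<xi> x"
    using lebesgue_borel_version[OF m] by metis
  have "AE x in lborel. smooth_on UNIV (a x) \<and> (\<forall>d\<in>D. a x d = v d x)"
    using s v(2) D(1) by (auto simp: AE_completion_iff AE_ball_countable)
  then obtain N where N: "\<And>x. x \<notin> N \<Longrightarrow> smooth_on UNIV (a x)" "\<And>x d. x \<notin> N \<Longrightarrow> d \<in> D \<Longrightarrow> a x d = v d x" "N \<in> null_sets lborel"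
    by (elim AE_E3) auto
  have Ns [measurable]: "N \<in> sets lborel" using N(3) by auto
  define b where "b \<alpha> x \<xi> = (if x \<in> N then 0 else pd \<alpha> (a x) \<xi>)" for \<alpha> x \<xi>
  have bc: "continuous_on S (b \<alpha> x)" for \<alpha> x S
    using pd_continuous_on[OF N(1), of x S \<alpha>] by (cases "x \<in> N") (auto simp: b_def[abs_def])
  have bd: "((\<lambda>s. b \<alpha> x (\<xi> + s *\<^sub>R axis i 1)) has_vector_derivative b (i # \<alpha>) x \<xi>) (at 0)" for \<alpha> i x \<xi>
    using pd_has_vector_derivative[OF N(1), of x \<alpha> \<xi> i] by (cases "x \<in> N") (auto simp: b_def)
  have bm: "(\<lambda>x. b \<alpha> x \<xi>) \<in> borel_measurable lborel" for \<alpha> \<xi>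
  proof (induction \<alpha> arbitrary: \<xi>)
    case Nil
    have "\<xi> \<in> closure D"
      unfolding closure_iff_nhds_not_empty using D(2) by blast
    then obtain d where d: "\<And>k::nat. d k \<in> D" "d \<longlonglongrightarrow> \<xi>" unfolding closure_sequential by blast
    show ?case
    proof (rule borel_measurable_LIMSEQ_metric[where f = "\<lambda>k x. b [] x (d k)"])
      fix k
      have "(\<lambda>x. b [] x (d k)) = (\<lambda>x. if x \<in> N then 0 else v (d k) x)"
        using N(2) d(1) by (auto simp: b_def pd_def)
      moreover note v(1)[of "d k", measurable]
      ultimately show "(\<lambda>x. b [] x (d k)) \<in> borel_measurable lborel" by simp
    next
      fix x
      have "isCont (b [] x) \<xi>" using bc[of UNIV] by (simp add: continuous_on_eq_continuous_at)
      then show "(\<lambda>k. b [] x (d k)) \<longlonglongrightarrow> b [] x \<xi>" using d(2) by (rule isCont_tendsto_compose)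
    qed
  next
    case (Cons i \<alpha>)
    note Cons.IH [measurable]
    show ?case
    proof (rule borel_measurable_LIMSEQ_metric)
      show "(\<lambda>k. (b \<alpha> x (\<xi> + (1 / real (Suc k)) *\<^sub>R axis i 1) - b \<alpha> x (\<xi> + 0 *\<^sub>R axis i 1)) * complex_of_real (real (Suc k))) \<longlonglongrightarrow> b (i # \<alpha>) x \<xi>" for x
        by (rule difference_quotient_tendsto[OF bd])
    qed measurable
  qed
  have bjm: "(\<lambda>(x, \<xi>). b \<alpha> x \<xi>) \<in> borel_measurable (lborel \<Otimes>\<^sub>M lborel)" for \<alpha>
    by (rule caratheodory_measurable[OF bm bc])
  have "b \<alpha> x = pd \<alpha> (a x)" if "x \<notin> N" for \<alpha> x using that by (simp add: b_def fun_eq_iff)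
  from that[OF N(3) this bjm bc bd] show ?thesis .
qed

lemma schwartz_measurable: "schwartz f \<Longrightarrow> f \<in> borel_measurable borel"
  using pd_continuous_on[of f UNIV "[]"] by (auto simp: schwartz_def pd_def intro: borel_measurable_continuous_onI)

text \<open>Decay of order n + 1 is compared with \<open>decay_weight\<close> centred at 0, whose
  integral is already bounded.\<close>

lemma schwartz_integrable:
  fixes f :: "real^'n::finite \<Rightarrow> complex"
  assumes "schwartz f" shows "integrable lborel f"
proof -
  let ?N = "Suc DIM(real^'n)"
  have fm [measurable]: "f \<in> borel_measurable lborel" using schwartz_measurable[OF assms] by simp
  obtain C where "\<And>x. (1 + norm x) ^ ?N * norm (pd [] f x) \<le> C" using assms unfolding schwartz_def by blast
  then have C: "(1 + norm x) ^ ?N * norm (f x) \<le> C" for x by (simp add: pd_def)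
  have C0: "0 \<le> C" using order_trans[OF _ C[of 0]] by simp
  have "norm (f x) \<le> C * decay_weight ?N (1 * norm (0 - x))" for x
  proof (cases "norm x \<le> 1")
    case True
    have "1 * norm (f x) \<le> (1 + norm x) ^ ?N * norm (f x)" by (intro mult_right_mono one_le_power) auto
    then show ?thesis using True C[of x] by (simp add: decay_weight_def)
  next
    case False
    have "norm x ^ ?N * norm (f x) \<le> (1 + norm x) ^ ?N * norm (f x)" by (intro mult_right_mono power_mono) auto
    then have "norm x ^ ?N * norm (f x) \<le> C" using C[of x] by linarith
    moreover have "norm x ^ ?N > 0" using False by (intro zero_less_power) linarith
    ultimately have "norm (f x) \<le> C / norm x ^ ?N" by (simp add: pos_le_divide_eq mult.commute)
    then show ?thesis using False by (simp add: decay_weight_def power_one_over divide_inverse power_inverse)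
  qed
  then have "(\<integral>\<^sup>+x. ennreal (norm (f x)) \<partial>lborel) \<le> (\<integral>\<^sup>+x. ennreal C * ennreal (decay_weight ?N (1 * norm (0 - x :: real^'n))) \<partial>lborel)"
    using C0 by (intro nn_integral_mono) (simp add: ennreal_mult'[symmetric] ennreal_leI)
  also have "\<dots> = ennreal C * (\<integral>\<^sup>+x. ennreal (decay_weight ?N (1 * norm (0 - x :: real^'n))) \<partial>lborel)"
    by (intro nn_integral_cmult) measurable
  also have "\<dots> \<le> ennreal C * ennreal (2 ^ (2 * DIM(real^'n) + 2) / 1 ^ DIM(real^'n))"
    by (intro mult_left_mono decay_weight_integral) auto
  also have "\<dots> < \<infinity>" by (simp add: ennreal_mult_less_top)
  finally show ?thesis by (intro integrableI_bounded) auto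
qed

lemma fourier_eq:
  assumes "schwartz f"
  shows "fourier f = (\<lambda>\<xi>. \<integral>x. exp (- \<i> * complex_of_real (x \<bullet> \<xi>)) * f x \<partial>lborel)"
proof
  fix \<xi>
  have [measurable]: "f \<in> borel_measurable borel" by (rule schwartz_measurable[OF assms])
  show "fourier f \<xi> = (\<integral>x. exp (- \<i> * complex_of_real (x \<bullet> \<xi>)) * f x \<partial>lborel)"
    unfolding fourier_def by (rule integral_completion) measurable
qed

lemma fourier_measurable:
  assumes "schwartz f" shows "fourier f \<in> borel_measurable lborel"
proof -
  have [measurable]: "f \<in> borel_measurable borel" by (rule schwartz_measurable[OF assms])
  show ?thesis unfolding fourier_eq[OF assms] by measurable
qed

lemma Lp_norm_le:
  assumes "1 \<le> r" "Lr_le M r u A" "0 \<le> A"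
  shows "Lp_norm (ennreal r) u M \<le> ennreal A"
proof -
  let ?I = "\<integral>\<^sup>+x. ennreal (norm (u x) powr r) \<partial>M"
  have I: "?I \<le> ennreal (A powr r)" using assms by (simp add: Lr_le_def)
  then have "?I \<noteq> \<infinity>" by (auto simp: top_unique)
  moreover have "enn2real ?I powr (1/r) \<le> A"
  proof -
    have "enn2real ?I \<le> A powr r" using I by (intro enn2real_leI) auto
    then have "enn2real ?I powr (1/r) \<le> (A powr r) powr (1/r)" using assms by (intro powr_mono2) auto
    then show ?thesis using assms by (simp add: powr_powr)
  qed
  ultimately show ?thesis using assms by (simp add: Lp_norm_def Let_def ennreal_leI)
qed

theorem theorem4p6:
  fixes p :: ennreal and r m \<rho> :: real
    and \<phi> :: "real^'n::finite \<Rightarrow> real^'n \<Rightarrow> real"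
    and a :: "real^'n \<Rightarrow> real^'n \<Rightarrow> complex"
  assumes "2 \<le> p"
    and "r = (if p = \<infinity> then 2 else 2 * enn2real p / (enn2real p + 2))"
    and "PhiK 2 \<phi>" and "SND \<phi>"
    and "0 \<le> \<rho>" and "\<rho> \<le> 1"
    and "LpS p m \<rho> a"
    and "m < real CARD('n) * (\<rho> - 1) / 2"
  shows "\<exists>C::real. \<forall>f. schwartz f \<longrightarrow>
           FIO \<phi> a f \<in> borel_measurable lebesgue \<and>
           Lp_norm (ennreal r) (FIO \<phi> a f) lebesgue \<le> ennreal C * Lp_norm 2 f lebesgue"
proof -
  interpret snd_phase \<phi> using assms(3,4) by unfold_locales
  have r1: "1 \<le> r"
  proof (cases "p = \<infinity>")
    case False
    then have "2 \<le> enn2real p" using assms(1) using enn2real_mono[OF assms(1)] False by (simp add: less_top)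
    then show ?thesis using False by (simp add: assms(2) field_simps)
  qed (simp add: assms(2))
  have am: "(\<lambda>x. a x \<xi>) \<in> borel_measurable lebesgue" for \<xi> using assms(7) by (simp add: LpS_def)
  have "AE x in lebesgue. smooth_on UNIV (a x)" using assms(7) by (simp add: LpS_def)
  then obtain N b where N: "N \<in> null_sets lborel"
    and ba: "\<And>x \<alpha>. x \<notin> N \<Longrightarrow> b \<alpha> x = pd \<alpha> (a x)"
    and bm: "\<And>\<alpha>. (\<lambda>(x, \<xi>). b \<alpha> x \<xi>) \<in> borel_measurable (lborel \<Otimes>\<^sub>M lborel)"
    and bc: "\<And>\<alpha> x S. continuous_on S (b \<alpha> x)"
    and bd: "\<And>\<alpha> i x \<xi>. ((\<lambda>s. b \<alpha> x (\<xi> + s *\<^sub>R axis i 1)) has_vector_derivative b (i # \<alpha>) x \<xi>) (at 0)"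
    by (rule symbol_borel_version[OF am]) (rule that)
  have aeN: "AE x in lborel. x \<notin> N" using N by (rule AE_not_in)
  have "\<exists>C. \<forall>\<sigma>. Lp_norm p (\<lambda>x. b \<alpha> x \<sigma>) lborel \<le> ennreal (C * japan \<sigma> powr (m - \<rho> * real (length \<alpha>)))" for \<alpha>
  proof -
    have eq: "Lp_norm p (\<lambda>x. pd \<alpha> (a x) \<sigma>) lebesgue = Lp_norm p (\<lambda>x. b \<alpha> x \<sigma>) lborel" for \<sigma>
      by (rule Lp_norm_lebesgue) (use aeN in eventually_elim, simp add: ba)
    have "\<exists>C. \<forall>\<sigma>. Lp_norm p (\<lambda>x. pd \<alpha> (a x) \<sigma>) lebesgue \<le> ennreal (C * japan \<sigma> powr (m - \<rho> * real (length \<alpha>)))"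
      using assms(7) unfolding LpS_def by blast
    then show ?thesis unfolding eq .
  qed
  from operator_bound[OF assms(1,2) r1 assms(5,6,8) bm bc bd this] obtain K where K: "K > 0"
    and KF: "\<And>F f. Lr_le lborel 2 F f \<Longrightarrow> 0 < f \<Longrightarrow>
      Lr_le lborel r (\<lambda>x. \<integral>\<xi>. exp (\<i> * complex_of_real (\<phi>0 x \<xi>)) * b [] x \<xi> * F \<xi> \<partial>lborel) (K * f)"
    by blast
  obtain P where P: "P > 0" "\<And>g::real^'n \<Rightarrow> complex. integrable lborel g \<Longrightarrow>
     (\<integral>\<^sup>+\<xi>. ennreal ((norm (\<integral>x. exp (- \<i> * complex_of_real (x \<bullet> \<xi>)) * g x \<partial>lborel))\<^sup>2) \<partial>lborel)
       \<le> ennreal P * (\<integral>\<^sup>+x. ennreal ((norm (g x))\<^sup>2) \<partial>lborel)"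
    using fourier_L2 by blast
  define c :: real where "c = (2 * pi) powr (- real CARD('n))"
  have c: "c > 0" by (simp add: c_def)
  note bm' [measurable (raw)] = measurable_case_prod_compose[OF bm]
  show ?thesis
  proof (intro exI[of _ "c * K * sqrt P"] allI impI)
    fix f :: "real^'n \<Rightarrow> complex" assume f: "schwartz f"
    note Fm [measurable] = fourier_measurable[OF f]
    define W where "W x = (\<integral>\<xi>. exp (\<i> * complex_of_real (\<phi>0 x \<xi>)) * b [] x \<xi> * fourier f \<xi> \<partial>lborel)" for x
    have Wm [measurable]: "W \<in> borel_measurable lborel" unfolding W_def by measurable
    have FW: "FIO \<phi> a f x = complex_of_real c * W x" if x: "x \<notin> N" for x
    proof -
      let ?g = "\<lambda>\<xi>. exp (\<i> * complex_of_real (\<phi> x \<xi>)) * a x \<xi> * fourier f \<xi>"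
      have bx: "b [] x \<xi> = a x \<xi>" for \<xi> using ba[OF x, of "[]"] by (simp add: pd_def)
      \<comment> \<open>The value at the origin is split off as a constant; elsewhere the integrand
        agrees with the Borel version, which yields measurability.\<close>
      have "?g = (\<lambda>\<xi>. if \<xi> = 0 then ?g 0 else exp (\<i> * complex_of_real (\<phi>0 x \<xi>)) * b [] x \<xi> * fourier f \<xi>)"
        by (auto simp: \<phi>0_def bx)
      also have "\<dots> \<in> borel_measurable lborel" by measurable
      finally have gm: "?g \<in> borel_measurable lborel" .
      have "(\<integral>\<xi>. ?g \<xi> \<partial>lebesgue) = (\<integral>\<xi>. ?g \<xi> \<partial>lborel)" by (rule integral_completion[OF gm])
      also have "\<dots> = W x" unfolding W_def
      proof (rule integral_cong_AE[OF gm])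
        show "AE \<xi> in lborel. ?g \<xi> = exp (\<i> * complex_of_real (\<phi>0 x \<xi>)) * b [] x \<xi> * fourier f \<xi>"
          using AE_lborel_singleton[of 0] by eventually_elim (simp add: \<phi>0_def bx)
      qed measurable
      finally show ?thesis by (simp add: FIO_def c_def)
    qed
    have ae: "AE x in lborel. FIO \<phi> a f x = complex_of_real c * W x"
      using aeN by eventually_elim (rule FW)
    have "FIO \<phi> a f \<in> borel_measurable lebesgue"
    proof (rule borel_measurable_AE)
      show "(\<lambda>x. complex_of_real c * W x) \<in> borel_measurable lebesgue" by (intro measurable_completion) measurable
      show "AE x in lebesgue. complex_of_real c * W x = FIO \<phi> a f x"
        using AE_completion[OF ae] by eventually_elim simp
    qed
    moreover have "Lp_norm (ennreal r) (FIO \<phi> a f) lebesgue \<le> ennreal (c * K * sqrt P) * Lp_norm 2 f lebesgue"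
    proof -
      define I where "I = (\<integral>\<^sup>+x. ennreal ((norm (f x))\<^sup>2) \<partial>lborel)"
      have L2: "Lp_norm 2 f lebesgue = (if I = \<infinity> then \<infinity> else ennreal (sqrt (enn2real I)))"
        unfolding Lp_norm_lebesgue[OF AE_I2[OF refl]]
        by (simp add: Lp_norm_def I_def powr_half_sqrt powr_numeral Let_def)
      show ?thesis
      proof (cases "I = \<infinity>")
        case True
        then show ?thesis using L2 c K P(1) by (simp add: ennreal_mult_top)
      next
        case False
        define s where "s = enn2real I"
        have s: "0 \<le> s" "I = ennreal s" using False by (auto simp: s_def less_top)
        \<comment> \<open>\<open>KF\<close> asks for a positive bound on the norm, whereas the norm
          of the input may vanish. The slack \<open>e\<close> is removed afterwards by
          \<open>ennreal_le_epsilon\<close>.\<close>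
        have Lr: "Lr_le lborel r W (K * (sqrt (P * s) + e))" if e: "0 < e" for e
          unfolding W_def
        proof (rule KF)
          have Ps: "0 \<le> P * s" using P s by simp
          show e': "0 < sqrt (P * s) + e" using e Ps by (simp add: add_nonneg_pos)
          have "(\<integral>\<^sup>+\<xi>. ennreal (norm (fourier f \<xi>) powr 2) \<partial>lborel) = (\<integral>\<^sup>+\<xi>. ennreal ((norm (fourier f \<xi>))\<^sup>2) \<partial>lborel)"
            by (simp add: powr_numeral)
          also have "\<dots> \<le> ennreal P * I"
            unfolding fourier_eq[OF f] I_def by (rule P(2)[OF schwartz_integrable[OF f]])
          also have "\<dots> = ennreal ((sqrt (P * s))\<^sup>2)" using P s by (simp add: ennreal_mult' s(2))
          also have "\<dots> \<le> ennreal ((sqrt (P * s) + e)\<^sup>2)" using e Ps by (intro ennreal_leI power_mono) auto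
          also have "\<dots> = ennreal ((sqrt (P * s) + e) powr 2)" using e' by (simp add: powr_numeral)
          finally show "Lr_le lborel 2 (fourier f) (sqrt (P * s) + e)" using Fm by (simp add: Lr_le_def)
        qed
        have "Lp_norm (ennreal r) (FIO \<phi> a f) lebesgue \<le> ennreal (c * K * sqrt (P * s))"
        proof (rule ennreal_le_epsilon)
          fix e :: real assume e: "0 < e"
          define e1 where "e1 = e / (c * K)"
          have e1: "0 < e1" using e c K by (simp add: e1_def)
          have A0: "0 \<le> K * (sqrt (P * s) + e1)" using K P s e1 by (intro mult_nonneg_nonneg add_nonneg_nonneg) auto
          have "Lr_le lborel r (\<lambda>x. complex_of_real c * W x) (c * (K * (sqrt (P * s) + e1)))"
            using Lr_le_scale[OF Lr[OF e1] A0, of "complex_of_real c"] c by simp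
          then have "Lp_norm (ennreal r) (\<lambda>x. complex_of_real c * W x) lborel \<le> ennreal (c * (K * (sqrt (P * s) + e1)))"
            using c A0 by (intro Lp_norm_le[OF r1]) auto
          also have "c * (K * (sqrt (P * s) + e1)) = c * K * sqrt (P * s) + e"
            using c K by (simp add: e1_def field_simps)
          also have "ennreal \<dots> = ennreal (c * K * sqrt (P * s)) + ennreal e"
            using c K P s e by (intro ennreal_plus) auto
          finally show "Lp_norm (ennreal r) (FIO \<phi> a f) lebesgue \<le> ennreal (c * K * sqrt (P * s)) + ennreal e"
            unfolding Lp_norm_lebesgue[OF ae] .
        qed
        also have "\<dots> = ennreal (c * K * sqrt P) * Lp_norm 2 f lebesgue"
          using c K P s by (simp add: L2 s_def[symmetric] False real_sqrt_mult ennreal_mult'[symmetric] mult.assoc)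
        finally show ?thesis .
      qed
    qed
    ultimately show "FIO \<phi> a f \<in> borel_measurable lebesgue \<and>
           Lp_norm (ennreal r) (FIO \<phi> a f) lebesgue \<le> ennreal (c * K * sqrt P) * Lp_norm 2 f lebesgue" ..
  qed
qed

end
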